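(* Let $\sigma\ge0$, with $\sigma>0$ if $\mathcal{H}^{n-1}(\Gamma_D)=0$. Let $p\in\mathbb{R}$ satisfy $1<p<\infty$ and $p\ge\frac{2n}{n+2}$. Let $f\in L^p(\Omega)$ and $\psi\in V$ with $A\psi\in L^p(\Omega)$, and set $\hat f:=A\psi$. Then for $u\in V$ each of the following conditions (f)–(h) is equivalent to each of the (mutually equivalent) conditions (a)–(e): (a) $u\in K_0$, $J(u)\le J(v)$ for all $v\in K_0$; (b) $u\in K_0$, $a(u,v-u)\ge\langle f,v-u\rangle_V$ for all $v\in K_0$; (c) $u\in K_0\cap K_1$, $\langle Au-f,u-\psi\rangle_V=0$; (d) $u\in K_1$, $a(u,v-u)\ge\langle\hat f,v-u\rangle_V$ for all $v\in K_1$; (e) $u\in K_1$, $\hat J(u)\le\hat J(v)$ for all $v\in K_1$; (f) $u\in K_2$, $\hat J(u)\le\hat J(v)$ for all $v\in K_2$; (g) $u\in K_2$, $a(u,v-u)\ge\langle\hat f,v-u\rangle_V$ for all $v\in K_2$; (h) $u\in K_0\cap K_2$, $(Au-f)(u-\psi)=0$ a.e. in $\Omega$.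
   Context: $\Omega\subset\mathbb{R}^n$ ($n\in\mathbb{N}$) is a bounded Lipschitz domain whose boundary $\Gamma$ is the disjoint union of $\Gamma_D$ (relatively open in $\Gamma$) and $\Gamma_N$ (one may be empty). $\gamma_0$ is the trace operator, $\mathcal{H}^{n-1}$ is the $(n-1)$-dimensional Hausdorff measure, and $V:=\{v\in H^1(\Omega):\gamma_0v=0\ \mathcal{H}^{n-1}\text{-a.e. on }\Gamma_D\}$ with the $H^1(\Omega)$ norm. $\langle\cdot,\cdot\rangle_V$ is the duality pairing between $V'$ and $V$. By the Sobolev embedding, $L^p(\Omega)$ is continuously embedded in $V'$ via $\langle g,v\rangle_V=\int_\Omega gv\,dx$; "$Av\in L^p(\Omega)$" is meant in this sense. $A=A_\sigma:V\to V'$ and the bilinear form $a$ are given by $a(u,v)=\langle Au,v\rangle_V=\int_\Omega(\nabla u\cdot\nabla v+\sigma uv)\,dx$ for $u,v\in V$. For $g_1,g_2\in V'$, $g_1\ge g_2$ in $V'$ means $\langle g_1-g_2,\varphi\rangle_V\ge0$ for all $\varphi\in V$ with $\varphi\ge0$ a.e. in $\Omega$. Define $$K_0:=\{v\in V: v\ge\psi\text{ a.e. in }\Omega\},\quad K_1:=\{v\in V: Av\ge f\text{ in }V'\},\quad K_2:=\{v\in V: f\le Av\le f\vee\hat f\text{ in }V'\},$$ where $f\vee\hat f=\max\{f,\hat f\}$ pointwise, and, for $v\in V$, $$J(v):=\tfrac12a(v,v)-\langle f,v\rangle_V,\qquad \hat J(v):=\tfrac12a(v,v)-\langle\hat f,v\rangle_V.$$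 *)

theory Defs
  imports "HOL-Analysis.Analysis"
begin

section \<open>Hausdorff measure of integer dimension\<close>

text \<open>The dimension is a natural number, so that \<open>0 ^ 0 = 1\<close> gives the counting measure for
  \<open>m = 0\<close>. The empty set costs nothing in a cover. Boundedness is required explicitly since
  \<^const>\<open>diameter\<close> says nothing about unbounded sets.\<close>

definition hausdorff_weight :: "nat \<Rightarrow> 'a::metric_space set \<Rightarrow> ennreal" where
  "hausdorff_weight m C =
     (if C = {} then 0 else ennreal (unit_ball_vol (real m) * (diameter C / 2) ^ m))"

definition hausdorff_covers :: "real \<Rightarrow> 'a::metric_space set \<Rightarrow> (nat \<Rightarrow> 'a set) set" where
  "hausdorff_covers \<delta> A =
     {C. A \<subseteq> (\<Union>i. C i) \<and> (\<forall>i. bounded (C i) \<and> diameter (C i) \<le> \<delta>)}"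

definition hausdorff_content :: "nat \<Rightarrow> real \<Rightarrow> 'a::metric_space set \<Rightarrow> ennreal" where
  "hausdorff_content m \<delta> A = (INF C\<in>hausdorff_covers \<delta> A. \<Sum>i. hausdorff_weight m (C i))"

definition hausdorff_outer :: "nat \<Rightarrow> 'a::metric_space set \<Rightarrow> ennreal" where
  "hausdorff_outer m A = (SUP \<delta>\<in>{0<..}. hausdorff_content m \<delta> A)"

text \<open>The measure lives on the Caratheodory-measurable sets.\<close>

definition hausdorff_measure :: "nat \<Rightarrow> 'a::metric_space measure" where
  "hausdorff_measure m =
     measure_of UNIV (lambda_system UNIV UNIV (hausdorff_outer m)) (hausdorff_outer m)"

lemma hausdorff_content_mono: "A \<subseteq> B \<Longrightarrow> hausdorff_content m \<delta> A \<le> hausdorff_content m \<delta> B"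
  unfolding hausdorff_content_def hausdorff_covers_def by (rule INF_superset_mono) auto

lemma hausdorff_content_countably_subadditive:
  fixes A :: "nat \<Rightarrow> 'a::metric_space set"
  shows "hausdorff_content m \<delta> (\<Union>i. A i) \<le> (\<Sum>i. hausdorff_content m \<delta> (A i))"
proof (rule ennreal_le_epsilon)
  fix e :: real
  assume fin: "(\<Sum>i. hausdorff_content m \<delta> (A i)) < top" and e: "e > 0"
  have "\<exists>C\<in>hausdorff_covers \<delta> (A i).
      (\<Sum>j. hausdorff_weight m (C j)) \<le> hausdorff_content m \<delta> (A i) + ennreal (e * (1/2) ^ Suc i)" for i
  proof -
    have "hausdorff_content m \<delta> (A i) \<noteq> \<infinity>"
      using ennreal_suminf_lessD[OF fin, of i] by simp
    then have "hausdorff_content m \<delta> (A i) < hausdorff_content m \<delta> (A i) + ennreal (e * (1/2) ^ Suc i)"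
      using e by (simp add: less_top)
    then obtain C where "C \<in> hausdorff_covers \<delta> (A i)"
      "(\<Sum>j. hausdorff_weight m (C j)) < hausdorff_content m \<delta> (A i) + ennreal (e * (1/2) ^ Suc i)"
      by (subst (asm) (1) hausdorff_content_def) (auto simp: Inf_less_iff)
    then show ?thesis by (auto intro: less_imp_le)
  qed
  then obtain C where C: "C i \<in> hausdorff_covers \<delta> (A i)"
    and le: "(\<Sum>j. hausdorff_weight m (C i j)) \<le> hausdorff_content m \<delta> (A i) + ennreal (e * (1/2) ^ Suc i)" for i
    by metis
  define D where "D = (\<lambda>k. case_prod C (prod_decode k))"
  have DC: "D (prod_encode (i, j)) = C i j" for i j
    by (simp add: D_def)
  have "D \<in> hausdorff_covers \<delta> (\<Union>i. A i)"
  proof -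
    have "(\<Union>i. A i) \<subseteq> (\<Union>k. D k)"
    proof safe
      fix x i assume "x \<in> A i"
      then obtain j where "x \<in> C i j" using C[of i] by (auto simp: hausdorff_covers_def)
      then show "x \<in> (\<Union>k. D k)" using DC by blast
    qed
    then show ?thesis
      using C by (auto simp: hausdorff_covers_def D_def split: prod.splits)
  qed
  then have "hausdorff_content m \<delta> (\<Union>i. A i) \<le> (\<Sum>k. hausdorff_weight m (D k))"
    unfolding hausdorff_content_def by (rule INF_lower)
  also have "\<dots> = (\<Sum>i. \<Sum>j. hausdorff_weight m (C i j))"
    using suminf_ennreal_2dimen[of "\<lambda>i. \<Sum>j. hausdorff_weight m (C i j)"
        "\<lambda>(i, j). hausdorff_weight m (C i j)"]
    by (simp add: D_def case_prod_beta comp_def)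
  also have "\<dots> \<le> (\<Sum>i. hausdorff_content m \<delta> (A i) + ennreal (e * (1/2) ^ Suc i))"
    using le by (intro suminf_le) auto
  also have "\<dots> = (\<Sum>i. hausdorff_content m \<delta> (A i)) + (\<Sum>i. ennreal (e * (1/2) ^ Suc i))"
    by (rule suminf_add[symmetric]) auto
  also have "(\<Sum>i. ennreal (e * (1/2) ^ Suc i)) = ennreal e"
    using sums_mult[OF power_half_series, of e] e
    by (intro suminf_ennreal_eq) (auto simp: mult_ac)
  finally show "hausdorff_content m \<delta> (\<Union>i. A i) \<le> (\<Sum>i. hausdorff_content m \<delta> (A i)) + ennreal e" .
qed

lemma outer_measure_space_hausdorff:
  "outer_measure_space UNIV (hausdorff_outer m :: 'a::metric_space set \<Rightarrow> ennreal)"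
  unfolding outer_measure_space_def
proof (intro conjI)
  have "hausdorff_content m \<delta> ({} :: 'a set) = 0" if "\<delta> > 0" for \<delta>
  proof -
    have "(\<lambda>_. {}) \<in> hausdorff_covers \<delta> ({} :: 'a set)"
      using that by (auto simp: hausdorff_covers_def diameter_def)
    then have "hausdorff_content m \<delta> ({} :: 'a set) \<le> (\<Sum>i::nat. hausdorff_weight m ({} :: 'a set))"
      unfolding hausdorff_content_def by (rule INF_lower2) simp
    then show ?thesis by (simp add: hausdorff_weight_def)
  qed
  then show "positive UNIV (hausdorff_outer m :: 'a set \<Rightarrow> ennreal)"
    by (simp add: positive_def hausdorff_outer_def bot_ennreal[symmetric])
  show "increasing UNIV (hausdorff_outer m :: 'a set \<Rightarrow> ennreal)"
    unfolding increasing_def hausdorff_outer_def by (auto intro!: SUP_mono' hausdorff_content_mono)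
  show "countably_subadditive UNIV (hausdorff_outer m :: 'a set \<Rightarrow> ennreal)"
    unfolding countably_subadditive_def
  proof (intro allI impI)
    fix A :: "nat \<Rightarrow> 'a set"
    have "hausdorff_content m \<delta> (\<Union>i. A i) \<le> (\<Sum>i. hausdorff_outer m (A i))" if "\<delta> > 0" for \<delta>
      using hausdorff_content_countably_subadditive
    proof (rule order_trans)
      show "(\<Sum>i. hausdorff_content m \<delta> (A i)) \<le> (\<Sum>i. hausdorff_outer m (A i))"
        using that by (intro suminf_le) (auto simp: hausdorff_outer_def intro!: SUP_upper)
    qed
    then show "hausdorff_outer m (\<Union>i. A i) \<le> (\<Sum>i. hausdorff_outer m (A i))"
      by (subst hausdorff_outer_def) (auto intro!: SUP_least)
  qed
qed

lemma measure_space_hausdorff: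
  "measure_space UNIV (lambda_system UNIV UNIV (hausdorff_outer m)) (hausdorff_outer m)"
  using sigma_algebra.caratheodory_lemma[OF sigma_algebra_Pow[of UNIV], of "hausdorff_outer m"]
    outer_measure_space_hausdorff[of m] by simp

lemma sets_hausdorff_measure:
  "sets (hausdorff_measure m) = lambda_system UNIV UNIV (hausdorff_outer m)"
  using measure_space_hausdorff[of m]
  by (auto simp: hausdorff_measure_def measure_space_def intro!: sigma_algebra.sigma_sets_eq)

lemma emeasure_hausdorff_measure:
  "A \<in> sets (hausdorff_measure m) \<Longrightarrow> emeasure (hausdorff_measure m) A = hausdorff_outer m A"
  using measure_space_hausdorff[of m] unfolding sets_hausdorff_measure
  by (auto simp: hausdorff_measure_def measure_space_def intro!: emeasure_measure_of_sigma)


section \<open>Lipschitz domains\<close>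

text \<open>Around every boundary point, \<open>\<Omega>\<close> is the part above the graph of a Lipschitz function
  over the hyperplane orthogonal to a unit vector \<open>e\<close>; thus \<open>(y - (y \<bullet> e) e, y \<bullet> e)\<close> are the
  rotated Cartesian coordinates of \<open>y\<close>.\<close>

definition bounded_lipschitz_domain :: "'a::euclidean_space set \<Rightarrow> bool" where
  "bounded_lipschitz_domain \<Omega> \<longleftrightarrow>
     open \<Omega> \<and> connected \<Omega> \<and> \<Omega> \<noteq> {} \<and> bounded \<Omega> \<and>
     (\<forall>x\<in>frontier \<Omega>. \<exists>U e h L. open U \<and> x \<in> U \<and> norm e = 1 \<and>
        L-lipschitz_on {z. z \<bullet> e = 0} (h :: 'a \<Rightarrow> real) \<and>
        (\<forall>y\<in>U. y \<in> \<Omega> \<longleftrightarrow> h (y - (y \<bullet> e) *\<^sub>R e) < y \<bullet> e))"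


section \<open>Lebesgue and Sobolev spaces\<close>

text \<open>Elements of function spaces are represented by functions (not by classes modulo a.e.
  equality); values outside of the domain are irrelevant.\<close>

definition Lp :: "real \<Rightarrow> 'a measure \<Rightarrow> ('a \<Rightarrow> 'b::euclidean_space) set" where
  "Lp p M = {g \<in> borel_measurable M. integrable M (\<lambda>x. norm (g x) powr p)}"

definition locally_integrable :: "'a::euclidean_space set \<Rightarrow> ('a \<Rightarrow> 'b::euclidean_space) \<Rightarrow> bool" where
  "locally_integrable \<Omega> g \<longleftrightarrow> (\<forall>K. compact K \<longrightarrow> K \<subseteq> \<Omega> \<longrightarrow> integrable (lebesgue_on K) g)"

definition partial :: "'a::euclidean_space \<Rightarrow> ('a \<Rightarrow> real) \<Rightarrow> 'a \<Rightarrow> real" where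
  "partial b \<phi> x = frechet_derivative \<phi> (at x) b"

primrec Ck :: "nat \<Rightarrow> ('a::euclidean_space \<Rightarrow> real) \<Rightarrow> bool" where
  "Ck 0 \<phi> \<longleftrightarrow> continuous_on UNIV \<phi>"
| "Ck (Suc k) \<phi> \<longleftrightarrow> (\<forall>x. \<phi> differentiable (at x)) \<and> (\<forall>b\<in>Basis. Ck k (partial b \<phi>))"

definition test_functions :: "'a::euclidean_space set \<Rightarrow> ('a \<Rightarrow> real) set" where
  "test_functions \<Omega> =
     {\<phi>. (\<forall>k. Ck k \<phi>) \<and> compact (closure {x. \<phi> x \<noteq> 0}) \<and> closure {x. \<phi> x \<noteq> 0} \<subseteq> \<Omega>}"

definition has_weak_gradient ::
  "'a::euclidean_space set \<Rightarrow> ('a \<Rightarrow> real) \<Rightarrow> ('a \<Rightarrow> 'a) \<Rightarrow> bool" where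
  "has_weak_gradient \<Omega> u G \<longleftrightarrow>
     locally_integrable \<Omega> u \<and> locally_integrable \<Omega> G \<and>
     (\<forall>\<phi>\<in>test_functions \<Omega>. \<forall>b\<in>Basis.
        (LINT x|lebesgue_on \<Omega>. u x * partial b \<phi> x) = - (LINT x|lebesgue_on \<Omega>. (G x \<bullet> b) * \<phi> x))"

text \<open>The weak gradient is determined up to a null set, so the choice below is immaterial.\<close>

definition weak_gradient :: "'a::euclidean_space set \<Rightarrow> ('a \<Rightarrow> real) \<Rightarrow> 'a \<Rightarrow> 'a" where
  "weak_gradient \<Omega> u = (SOME G. has_weak_gradient \<Omega> u G)"

definition H1 :: "'a::euclidean_space set \<Rightarrow> ('a \<Rightarrow> real) set" where
  "H1 \<Omega> = {u \<in> Lp 2 (lebesgue_on \<Omega>). \<exists>G\<in>Lp 2 (lebesgue_on \<Omega>). has_weak_gradient \<Omega> u G}"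

definition H1_norm :: "'a::euclidean_space set \<Rightarrow> ('a \<Rightarrow> real) \<Rightarrow> real" where
  "H1_norm \<Omega> u =
     sqrt (LINT x|lebesgue_on \<Omega>. (u x)\<^sup>2 + weak_gradient \<Omega> u x \<bullet> weak_gradient \<Omega> u x)"


section \<open>Traces and the space V\<close>

definition surface_measure :: "'a::euclidean_space measure" where
  "surface_measure = hausdorff_measure (DIM('a) - 1)"

text \<open>The graph of the trace operator \<open>\<gamma>\<^sub>0 : H\<^sup>1(\<Omega>) \<rightarrow> L\<^sup>2(\<Gamma>)\<close>, i.e. of the continuous extension of
  the restriction \<open>w \<mapsto> w|\<Gamma>\<close> from the functions in \<open>H\<^sup>1(\<Omega>)\<close> that are continuous up to the
  boundary: \<open>has_trace \<Omega> v g\<close> says that \<open>\<gamma>\<^sub>0 v = g\<close> a.e. on \<open>\<Gamma> = frontier \<Omega>\<close>. On a bounded Lipschitz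
  domain every \<open>v \<in> H\<^sup>1(\<Omega>)\<close> has such a \<open>g\<close>, unique up to a null set. The \<open>ennreal\<close>-valued integral is used
  because the Bochner integral of a non-integrable function is 0.\<close>

definition has_trace :: "'a::euclidean_space set \<Rightarrow> ('a \<Rightarrow> real) \<Rightarrow> ('a \<Rightarrow> real) \<Rightarrow> bool" where
  "has_trace \<Omega> v g \<longleftrightarrow>
     v \<in> H1 \<Omega> \<and> g \<in> Lp 2 (restrict_space surface_measure (frontier \<Omega>)) \<and>
     (\<exists>w. (\<forall>k::nat. w k \<in> H1 \<Omega> \<and> continuous_on (closure \<Omega>) (w k)) \<and>
        (\<lambda>k. H1_norm \<Omega> (\<lambda>x. w k x - v x)) \<longlonglongrightarrow> 0 \<and>
        (\<lambda>k. \<integral>\<^sup>+x. ennreal ((w k x - g x)\<^sup>2) \<partial>restrict_space surface_measure (frontier \<Omega>)) \<longlonglongrightarrow> 0)"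

definition V_space :: "'a::euclidean_space set \<Rightarrow> 'a set \<Rightarrow> ('a \<Rightarrow> real) set" where
  "V_space \<Omega> \<Gamma>\<^sub>D =
     {v \<in> H1 \<Omega>. \<exists>g. has_trace \<Omega> v g \<and> (AE x in surface_measure. x \<in> \<Gamma>\<^sub>D \<longrightarrow> g x = 0)}"


section \<open>The obstacle problem\<close>

text \<open>Elements of the dual space V' are represented by functionals on functions, of which only
  the values on V matter: \<open>Lp_functional \<Omega> g\<close> is the image of \<open>g \<in> L\<^sup>p(\<Omega>)\<close> in V',
  \<open>A_op \<Omega> \<sigma> u\<close> is \<open>A\<^sub>\<sigma> u\<close>, and the duality pairing is application.\<close>

definition bilin_a ::
  "'a::euclidean_space set \<Rightarrow> real \<Rightarrow> ('a \<Rightarrow> real) \<Rightarrow> ('a \<Rightarrow> real) \<Rightarrow> real" where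
  "bilin_a \<Omega> \<sigma> u v =
     (LINT x|lebesgue_on \<Omega>. weak_gradient \<Omega> u x \<bullet> weak_gradient \<Omega> v x + \<sigma> * u x * v x)"

definition A_op ::
  "'a::euclidean_space set \<Rightarrow> real \<Rightarrow> ('a \<Rightarrow> real) \<Rightarrow> (('a \<Rightarrow> real) \<Rightarrow> real)" where
  "A_op \<Omega> \<sigma> u = (\<lambda>v. bilin_a \<Omega> \<sigma> u v)"

definition Lp_functional ::
  "'a::euclidean_space set \<Rightarrow> ('a \<Rightarrow> real) \<Rightarrow> (('a \<Rightarrow> real) \<Rightarrow> real)" where
  "Lp_functional \<Omega> g = (\<lambda>v. LINT x|lebesgue_on \<Omega>. g x * v x)"

text \<open>\<open>is_Lp_density \<Omega> \<Gamma>\<^sub>D p F g\<close>: the functional \<open>F\<close> belongs to \<open>L\<^sup>p(\<Omega>)\<close>, being the image of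
  \<open>g \<in> L\<^sup>p(\<Omega>)\<close> in V'.\<close>

definition is_Lp_density ::
  "'a::euclidean_space set \<Rightarrow> 'a set \<Rightarrow> real \<Rightarrow> (('a \<Rightarrow> real) \<Rightarrow> real) \<Rightarrow> ('a \<Rightarrow> real) \<Rightarrow> bool" where
  "is_Lp_density \<Omega> \<Gamma>\<^sub>D p F g \<longleftrightarrow>
     g \<in> Lp p (lebesgue_on \<Omega>) \<and> (\<forall>v\<in>V_space \<Omega> \<Gamma>\<^sub>D. F v = Lp_functional \<Omega> g v)"

definition dual_le ::
  "'a::euclidean_space set \<Rightarrow> 'a set \<Rightarrow> (('a \<Rightarrow> real) \<Rightarrow> real) \<Rightarrow> (('a \<Rightarrow> real) \<Rightarrow> real) \<Rightarrow> bool" where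
  "dual_le \<Omega> \<Gamma>\<^sub>D F G \<longleftrightarrow>
     (\<forall>\<phi>\<in>V_space \<Omega> \<Gamma>\<^sub>D. (AE x in lebesgue_on \<Omega>. 0 \<le> \<phi> x) \<longrightarrow> 0 \<le> G \<phi> - F \<phi>)"

definition K0 :: "'a::euclidean_space set \<Rightarrow> 'a set \<Rightarrow> ('a \<Rightarrow> real) \<Rightarrow> ('a \<Rightarrow> real) set" where
  "K0 \<Omega> \<Gamma>\<^sub>D \<psi> = {v \<in> V_space \<Omega> \<Gamma>\<^sub>D. AE x in lebesgue_on \<Omega>. \<psi> x \<le> v x}"

definition K1 :: "'a::euclidean_space set \<Rightarrow> 'a set \<Rightarrow> real \<Rightarrow> ('a \<Rightarrow> real) \<Rightarrow> ('a \<Rightarrow> real) set" where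
  "K1 \<Omega> \<Gamma>\<^sub>D \<sigma> f = {v \<in> V_space \<Omega> \<Gamma>\<^sub>D. dual_le \<Omega> \<Gamma>\<^sub>D (Lp_functional \<Omega> f) (A_op \<Omega> \<sigma> v)}"

definition K2 ::
  "'a::euclidean_space set \<Rightarrow> 'a set \<Rightarrow> real \<Rightarrow> ('a \<Rightarrow> real) \<Rightarrow> ('a \<Rightarrow> real) \<Rightarrow> ('a \<Rightarrow> real) set" where
  "K2 \<Omega> \<Gamma>\<^sub>D \<sigma> f fhat =
     {v \<in> V_space \<Omega> \<Gamma>\<^sub>D. dual_le \<Omega> \<Gamma>\<^sub>D (Lp_functional \<Omega> f) (A_op \<Omega> \<sigma> v) \<and>
        dual_le \<Omega> \<Gamma>\<^sub>D (A_op \<Omega> \<sigma> v) (Lp_functional \<Omega> (\<lambda>x. max (f x) (fhat x)))}"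

definition J :: "'a::euclidean_space set \<Rightarrow> real \<Rightarrow> ('a \<Rightarrow> real) \<Rightarrow> ('a \<Rightarrow> real) \<Rightarrow> real" where
  "J \<Omega> \<sigma> f v = 1 / 2 * bilin_a \<Omega> \<sigma> v v - Lp_functional \<Omega> f v"

end

theory Submission
 imports Defs
begin

text \<open>The Sobolev, Poincare and trace inequalities all come from one pointwise estimate: an average of
 \<open>u\<close> over cones inside \<open>\<Omega>\<close> differs from \<open>u\<close> by at most a dyadic Riesz potential of \<open>|grad u|\<close>, which is
 bounded in \<open>L\<^sup>2\<close> of the volume and of the surface measure, and, by the maximal function, in the critical
 \<open>L\<^sup>q\<close>. Hence \<open>V\<close> is a Hilbert space with form \<open>a\<close>, and \<open>L\<^sup>p\<close> embeds into \<open>V'\<close>.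

 For the solution \<open>u\<close> of the obstacle problem the Lewy--Stampacchia inequality \<open>f \<le> A u \<le> max f (A \<psi>)\<close> puts
 \<open>u\<close> into \<open>K\<^sub>2\<close>; symmetry of \<open>a\<close> and uniqueness on \<open>K\<^sub>1\<close> and \<open>K\<^sub>2\<close> then identify all the variational
 inequalities. The same bounds show that \<open>A u - f\<close> has a density, by Riesz' theorem in a weighted \<open>L\<^sup>2\<close> space,
 so the complementarity condition holds pointwise.\<close>

text \<open>Three features of the statement shape the proof. The trace is given by approximation
  with functions continuous up to the boundary, so membership in V is always tested along such
  sequences, and the pointwise estimate has to hold at boundary points too; hence averages over
  cones with vertex x rather than balls about x. And A u is only a functional: the density demanded
  in (h) has to be constructed, and the weight \<open>max f fh - f\<close> is merely in L^p, hence a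
  weighted space in place of L^2.

  The weak gradient enters only through test functions: the derivative of an average with respect to
  vertex and scale falls on the kernel and is a divergence there. No extension operator, no
  flattening of the boundary and no compact embedding is used; in the Poincare inequality
  connectedness takes the place of compactness.\<close>

notation LIMSEQ (infix "\<leadsto>" 60)

section \<open>Flat functions and kernels\<close>

text \<open>The powers of 1/t belong to the family so that its span is closed under differentiation;
  \<open>flat 0\<close> is the standard smooth function that vanishes to infinite order at
  0.\<close>

definition flat :: "nat => real => real" where
 "flat m t = (if t > 0 then (1 / t) ^ m * exp (- 1 / t) else 0)"

lemma flat_nonneg: "0 \<le> flat m t"
 by (simp add: flat_def)

text \<open>A single term of the exponential series at 1/t bounds exp (1/t) from below. The case k =
  2 gives differentiability at 0, the case k = 0 boundedness.\<close>

lemma flat_bound: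
 assumes "t > 0"
 shows "flat m t \<le> fact (m + k) * t ^ k"
proof -
 have "(1 / t) ^ (m + k) /\<^sub>R fact (m + k) \<le> exp (1 / t)"
 proof -
  have "(\<lambda>n. (1 / t) ^ n /\<^sub>R fact n) sums exp (1 / t)"
   by (rule exp_converges)
  moreover have "sum (\<lambda>n. (1 / t) ^ n /\<^sub>R fact n) {m + k} \<le> suminf (\<lambda>n. (1 / t) ^ n /\<^sub>R fact n)"
   using assms calculation by (intro sum_le_suminf) (auto simp: sums_iff)
  ultimately show ?thesis by (simp add: sums_iff)
 qed
 then have "fact (m + k) * ((1 / t) ^ (m + k) / fact (m + k)) \<le> fact (m + k) * exp (1 / t)"
  by (intro mult_left_mono) (auto simp: divide_inverse_commute scaleR_conv_of_real)
 then have "(1 / t) ^ (m + k) \<le> fact (m + k) * exp (1 / t)"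
  by simp
 then have "(1 / t) ^ m * (1 / t) ^ k * exp (- 1 / t) \<le> fact (m + k) * (exp (1 / t) * exp (- 1 / t))"
  using mult_right_mono[of _ _ "exp (- 1 / t)"] by (simp add: power_add mult.assoc)
 also have "exp (1 / t) * exp (- 1 / t) = 1"
  by (simp add: exp_add[symmetric])
 finally have "((1 / t) ^ m * exp (- 1 / t)) * (1 / t) ^ k \<le> fact (m + k)"
  by (simp add: mult_ac)
 then show ?thesis
  using assms by (simp add: flat_def field_simps)
qed

lemma flat_has_derivative:
 "(flat m has_real_derivative flat (m + 2) t - real m * flat (m + 1) t) (at t)"
proof -
 consider "t > 0" | "t < 0" | "t = 0" by linarith
 then show ?thesis
 proof cases
  case 1
  have eq: "- (real m * r ^ (m + 1)) * E + E * r ^ 2 * r ^ m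
    = r ^ (m + 2) * E - real m * (r ^ (m + 1) * E)" for r E :: real
   by (simp add: power_add power2_eq_square algebra_simps)
  have d1: "((\<lambda>t. 1 / t) has_real_derivative - ((1 / t) ^ 2)) (at t)"
   using 1 by (auto intro!: derivative_eq_intros simp: power2_eq_square)
  have "((\<lambda>t. (1 / t) ^ m) has_real_derivative - (real m * (1 / t) ^ (m + 1))) (at t)"
   using DERIV_power[OF d1, of m] by (cases m) (auto simp: power2_eq_square mult_ac)
  moreover have "((\<lambda>t. exp (- 1 / t)) has_real_derivative exp (- 1 / t) * (1 / t) ^ 2) (at t)"
   using 1 by (auto intro!: derivative_eq_intros simp: power2_eq_square)
  ultimately have "((\<lambda>t. (1 / t) ^ m * exp (- 1 / t)) has_real_derivative
    flat (m + 2) t - real m * flat (m + 1) t) (at t)"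
   using DERIV_cong[OF DERIV_mult _, of "\<lambda>t. (1 / t) ^ m" _ t _ "\<lambda>t. exp (- 1 / t)"] eq[of "1 / t"] 1
   by (simp add: flat_def del: power_one_over)
  moreover have "\<forall>\<^sub>F s in nhds t. (1 / s) ^ m * exp (- 1 / s) = flat m s"
   using eventually_nhds_in_open[of "{0<..}" t] 1
   by (auto elim!: eventually_mono simp: flat_def)
  ultimately show ?thesis
   by (rule DERIV_cong_ev[OF refl _ refl, THEN iffD1, rotated])
 next
  case 2
  have "((\<lambda>t. 0) has_real_derivative flat (m + 2) t - real m * flat (m + 1) t) (at t)"
   using 2 by (simp add: flat_def)
  moreover have "\<forall>\<^sub>F s in nhds t. 0 = flat m s"
   using eventually_nhds_in_open[of "{..<0}" t] 2
   by (auto elim!: eventually_mono simp: flat_def)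
  ultimately show ?thesis
   by (rule DERIV_cong_ev[OF refl _ refl, THEN iffD1, rotated])
 next
  case 3
  have "((\<lambda>h. (flat m (0 + h) - flat m 0) / h) \<longlongrightarrow> 0) (at 0)"
  proof (rule Lim_null_comparison)
   show "\<forall>\<^sub>F h in at 0. norm ((flat m (0 + h) - flat m 0) / h) \<le> fact (m + 2) * \<bar>h\<bar>"
   proof (intro always_eventually allI)
    fix h :: real
    show "norm ((flat m (0 + h) - flat m 0) / h) \<le> fact (m + 2) * \<bar>h\<bar>"
    proof (cases "h > 0")
     case True
     then show ?thesis
      using flat_bound[OF True, of m 2] flat_nonneg[of m h]
      by (simp add: flat_def[of m 0] field_simps power2_eq_square)
    next
     case False
     then have "flat m (0 + h) - flat m 0 = 0" by (simp add: flat_def)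
     then show ?thesis by (simp only: div_0 norm_zero) simp
    qed
   qed
   show "((\<lambda>h::real. fact (m + 2) * \<bar>h\<bar>) \<longlongrightarrow> 0) (at 0)"
    by (intro tendsto_mult_right_zero tendsto_rabs_zero tendsto_ident_at)
  qed
  then show ?thesis
   using 3 by (simp add: DERIV_def flat_def)
 qed
qed

lemma has_derivative_imp_partial:
 "(F has_derivative F') (at x) ==> partial b F x = F' b"
 unfolding partial_def by (simp add: frechet_derivative_at[symmetric])

lemma partial_add:
 assumes "f differentiable (at x)" "g differentiable (at x)"
 shows "partial b (\<lambda>x. f x + g x) x = partial b f x + partial b g x"
 using has_derivative_imp_partial[OF has_derivative_add[OF assms[unfolded frechet_derivative_works]]]
 by (simp add: partial_def)

lemma partial_mult:
 assumes "f differentiable (at x)" "g differentiable (at x)"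
 shows "partial b (\<lambda>x. f x * g x) x = f x * partial b g x + partial b f x * g x"
 using has_derivative_imp_partial[OF has_derivative_mult[OF assms[unfolded frechet_derivative_works]]]
 by (simp add: partial_def)

lemma real_polynomial_partial:
 assumes "real_polynomial_function q"
 shows "q differentiable (at x)" "real_polynomial_function (partial b q)"
proof -
 have "(\<forall>x. q differentiable (at x)) \<and> real_polynomial_function (partial b q)"
  using assms
 proof induction
  case (linear f)
  have "(f has_derivative f) (at x)" for x
   using bounded_linear_imp_has_derivative[OF linear] .
  moreover from this have "partial b f = (\<lambda>x. f b)"
   using has_derivative_imp_partial by fastforce
  ultimately show ?case
   by (auto simp: differentiable_def)
 next
  case (const c)
  have "partial b (\<lambda>x. c) = (\<lambda>x. 0)"
   using has_derivative_imp_partial[OF has_derivative_const] by fastforce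
  then show ?case by auto
 next
  case (add f g)
  have "partial b (\<lambda>x. f x + g x) = (\<lambda>x. partial b f x + partial b g x)"
   using add.IH by (intro ext partial_add) auto
  then show ?case using add.IH by (auto intro!: derivative_intros)
 next
  case (mult f g)
  have "partial b (\<lambda>x. f x * g x) = (\<lambda>x. f x * partial b g x + partial b f x * g x)"
   using mult.IH by (intro ext partial_mult) auto
  then show ?case using mult by (auto intro!: derivative_intros)
 qed
 then show "q differentiable (at x)" "real_polynomial_function (partial b q)" by auto
qed

text \<open>The derivatives of \<open>flat 0\<close> composed with a polynomial have no convenient
  closed form, but all of them are sums of this shape. Stability under \<open>partial\<close> then
  gives \<open>Ck k\<close> for every k by one induction.\<close>

inductive flat_poly :: "('a::euclidean_space => real) => ('a => real) => bool" for Q where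
 base: "real_polynomial_function q ==> flat_poly Q (\<lambda>x. q x * flat m (Q x))"
| add: "flat_poly Q F ==> flat_poly Q G ==> flat_poly Q (\<lambda>x. F x + G x)"

lemma flat_poly_partial:
 assumes Q: "real_polynomial_function Q" and "flat_poly Q F"
 shows "(\<forall>x. F differentiable (at x)) \<and> flat_poly Q (partial b F)"
 using assms(2)
proof induction
 case (base q m)
 have der: "((\<lambda>x. q x * flat m (Q x)) has_derivative
   (\<lambda>h. q x * ((flat (m + 2) (Q x) - real m * flat (m + 1) (Q x)) * frechet_derivative Q (at x) h)
    + frechet_derivative q (at x) h * flat m (Q x))) (at x)" for x
  by (intro has_derivative_mult has_derivative_compose[OF _ flat_has_derivative[unfolded has_field_derivative_def]]
    frechet_derivative_works[THEN iffD1] real_polynomial_partial(1) Q base)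
 have "partial b (\<lambda>x. q x * flat m (Q x)) =
   (\<lambda>x. (q x * partial b Q x) * flat (m + 2) (Q x) +
    ((- real m * (q x * partial b Q x)) * flat (m + 1) (Q x) + partial b q x * flat m (Q x)))"
  using has_derivative_imp_partial[OF der, of b] by (auto simp: partial_def algebra_simps)
 moreover have "flat_poly Q \<dots>"
  by (intro flat_poly.intros real_polynomial_function.intros real_polynomial_partial(2) Q base)
 ultimately show ?case
  using der by (auto simp: differentiable_def)
next
 case (add F G)
 have "partial b (\<lambda>x. F x + G x) = (\<lambda>x. partial b F x + partial b G x)"
  using add.IH by (intro ext partial_add) auto
 then show ?case using add.IH by (auto intro!: derivative_intros flat_poly.add)
qed

lemma flat_poly_Ck:
 assumes Q: "real_polynomial_function Q" and "flat_poly Q F"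
 shows "Ck k F"
 using assms(2)
proof (induction k arbitrary: F)
 case 0
 then show ?case
  using flat_poly_partial[OF Q 0] differentiable_imp_continuous_on differentiable_on_def
  by (metis Ck.simps(1) differentiable_at_withinI)
next
 case (Suc k)
 then show ?case using flat_poly_partial[OF Q Suc.prems] by auto
qed

lemma real_polynomial_norm_affine:
 "real_polynomial_function (\<lambda>y::'a::euclidean_space. r - (norm ((1 / s) *\<^sub>R (y - x) - e))^2)"
proof -
 have "(\<lambda>y::'a. r - (norm ((1 / s) *\<^sub>R (y - x) - e))^2) =
   (\<lambda>y. r - (\<Sum>b\<in>Basis. (y \<bullet> b * (1 / s) - (x \<bullet> b / s + e \<bullet> b)) * (y \<bullet> b * (1 / s) - (x \<bullet> b / s + e \<bullet> b))))"
  by (rule ext, subst power2_norm_eq_inner, subst euclidean_inner)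
   (simp add: inner_simps field_simps)
 moreover have coord: "real_polynomial_function (\<lambda>y. y \<bullet> b * (1 / s) - c)" for b :: 'a and c
  by (intro real_polynomial_function_diff real_polynomial_function.intros(4)
    real_polynomial_function.intros(1)[OF bounded_linear_inner_left] real_polynomial_function.intros(2))
 have "real_polynomial_function (\<lambda>y::'a. r - (\<Sum>b\<in>Basis.
   (y \<bullet> b * (1 / s) - (x \<bullet> b / s + e \<bullet> b)) * (y \<bullet> b * (1 / s) - (x \<bullet> b / s + e \<bullet> b))))"
  by (intro real_polynomial_function_diff[OF real_polynomial_function.intros(2)]
    real_polynomial_function_sum real_polynomial_function.intros(4) coord finite_Basis)
 ultimately show ?thesis by metis
qed

subsection \<open>The kernel\<close>

definition ker0 :: "'a::euclidean_space => real => 'a => real" where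
 "ker0 e k z = flat 0 (k^2 - (norm (z - e))^2)"

text \<open>Supported in the ball of radius s k about x + s e. For s in (0, 1] these balls sweep out
  a cone with vertex x, so small s approaches x from one side; e = 0 gives an ordinary mollifier.
  The factor (1/s)^n keeps the mass independent of s.\<close>

definition ker :: "'a::euclidean_space => real => 'a => real => 'a => real" where
 "ker e k x s y = (1 / s) ^ DIM('a) * ker0 e k ((1 / s) *\<^sub>R (y - x))"

lemma ker0_nonneg: "0 \<le> ker0 e k z"
 by (simp add: ker0_def flat_nonneg)

lemma ker0_le_1: "ker0 e k z \<le> 1"
 by (simp add: ker0_def flat_def)

lemma ker0_pos: "z \<in> ball e k ==> 0 < ker0 e k z"
 by (auto simp: ker0_def flat_def dist_norm norm_minus_commute intro!: power_strict_mono)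

lemma ker0_eq_0: "k > 0 ==> z \<notin> ball e k ==> ker0 e k z = 0"
 by (auto simp: ker0_def flat_def dist_norm norm_minus_commute dest!: power2_less_imp_less)

lemma ker_nonneg: "s > 0 ==> 0 \<le> ker e k x s y"
 by (simp add: ker_def ker0_nonneg)

lemma ker_eq_0:
 assumes "k > 0" "s > 0" "y \<notin> ball (x + s *\<^sub>R e) (s * k)"
 shows "ker e k x s y = 0"
proof -
 have "norm (y - (x + s *\<^sub>R e)) = s * norm ((1 / s) *\<^sub>R (y - x) - e)"
 proof -
  have "y - (x + s *\<^sub>R e) = s *\<^sub>R ((1 / s) *\<^sub>R (y - x) - e)"
   using assms by (simp add: algebra_simps)
  then show ?thesis using assms by simp
 qed
 then have "(1 / s) *\<^sub>R (y - x) \<notin> ball e k"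
  using assms by (auto simp: dist_norm norm_minus_commute)
 then show ?thesis using assms by (simp add: ker_def ker0_eq_0)
qed

text \<open>The polynomial factor provides for the affine vector field that appears when an average
  is differentiated, see \<open>mol_path_derivative\<close>.\<close>

lemma ker_test_function:
 assumes "c > 0" "s > 0" "cball (x + s *\<^sub>R e) (s * c) \<subseteq> \<Omega>" "real_polynomial_function q"
 shows "(\<lambda>y. q y * ker e c x s y) \<in> test_functions \<Omega>"
proof -
 let ?Q = "\<lambda>y. c^2 - (norm ((1 / s) *\<^sub>R (y - x) - e))^2"
 have eq: "(\<lambda>y. q y * ker e c x s y) = (\<lambda>y. (q y * (1 / s) ^ DIM('a)) * flat 0 (?Q y))"
  by (simp add: ker_def ker0_def mult.assoc)
 have "flat_poly ?Q (\<lambda>y. q y * ker e c x s y)"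
  unfolding eq using assms by (intro flat_poly.base) auto
 then have "\<forall>k. Ck k (\<lambda>y. q y * ker e c x s y)"
  using flat_poly_Ck[OF real_polynomial_norm_affine] by blast
 moreover have sub: "closure {y. q y * ker e c x s y \<noteq> 0} \<subseteq> cball (x + s *\<^sub>R e) (s * c)"
 proof (rule closure_minimal)
  show "{y. q y * ker e c x s y \<noteq> 0} \<subseteq> cball (x + s *\<^sub>R e) (s * c)"
  proof
   fix y assume "y \<in> {y. q y * ker e c x s y \<noteq> 0}"
   then have "ker e c x s y \<noteq> 0" by simp
   then show "y \<in> cball (x + s *\<^sub>R e) (s * c)"
    using ker_eq_0[OF assms(1,2)] ball_subset_cball by blast
  qed
 qed simp
 moreover have "compact (closure {y. q y * ker e c x s y \<noteq> 0})"
  using bounded_subset[OF bounded_cball sub] by (simp add: compact_eq_bounded_closed)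
 ultimately show ?thesis
  using assms(3) by (auto simp: test_functions_def)
qed

section \<open>Integration lemmas\<close>

lemma lborel_integral_translate:
 fixes f :: "'a::euclidean_space => real"
 shows "(\<integral>x. f (x + h) \<partial>lborel) = (\<integral>x. f x \<partial>lborel)"
proof (cases "f \<in> borel_measurable borel")
 case True
 have "(\<integral>x. f x \<partial>lborel) = (\<integral>x. f x \<partial>distr lborel borel ((+) h))"
  by (simp add: lborel_distr_plus)
 also have "\<dots> = (\<integral>x. f (h + x) \<partial>lborel)"
  by (rule integral_distr) (use True in auto)
 finally show ?thesis by (simp add: add.commute)
next
 \<comment> \<open>For a non-measurable f both integrals take the default value 0.\<close>
 case False
 have "(\<lambda>x. f (x + h)) \<notin> borel_measurable borel"
 proof
  assume "(\<lambda>x. f (x + h)) \<in> borel_measurable borel"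
  from measurable_compose[OF _ this, of "\<lambda>x. x - h" borel] show False
   using False by simp
 qed
 then show ?thesis
  using False by (simp add: not_integrable_integral_eq borel_measurable_integrable
    integrable_iff_bounded)
qed

lemma nn_integral_lborel_translate:
 fixes f :: "'a::euclidean_space => ennreal"
 assumes [measurable]: "f \<in> borel_measurable borel"
 shows "(\<integral>\<^sup>+x. f (x + h) \<partial>lborel) = (\<integral>\<^sup>+x. f x \<partial>lborel)"
proof -
 have "(\<integral>\<^sup>+x. f x \<partial>lborel) = (\<integral>\<^sup>+x. f x \<partial>distr lborel borel ((+) h))"
  by (simp add: lborel_distr_plus)
 also have "\<dots> = (\<integral>\<^sup>+x. f (h + x) \<partial>lborel)"
  by (rule nn_integral_distr) auto
 finally show ?thesis by (simp add: add.commute)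
qed

text \<open>The mean value inequality bounds the difference quotients of k by B, so B |u| dominates
  along every sequence tending to t.\<close>

lemma has_derivative_integral_param:
 fixes k k' :: "real => 'a::euclidean_space => real"
 assumes u: "integrable lborel u" and t: "t \<in> {a<..<b}"
  and der: "\<And>\<tau> y. \<tau> \<in> {a<..<b} ==> ((\<lambda>\<tau>. k \<tau> y) has_real_derivative k' \<tau> y) (at \<tau>)"
  and bd: "\<And>\<tau> y. \<tau> \<in> {a<..<b} ==> \<bar>k' \<tau> y\<bar> \<le> B"
  and int: "\<And>\<tau>. \<tau> \<in> {a<..<b} ==> integrable lborel (\<lambda>y. u y * k \<tau> y)"
  and meas: "k' t \<in> borel_measurable borel"
 shows "((\<lambda>\<tau>. LINT y|lborel. u y * k \<tau> y) has_real_derivative (LINT y|lborel. u y * k' t y)) (at t)"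
proof -
 have [measurable]: "u \<in> borel_measurable lborel" using u by auto
 note meas[measurable]
 have "((\<lambda>\<tau>. ((LINT y|lborel. u y * k \<tau> y) - (LINT y|lborel. u y * k t y)) / (\<tau> - t))
   \<longlongrightarrow> (LINT y|lborel. u y * k' t y)) (at t within {a<..<b})"
  unfolding tendsto_at_iff_sequentially
 proof (intro allI impI)
  fix X :: "nat => real" assume X: "\<forall>i. X i \<in> {a<..<b} - {t}" "X \<leadsto> t"
  have X': "X i \<in> {a<..<b}" "X i \<noteq> t" for i using X by auto
  have "(\<lambda>i. LINT y|lborel. u y * ((k (X i) y - k t y) / (X i - t)))
    \<leadsto> (LINT y|lborel. u y * k' t y)"
  proof (rule integral_dominated_convergence[where w = "\<lambda>y. \<bar>u y\<bar> * B"])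
   show "(\<lambda>y. u y * k' t y) \<in> borel_measurable lborel" by measurable
   show "(\<lambda>y. u y * ((k (X i) y - k t y) / (X i - t))) \<in> borel_measurable lborel" for i
   proof -
    have "(\<lambda>y. (u y * k (X i) y - u y * k t y) / (X i - t)) \<in> borel_measurable lborel"
     using int[OF X'(1)[of i]] int[OF t] by measurable
    then show ?thesis by (simp add: algebra_simps)
   qed
   show "integrable lborel (\<lambda>y. \<bar>u y\<bar> * B)" using u by auto
   show "AE y in lborel. (\<lambda>i. u y * ((k (X i) y - k t y) / (X i - t))) \<leadsto> u y * k' t y"
   proof (rule AE_I2, rule tendsto_mult_left)
    fix y :: 'a
    have "((\<lambda>\<tau>. (k \<tau> y - k t y) / (\<tau> - t)) \<longlongrightarrow> k' t y) (at t)"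
     using der[OF t, of y] by (simp add: has_field_derivative_iff)
    moreover have "filterlim X (at t) sequentially"
     using X by (auto simp: filterlim_at intro!: always_eventually)
    ultimately show "(\<lambda>i. (k (X i) y - k t y) / (X i - t)) \<leadsto> k' t y"
     by (rule filterlim_compose)
   qed
   show "AE y in lborel. norm (u y * ((k (X i) y - k t y) / (X i - t))) \<le> \<bar>u y\<bar> * B" for i
   proof (rule AE_I2)
    fix y :: 'a
    have "norm (k (X i) y - k t y) \<le> B * norm (X i - t)"
     by (rule field_differentiable_bound[where S = "{a<..<b}" and f' = "\<lambda>\<tau>. k' \<tau> y"])
      (use der bd X'(1) t in \<open>auto intro: has_field_derivative_at_within\<close>)
    then have "\<bar>(k (X i) y - k t y) / (X i - t)\<bar> \<le> B"
     using X'(2)[of i] by (simp add: field_simps)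
    then show "norm (u y * ((k (X i) y - k t y) / (X i - t))) \<le> \<bar>u y\<bar> * B"
     unfolding real_norm_def abs_mult[of "u y"] by (rule mult_left_mono) simp
   qed
  qed
  moreover have "(LINT y|lborel. u y * ((k (X i) y - k t y) / (X i - t))) =
    ((LINT y|lborel. u y * k (X i) y) - (LINT y|lborel. u y * k t y)) / (X i - t)" for i
  proof -
   have "(LINT y|lborel. u y * ((k (X i) y - k t y) / (X i - t))) =
    (LINT y|lborel. (u y * k (X i) y - u y * k t y) / (X i - t))"
    by (simp add: algebra_simps)
   then show ?thesis using int[OF X'(1)[of i]] int[OF t] by simp
  qed
  ultimately show "((\<lambda>\<tau>. ((LINT y|lborel. u y * k \<tau> y) - (LINT y|lborel. u y * k t y)) / (\<tau> - t)) \<circ> X)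
   \<leadsto> (LINT y|lborel. u y * k' t y)" by (simp only: o_def)
 qed
 then show ?thesis
  by (simp add: has_field_derivative_iff at_within_open[OF t open_greaterThanLessThan])
qed

text \<open>By translation invariance every difference quotient of F has integral 0, and dominated
  convergence carries this over to F'. Steps of size at most 1 keep all quotients supported in the
  ball of radius R + |b|.\<close>

lemma integral_directional_derivative_0:
 fixes F :: "'a::euclidean_space => real"
 assumes der: "\<And>y. ((\<lambda>t. F (y + t *\<^sub>R b)) has_real_derivative F' y) (at 0)"
  and bd: "\<And>y. \<bar>F' y\<bar> \<le> B" and supp: "\<And>y. F y \<noteq> 0 ==> norm y \<le> R"
  and meas: "F \<in> borel_measurable borel" and int: "integrable lborel F"
 shows "(LINT y|lborel. F' y) = 0"
proof -
 note meas[measurable]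
 have der': "((\<lambda>t. F (y + t *\<^sub>R b)) has_real_derivative F' (y + t *\<^sub>R b)) (at t)" for y t
  using der[of "y + t *\<^sub>R b"] DERIV_shift[of "\<lambda>t. F (y + t *\<^sub>R b)" "F' (y + t *\<^sub>R b)" 0 t]
  by (simp add: algebra_simps)
 have lip: "\<bar>F (y + t *\<^sub>R b) - F y\<bar> \<le> B * \<bar>t\<bar>" for y t
  using field_differentiable_bound[of UNIV "\<lambda>t. F (y + t *\<^sub>R b)" "\<lambda>t. F' (y + t *\<^sub>R b)" B 0 t]
   der' bd by auto
 define X where "X = (\<lambda>i::nat. 1 / (real i + 1))"
 have X: "X i > 0" "X i \<le> 1" for i by (auto simp: X_def)
 have Xlim: "filterlim X (at 0) sequentially"
  unfolding filterlim_at using X(1) LIMSEQ_inverse_real_of_nat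
  by (auto simp: X_def inverse_eq_divide add.commute less_imp_neq[symmetric] intro!: always_eventually)
 define W where "W = (\<lambda>y::'a. B * indicator (cball 0 (R + norm b)) y :: real)"
 have lim: "(\<lambda>i. (F (y + X i *\<^sub>R b) - F y) / X i) \<leadsto> F' y" for y
  using filterlim_compose[OF der[of y, unfolded DERIV_def] Xlim] by simp
 have "(\<lambda>i. LINT y|lborel. (F (y + X i *\<^sub>R b) - F y) / X i) \<leadsto> (LINT y|lborel. F' y)"
 proof (rule integral_dominated_convergence[where w = W])
  show "F' \<in> borel_measurable lborel"
   by (rule borel_measurable_LIMSEQ_real[where u = "\<lambda>i y. (F (y + X i *\<^sub>R b) - F y) / X i"])
    (use lim in auto)
  show "(\<lambda>y. (F (y + X i *\<^sub>R b) - F y) / X i) \<in> borel_measurable lborel" for i by measurable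
  show "integrable lborel W"
   unfolding W_def using emeasure_lborel_cball_finite[of "0 :: 'a" "R + norm b"]
   by (intro integrable_mult_right integrable_real_indicator) auto
  show "AE y in lborel. (\<lambda>i. (F (y + X i *\<^sub>R b) - F y) / X i) \<leadsto> F' y"
   using lim by auto
  show "AE y in lborel. norm ((F (y + X i *\<^sub>R b) - F y) / X i) \<le> W y" for i
  proof (rule AE_I2)
   fix y
   have B: "0 \<le> B" using bd[of y] by linarith
   show "norm ((F (y + X i *\<^sub>R b) - F y) / X i) \<le> W y"
   proof (cases "y \<in> cball 0 (R + norm b)")
    case True
    then show ?thesis using lip[of y "X i"] X(1)[of i] by (simp add: W_def field_simps)
   next
    case False
    then have far: "norm y > R + norm b" by auto
    then have "F y = 0" using supp[of y] norm_ge_zero[of b] by fastforce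
    moreover have "norm (X i *\<^sub>R b) \<le> norm b" using X[of i] by (simp add: mult_left_le_one_le)
    then have "F (y + X i *\<^sub>R b) = 0"
     using supp[of "y + X i *\<^sub>R b"] far norm_diff_ineq[of y "X i *\<^sub>R b"] by force
    ultimately show ?thesis using B by (simp add: W_def)
   qed
  qed
 qed
 moreover have "(LINT y|lborel. (F (y + X i *\<^sub>R b) - F y) / X i) = 0" for i
 proof -
  have "integrable lborel (\<lambda>y. F (y + X i *\<^sub>R b))"
   using int lborel_integrable_real_affine
   by (subst (asm) lborel_distr_plus[of "X i *\<^sub>R b", symmetric], subst (asm) integrable_distr_eq) (auto simp: add.commute)
  then show ?thesis using int by (simp add: lborel_integral_translate)
 qed
 ultimately have "(\<lambda>i::nat. 0::real) \<leadsto> (LINT y|lborel. F' y)" by (simp only:)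
 then show ?thesis by (simp add: LIMSEQ_const_iff)
qed

definition L1_shift :: "('a::euclidean_space => real) => 'a => ennreal" where
 "L1_shift f h = (\<integral>\<^sup>+x. ennreal \<bar>f (x + h) - f x\<bar> \<partial>lborel)"

lemma L1_shift_approx:
 assumes f[measurable]: "f \<in> borel_measurable borel"
  and approx: "\<And>e. e > 0 ==> \<exists>g\<in>borel_measurable borel. (L1_shift g \<longlongrightarrow> 0) (at 0) \<and>
   (\<integral>\<^sup>+x. ennreal \<bar>g x - f x\<bar> \<partial>lborel) < ennreal e"
 shows "(L1_shift f \<longlongrightarrow> 0) (at 0)"
proof (rule order_tendstoI)
 fix a :: ennreal assume "0 < a"
 then obtain b where b: "0 < b" "b < a" using dense by blast
 then obtain e where e: "b = ennreal e" "e > 0" by (cases b) auto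
 obtain g where g[measurable]: "g \<in> borel_measurable borel" and lim: "(L1_shift g \<longlongrightarrow> 0) (at 0)"
  and gf: "(\<integral>\<^sup>+x. ennreal \<bar>g x - f x\<bar> \<partial>lborel) < ennreal (e / 3)" (is "?D < _")
  using approx[of "e / 3"] e by auto
 have le: "L1_shift f h \<le> L1_shift g h + (?D + ?D)" for h
 proof -
  have "L1_shift f h \<le> (\<integral>\<^sup>+x. ennreal \<bar>g (x + h) - g x\<bar> + (ennreal \<bar>g (x + h) - f (x + h)\<bar> + ennreal \<bar>g x - f x\<bar>) \<partial>lborel)"
   unfolding L1_shift_def
   by (intro nn_integral_mono) (auto simp: ennreal_plus[symmetric] simp del: ennreal_plus intro!: ennreal_leI)
  also have "\<dots> = L1_shift g h + ((\<integral>\<^sup>+x. ennreal \<bar>g (x + h) - f (x + h)\<bar> \<partial>lborel) + ?D)"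
   by (simp add: nn_integral_add L1_shift_def)
  finally show ?thesis using nn_integral_lborel_translate[of "\<lambda>x. ennreal \<bar>g x - f x\<bar>" h] by simp
 qed
 have "\<forall>\<^sub>F h in at 0. L1_shift g h < ennreal (e / 3)" by (rule order_tendstoD(2)[OF lim]) (use e in simp)
 then show "\<forall>\<^sub>F h in at 0. L1_shift f h < a"
 proof eventually_elim
  case (elim h)
  have "L1_shift f h < ennreal (e / 3) + (ennreal (e / 3) + ennreal (e / 3))"
   by (rule le_less_trans[OF le]) (intro add_strict_mono elim gf)
  also have "\<dots> = b" using e by (simp add: ennreal_plus[symmetric] del: ennreal_plus)
  finally show ?case using b by simp
 qed
qed simp

text \<open>Continuity of translation in L1. Open sets come first, because a point of U stays in U
  under small shifts; outer regularity extends this to Borel sets, and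
  \<open>L1_shift_approx\<close> to limits.\<close>

lemma L1_shift_tendsto_0:
 fixes f :: "'a::euclidean_space => real"
 assumes "integrable lborel f"
 shows "(L1_shift f \<longlongrightarrow> 0) (at 0)"
 using assms
proof (induction rule: integrable_induct)
 case (base A c)
 then have A[measurable]: "A \<in> sets borel" and fin: "emeasure lborel A < \<infinity>" by auto
 have "(L1_shift (\<lambda>x. indicator U x * c) \<longlongrightarrow> 0) (at 0)"
  if U: "open U" and Uf: "emeasure lborel U < \<infinity>" for U :: "'a set"
  unfolding tendsto_at_iff_sequentially
 proof (intro allI impI)
  fix X :: "nat => 'a" assume "X \<leadsto> 0"
  have [measurable]: "U \<in> sets borel" using U by simp
  have half: "(\<lambda>n. \<integral>\<^sup>+x. ennreal (\<bar>c\<bar> * (indicator U x * (1 - indicator U (x + Y n)))) \<partial>lborel) \<leadsto> 0"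
   if Y: "Y \<leadsto> 0" for Y :: "nat => 'a"
  proof -
   have "(\<lambda>n. \<integral>\<^sup>+x. ennreal (\<bar>c\<bar> * (indicator U x * (1 - indicator U (x + Y n)))) \<partial>lborel) \<leadsto> (\<integral>\<^sup>+x. 0 \<partial>(lborel :: 'a measure))"
   proof (rule nn_integral_dominated_convergence[where w = "\<lambda>x. ennreal \<bar>c\<bar> * indicator U x"])
    show "(\<integral>\<^sup>+x\<in>U. ennreal \<bar>c\<bar> \<partial>lborel) < \<infinity>" using Uf by (simp add: nn_integral_cmult ennreal_mult_less_top)
    show "AE x in lborel. (\<lambda>n. ennreal (\<bar>c\<bar> * (indicator U x * (1 - indicator U (x + Y n))))) \<leadsto> 0"
    proof (rule AE_I2)
     fix x
     have "(\<lambda>n. x + Y n) \<leadsto> x + 0" by (intro tendsto_intros Y)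
     then have "\<forall>\<^sub>F n in sequentially. x \<in> U --> x + Y n \<in> U"
      using topological_tendstoD[OF _ U] by (cases "x \<in> U") auto
     then have "\<forall>\<^sub>F n in sequentially. ennreal (\<bar>c\<bar> * (indicator U x * (1 - indicator U (x + Y n)))) = 0"
      by eventually_elim (auto split: split_indicator)
     then show "(\<lambda>n. ennreal (\<bar>c\<bar> * (indicator U x * (1 - indicator U (x + Y n))))) \<leadsto> 0"
      by (rule tendsto_eventually)
    qed
   qed (auto split: split_indicator)
   then show ?thesis by simp
  qed
  \<comment> \<open>Points that leave U and points that enter it are counted separately. After a
    translation the second integral is of the first kind with shift -h, so both are dominated by a
    multiple of the indicator of U.\<close>
  have "L1_shift (\<lambda>x. indicator U x * c) h = (\<integral>\<^sup>+x. ennreal (\<bar>c\<bar> * (indicator U x * (1 - indicator U (x + h)))) \<partial>lborel)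
    + (\<integral>\<^sup>+x. ennreal (\<bar>c\<bar> * (indicator U x * (1 - indicator U (x + - h)))) \<partial>lborel)" for h
  proof -
   have "L1_shift (\<lambda>x. indicator U x * c) h = (\<integral>\<^sup>+x. ennreal (\<bar>c\<bar> * (indicator U x * (1 - indicator U (x + h)))) +
     ennreal (\<bar>c\<bar> * (indicator U (x + h) * (1 - indicator U (x + h + - h)))) \<partial>lborel)"
    unfolding L1_shift_def by (intro nn_integral_cong) (auto split: split_indicator)
   then show ?thesis
    using nn_integral_lborel_translate[of "\<lambda>x. ennreal (\<bar>c\<bar> * (indicator U x * (1 - indicator U (x + - h))))" h]
    by (simp add: nn_integral_add)
  qed
  then show "(L1_shift (\<lambda>x. indicator U x * c) \<circ> X) \<leadsto> 0"
   using tendsto_add[OF half[OF \<open>X \<leadsto> 0\<close>] half[of "\<lambda>n. - X n"]] tendsto_minus[OF \<open>X \<leadsto> 0\<close>] by (simp add: o_def)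
 qed
 note op = this
 have "(L1_shift (\<lambda>x. indicator A x * c) \<longlongrightarrow> 0) (at 0)"
 proof (rule L1_shift_approx)
  fix e :: real assume e: "e > 0"
  define et where "et = e / (\<bar>c\<bar> + 1)"
  have et: "et > 0" "\<bar>c\<bar> * et < e" using e by (auto simp: et_def field_simps)
  obtain U where U: "open U" "A \<subseteq> U" "emeasure lborel (U - A) < ennreal et"
   using outer_regular_lborel[OF A et(1)] by metis
  have [measurable]: "U \<in> sets borel" using U by simp
  have "emeasure lborel U \<le> emeasure lborel A + emeasure lborel (U - A)"
   using emeasure_subadditive[of A lborel "U - A"] U(2) by (simp add: Un_absorb1)
  also have "\<dots> < \<infinity>" using fin less_trans[OF U(3) ennreal_less_top] by simp
  finally have "(L1_shift (\<lambda>x. indicator U x * c) \<longlongrightarrow> 0) (at 0)" by (rule op[OF U(1)])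
  moreover have "(\<integral>\<^sup>+x. ennreal \<bar>indicator U x * c - indicator A x * c\<bar> \<partial>lborel) = (\<integral>\<^sup>+x\<in>U - A. ennreal \<bar>c\<bar> \<partial>lborel)"
   using U(2) by (intro nn_integral_cong) (auto split: split_indicator)
  then have "(\<integral>\<^sup>+x. ennreal \<bar>indicator U x * c - indicator A x * c\<bar> \<partial>lborel) < ennreal e"
   using mult_left_mono[OF less_imp_le[OF U(3)], of "ennreal \<bar>c\<bar>"] et e
   by (auto simp: nn_integral_cmult ennreal_mult[symmetric] intro: le_less_trans ennreal_lessI)
  ultimately show "\<exists>g\<in>borel_measurable borel. (L1_shift g \<longlongrightarrow> 0) (at 0) \<and>
    (\<integral>\<^sup>+x. ennreal \<bar>g x - indicator A x * c\<bar> \<partial>lborel) < ennreal e"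
   by (intro bexI[of _ "\<lambda>x. indicator U x * c"]) auto
 qed simp
 then show ?case by simp
next
 case (add f g)
 then have [measurable]: "f \<in> borel_measurable borel" "g \<in> borel_measurable borel" by auto
 have "L1_shift (\<lambda>x. f x + g x) h \<le> L1_shift f h + L1_shift g h" for h
  unfolding L1_shift_def
  by (subst nn_integral_add[symmetric])
   (auto simp: ennreal_plus[symmetric] simp del: ennreal_plus intro!: nn_integral_mono ennreal_leI)
 then show ?case
  by (intro tendsto_sandwich[OF _ _ tendsto_const tendsto_add[OF add.IH, simplified]]) auto
next
 case (lim f s)
 then have [measurable]: "f \<in> borel_measurable borel" "\<And>i. s i \<in> borel_measurable borel" by auto
 have "(\<lambda>i. \<integral>\<^sup>+x. ennreal \<bar>s i x - f x\<bar> \<partial>lborel) \<leadsto> (\<integral>\<^sup>+x. 0 \<partial>(lborel :: 'a measure))"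
 proof (rule nn_integral_dominated_convergence[where w = "\<lambda>x. ennreal (3 * \<bar>f x\<bar>)"])
  show "AE x in lborel. ennreal \<bar>s j x - f x\<bar> \<le> ennreal (3 * \<bar>f x\<bar>)" for j
  proof (intro AE_I2 ennreal_leI)
   fix x :: 'a
   show "\<bar>s j x - f x\<bar> \<le> 3 * \<bar>f x\<bar>"
    using lim.hyps(3)[of x j] abs_triangle_ineq4[of "s j x" "f x"] by simp
  qed
  have "integrable lborel (\<lambda>x. 3 * \<bar>f x\<bar>)" using lim by auto
  then show "(\<integral>\<^sup>+x. ennreal (3 * \<bar>f x\<bar>) \<partial>lborel) < \<infinity>"
   by (subst (asm) integrable_iff_bounded) auto
  show "AE x in lborel. (\<lambda>i. ennreal \<bar>s i x - f x\<bar>) \<leadsto> 0"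
   using tendsto_ennrealI[OF tendsto_rabs_zero[OF LIM_zero[OF lim.hyps(2)]]] by simp
 qed auto
 then have "(\<lambda>i. \<integral>\<^sup>+x. ennreal \<bar>s i x - f x\<bar> \<partial>lborel) \<leadsto> 0" by simp
 show ?case
 proof (rule L1_shift_approx)
  fix e :: real assume "e > 0"
  then obtain N where "\<forall>n\<ge>N. (\<integral>\<^sup>+x. ennreal \<bar>s n x - f x\<bar> \<partial>lborel) < ennreal e"
   using order_tendstoD(2)[OF \<open>_ \<leadsto> 0\<close>, of "ennreal e"] unfolding eventually_sequentially by auto
  then show "\<exists>g\<in>borel_measurable borel. (L1_shift g \<longlongrightarrow> 0) (at 0) \<and> (\<integral>\<^sup>+x. ennreal \<bar>g x - f x\<bar> \<partial>lborel) < ennreal e"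
   by (intro bexI[of _ "s N"] conjI lim.IH) auto
 qed simp
qed

section \<open>Averages against the kernel\<close>

lemma ker_measurable[measurable]: "ker e k x s \<in> borel_measurable borel"
 unfolding ker_def ker0_def flat_def by measurable

lemma ker_measurable2[measurable]:
 "(\<lambda>p. ker e k (fst p) s (snd p)) \<in> borel_measurable (borel \<Otimes>\<^sub>M borel)"
 unfolding ker_def ker0_def flat_def by measurable

lemma ker0_measurable[measurable]: "ker0 e k \<in> borel_measurable borel"
 unfolding ker0_def flat_def by measurable

lemma ker_le: "s > 0 ==> ker e k (x::'a::euclidean_space) s y \<le> (1 / s) ^ DIM('a)"
 unfolding ker_def using ker0_le_1 mult_left_mono[of "ker0 e k _" 1 "(1 / s) ^ DIM('a)"] by simp

lemma integrable_times_ker: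
 assumes "integrable lborel u" "s > 0"
 shows "integrable lborel (\<lambda>y. u y * ker e k (x::'a::euclidean_space) s y :: real)"
proof (rule Bochner_Integration.integrable_bound)
 show "integrable lborel (\<lambda>y. u y * (1 / s) ^ DIM('a))" using assms by auto
 show "(\<lambda>y. u y * ker e k x s y) \<in> borel_measurable lborel" using assms by auto
 show "AE y in lborel. norm (u y * ker e k x s y) \<le> norm (u y * (1 / s) ^ DIM('a))"
 proof (rule AE_I2)
  fix y
  have "\<bar>ker e k x s y\<bar> \<le> \<bar>(1 / s) ^ DIM('a)\<bar>"
   using ker_le[OF assms(2), of e k x y] ker_nonneg[OF assms(2), of e k x y] by linarith
  then show "norm (u y * ker e k x s y) \<le> norm (u y * (1 / s) ^ DIM('a))"
   unfolding real_norm_def abs_mult by (rule mult_left_mono) simp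
 qed
qed

lemma ker_ball_subset:
 assumes "s > 0" "y \<in> ball (x + s *\<^sub>R e) (s * k)"
 shows "norm (y - x) < s * (norm e + k)"
proof -
 have "norm (y - x) \<le> norm (s *\<^sub>R e) + norm (y - (x + s *\<^sub>R e))"
  using norm_triangle_ineq[of "s *\<^sub>R e" "y - (x + s *\<^sub>R e)"] by simp
 also have "\<dots> < s * norm e + s * k" using assms by (simp add: dist_norm norm_minus_commute)
 finally show ?thesis by (simp add: distrib_left)
qed

text \<open>The bound of F is asked only on the support of the kernel. No measurability of F is
  assumed: if the integrand is not integrable, its integral is 0 by convention.\<close>

lemma ker_integral_bound:
 fixes G :: "'a::euclidean_space => 'b::euclidean_space"
 assumes k: "k > 0" and s: "s > 0" and G: "integrable lborel G" and c: "c \<ge> 0"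
  and F: "\<And>y. y \<in> ball (x + s *\<^sub>R e) (s * k) ==> \<bar>F y\<bar> \<le> c * norm (G y)"
 shows "\<bar>LINT y|lborel. F y * ker e k x s y\<bar> \<le>
  c * (1 / s) ^ DIM('a) * (LINT y|lborel. norm (G y) * indicator (ball x ((norm e + k) * s)) y)"
  (is "_ \<le> ?c * integral\<^sup>L _ ?g")
proof (cases "integrable lborel (\<lambda>y. F y * ker e k x s y)")
 case True
 have g: "integrable lborel ?g" by (rule integrable_real_mult_indicator) (use G in auto)
 have "\<bar>F y * ker e k x s y\<bar> \<le> ?c * ?g y" for y
 proof (cases "y \<in> ball (x + s *\<^sub>R e) (s * k)")
  case True
  have "\<bar>F y\<bar> * \<bar>ker e k x s y\<bar> \<le> (c * norm (G y)) * (1 / s) ^ DIM('a)"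
   using F[OF True] ker_le[OF s, of e k x y] ker_nonneg[OF s, of e k x y] c by (intro mult_mono) auto
  then show ?thesis
   using ker_ball_subset[OF s True] by (simp add: abs_mult mult_ac dist_norm norm_minus_commute)
 next
  case False
  then show ?thesis using ker_eq_0[OF k s False] c s by simp
 qed
 then have "\<bar>LINT y|lborel. F y * ker e k x s y\<bar> \<le> (LINT y|lborel. ?c * ?g y)"
  by (intro order_trans[OF integral_abs_bound integral_mono]) (use True g in auto)
 then show ?thesis by simp
next
 case False
 have "0 \<le> integral\<^sup>L lborel ?g" by (rule Bochner_Integration.integral_nonneg) simp
 then show ?thesis unfolding not_integrable_integral_eq[OF False] using c s by simp
qed

lemma ker_integral_bound':
 fixes G :: "'a::euclidean_space => 'b::euclidean_space"
 assumes k: "k > 0" and s: "s > 0" and G: "integrable lborel G" and c: "c \<ge> 0"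
  and F: "\<And>y. \<bar>F y\<bar> \<le> c * norm (G y)"
 shows "\<bar>LINT y|lborel. F y * ker e k x s y\<bar> \<le> c * (1 / s) ^ DIM('a) * (LINT y|lborel. norm (G y))"
proof (rule order_trans[OF ker_integral_bound[OF k s G c F] mult_left_mono])
 show "(LINT y|lborel. norm (G y) * indicator (ball x ((norm e + k) * s)) y) \<le> (LINT y|lborel. norm (G y))"
  using G by (intro integral_mono integrable_real_mult_indicator) (auto split: split_indicator)
qed (use c s in auto)

text \<open>The kernels are not normalised to mass 1, so averages of u converge to
  \<open>kmass e k\<close> times u.\<close>

definition kmass :: "'a::euclidean_space => real => real" where
 "kmass e k = (LINT z|lborel. ker0 e k z)"

lemma integrable_ker0: "k > 0 ==> integrable lborel (ker0 (e::'a::euclidean_space) k)"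
proof (rule Bochner_Integration.integrable_bound[where f = "indicator (ball e k) :: 'a => real"])
 assume k: "k > 0"
 show "AE z in lborel. norm (ker0 e k z) \<le> norm (indicator (ball e k) z :: real)"
  using ker0_eq_0[OF k, of _ e] ker0_le_1[of e k] ker0_nonneg[of e k]
  by (intro AE_I2) (auto split: split_indicator)
 show "integrable lborel (indicator (ball e k) :: 'a => real)"
  using emeasure_lborel_ball_finite[of e k] by (intro integrable_real_indicator) auto
qed auto

lemma nn_integral_ker:
 assumes "k > 0" "s > 0"
 shows "(\<integral>\<^sup>+y. ennreal (ker e k (x::'a::euclidean_space) s y) \<partial>lborel) = ennreal (kmass e k)"
proof -
 have "(\<integral>\<^sup>+y. ennreal (ker e k x s y) \<partial>lborel) =
   (\<integral>\<^sup>+y. ennreal (ker e k x s y) \<partial>density (distr lborel borel (\<lambda>z. x + s *\<^sub>R z)) (\<lambda>_. ennreal (\<bar>s\<bar> ^ DIM('a))))"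
  using lborel_affine[of s x] assms by simp
 also have "\<dots> = (\<integral>\<^sup>+z. ennreal (\<bar>s\<bar> ^ DIM('a)) * ennreal (ker e k x s (x + s *\<^sub>R z)) \<partial>lborel)"
  by (simp add: nn_integral_density nn_integral_distr)
 also have "\<dots> = (\<integral>\<^sup>+z. ennreal (ker0 e k z) \<partial>lborel)"
  using assms
  by (intro nn_integral_cong) (simp add: ker_def ennreal_mult[symmetric] ker0_nonneg power_divide)
 also have "\<dots> = ennreal (kmass e k)"
  unfolding kmass_def by (rule nn_integral_eq_integral[OF integrable_ker0[OF assms(1)]]) (simp add: ker0_nonneg)
 finally show ?thesis .
qed

lemma kmass_pos:
 assumes "k > 0"
 shows "kmass (e::'a::euclidean_space) k > 0"
proof (rule ccontr)
 assume "\<not> kmass e k > 0"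
 then have "(\<integral>\<^sup>+z. ennreal (ker0 e k z) \<partial>lborel) = 0"
  using nn_integral_eq_integral[OF integrable_ker0[OF assms, of e]]
  by (simp add: ker0_nonneg kmass_def ennreal_neg)
 then have "AE z in lborel. ennreal (ker0 e k z) = 0"
  by (subst (asm) nn_integral_0_iff_AE) auto
 then have "AE z in lborel. z \<notin> ball e k"
  by eventually_elim (metis ennreal_eq_0_iff ker0_pos not_le)
 then have "emeasure lborel (ball e k) = 0"
  by (subst (asm) AE_iff_measurable[OF _ refl]) (auto simp: ball_def)
 then show False
  using assms unit_ball_vol_pos[of "real DIM('a)"] by (simp add: emeasure_ball)
qed

lemma integral_ker:
 assumes "k > 0" "s > 0"
 shows "integrable lborel (ker e k (x::'a::euclidean_space) s)"
  "(LINT y|lborel. ker e k x s y) = kmass e k"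
proof -
 show "integrable lborel (ker e k x s)"
  by (rule integrableI_nn_integral_finite[where x = "kmass e k"])
   (use assms kmass_pos[OF assms(1), of e] in \<open>auto simp: nn_integral_ker ker_nonneg\<close>)
 then show "(LINT y|lborel. ker e k x s y) = kmass e k"
  using nn_integral_eq_integral[of lborel "ker e k x s"] assms nn_integral_ker[OF assms, of e x] kmass_pos[OF assms(1), of e]
  by (simp add: ker_nonneg)
qed

definition mol :: "'a::euclidean_space => real => ('a => real) => 'a => real => real" where
 "mol e k u x s = (LINT y|lborel. u y * ker e k x s y)"

lemma mol_minus_const:
 assumes u: "integrable lborel u" and k: "k > 0" and s: "s > 0"
 shows "integrable lborel (\<lambda>y. (u y - c) * ker e k (x::'a::euclidean_space) s y)"
  "mol e k u x s - kmass e k * c = (LINT y|lborel. (u y - c) * ker e k x s y)"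
 using integrable_times_ker[OF u s, of e k x] integral_ker[OF k s, of e x]
 by (simp_all add: left_diff_distrib mol_def)

lemma ker_translate: "ker e k x s (w + x) = ker e k 0 s w"
 by (simp add: ker_def)

lemma mol_measurable[measurable]:
 assumes [measurable]: "u \<in> borel_measurable borel"
 shows "(\<lambda>x. mol e k u x s) \<in> borel_measurable borel"
proof -
 have "(\<lambda>p. u (snd p) * ker e k (fst p) s (snd p)) \<in> borel_measurable (borel \<Otimes>\<^sub>M lborel)"
  by measurable
 then show ?thesis
  unfolding mol_def by (intro lborel.borel_measurable_lebesgue_integral) (simp add: case_prod_beta')
qed

text \<open>Exchanging the integrals bounds the L1 distance by an average of
  \<open>L1_shift u w\<close> over the shifts w in the support of the kernel, where |w| < s (|e| +
  k); hence the choice of \<open>dl\<close>.\<close>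

lemma mol_L1_converges:
 fixes u :: "'a::euclidean_space => real"
 assumes u: "integrable lborel u" and k: "k > 0" and ep: "ep > 0"
 shows "\<exists>dl>0. \<forall>s\<in>{0<..<dl}. (\<integral>\<^sup>+x. ennreal \<bar>mol e k u x s - kmass e k * u x\<bar> \<partial>lborel) \<le> ennreal ep"
proof -
 have [measurable]: "u \<in> borel_measurable borel" using u by auto
 define m where "m = kmass e k"
 have m: "m > 0" using kmass_pos[OF k] by (simp add: m_def)
 have "\<forall>\<^sub>F h in at 0. L1_shift u h < ennreal (ep / m)"
  by (rule order_tendstoD(2)[OF L1_shift_tendsto_0[OF u]]) (use m ep in simp)
 then obtain d where d: "d > 0" "\<And>h. h \<noteq> 0 ==> norm h < d ==> L1_shift u h < ennreal (ep / m)"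
  by (auto simp: eventually_at)
 have d': "L1_shift u h \<le> ennreal (ep / m)" if "norm h < d" for h
  using d(2)[OF _ that] by (cases "h = 0") (auto simp: L1_shift_def)
 define dl where "dl = d / (norm e + k)"
 have n: "norm e + k > 0" using k by (simp add: add_nonneg_pos)
 show ?thesis
 proof (intro exI[of _ dl] conjI ballI)
  show "dl > 0" using d n by (simp add: dl_def)
  fix s assume s: "s \<in> {0<..<dl}"
  then have s0: "s > 0" by simp
  have pt: "ennreal \<bar>mol e k u x s - m * u x\<bar> \<le> (\<integral>\<^sup>+w. ennreal (ker e k 0 s w) * ennreal \<bar>u (x + w) - u x\<bar> \<partial>lborel)" for x
  proof -
   have "ennreal \<bar>mol e k u x s - m * u x\<bar> \<le> (\<integral>\<^sup>+y. ennreal (norm ((u y - u x) * ker e k x s y)) \<partial>lborel)"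
    using integral_norm_bound_ennreal[OF mol_minus_const(1)[OF u k s0, of "u x" e x]]
    by (simp add: m_def mol_minus_const(2)[OF u k s0])
   also have "\<dots> = (\<integral>\<^sup>+w. ennreal (norm ((u (w + x) - u x) * ker e k x s (w + x))) \<partial>lborel)"
    using nn_integral_lborel_translate[of "\<lambda>y. ennreal (norm ((u y - u x) * ker e k x s y))" x] by simp
   also have "\<dots> = (\<integral>\<^sup>+w. ennreal (ker e k 0 s w) * ennreal \<bar>u (x + w) - u x\<bar> \<partial>lborel)"
    using s0 by (intro nn_integral_cong) (simp add: ker_translate abs_mult ker_nonneg add.commute ennreal_mult mult.commute)
   finally show ?thesis .
  qed
  have "(\<integral>\<^sup>+x. ennreal \<bar>mol e k u x s - m * u x\<bar> \<partial>lborel) \<le>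
    (\<integral>\<^sup>+x. (\<integral>\<^sup>+w. ennreal (ker e k 0 s w) * ennreal \<bar>u (x + w) - u x\<bar> \<partial>lborel) \<partial>lborel)"
   using pt by (intro nn_integral_mono) auto
  also have "\<dots> = (\<integral>\<^sup>+w. (\<integral>\<^sup>+x. ennreal (ker e k 0 s w) * ennreal \<bar>u (x + w) - u x\<bar> \<partial>lborel) \<partial>lborel)"
   by (rule lborel_pair.Fubini') measurable
  also have "\<dots> = (\<integral>\<^sup>+w. ennreal (ker e k 0 s w) * L1_shift u w \<partial>lborel)"
   unfolding L1_shift_def by (subst nn_integral_cmult) auto
  also have "\<dots> \<le> (\<integral>\<^sup>+w. ennreal (ker e k 0 s w) * ennreal (ep / m) \<partial>lborel)"
  proof (rule nn_integral_mono)
   fix w :: 'a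
   show "ennreal (ker e k 0 s w) * L1_shift u w \<le> ennreal (ker e k 0 s w) * ennreal (ep / m)"
   proof (cases "w \<in> ball (0 + s *\<^sub>R e) (s * k)")
    case True
    have "s * (norm e + k) < d" using s n by (simp add: dl_def pos_less_divide_eq)
    then show ?thesis using ker_ball_subset[OF s0 True] by (intro mult_left_mono d') auto
   next
    case False
    then show ?thesis using ker_eq_0[OF k s0 False] by simp
   qed
  qed
  also have "\<dots> = (\<integral>\<^sup>+w. ennreal (ker e k 0 s w) \<partial>lborel) * ennreal (ep / m)"
   by (rule nn_integral_multc) auto
  also have "\<dots> = ennreal ep"
   using nn_integral_ker[OF k s0, of e 0] m ep by (simp add: m_def ennreal_mult[symmetric])
  finally show "(\<integral>\<^sup>+x. ennreal \<bar>mol e k u x s - kmass e k * u x\<bar> \<partial>lborel) \<le> ennreal ep"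
   by (simp add: m_def)
 qed
qed

subsection \<open>Test functions\<close>

lemma test_function_continuous:
 assumes "\<phi> \<in> test_functions \<Omega>"
 shows "continuous_on UNIV \<phi>"
 using assms by (auto simp: test_functions_def dest: spec[of _ 0])

lemma test_function_bounded:
 assumes "\<phi> \<in> test_functions \<Omega>"
 shows "\<exists>B. \<forall>x. \<bar>\<phi> x\<bar> \<le> B"
proof -
 define K where "K = closure {x. \<phi> x \<noteq> 0}"
 have "compact (\<phi> ` K)"
  using assms test_function_continuous[OF assms]
  by (intro compact_continuous_image) (auto simp: test_functions_def K_def intro: continuous_on_subset)
 then obtain B where B: "\<forall>y\<in>\<phi> ` K. norm y \<le> B"
  using compact_imp_bounded bounded_iff by metis
 have "\<bar>\<phi> x\<bar> \<le> max B 0" for x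
 proof (cases "\<phi> x = 0")
  case False
  then have "x \<in> K" using closure_subset[of "{x. \<phi> x \<noteq> 0}"] by (auto simp: K_def)
  then show ?thesis using B by auto
 qed auto
 then show ?thesis by blast
qed

lemma partial_support: "{x. partial b \<phi> x \<noteq> 0} \<subseteq> closure {x. \<phi> x \<noteq> 0}" (is "_ \<subseteq> ?K")
proof (rule subsetI, rule ccontr)
 fix x assume x: "x \<in> {x. partial b \<phi> x \<noteq> 0}" "x \<notin> ?K"
 have "(\<phi> has_derivative (\<lambda>h. 0)) (at x)"
 proof (rule has_derivative_transform_within_open[OF has_derivative_const])
  show "open (- ?K)" by (rule open_Compl) simp
  show "x \<in> - ?K" using x by simp
  show "0 = \<phi> y" if "y \<in> - ?K" for y using that closure_subset[of "{x. \<phi> x \<noteq> 0}"] by auto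
 qed
 then show False using has_derivative_imp_partial[of \<phi> _ x b] x by simp
qed

lemma test_function_partial:
 assumes "\<phi> \<in> test_functions \<Omega>" "b \<in> Basis"
 shows "partial b \<phi> \<in> test_functions \<Omega>"
proof -
 let ?K = "closure {x. \<phi> x \<noteq> 0}"
 have "Ck k (partial b \<phi>)" for k
 proof -
  have "Ck (Suc k) \<phi>" using assms(1) by (simp add: test_functions_def del: Ck.simps)
  then show ?thesis using assms(2) by simp
 qed
 moreover have sub: "closure {x. partial b \<phi> x \<noteq> 0} \<subseteq> ?K"
  by (rule closure_minimal[OF partial_support]) simp
 moreover from this have "compact (closure {x. partial b \<phi> x \<noteq> 0})"
  using assms(1) compact_Int_closed[of ?K "closure {x. partial b \<phi> x \<noteq> 0}"]
  by (simp add: test_functions_def Int_absorb1)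
 ultimately show ?thesis using assms(1) by (auto simp: test_functions_def)
qed

lemma test_function_measurable:
 assumes "\<phi> \<in> test_functions \<Omega>"
 shows "\<phi> \<in> borel_measurable borel"
 using test_function_continuous[OF assms] by (rule borel_measurable_continuous_onI)

lemma integrable_times_test_function:
 fixes u :: "'a::euclidean_space => real"
 assumes u: "integrable lborel u" and \<phi>: "\<phi> \<in> test_functions \<Omega>"
 shows "integrable lborel (\<lambda>y. u y * \<phi> y)"
proof -
 obtain B where B: "\<And>x. \<bar>\<phi> x\<bar> \<le> B" using test_function_bounded[OF \<phi>] by auto
 show ?thesis
 proof (rule Bochner_Integration.integrable_bound)
  show "integrable lborel (\<lambda>y. u y * B)" using u by auto
  show "(\<lambda>y. u y * \<phi> y) \<in> borel_measurable lborel"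
   using u test_function_measurable[OF \<phi>] by auto
  show "AE y in lborel. norm (u y * \<phi> y) \<le> norm (u y * B)"
   using B by (intro AE_I2) (simp add: abs_mult mult_left_mono order_trans[OF _ abs_ge_self])
 qed
qed

subsection \<open>Differentiating the averages\<close>

text \<open>The gradient of \<open>ker0 e k\<close>; the derivative of \<open>flat 0\<close> is
  \<open>flat 2\<close>.\<close>

definition gker0 :: "'a::euclidean_space => real => 'a => 'a" where
 "gker0 e k z = (- 2 * flat 2 (k^2 - (norm (z - e))^2)) *\<^sub>R (z - e)"

lemma ker0_has_derivative:
 "(ker0 e k has_derivative (\<lambda>h. gker0 e k z \<bullet> h)) (at z)"
proof -
 have n: "((\<lambda>z. k^2 - (norm (z - e))^2) has_derivative (\<lambda>h. - (2 * ((z - e) \<bullet> h)))) (at z)"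
  unfolding power2_norm_eq_inner
  by (auto intro!: derivative_eq_intros simp: inner_commute)
 have f: "(flat 0 has_derivative (\<lambda>h. flat 2 t * h)) (at t)" for t
  using flat_has_derivative[of 0 t] by (simp add: has_field_derivative_def numeral_2_eq_2)
 show ?thesis
  using has_derivative_compose[OF n f] unfolding ker0_def[abs_def] gker0_def by (simp add: mult_ac)
qed

lemma gker0_bound:
 assumes "k > 0"
 shows "norm (gker0 e k z) \<le> 4 * k" "z \<notin> ball e k ==> gker0 e k z = 0"
proof -
 show 0: "gker0 e k z = 0" if "z \<notin> ball e k"
 proof -
  have "k^2 \<le> (norm (z - e))^2"
   using that assms by (intro power_mono) (auto simp: dist_norm norm_minus_commute)
  then show ?thesis by (simp add: gker0_def flat_def)
 qed
 show "norm (gker0 e k z) \<le> 4 * k"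
 proof (cases "z \<in> ball e k")
  case True
  have "flat 2 (k^2 - (norm (z - e))^2) \<le> 2"
   using flat_bound[of "k^2 - (norm (z - e))^2" 2 0]
   by (cases "k^2 - (norm (z - e))^2 > 0") (auto simp: flat_def)
  then have "(2 * flat 2 (k^2 - (norm (z - e))^2)) * norm (z - e) \<le> 4 * k"
   using True flat_nonneg by (intro mult_mono) (auto simp: dist_norm norm_minus_commute)
  then show ?thesis by (simp add: gker0_def flat_nonneg)
 qed (use 0 assms in simp)
qed

text \<open>When the vertex moves with velocity d and the scale with velocity \<sigma>, the kernel
  is transported by the velocity field d + \<sigma> z with z = (y - x)/S. Conservation of mass makes
  this time derivative minus the divergence computed in \<open>ker_divergence\<close>.\<close>

lemma ker_path_derivative:
 fixes x d y :: "'a::euclidean_space"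
 assumes "s + t * \<sigma> > 0"
 defines "S \<equiv> s + t * \<sigma>" and "z \<equiv> (1 / (s + t * \<sigma>)) *\<^sub>R (y - (x + t *\<^sub>R d))"
 shows "((\<lambda>\<tau>. ker e k (x + \<tau> *\<^sub>R d) (s + \<tau> * \<sigma>) y) has_real_derivative
   - ((1 / S) ^ (DIM('a) + 1) * (real DIM('a) * \<sigma> * ker0 e k z + gker0 e k z \<bullet> (d + \<sigma> *\<^sub>R z)))) (at t)"
proof -
 have S: "S > 0" using assms by simp
 have dS: "((\<lambda>\<tau>. 1 / (s + \<tau> * \<sigma>)) has_real_derivative - \<sigma> * (1 / S) ^ 2) (at t)"
  using S unfolding S_def by (auto intro!: derivative_eq_intros simp: power2_eq_square)
 have dz: "((\<lambda>\<tau>. (1 / (s + \<tau> * \<sigma>)) *\<^sub>R (y - (x + \<tau> *\<^sub>R d))) has_vector_derivative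
   (1 / S) *\<^sub>R (- d) + (- \<sigma> * (1 / S) ^ 2) *\<^sub>R (y - (x + t *\<^sub>R d))) (at t)"
  unfolding S_def
  by (rule has_vector_derivative_scaleR[OF dS[unfolded S_def]])
   (auto intro!: derivative_eq_intros simp: has_vector_derivative_def)
 have v: "(1 / S) *\<^sub>R (- d) + (- \<sigma> * (1 / S) ^ 2) *\<^sub>R (y - (x + t *\<^sub>R d)) = - (1 / S) *\<^sub>R (d + \<sigma> *\<^sub>R z)"
  by (simp add: z_def S_def power2_eq_square scaleR_add_right)
 have dk: "((\<lambda>\<tau>. ker0 e k ((1 / (s + \<tau> * \<sigma>)) *\<^sub>R (y - (x + \<tau> *\<^sub>R d)))) has_real_derivative
   - (1 / S) * (gker0 e k z \<bullet> (d + \<sigma> *\<^sub>R z))) (at t)"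
  unfolding has_field_derivative_def
  by (rule has_derivative_eq_rhs[OF has_derivative_compose[OF dz[unfolded v has_vector_derivative_def] ker0_has_derivative]])
   (rule ext, fold z_def, simp only: inner_scaleR_right, simp)
 have dp: "((\<lambda>\<tau>. (1 / (s + \<tau> * \<sigma>)) ^ DIM('a)) has_real_derivative
   - (real DIM('a) * \<sigma> * (1 / S) ^ (DIM('a) + 1))) (at t)"
 proof -
  obtain m where m: "DIM('a) = Suc m" using DIM_positive[where 'a = 'a] by (metis Suc_pred)
  show ?thesis
   using DERIV_power[OF dS, of "DIM('a)"] by (simp add: m S_def power2_eq_square mult_ac)
 qed
 have eq: "P * (- (1 / S) * D) + - (N * \<sigma> * (P * (1 / S))) * r = - (P * (1 / S) * (N * \<sigma> * r + D))"
  for P D N r :: real by (simp add: algebra_simps)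
 show ?thesis
  unfolding ker_def
  using DERIV_mult[OF dp dk] eq[of "(1 / S) ^ DIM('a)" "gker0 e k z \<bullet> (d + \<sigma> *\<^sub>R z)" "real DIM('a)" "ker0 e k z"]
  by (simp add: S_def z_def power_add algebra_simps)
qed

text \<open>The second half of the continuity equation. As long as the ball of the kernel lies in
  \<Omega>, each component of the field times the kernel is a test function, so in this form the
  derivative can be passed on to a weak gradient.\<close>

lemma ker_divergence:
 fixes x d y :: "'a::euclidean_space"
 assumes "S > 0"
 defines "z \<equiv> (1 / S) *\<^sub>R (y - x)"
 shows "(\<Sum>b\<in>Basis. partial b (\<lambda>y. ((d + \<sigma> *\<^sub>R ((1 / S) *\<^sub>R (y - x))) \<bullet> b) * ker e c x S y) y) =
   (1 / S) ^ (DIM('a) + 1) * (real DIM('a) * \<sigma> * ker0 e c z + gker0 e c z \<bullet> (d + \<sigma> *\<^sub>R z))"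
proof -
 have dk: "((\<lambda>y. ker e c x S y) has_derivative
   (\<lambda>h. (1 / S) ^ DIM('a) * (gker0 e c z \<bullet> ((1 / S) *\<^sub>R h)))) (at y)"
  unfolding ker_def z_def
  by (intro has_derivative_mult_right has_derivative_compose[OF _ ker0_has_derivative])
   (auto intro!: derivative_eq_intros)
 have "partial b (\<lambda>y. ((d + \<sigma> *\<^sub>R ((1 / S) *\<^sub>R (y - x))) \<bullet> b) * ker e c x S y) y =
   (1 / S) ^ (DIM('a) + 1) * (\<sigma> * ker0 e c z + (gker0 e c z \<bullet> b) * ((d + \<sigma> *\<^sub>R z) \<bullet> b))"
  if b: "b \<in> Basis" for b
 proof -
  have "((\<lambda>y. (d + \<sigma> *\<^sub>R ((1 / S) *\<^sub>R (y - x))) \<bullet> b) has_derivative (\<lambda>h. (\<sigma> * (1 / S)) * (h \<bullet> b))) (at y)"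
   by (auto intro!: derivative_eq_intros)
  from has_derivative_imp_partial[OF has_derivative_mult[OF this dk], of b]
  have p: "partial b (\<lambda>y. ((d + \<sigma> *\<^sub>R ((1 / S) *\<^sub>R (y - x))) \<bullet> b) * ker e c x S y) y =
   ((d + \<sigma> *\<^sub>R z) \<bullet> b) * ((1 / S) ^ DIM('a) * (gker0 e c z \<bullet> ((1 / S) *\<^sub>R b)))
   + (\<sigma> * (1 / S)) * (b \<bullet> b) * ker e c x S y" by (simp only: z_def)
  have k: "ker e c x S y = (1 / S) ^ DIM('a) * ker0 e c z" by (simp only: ker_def z_def)
  show ?thesis using b unfolding p k by (simp add: algebra_simps add_divide_distrib)
 qed
 then have "(\<Sum>b\<in>Basis. partial b (\<lambda>y. ((d + \<sigma> *\<^sub>R ((1 / S) *\<^sub>R (y - x))) \<bullet> b) * ker e c x S y) y) =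
   (\<Sum>b\<in>Basis. (1 / S) ^ (DIM('a) + 1) * (\<sigma> * ker0 e c z + (gker0 e c z \<bullet> b) * ((d + \<sigma> *\<^sub>R z) \<bullet> b)))"
  by simp
 also have "\<dots> = (1 / S) ^ (DIM('a) + 1) * (real DIM('a) * \<sigma> * ker0 e c z + gker0 e c z \<bullet> (d + \<sigma> *\<^sub>R z))"
  by (subst euclidean_inner[of "gker0 e c z" "d + \<sigma> *\<^sub>R z"]) (simp only: sum_distrib_left[symmetric] sum.distrib sum_constant mult.assoc mult.left_commute)
 finally show ?thesis .
qed

text \<open>The weak gradient relation for functions integrable over the whole space, so that
  translations and Fubini can be used over \<open>lborel\<close>. Sobolev functions take this form
  through Borel representatives extended by 0, see \<open>H1_wgrad\<close>; as the tests live in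
  \<Omega>, nothing is claimed across the boundary.\<close>

definition wgrad :: "'a::euclidean_space set => ('a => real) => ('a => 'a) => bool" where
 "wgrad \<Omega> u G \<longleftrightarrow> integrable lborel u \<and> integrable lborel G \<and>
   (\<forall>\<phi>\<in>test_functions \<Omega>. \<forall>b\<in>Basis.
    (LINT x|lborel. u x * partial b \<phi> x) = - (LINT x|lborel. (G x \<bullet> b) * \<phi> x))"

lemma real_polynomial_coord:
 "real_polynomial_function (\<lambda>y. (d + \<sigma> *\<^sub>R ((1 / S) *\<^sub>R (y - x))) \<bullet> b)"
proof -
 have "(\<lambda>y. (d + \<sigma> *\<^sub>R ((1 / S) *\<^sub>R (y - x))) \<bullet> b) = (\<lambda>y. d \<bullet> b + (\<sigma> / S) * (y \<bullet> b) - (\<sigma> / S) * (x \<bullet> b))"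
  by (simp add: inner_simps algebra_simps)
 moreover have "real_polynomial_function (\<lambda>y. d \<bullet> b + (\<sigma> / S) * (y \<bullet> b) - (\<sigma> / S) * (x \<bullet> b))"
  by (rule real_polynomial_function_diff[OF real_polynomial_function.intros(3)[OF
   real_polynomial_function.intros(2) real_polynomial_function.intros(4)[OF
   real_polynomial_function.intros(2) real_polynomial_function.intros(1)[OF bounded_linear_inner_left]]]
   real_polynomial_function.intros(2)])
 ultimately show ?thesis by (simp only:)
qed

text \<open>Differentiation falls on the kernel; the continuity equation and the weak gradient then
  move it onto u. With \<sigma> = 0 only the vertex moves, with d = 0 only the scale.\<close>

lemma mol_path_derivative:
 fixes x d :: "'a::euclidean_space"
 assumes w: "wgrad \<Omega> u G" and k: "k > 0" and S: "s + t * \<sigma> > 0"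
  and sub: "cball (x + t *\<^sub>R d + (s + t * \<sigma>) *\<^sub>R e) ((s + t * \<sigma>) * k) \<subseteq> \<Omega>"
 shows "((\<lambda>\<tau>. mol e k u (x + \<tau> *\<^sub>R d) (s + \<tau> * \<sigma>)) has_real_derivative
   (LINT y|lborel. (G y \<bullet> (d + \<sigma> *\<^sub>R ((1 / (s + t * \<sigma>)) *\<^sub>R (y - (x + t *\<^sub>R d))))) *
    ker e k (x + t *\<^sub>R d) (s + t * \<sigma>) y)) (at t)"
proof -
 define S0 where "S0 = s + t * \<sigma>"
 define Z where "Z = (\<lambda>\<tau> y. (1 / (s + \<tau> * \<sigma>)) *\<^sub>R (y - (x + \<tau> *\<^sub>R d)))"
 define k' where "k' = (\<lambda>\<tau> y. - ((1 / (s + \<tau> * \<sigma>)) ^ (DIM('a) + 1) *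
   (real DIM('a) * \<sigma> * ker0 e k (Z \<tau> y) + gker0 e k (Z \<tau> y) \<bullet> (d + \<sigma> *\<^sub>R Z \<tau> y))))"
 define q where "q = (\<lambda>b y. (d + \<sigma> *\<^sub>R ((1 / S0) *\<^sub>R (y - (x + t *\<^sub>R d)))) \<bullet> b)"
 have S0: "S0 > 0" using S by (simp add: S0_def)
 have u: "integrable lborel u" and G: "integrable lborel G" using w by (auto simp: wgrad_def)
 have "(\<lambda>\<tau>. s + \<tau> * \<sigma>) \<midarrow>t\<rightarrow> S0" unfolding S0_def by (intro tendsto_intros)
 then have "\<forall>\<^sub>F \<tau> in at t. s + \<tau> * \<sigma> > S0 / 2" by (rule order_tendstoD) (use S0 in auto)
 then obtain dl where dl: "dl > 0" "\<And>\<tau>. \<tau> \<noteq> t ==> dist \<tau> t < dl ==> s + \<tau> * \<sigma> > S0 / 2"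
  by (auto simp: eventually_at)
 \<comment> \<open>Near t the scale stays above S0 / 2, which makes the bound B of the kernel
   derivatives uniform in \<tau>.\<close>
 have S': "s + \<tau> * \<sigma> > S0 / 2" if "\<tau> \<in> {t - dl<..<t + dl}" for \<tau>
 proof (cases "\<tau> = t")
  case True
  then have "s + \<tau> * \<sigma> = S0" by (simp add: S0_def)
  then show ?thesis using S0 by simp
 next
  case False
  then show ?thesis using dl(2)[of \<tau>] that by (auto simp: dist_real_def)
 qed
 have S'': "s + \<tau> * \<sigma> > 0" if "\<tau> \<in> {t - dl<..<t + dl}" for \<tau> using S'[OF that] S0 by simp
 define B where "B = (2 / S0) ^ (DIM('a) + 1) * (real DIM('a) * \<bar>\<sigma>\<bar> + 4 * k * (norm d + \<bar>\<sigma>\<bar> * (norm e + k)))"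
 have bd: "\<bar>k' \<tau> y\<bar> \<le> B" if \<tau>: "\<tau> \<in> {t - dl<..<t + dl}" for \<tau> y
 proof -
  have "\<bar>gker0 e k (Z \<tau> y) \<bullet> (d + \<sigma> *\<^sub>R Z \<tau> y)\<bar> \<le> 4 * k * (norm d + \<bar>\<sigma>\<bar> * (norm e + k))"
  proof (cases "Z \<tau> y \<in> ball e k")
   case True
   have "norm (Z \<tau> y) \<le> norm e + k"
    using True norm_triangle_ineq[of e "Z \<tau> y - e"] by (simp add: dist_norm norm_minus_commute)
   then have "norm (d + \<sigma> *\<^sub>R Z \<tau> y) \<le> norm d + \<bar>\<sigma>\<bar> * (norm e + k)"
    by (intro order_trans[OF norm_triangle_ineq]) (auto intro: mult_left_mono)
   then show ?thesis
    using gker0_bound(1)[OF k, of e "Z \<tau> y"]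
    by (intro order_trans[OF Cauchy_Schwarz_ineq2] mult_mono) (use k in auto)
  next
   case False
   then show ?thesis using k by (simp add: gker0_bound(2)[OF k])
  qed
  moreover have "\<bar>real DIM('a) * \<sigma> * ker0 e k (Z \<tau> y)\<bar> \<le> real DIM('a) * \<bar>\<sigma>\<bar>"
   using ker0_le_1[of e k "Z \<tau> y"] ker0_nonneg[of e k "Z \<tau> y"]
   by (simp add: abs_mult mult_left_le)
  ultimately have 1: "\<bar>real DIM('a) * \<sigma> * ker0 e k (Z \<tau> y) + gker0 e k (Z \<tau> y) \<bullet> (d + \<sigma> *\<^sub>R Z \<tau> y)\<bar>
    \<le> real DIM('a) * \<bar>\<sigma>\<bar> + 4 * k * (norm d + \<bar>\<sigma>\<bar> * (norm e + k))" by linarith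
  have "1 / (s + \<tau> * \<sigma>) \<le> 2 / S0"
   using S'[OF \<tau>] S0 by (simp add: field_simps)
  then have 2: "(1 / (s + \<tau> * \<sigma>)) ^ (DIM('a) + 1) \<le> (2 / S0) ^ (DIM('a) + 1)"
   using S''[OF \<tau>] by (intro power_mono) auto
  show ?thesis
   unfolding k'_def B_def abs_minus_cancel abs_mult
   using S''[OF \<tau>] S0 by (intro mult_mono) (use 1 2 k in \<open>auto simp: abs_mult\<close>)
 qed
 have meas: "k' t \<in> borel_measurable borel"
  unfolding k'_def Z_def gker0_def flat_def by measurable
 have "((\<lambda>\<tau>. LINT y|lborel. u y * ker e k (x + \<tau> *\<^sub>R d) (s + \<tau> * \<sigma>) y) has_real_derivative
   (LINT y|lborel. u y * k' t y)) (at t)"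
 proof (rule has_derivative_integral_param[OF u, where a = "t - dl" and b = "t + dl" and B = B])
  fix \<tau> y assume "\<tau> \<in> {t - dl<..<t + dl}"
  show "((\<lambda>\<tau>. ker e k (x + \<tau> *\<^sub>R d) (s + \<tau> * \<sigma>) y) has_real_derivative k' \<tau> y) (at \<tau>)"
   unfolding k'_def Z_def by (rule ker_path_derivative) (rule S''[OF \<open>\<tau> \<in> _\<close>])
 next
  fix \<tau> assume "\<tau> \<in> {t - dl<..<t + dl}"
  then show "integrable lborel (\<lambda>y. u y * ker e k (x + \<tau> *\<^sub>R d) (s + \<tau> * \<sigma>) y)"
   by (intro integrable_times_ker u S'')
 qed (use dl bd meas in auto)
 moreover have "(LINT y|lborel. u y * k' t y) = (LINT y|lborel. (G y \<bullet> (d + \<sigma> *\<^sub>R Z t y)) * ker e k (x + t *\<^sub>R d) S0 y)"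
 proof -
  have tf: "(\<lambda>y. q b y * ker e k (x + t *\<^sub>R d) S0 y) \<in> test_functions \<Omega>" for b
   unfolding q_def by (rule ker_test_function[OF k S0 _ real_polynomial_coord]) (use sub in \<open>simp add: S0_def\<close>)
  have int1: "integrable lborel (\<lambda>y. u y * partial b (\<lambda>y. q b y * ker e k (x + t *\<^sub>R d) S0 y) y)" if "b \<in> Basis" for b
   using integrable_times_test_function[OF u test_function_partial[OF tf that]] .
  have int2: "integrable lborel (\<lambda>y. (G y \<bullet> b) * (q b y * ker e k (x + t *\<^sub>R d) S0 y))" if "b \<in> Basis" for b
   by (rule integrable_times_test_function[OF _ tf]) (use G in simp)
  have "(LINT y|lborel. u y * k' t y) =
    (LINT y|lborel. - (\<Sum>b\<in>Basis. u y * partial b (\<lambda>y. q b y * ker e k (x + t *\<^sub>R d) S0 y) y))"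
   unfolding k'_def q_def Z_def sum_distrib_left[symmetric]
   by (subst ker_divergence[OF S0]) (simp add: S0_def)
  also have "\<dots> = - (\<Sum>b\<in>Basis. LINT y|lborel. u y * partial b (\<lambda>y. q b y * ker e k (x + t *\<^sub>R d) S0 y) y)"
   using int1 by (simp add: Bochner_Integration.integral_sum)
  also have "\<dots> = (\<Sum>b\<in>Basis. LINT y|lborel. (G y \<bullet> b) * (q b y * ker e k (x + t *\<^sub>R d) S0 y))"
   using w tf by (simp add: wgrad_def sum_negf)
  also have "\<dots> = (LINT y|lborel. (\<Sum>b\<in>Basis. (G y \<bullet> b) * (q b y * ker e k (x + t *\<^sub>R d) S0 y)))"
   using int2 by (simp add: Bochner_Integration.integral_sum)
  also have "\<dots> = (LINT y|lborel. (G y \<bullet> (d + \<sigma> *\<^sub>R Z t y)) * ker e k (x + t *\<^sub>R d) S0 y)"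
   unfolding q_def Z_def S0_def
   by (subst (3) euclidean_inner) (simp add: sum_distrib_right mult.assoc)
  finally show ?thesis .
 qed
 ultimately show ?thesis by (simp add: mol_def Z_def S0_def)
qed

section \<open>Dyadic Riesz potentials\<close>

definition dyad_avg :: "real => ('a::euclidean_space => ennreal) => nat => 'a => ennreal" where
 "dyad_avg R g j x = 2 ^ (j * DIM('a)) * (\<integral>\<^sup>+y\<in>ball x (R * (1/2) ^ j). g y \<partial>lborel)"

text \<open>For n \<ge> 2 comparable with the Riesz potential, the integral of g y |x - y|^(1-n)
  over the ball of radius R. The dyadic form needs no polar coordinates and lets every scale be
  estimated separately.\<close>

definition dyad_pot :: "real => ('a::euclidean_space => ennreal) => 'a => ennreal" where
 "dyad_pot R g x = (\<Sum>j. ennreal ((1/2) ^ j) * dyad_avg R g j x)"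

text \<open>The Hardy-Littlewood maximal function restricted to the radii R 2^(-j), up to the volume
  of the ball of radius R as a factor.\<close>

definition dyad_max :: "real => ('a::euclidean_space => ennreal) => 'a => ennreal" where
 "dyad_max R g x = (SUP j. dyad_avg R g j x)"

lemma ball_sets_borel[measurable]: "ball x r \<in> sets borel" "cball x r \<in> sets borel"
 by auto

lemma ball_indicator_measurable[measurable]:
 "(\<lambda>p. indicator (ball (fst p) r) (snd p) :: ennreal) \<in> borel_measurable (borel \<Otimes>\<^sub>M (borel :: 'a::euclidean_space measure))"
proof -
 have "(\<lambda>p. indicator (ball (fst p) r) (snd p) :: ennreal) = indicator {p :: 'a \<times> 'a. dist (fst p) (snd p) < r}"
  by (auto simp: fun_eq_iff split: split_indicator)
 moreover have "{p :: 'a \<times> 'a. dist (fst p) (snd p) < r} \<in> sets (borel \<Otimes>\<^sub>M borel)"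
  unfolding borel_prod by (intro borel_open open_Collect_less continuous_intros)
 ultimately show ?thesis by simp
qed

lemma dyad_avg_measurable[measurable]:
 assumes [measurable]: "g \<in> borel_measurable borel"
 shows "dyad_avg R g j \<in> borel_measurable borel"
proof -
 have "(\<lambda>p. g (snd p) * indicator (ball (fst p) (R * (1/2) ^ j)) (snd p)) \<in> borel_measurable (borel \<Otimes>\<^sub>M lborel)"
  by measurable
 then show ?thesis
  unfolding dyad_avg_def[abs_def]
  by (intro borel_measurable_times_ennreal borel_measurable_const lborel.borel_measurable_nn_integral)
   (simp_all add: case_prod_beta')
qed

lemma dyad_pot_measurable[measurable]:
 "g \<in> borel_measurable borel ==> dyad_pot R g \<in> borel_measurable borel"
 unfolding dyad_pot_def[abs_def] by measurable

lemma dyad_max_measurable[measurable]: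
 "g \<in> borel_measurable borel ==> dyad_max R g \<in> borel_measurable borel"
 unfolding dyad_max_def[abs_def] by measurable

lemma emeasure_ball_dyad:
 assumes "R > 0" "c > 0"
 shows "2 ^ (j * DIM('a)) * emeasure lborel (ball (x::'a::euclidean_space) (c * R * (1/2) ^ j)) =
  ennreal (unit_ball_vol (real DIM('a)) * (c * R) ^ DIM('a))"
proof -
 have "2 ^ (j * DIM('a)) * emeasure lborel (ball x (c * R * (1/2) ^ j)) =
   ennreal (2 ^ (j * DIM('a))) * ennreal (unit_ball_vol (real DIM('a)) * (c * R * (1/2) ^ j) ^ DIM('a))"
  using assms by (simp add: emeasure_ball ennreal_power[symmetric])
 also have "\<dots> = ennreal (2 ^ (j * DIM('a)) * (unit_ball_vol (real DIM('a)) * (c * R * (1/2) ^ j) ^ DIM('a)))"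
  using assms by (subst ennreal_mult) auto
 also have "2 ^ (j * DIM('a)) * (unit_ball_vol (real DIM('a)) * (c * R * (1/2) ^ j) ^ DIM('a)) =
   unit_ball_vol (real DIM('a)) * (c * R) ^ DIM('a)"
  by (simp add: power_mult_distrib power_mult power_one_over power_divide)
 finally show ?thesis .
qed

subsection \<open>Quadratic estimates\<close>

lemma dyad_avg_square_le:
 fixes g :: "'a::euclidean_space => ennreal"
 assumes [measurable]: "g \<in> borel_measurable borel" and "R > 0"
 shows "(dyad_avg R g j x)^2 \<le> ennreal (unit_ball_vol (real DIM('a)) * R ^ DIM('a)) * 2 ^ (j * DIM('a)) *
   (\<integral>\<^sup>+y\<in>ball x (R * (1/2) ^ j). (g y)^2 \<partial>lborel)"
proof -
 let ?B = "ball x (R * (1/2) ^ j)"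
 have "(\<integral>\<^sup>+y\<in>?B. g y \<partial>lborel)^2 = (\<integral>\<^sup>+y\<in>?B. (g y * indicator ?B y) \<partial>lborel)^2"
  by (simp add: mult.assoc indicator_inter_arith[symmetric])
 also have "\<dots> \<le> (\<integral>\<^sup>+y. (g y * indicator ?B y)^2 \<partial>lborel) * (\<integral>\<^sup>+y. (indicator ?B y)^2 \<partial>lborel)"
  by (rule Cauchy_Schwarz_nn_integral) auto
 also have "(\<integral>\<^sup>+y. (g y * indicator ?B y)^2 \<partial>lborel) = (\<integral>\<^sup>+y\<in>?B. (g y)^2 \<partial>lborel)"
  by (intro nn_integral_cong) (auto split: split_indicator)
 also have "(\<integral>\<^sup>+y. (indicator ?B y)^2 \<partial>lborel) = (\<integral>\<^sup>+y. indicator ?B y \<partial>lborel)"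
  by (intro nn_integral_cong) (auto split: split_indicator)
 also have "\<dots> = emeasure lborel ?B" by simp
 finally have *: "(\<integral>\<^sup>+y\<in>?B. g y \<partial>lborel)^2 \<le>
   (\<integral>\<^sup>+y\<in>?B. (g y)^2 \<partial>lborel) * emeasure lborel ?B" .
 have "(dyad_avg R g j x)^2 \<le> 2 ^ (j * DIM('a)) * (2 ^ (j * DIM('a)) *
   ((\<integral>\<^sup>+y\<in>?B. (g y)^2 \<partial>lborel) * emeasure lborel ?B))"
  unfolding dyad_avg_def power_mult_distrib power2_eq_square[of "2 ^ _"] mult.assoc
  by (intro mult_left_mono *) auto
 also have "\<dots> = (2 ^ (j * DIM('a)) * emeasure lborel ?B) * 2 ^ (j * DIM('a)) *
   (\<integral>\<^sup>+y\<in>?B. (g y)^2 \<partial>lborel)" by (simp add: mult_ac)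
 also have "2 ^ (j * DIM('a)) * emeasure lborel ?B = ennreal (unit_ball_vol (real DIM('a)) * R ^ DIM('a))"
  using emeasure_ball_dyad[OF \<open>R > 0\<close>, where c = 1 and j = j and x = x] by simp
 finally show ?thesis .
qed

lemma nn_suminf_Cauchy_Schwarz:
 fixes f g :: "nat => ennreal"
 shows "(\<Sum>j. f j * g j)^2 \<le> (\<Sum>j. (f j)^2) * (\<Sum>j. (g j)^2)"
 using Cauchy_Schwarz_nn_integral[of f "count_space UNIV" g]
 by (simp add: nn_integral_count_space_nat)

text \<open>By Cauchy-Schwarz in each ball and Fubini the squared L2 norm of the j-th average grows
  like 2^j: a factor 2^(jn) from the normalisation against 2^(-j(n-1)) from the growth of M. The
  weights 2^(-j) of the potential absorb this. Both volume and surface measure satisfy the growth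
  condition locally.\<close>

lemma dyad_pot_L2:
 fixes g :: "'a::euclidean_space => ennreal"
 assumes [measurable]: "g \<in> borel_measurable borel" and R: "R > 0"
  and M: "sigma_finite_measure M" "(\<lambda>x. x) \<in> measurable M borel"
  and c: "c \<ge> 0" "\<And>y r. 0 < r ==> r \<le> R ==> emeasure M (ball y r \<inter> space M) \<le> ennreal (c * r ^ (DIM('a) - 1))"
 shows "(\<integral>\<^sup>+x. (dyad_pot R g x)^2 \<partial>M) \<le>
   ennreal (21 * unit_ball_vol (real DIM('a)) * R ^ DIM('a) * c * R ^ (DIM('a) - 1)) * (\<integral>\<^sup>+y. (g y)^2 \<partial>lborel)"
proof -
 interpret M: sigma_finite_measure M by fact
 interpret P: pair_sigma_finite M "lborel :: 'a measure" ..
 note [measurable] = M(2)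
 define v where "v = unit_ball_vol (real DIM('a)) * R ^ DIM('a)"
 have v: "v \<ge> 0" using R by (simp add: v_def)
 define I where "I = (\<integral>\<^sup>+y. (g y)^2 \<partial>lborel)"
 define D where "D = v * c * R ^ (DIM('a) - 1)"
 have D: "D \<ge> 0" using v c R by (simp add: D_def)
 have bi[measurable]: "(\<lambda>p. indicator (ball (fst p) r) (snd p) :: ennreal) \<in> borel_measurable (M \<Otimes>\<^sub>M lborel)" for r
 proof -
  have "(\<lambda>p. (fst p, snd p)) \<in> measurable (M \<Otimes>\<^sub>M lborel) (borel \<Otimes>\<^sub>M (borel :: 'a measure))"
   using measurable_compose[OF measurable_fst M(2)] by (intro measurable_Pair) auto
  from measurable_compose[OF this ball_indicator_measurable[of r]] show ?thesis by simp
 qed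
 have avg: "(\<integral>\<^sup>+x. (dyad_avg R g j x)^2 \<partial>M) \<le> ennreal (D * 2 ^ j) * I" for j
 proof -
  let ?r = "R * (1/2) ^ j"
  have r: "?r > 0" "?r \<le> R" using R by (auto simp: mult_left_le power_le_one)
  have "(\<integral>\<^sup>+x. (dyad_avg R g j x)^2 \<partial>M) \<le>
    (\<integral>\<^sup>+x. ennreal v * 2 ^ (j * DIM('a)) * (\<integral>\<^sup>+y\<in>ball x ?r. (g y)^2 \<partial>lborel) \<partial>M)"
   unfolding v_def using assms by (intro nn_integral_mono dyad_avg_square_le)
  also have "\<dots> = ennreal v * 2 ^ (j * DIM('a)) * (\<integral>\<^sup>+x. (\<integral>\<^sup>+y\<in>ball x ?r. (g y)^2 \<partial>lborel) \<partial>M)"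
   by (intro nn_integral_cmult lborel.borel_measurable_nn_integral) (simp add: case_prod_beta')
  also have "(\<integral>\<^sup>+x. (\<integral>\<^sup>+y\<in>ball x ?r. (g y)^2 \<partial>lborel) \<partial>M) =
    (\<integral>\<^sup>+y. (\<integral>\<^sup>+x. (g y)^2 * indicator (ball x ?r) y \<partial>M) \<partial>lborel)"
  proof (rule P.Fubini'[symmetric])
   have "(\<lambda>p. (g (snd p))^2 * indicator (ball (fst p) ?r) (snd p)) \<in> borel_measurable (M \<Otimes>\<^sub>M lborel)"
    by measurable
   then show "(\<lambda>(x, y). (g y)^2 * indicator (ball x ?r) y) \<in> borel_measurable (M \<Otimes>\<^sub>M lborel)"
    by (simp add: case_prod_beta')
  qed
  also have "\<dots> = (\<integral>\<^sup>+y. (g y)^2 * emeasure M (ball y ?r \<inter> space M) \<partial>lborel)"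
  proof (rule nn_integral_cong)
   fix y :: 'a
   have m: "ball y ?r \<inter> space M \<in> sets M"
    using measurable_sets[OF M(2), of "ball y ?r"] by (simp add: Int_commute)
   have "(\<integral>\<^sup>+x. (g y)^2 * indicator (ball x ?r) y \<partial>M) = (\<integral>\<^sup>+x\<in>ball y ?r \<inter> space M. (g y)^2 \<partial>M)"
    by (intro nn_integral_cong) (auto split: split_indicator simp: dist_commute)
   then show "(\<integral>\<^sup>+x. (g y)^2 * indicator (ball x ?r) y \<partial>M) = (g y)^2 * emeasure M (ball y ?r \<inter> space M)"
    using m by (simp add: nn_integral_cmult)
  qed
  also have "\<dots> \<le> (\<integral>\<^sup>+y. (g y)^2 * ennreal (c * ?r ^ (DIM('a) - 1)) \<partial>lborel)"
   by (intro nn_integral_mono mult_left_mono c(2) r) auto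
  also have "\<dots> = I * ennreal (c * ?r ^ (DIM('a) - 1))"
   unfolding I_def by (rule nn_integral_multc) (use assms(1) in simp)
  finally have "(\<integral>\<^sup>+x. (dyad_avg R g j x)^2 \<partial>M) \<le>
    ennreal v * 2 ^ (j * DIM('a)) * (I * ennreal (c * ?r ^ (DIM('a) - 1)))"
   by (simp add: mult_left_mono)
  also have "\<dots> = ennreal (v * 2 ^ (j * DIM('a)) * (c * ?r ^ (DIM('a) - 1))) * I"
   using v c R by (simp add: ennreal_mult ennreal_power[symmetric] mult_ac)
  also have "v * 2 ^ (j * DIM('a)) * (c * ?r ^ (DIM('a) - 1)) = D * 2 ^ j"
  proof -
   obtain m where m: "DIM('a) = Suc m" using DIM_positive[where 'a = 'a] by (metis Suc_pred)
   show ?thesis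
    by (simp add: D_def m power_add power_mult power_mult_distrib power_one_over power_divide)
  qed
  finally show ?thesis .
 qed
 \<comment> \<open>The weight 2^(-j) is split as (3/4)^j (2/3)^j. The squares of the first factors
   sum to 16/7; those of the second, (4/9)^j, still beat the growth 2^j and leave a series with sum
   9. The constant 21 rounds up 9 times 16/7.\<close>
 have sq: "(dyad_pot R g x)^2 \<le> ennreal (16/7) * (\<Sum>j. ennreal ((4/9) ^ j) * (dyad_avg R g j x)^2)" for x
 proof -
  have "dyad_pot R g x = (\<Sum>j. ennreal ((3/4) ^ j) * (ennreal ((2/3) ^ j) * dyad_avg R g j x))"
   unfolding dyad_pot_def
   by (simp add: mult.assoc[symmetric] ennreal_mult[symmetric] power_mult_distrib[symmetric])
  also have "\<dots>\<^sup>2 \<le> (\<Sum>j. (ennreal ((3/4) ^ j))^2) * (\<Sum>j. (ennreal ((2/3) ^ j) * dyad_avg R g j x)^2)"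
   by (rule nn_suminf_Cauchy_Schwarz)
  also have "(\<Sum>j. (ennreal ((3/4) ^ j))^2) = (\<Sum>j. ennreal ((9/16) ^ j))"
  proof -
   have "(ennreal ((3/4) ^ j))^2 = ennreal ((9/16) ^ j)" for j
    by (simp add: ennreal_power power_mult[symmetric] mult.commute[of j])
     (simp add: power_mult power2_eq_square)
   then show ?thesis by simp
  qed
  also have "\<dots> = ennreal (16/7)"
   using geometric_sums[of "9/16::real"] by (intro suminf_ennreal_eq) auto
  also have "(\<Sum>j. (ennreal ((2/3) ^ j) * dyad_avg R g j x)^2) = (\<Sum>j. ennreal ((4/9) ^ j) * (dyad_avg R g j x)^2)"
  proof -
   have "(ennreal ((2/3) ^ j))^2 = ennreal ((4/9) ^ j)" for j
    by (simp add: ennreal_power power_mult[symmetric] mult.commute[of j])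
     (simp add: power_mult power2_eq_square)
   then show ?thesis by (simp add: power_mult_distrib)
  qed
  finally show ?thesis .
 qed
 have [measurable]: "dyad_avg R g j \<in> borel_measurable M" for j
  using measurable_compose[OF M(2) dyad_avg_measurable[of g R j]] by simp
 have "(\<integral>\<^sup>+x. (dyad_pot R g x)^2 \<partial>M) \<le> (\<integral>\<^sup>+x. ennreal (16/7) * (\<Sum>j. ennreal ((4/9) ^ j) * (dyad_avg R g j x)^2) \<partial>M)"
  using sq by (rule nn_integral_mono)
 also have "\<dots> = ennreal (16/7) * (\<Sum>j. ennreal ((4/9) ^ j) * (\<integral>\<^sup>+x. (dyad_avg R g j x)^2 \<partial>M))"
  by (simp add: nn_integral_cmult nn_integral_suminf)
 also have "\<dots> \<le> ennreal (16/7) * (\<Sum>j. ennreal ((4/9) ^ j) * (ennreal (D * 2 ^ j) * I))"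
  by (intro mult_left_mono suminf_le avg) auto
 also have "\<dots> = ennreal (16/7) * ((\<Sum>j. ennreal (D * (8/9) ^ j)) * I)"
 proof -
  have "ennreal ((4/9) ^ j) * (ennreal (D * 2 ^ j) * I) = ennreal (D * (8/9) ^ j) * I" for j
  proof -
   have "(4/9) ^ j * (2::real) ^ j = (8/9) ^ j" by (simp add: power_mult_distrib[symmetric])
   then have "ennreal ((4/9) ^ j) * ennreal (D * 2 ^ j) = ennreal (D * (8/9) ^ j)"
    using D by (simp add: ennreal_mult[symmetric] mult.left_commute[of _ D])
   then show ?thesis by (simp add: mult.assoc[symmetric])
  qed
  then show ?thesis by simp
 qed
 also have "(\<Sum>j. ennreal (D * (8/9) ^ j)) = ennreal (D * 9)"
  using sums_mult[OF geometric_sums[of "8/9::real"], of D] D by (intro suminf_ennreal_eq) auto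
 also have "ennreal (16/7) * (ennreal (D * 9) * I) = ennreal (16/7 * (D * 9)) * I"
  using D by (subst ennreal_mult) (auto simp: mult.assoc)
 also have "\<dots> \<le> ennreal (21 * D) * I"
  using D by (intro mult_right_mono ennreal_leI) auto
 finally show ?thesis by (simp add: D_def v_def I_def mult_ac)
qed

subsection \<open>The maximal function\<close>

text \<open>Countable subadditivity over a countable index set without an enumeration, as delivered
  by Vitali's covering lemma.\<close>

lemma emeasure_UN_le_nn_integral:
 assumes [simp]: "countable I" and [measurable]: "\<And>i. i \<in> I ==> X i \<in> sets M"
 shows "emeasure M (\<Union>i\<in>I. X i) \<le> (\<integral>\<^sup>+i. emeasure M (X i) \<partial>count_space I)"
proof -
 have "emeasure M (\<Union>i\<in>I. X i) = (\<integral>\<^sup>+x. indicator (\<Union>i\<in>I. X i) x \<partial>M)"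
  by (rule nn_integral_indicator[symmetric]) (auto intro!: sets.countable_UN')
 also have "\<dots> \<le> (\<integral>\<^sup>+x. (\<integral>\<^sup>+i. indicator (X i) x \<partial>count_space I) \<partial>M)"
 proof (rule nn_integral_mono)
  fix x
  show "indicator (\<Union>i\<in>I. X i) x \<le> (\<integral>\<^sup>+i. indicator (X i) x \<partial>count_space I)"
  proof (cases "x \<in> (\<Union>i\<in>I. X i)")
   case True
   then obtain i where i: "i \<in> I" "x \<in> X i" by auto
   from nn_integral_ge_point[OF i(1), of "\<lambda>i. indicator (X i) x"] show ?thesis using i by (auto simp: indicator_def)
  qed simp
 qed
 also have "\<dots> = (\<integral>\<^sup>+i. (\<integral>\<^sup>+x. indicator (X i) x \<partial>M) \<partial>count_space I)"
  by (rule nn_integral_count_space_nn_integral) auto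
 also have "\<dots> = (\<integral>\<^sup>+i. emeasure M (X i) \<partial>count_space I)"
  by (intro nn_integral_cong) auto
 finally show ?thesis .
qed

text \<open>The weak type (1,1) inequality of Hardy and Littlewood. Vitali's lemma selects disjoint
  balls whose fivefold enlargements cover the level set, which is where 5 R comes from; each
  selected ball carries a share of the integral of g proportional to its volume, and disjointness
  lets these shares be added.\<close>

lemma dyad_max_weak_type:
 fixes g :: "'a::euclidean_space => ennreal"
 assumes [measurable]: "g \<in> borel_measurable borel" and R: "R > 0" and t: "t > 0"
 shows "ennreal t * emeasure lborel {x. dyad_max R g x > ennreal t} \<le>
   ennreal (unit_ball_vol (real DIM('a)) * (5 * R) ^ DIM('a)) * (\<integral>\<^sup>+y. g y \<partial>lborel)"
proof -
 define S where "S = {x. dyad_max R g x > ennreal t}"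
 define K where "K = {(x, j). dyad_avg R g j x > ennreal t}"
 define r where "r = (\<lambda>(x::'a, j). R * (1/2) ^ j)"
 define V where "V = unit_ball_vol (real DIM('a)) * (5 * R) ^ DIM('a)"
 have V: "V \<ge> 0" using R by (simp add: V_def)
 have Sm[measurable]: "S \<in> sets lborel" unfolding S_def by measurable
 have cov: "S \<subseteq> (\<Union>i\<in>K. ball (fst i) (r i))"
 proof
  fix x assume "x \<in> S"
  then obtain j where "dyad_avg R g j x > ennreal t" by (auto simp: S_def dyad_max_def less_SUP_iff)
  then show "x \<in> (\<Union>i\<in>K. ball (fst i) (r i))"
   using R by (intro UN_I[of "(x, j)"]) (auto simp: K_def r_def)
 qed
 have rb: "0 < r i \<and> r i \<le> R" for i
  using R by (auto simp: r_def mult_left_le power_le_one split: prod.splits)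
 obtain C where C: "countable C" "C \<subseteq> K"
   "pairwise (\<lambda>i j. disjnt (ball (fst i) (r i)) (ball (fst j) (r j))) C"
   "S \<subseteq> (\<Union>i\<in>C. ball (fst i) (5 * r i))"
  by (rule Vitali_covering_lemma_balls[OF cov rb])
 have "emeasure lborel S \<le> emeasure lborel (\<Union>i\<in>C. ball (fst i) (5 * r i))"
  using C by (intro emeasure_mono sets.countable_UN') auto
 also have "\<dots> \<le> (\<integral>\<^sup>+i. emeasure lborel (ball (fst i) (5 * r i)) \<partial>count_space C)"
  using C(1) by (intro emeasure_UN_le_nn_integral) auto
 finally have "ennreal t * emeasure lborel S \<le> ennreal t * (\<integral>\<^sup>+i. emeasure lborel (ball (fst i) (5 * r i)) \<partial>count_space C)"
  by (intro mult_left_mono) auto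
 also have "\<dots> = (\<integral>\<^sup>+i. ennreal t * emeasure lborel (ball (fst i) (5 * r i)) \<partial>count_space C)"
  by (rule nn_integral_cmult[symmetric]) auto
 also have "\<dots> \<le> (\<integral>\<^sup>+i. ennreal V * (\<integral>\<^sup>+y\<in>ball (fst i) (r i). g y \<partial>lborel) \<partial>count_space C)"
 proof (rule nn_integral_mono)
  fix i assume "i \<in> space (count_space C)"
  then have "i \<in> K" using C by auto
  then obtain x j where i: "i = (x, j)" and avg: "dyad_avg R g j x > ennreal t" by (auto simp: K_def)
  have "ennreal t * emeasure lborel (ball x (5 * r i)) \<le> dyad_avg R g j x * emeasure lborel (ball x (5 * r i))"
   using avg by (intro mult_right_mono) auto
  also have "\<dots> = (2 ^ (j * DIM('a)) * emeasure lborel (ball x (5 * R * (1/2) ^ j))) *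
    (\<integral>\<^sup>+y\<in>ball x (r i). g y \<partial>lborel)"
   by (simp add: dyad_avg_def i r_def mult_ac)
  also have "\<dots> = ennreal V * (\<integral>\<^sup>+y\<in>ball x (r i). g y \<partial>lborel)"
   using emeasure_ball_dyad[OF R, where c = 5 and j = j and x = x] by (simp add: V_def)
  finally show "ennreal t * emeasure lborel (ball (fst i) (5 * r i)) \<le>
    ennreal V * (\<integral>\<^sup>+y\<in>ball (fst i) (r i). g y \<partial>lborel)" by (simp add: i)
 qed
 also have "\<dots> = ennreal V * (\<integral>\<^sup>+i. (\<integral>\<^sup>+y\<in>ball (fst i) (r i). g y \<partial>lborel) \<partial>count_space C)"
  by (rule nn_integral_cmult) auto
 also have "(\<integral>\<^sup>+i. (\<integral>\<^sup>+y\<in>ball (fst i) (r i). g y \<partial>lborel) \<partial>count_space C) =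
   (\<integral>\<^sup>+i. emeasure (density lborel g) (ball (fst i) (r i)) \<partial>count_space C)"
  by (intro nn_integral_cong) (simp add: emeasure_density)
 also have "\<dots> = emeasure (density lborel g) (\<Union>i\<in>C. ball (fst i) (r i))"
  using C by (intro emeasure_UN_countable[symmetric])
   (auto simp: disjoint_family_on_def pairwise_def disjnt_def)
 also have "\<dots> \<le> emeasure (density lborel g) (space (density lborel g))"
  by (rule emeasure_space)
 also have "\<dots> = (\<integral>\<^sup>+y. g y \<partial>lborel)" by (simp add: emeasure_density)
 finally show ?thesis by (simp add: S_def V_def mult_left_mono)
qed

text \<open>The values of g up to t / V contribute at most t to each average, since V is the
  normalised volume of every ball; only the large values of g are left for the weak type
  bound.\<close>

lemma dyad_avg_split:
 fixes g :: "'a::euclidean_space => ennreal"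
 assumes [measurable]: "g \<in> borel_measurable borel" and R: "R > 0" and t: "t > 0"
 defines "V \<equiv> unit_ball_vol (real DIM('a)) * R ^ DIM('a)"
 shows "dyad_avg R g j x \<le> dyad_avg R (\<lambda>y. g y * indicator {y. g y > ennreal (t / V)} y) j x + ennreal t"
proof -
 have V: "V > 0" using R by (simp add: V_def)
 let ?B = "ball x (R * (1/2) ^ j)"
 let ?h = "\<lambda>y. g y * indicator {y. g y > ennreal (t / V)} y"
 have "dyad_avg R g j x \<le> 2 ^ (j * DIM('a)) * (\<integral>\<^sup>+y. ?h y * indicator ?B y + ennreal (t / V) * indicator ?B y \<partial>lborel)"
  unfolding dyad_avg_def
  by (intro mult_left_mono nn_integral_mono) (auto split: split_indicator)
 also have "\<dots> = dyad_avg R ?h j x + ennreal (t / V) * (2 ^ (j * DIM('a)) * emeasure lborel ?B)"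
  by (subst nn_integral_add) (auto simp: dyad_avg_def nn_integral_cmult distrib_left mult_ac)
 also have "ennreal (t / V) * (2 ^ (j * DIM('a)) * emeasure lborel ?B) = ennreal t"
  using emeasure_ball_dyad[OF R, where c = 1 and j = j and x = x] V t by (simp add: V_def[symmetric] ennreal_mult[symmetric])
 finally show ?thesis .
qed

text \<open>Discrete layer cake: for the k with 2^k < M \<le> 2^(k+1) the single term 4^(k+1)
  suffices, and the summand 1 takes care of M \<le> 1.\<close>

lemma ennreal_layer_cake:
 fixes M :: ennreal
 shows "M^2 \<le> 1 + (\<Sum>k. ennreal (4 ^ (k + 1)) * indicator {x. x > ennreal (2 ^ k)} M)"
proof (cases M)
 case (real m)
 show ?thesis
 proof (cases "m \<le> 1")
  case True
  then have "M^2 \<le> 1" using real by (simp add: ennreal_power power_le_one)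
  then show ?thesis by (rule order_trans) simp
 next
  case False
  obtain n where n: "m \<le> 2 ^ n" using real_arch_pow[of 2 m] by (auto intro: less_imp_le)
  define N where "N = (LEAST n. m \<le> 2 ^ n)"
  have N: "m \<le> 2 ^ N" unfolding N_def using n by (rule LeastI)
  have N0: "N \<noteq> 0" using N False by (intro notI) simp
  then obtain k where k: "N = Suc k" by (cases N) auto
  have "m > 2 ^ k" using not_less_Least[of k "\<lambda>n. m \<le> 2 ^ n"] k by (auto simp: N_def[symmetric])
  then have ind: "ennreal (2 ^ k) < M" using real by (simp add: ennreal_less_iff)
  have "M^2 \<le> ennreal ((2 ^ (k + 1))^2)"
   using real power_mono[of m "2 ^ (k + 1)" 2] N k by (simp add: ennreal_power)
  also have "(2 ^ (k + 1))^2 = (4::real) ^ (k + 1)"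
   by (simp add: power2_eq_square power_mult_distrib[symmetric])
  also have "ennreal (4 ^ (k + 1)) = (\<Sum>k\<in>{k}. ennreal (4 ^ (k + 1)) * indicator {x. x > ennreal (2 ^ k)} M)"
   using ind by simp
  also have "\<dots> \<le> (\<Sum>k. ennreal (4 ^ (k + 1)) * indicator {x. x > ennreal (2 ^ k)} M)"
   by (rule sum_le_suminf) auto
  finally show ?thesis by (rule order_trans) simp
 qed
next
 case top
 have "(\<Sum>k::nat. 1::ennreal) = top"
  using nn_integral_count_space_nat[of "\<lambda>_. 1"] by simp
 moreover have "(1::ennreal) \<le> ennreal (4 ^ (k + 1))" for k
  using ennreal_leI[OF one_le_power[of "4::real" "k + 1"]] by simp
 then have "(\<Sum>k. 1) \<le> (\<Sum>k. ennreal (4 ^ (k + 1)) * indicator {x. x > ennreal (2 ^ k)} M)"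
  using top by (intro suminf_le) auto
 ultimately show ?thesis by (simp add: top_unique)
qed

lemma sum_powers_below:
 fixes a :: ennreal
 shows "(\<Sum>k. ennreal (2 ^ k) * indicator {k. ennreal (2 ^ k) < a} k) \<le> 2 * a"
proof (rule suminf_le_const)
 fix n :: nat
 show "(\<Sum>k<n. ennreal (2 ^ k) * indicator {k. ennreal (2 ^ k) < a} k) \<le> 2 * a"
 proof (induction n)
  case (Suc n)
  show ?case
  proof (cases "ennreal (2 ^ n) < a")
   case True
   have "(\<Sum>k<Suc n. ennreal (2 ^ k) * indicator {k. ennreal (2 ^ k) < a} k) \<le> (\<Sum>k<Suc n. ennreal (2 ^ k))"
    by (intro sum_mono) (auto split: split_indicator)
   also have "\<dots> = ennreal (\<Sum>k<Suc n. 2 ^ k)" by (rule sum_ennreal) auto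
   also have "\<dots> \<le> ennreal (2 * 2 ^ n)"
    by (intro ennreal_leI) (simp add: sum_power2[symmetric] lessThan_Suc geometric_sum)
   also have "\<dots> \<le> 2 * a" using True by (simp add: ennreal_mult mult_left_mono)
   finally show ?thesis .
  next
   case False
   then show ?thesis using Suc by simp
  qed
 qed simp
qed (rule summableI)

text \<open>Marcinkiewicz interpolation between the weak type inequality and the trivial bound for
  bounded functions, discretised at the levels 2^k: at each level only the part of g above a
  multiple of 2^k matters. The measure of W comes from the values of the maximal function up to
  1.\<close>

lemma dyad_max_L2:
 fixes g :: "'a::euclidean_space => ennreal"
 assumes [measurable]: "g \<in> borel_measurable borel" and R: "R > 0" and W[measurable]: "W \<in> sets lborel"
 shows "(\<integral>\<^sup>+x\<in>W. (dyad_max R g x)^2 \<partial>lborel) \<le> emeasure lborel W +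
   ennreal (32 * (unit_ball_vol (real DIM('a)) * (5 * R) ^ DIM('a)) * (unit_ball_vol (real DIM('a)) * R ^ DIM('a)))
    * (\<integral>\<^sup>+y. (g y)^2 \<partial>lborel)"
proof -
 define V where "V = unit_ball_vol (real DIM('a)) * R ^ DIM('a)"
 define V5 where "V5 = unit_ball_vol (real DIM('a)) * (5 * R) ^ DIM('a)"
 have V: "V > 0" "V5 > 0" using R by (auto simp: V_def V5_def)
 let ?E = "\<lambda>k. {x. dyad_max R g x > ennreal (2 ^ k)}"
 let ?h = "\<lambda>k y. g y * indicator {y. g y > ennreal (2 ^ k / 2 / V)} y"
 have E: "ennreal (4 ^ (k + 1)) * emeasure lborel (?E k) \<le> ennreal (8 * V5) * (ennreal (2 ^ k) * (\<integral>\<^sup>+y. ?h k y \<partial>lborel))" for k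
 proof -
  have "?E k \<subseteq> {x. dyad_max R (?h k) x > ennreal (2 ^ k / 2)}"
  proof
   fix x assume "x \<in> ?E k"
   then obtain j where j: "dyad_avg R g j x > ennreal (2 ^ k)" by (auto simp: dyad_max_def less_SUP_iff)
   have "dyad_avg R g j x \<le> dyad_avg R (?h k) j x + ennreal (2 ^ k / 2)"
    using dyad_avg_split[of g R "2 ^ k / 2" j x] R by (simp add: V_def)
   with j have lt: "ennreal (2 ^ k / 2) + ennreal (2 ^ k / 2) < dyad_avg R (?h k) j x + ennreal (2 ^ k / 2)"
    by (simp add: ennreal_plus[symmetric] del: ennreal_plus)
   have "ennreal (2 ^ k / 2) < dyad_avg R (?h k) j x"
    using lt add_right_mono[of "dyad_avg R (?h k) j x" "ennreal (2 ^ k / 2)" "ennreal (2 ^ k / 2)"] by (auto simp: not_le[symmetric])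
   then show "x \<in> {x. dyad_max R (?h k) x > ennreal (2 ^ k / 2)}"
    by (auto simp: dyad_max_def less_SUP_iff)
  qed
  then have "emeasure lborel (?E k) \<le> emeasure lborel {x. dyad_max R (?h k) x > ennreal (2 ^ k / 2)}"
   by (intro emeasure_mono) measurable
  then have "ennreal (2 ^ k / 2) * emeasure lborel (?E k) \<le>
    ennreal (2 ^ k / 2) * emeasure lborel {x. dyad_max R (?h k) x > ennreal (2 ^ k / 2)}"
   by (rule mult_left_mono) simp
  also have "\<dots> \<le> ennreal V5 * (\<integral>\<^sup>+y. ?h k y \<partial>lborel)"
   unfolding V5_def by (rule dyad_max_weak_type) (use R in auto)
  finally have *: "ennreal (2 ^ k / 2) * emeasure lborel (?E k) \<le> ennreal V5 * (\<integral>\<^sup>+y. ?h k y \<partial>lborel)" .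
  \<comment> \<open>4^(k+1) = (8 2^k) (2^k / 2): the last factor is the level in the weak type
    inequality, the factor 2^k stays behind for the sum over the levels.\<close>
  have "ennreal (4 ^ (k + 1)) * emeasure lborel (?E k) = ennreal (8 * 2 ^ k) * (ennreal (2 ^ k / 2) * emeasure lborel (?E k))"
   by (simp add: mult.assoc[symmetric] ennreal_mult[symmetric] power_mult_distrib[symmetric])
  also have "\<dots> \<le> ennreal (8 * 2 ^ k) * (ennreal V5 * (\<integral>\<^sup>+y. ?h k y \<partial>lborel))"
   by (rule mult_left_mono[OF *]) simp
  also have "\<dots> = ennreal (8 * V5) * (ennreal (2 ^ k) * (\<integral>\<^sup>+y. ?h k y \<partial>lborel))"
   using V by (simp add: ennreal_mult mult_ac)
  finally show ?thesis .
 qed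
 have "(\<integral>\<^sup>+x\<in>W. (dyad_max R g x)^2 \<partial>lborel) \<le>
   (\<integral>\<^sup>+x. indicator W x + (\<Sum>k. ennreal (4 ^ (k + 1)) * indicator (?E k) x) \<partial>lborel)"
 proof (rule nn_integral_mono)
  fix x
  show "(dyad_max R g x)^2 * indicator W x \<le> indicator W x + (\<Sum>k. ennreal (4 ^ (k + 1)) * indicator (?E k) x)"
   using ennreal_layer_cake[of "dyad_max R g x"] by (auto split: split_indicator simp: indicator_def)
 qed
 also have "\<dots> = emeasure lborel W + (\<Sum>k. ennreal (4 ^ (k + 1)) * emeasure lborel (?E k))"
 proof -
  have [measurable]: "?E k \<in> sets borel" for k by measurable
  have "(\<integral>\<^sup>+x. (\<Sum>k. ennreal (4 ^ (k + 1)) * indicator (?E k) x) \<partial>lborel) = (\<Sum>k. ennreal (4 ^ (k + 1)) * emeasure lborel (?E k))"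
   by (subst nn_integral_suminf) (auto simp: nn_integral_cmult)
  moreover have "(\<integral>\<^sup>+x. indicator W x \<partial>lborel) = emeasure lborel W" using W by simp
  ultimately show ?thesis by (subst nn_integral_add) (use W in auto)
 qed
 also have "\<dots> \<le> emeasure lborel W + (\<Sum>k. ennreal (8 * V5) * (ennreal (2 ^ k) * (\<integral>\<^sup>+y. ?h k y \<partial>lborel)))"
  by (intro add_left_mono suminf_le E) auto
 also have "(\<Sum>k. ennreal (8 * V5) * (ennreal (2 ^ k) * (\<integral>\<^sup>+y. ?h k y \<partial>lborel))) =
   ennreal (8 * V5) * (\<integral>\<^sup>+y. (\<Sum>k. ennreal (2 ^ k) * ?h k y) \<partial>lborel)"
  by (simp add: nn_integral_suminf nn_integral_cmult)
 also have "\<dots> \<le> ennreal (8 * V5) * (\<integral>\<^sup>+y. ennreal (4 * V) * (g y)^2 \<partial>lborel)"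
 proof (intro mult_left_mono nn_integral_mono)
  fix y
  \<comment> \<open>For fixed y the level condition becomes 2^k < 2 V g y, a condition on k; the
    geometric sum over these k is at most twice its bound, by
    \<open>sum_powers_below\<close>.\<close>
  have iff: "g y > ennreal (2 ^ k / 2 / V) \<longleftrightarrow> ennreal (2 ^ k) < ennreal (2 * V) * g y" for k
  proof -
   have "ennreal (2 * V) * ennreal (2 ^ k / 2 / V) = ennreal (2 ^ k)"
    using V by (simp add: ennreal_mult[symmetric])
   moreover have "ennreal (2 * V) * a < ennreal (2 * V) * b \<longleftrightarrow> a < b" for a b
    using V ennreal_mult_strict_left_mono[of a b "ennreal (2 * V)"] mult_left_mono[of b a "ennreal (2 * V)"]
    by (cases "a < b") (auto simp: not_less)
   ultimately show ?thesis by metis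
  qed
  have "(\<Sum>k. ennreal (2 ^ k) * ?h k y) =
    (\<Sum>k. g y * (ennreal (2 ^ k) * indicator {k. ennreal (2 ^ k) < ennreal (2 * V) * g y} k))"
   by (simp only: indicator_def mem_Collect_eq iff mult.left_commute[of "g y"])
  also have "\<dots> = g y * (\<Sum>k. ennreal (2 ^ k) * indicator {k. ennreal (2 ^ k) < ennreal (2 * V) * g y} k)"
   by simp
  also have "\<dots> \<le> g y * (2 * (ennreal (2 * V) * g y))"
   by (intro mult_left_mono sum_powers_below) auto
  also have "\<dots> = ennreal (4 * V) * (g y)^2"
   using V by (simp add: ennreal_mult power2_eq_square mult_ac)
  finally show "(\<Sum>k. ennreal (2 ^ k) * ?h k y) \<le> ennreal (4 * V) * (g y)^2" .
 qed auto
 also have "\<dots> = ennreal (32 * V5 * V) * (\<integral>\<^sup>+y. (g y)^2 \<partial>lborel)"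
  using V by (simp add: nn_integral_cmult mult.assoc[symmetric] ennreal_mult[symmetric])
 finally show ?thesis by (simp add: V_def V5_def)
qed

subsection \<open>Integrability of the potential at the critical exponent\<close>

lemma ennreal_square_le_imp:
 assumes "x^2 \<le> ennreal (c^2)" "c \<ge> 0"
 shows "x \<le> ennreal c"
proof (cases x)
 case (real r)
 then have "r^2 \<le> c^2" using assms by (simp add: ennreal_power)
 then have "r \<le> c" using assms(2) by (rule power2_le_imp_le)
 then show ?thesis using real by (simp add: ennreal_leI)
next
 case top
 then show ?thesis using assms by (simp add: top_unique)
qed

text \<open>Hedberg's splitting. At coarse scales the growing bound is the better one, at fine
  scales the bound M. The scale k with 2^k about M^(1/\<alpha>) separates them, and there both
  partial sums are of order M^((\<alpha>-1)/\<alpha>): the first is geometric with ratio b > 1 and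
  governed by its last term, the second is governed by its first term.\<close>

lemma dyadic_sum_bound:
 fixes a :: "nat => ennreal"
 assumes aM: "\<And>j. a j \<le> ennreal M" and aV: "\<And>j. a j \<le> ennreal (V * (2 powr \<alpha>) ^ j)"
  and M: "M \<ge> 1" and V: "V \<ge> 0" and \<alpha>: "\<alpha> > 1"
 defines "b \<equiv> 2 powr (\<alpha> - 1)"
 shows "(\<Sum>j. ennreal ((1/2) ^ j) * a j) \<le> ennreal ((V * b / (b - 1) + 2) * M powr ((\<alpha> - 1) / \<alpha>))"
proof (rule suminf_le_const)
 fix n :: nat
 define T where "T = M powr (1 / \<alpha>)"
 have T: "T \<ge> 1" using M \<alpha> by (simp add: T_def ge_one_powr_ge_zero)
 have b: "b > 1" using \<alpha> by (simp add: b_def)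
 have TM: "T powr (\<alpha> - 1) = M powr ((\<alpha> - 1) / \<alpha>)" by (simp add: T_def powr_powr)
 obtain k1 where k1: "T \<le> 2 ^ k1" using real_arch_pow[of 2 T] by (auto intro: less_imp_le)
 define k where "k = (LEAST k. T \<le> 2 ^ k)"
 have k: "T \<le> 2 ^ k" unfolding k_def using k1 by (rule LeastI)
 have bk: "b ^ k \<le> b * T powr (\<alpha> - 1)"
 proof (cases k)
  case 0
  have "1 * 1 \<le> b * T powr (\<alpha> - 1)" using b T \<alpha> by (intro mult_mono ge_one_powr_ge_zero) auto
  then show ?thesis using 0 by simp
 next
  case (Suc l)
  then have "2 ^ l < T" using not_less_Least[of l "\<lambda>k. T \<le> 2 ^ k"] by (auto simp: k_def[symmetric])
  then have "(2 ^ l) powr (\<alpha> - 1) \<le> T powr (\<alpha> - 1)" using \<alpha> by (intro powr_mono2) auto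
  also have "(2 ^ l) powr (\<alpha> - 1) = b ^ l"
   by (simp add: b_def powr_realpow[symmetric] powr_powr mult.commute)
  finally show ?thesis using Suc b by simp
 qed
 have Mk: "M * (1/2) ^ k \<le> T powr (\<alpha> - 1)"
 proof -
  have "M = T powr \<alpha>" using M \<alpha> by (simp add: T_def powr_powr)
  also have "\<dots> = T powr (\<alpha> - 1) * T" using T by (simp add: powr_diff)
  also have "\<dots> \<le> T powr (\<alpha> - 1) * 2 ^ k" using k by (intro mult_left_mono) auto
  finally show ?thesis by (simp add: power_one_over field_simps)
 qed
 define c where "c = (\<lambda>j. (if j < k then V * b ^ j else 0) + (if j < k then 0 else (1/2) ^ j * M))"
 have c0: "c j \<ge> 0" for j using V b M by (simp add: c_def)
 have "ennreal ((1/2) ^ j) * a j \<le> ennreal (c j)" for j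
 proof (cases "j < k")
  case True
  have "ennreal ((1/2) ^ j) * a j \<le> ennreal ((1/2) ^ j) * ennreal (V * (2 powr \<alpha>) ^ j)"
   by (intro mult_left_mono aV) auto
  also have "\<dots> = ennreal ((1/2) ^ j * (V * (2 powr \<alpha>) ^ j))" using V by (simp add: ennreal_mult)
  also have "(1/2) ^ j * (V * (2 powr \<alpha>) ^ j) = V * b ^ j"
   by (simp add: b_def powr_diff power_divide power_one_over)
  finally show ?thesis using True by (simp add: c_def)
 next
  case False
  have "ennreal ((1/2) ^ j) * a j \<le> ennreal ((1/2) ^ j) * ennreal M"
   by (intro mult_left_mono aM) auto
  also have "\<dots> = ennreal ((1/2) ^ j * M)" using M by (simp add: ennreal_mult)
  finally show ?thesis using False by (simp add: c_def)
 qed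
 then have "(\<Sum>j<n. ennreal ((1/2) ^ j) * a j) \<le> (\<Sum>j<n. ennreal (c j))" by (rule sum_mono)
 also have "\<dots> = ennreal (\<Sum>j<n. c j)" using c0 by simp
 also have "\<dots> \<le> ennreal (\<Sum>j<n + k. c j)" by (intro ennreal_leI sum_mono2) (auto simp: c0)
 also have "(\<Sum>j<n + k. c j) = (\<Sum>j<k. c j) + (\<Sum>j=k..<k + n. c j)"
  using sum.atLeastLessThan_concat[of 0 k "k + n" c] by (simp add: atLeast0LessThan add.commute)
 also have "(\<Sum>j<k. c j) = V * (\<Sum>j<k. b ^ j)" by (simp add: c_def sum_distrib_left)
 also have "(\<Sum>j=k..<k + n. c j) = M * ((1/2) ^ k * (\<Sum>j<n. (1/2) ^ j))"
  using sum.shift_bounds_nat_ivl[of c 0 k n]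
  by (simp add: c_def sum_distrib_left power_add atLeast0LessThan add.commute mult_ac)
 also have "V * (\<Sum>j<k. b ^ j) + M * ((1/2) ^ k * (\<Sum>j<n. (1/2) ^ j))
   \<le> V * (b * T powr (\<alpha> - 1) / (b - 1)) + 2 * T powr (\<alpha> - 1)"
 proof (rule add_mono)
  have "(\<Sum>j<k. b ^ j) = (b ^ k - 1) / (b - 1)" using b by (simp add: geometric_sum)
  also have "\<dots> \<le> b * T powr (\<alpha> - 1) / (b - 1)" using b bk by (intro divide_right_mono) auto
  finally show "V * (\<Sum>j<k. b ^ j) \<le> V * (b * T powr (\<alpha> - 1) / (b - 1))"
   using V by (rule mult_left_mono)
  have "(\<Sum>j<n. (1/2) ^ j) \<le> (2::real)" by (simp add: geometric_sum)
  then have "(M * (1/2) ^ k) * (\<Sum>j<n. (1/2) ^ j) \<le> T powr (\<alpha> - 1) * 2"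
   using Mk M by (intro mult_mono) (auto intro!: sum_nonneg)
  then show "M * ((1/2) ^ k * (\<Sum>j<n. (1/2) ^ j)) \<le> 2 * T powr (\<alpha> - 1)"
   by (simp add: mult_ac)
 qed
 also have "\<dots> = (V * b / (b - 1) + 2) * M powr ((\<alpha> - 1) / \<alpha>)"
  by (simp add: TM algebra_simps)
 finally show "(\<Sum>j<n. ennreal ((1/2) ^ j) * a j) \<le> ennreal ((V * b / (b - 1) + 2) * M powr ((\<alpha> - 1) / \<alpha>))"
  by (simp add: ennreal_leI)
qed (rule summableI)

text \<open>With \<alpha> = q/(q-2) one has (\<alpha>-1)/\<alpha> = 2/q, so Hedberg's bound turns
  the q-th power of the potential into the square of the maximal function. The second hypothesis on
  q says n/2 \<le> \<alpha>: the growth 2^(jn/2) of the averages, known from Cauchy-Schwarz, is at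
  most 2^(\<alpha> j), with equality at the critical exponent. The bound is stated on the unit ball;
  scaling is left to \<open>Lp_pairing\<close>.\<close>

lemma dyad_pot_Lq:
 assumes R: "R > 0" and q: "q > 2" "real DIM('a) * (q - 2) \<le> 2 * q"
  and W[measurable]: "W \<in> sets lborel" and Wfin: "emeasure lborel W < \<infinity>"
 shows "\<exists>C\<ge>0. \<forall>g::'a::euclidean_space => ennreal. g \<in> borel_measurable borel -->
   (\<integral>\<^sup>+y. (g y)^2 \<partial>lborel) \<le> 1 -->
   (AE x in lborel. x \<in> W --> dyad_pot R g x < \<infinity>) \<and>
   (\<integral>\<^sup>+x\<in>W. ennreal (enn2real (dyad_pot R g x) powr q) \<partial>lborel) \<le> ennreal C"
proof -
 define \<alpha> where "\<alpha> = q / (q - 2)"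
 have \<alpha>: "\<alpha> > 1" "(\<alpha> - 1) / \<alpha> = 2 / q" "real DIM('a) \<le> 2 * \<alpha>"
  using q by (auto simp: \<alpha>_def field_simps)
 define V where "V = unit_ball_vol (real DIM('a)) * R ^ DIM('a)"
 have V: "V \<ge> 0" using R by (simp add: V_def)
 define b :: real where "b = 2 powr (\<alpha> - 1)"
 have b: "b > 1" using \<alpha> by (simp add: b_def)
 define C0 where "C0 = sqrt V * b / (b - 1) + 2"
 have C0: "C0 > 0" using V b by (simp add: C0_def add_nonneg_pos)
 define w where "w = measure lborel W"
 have w: "emeasure lborel W = ennreal w" "w \<ge> 0"
  using Wfin by (auto simp: w_def emeasure_eq_ennreal_measure)
 define D where "D = 32 * (unit_ball_vol (real DIM('a)) * (5 * R) ^ DIM('a)) * V"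
 have D: "D \<ge> 0" using R V by (simp add: D_def)
 show ?thesis
 proof (intro exI[of _ "C0 powr q * (2 * w + D)"] conjI allI impI)
  show "0 \<le> C0 powr q * (2 * w + D)" using w D by simp
  fix g :: "'a => ennreal"
  assume g[measurable]: "g \<in> borel_measurable borel" and g1: "(\<integral>\<^sup>+y. (g y)^2 \<partial>lborel) \<le> 1"
  have max2: "(\<integral>\<^sup>+x\<in>W. (dyad_max R g x)^2 \<partial>lborel) \<le> ennreal (w + D)"
  proof -
   have "(\<integral>\<^sup>+x\<in>W. (dyad_max R g x)^2 \<partial>lborel) \<le>
     emeasure lborel W + ennreal D * (\<integral>\<^sup>+y. (g y)^2 \<partial>lborel)"
    unfolding D_def V_def by (rule dyad_max_L2[OF g R W])
   also have "\<dots> \<le> ennreal w + ennreal D * 1"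
    using g1 w by (intro add_mono mult_left_mono) auto
   finally show ?thesis using w D by simp
  qed
  have "AE x in lborel. (dyad_max R g x)^2 * indicator W x \<noteq> \<infinity>"
   by (rule nn_integral_noteq_infinite) (use max2 in \<open>auto simp: top_unique\<close>)
  then have fin: "AE x in lborel. x \<in> W --> dyad_max R g x \<noteq> \<infinity>"
   by eventually_elim (auto simp: power2_eq_square)
  \<comment> \<open>\<open>dyadic_sum_bound\<close> asks for M \<ge> 1, hence
    \<open>max 1 m\<close>. Its square is at most 1 + m^2, which adds the measure of W once more to
    the final bound.\<close>
  have pot: "dyad_pot R g x \<le> ennreal (C0 * max 1 m powr (2 / q))"
   if m: "dyad_max R g x = ennreal m" "m \<ge> 0" for x m
  proof -
   have "(\<Sum>j. ennreal ((1/2) ^ j) * dyad_avg R g j x) \<le>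
     ennreal ((sqrt V * b / (b - 1) + 2) * max 1 m powr ((\<alpha> - 1) / \<alpha>))"
    unfolding b_def
   proof (rule dyadic_sum_bound)
    fix j
    have "dyad_avg R g j x \<le> dyad_max R g x" unfolding dyad_max_def by (rule SUP_upper) simp
    also have "\<dots> \<le> ennreal (max 1 m)" using m by (simp add: ennreal_leI)
    finally show "dyad_avg R g j x \<le> ennreal (max 1 m)" .
    have "(dyad_avg R g j x)^2 \<le> ennreal V * 2 ^ (j * DIM('a)) *
      (\<integral>\<^sup>+y\<in>ball x (R * (1/2) ^ j). (g y)^2 \<partial>lborel)"
     unfolding V_def by (rule dyad_avg_square_le[OF g R])
    also have "\<dots> \<le> ennreal V * 2 ^ (j * DIM('a)) * (\<integral>\<^sup>+y. (g y)^2 \<partial>lborel)"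
     by (intro mult_left_mono nn_integral_mono) (auto split: split_indicator)
    also have "\<dots> \<le> ennreal V * 2 ^ (j * DIM('a)) * 1"
     using g1 by (intro mult_left_mono) auto
    also have "\<dots> = ennreal (V * 2 ^ (j * DIM('a)))"
     using V by (simp add: ennreal_mult ennreal_power[symmetric])
    also have "\<dots> \<le> ennreal ((sqrt V * (2 powr \<alpha>) ^ j)^2)"
    proof (rule ennreal_leI)
     have "(2::real) ^ (j * DIM('a)) = 2 powr (real j * real DIM('a))"
      by (simp add: powr_realpow[symmetric])
     also have "\<dots> \<le> 2 powr (real j * (2 * \<alpha>))"
      using \<alpha> by (intro powr_mono mult_left_mono) auto
     also have "\<dots> = ((2 powr \<alpha>) ^ j)^2"
      by (simp add: powr_realpow[symmetric] powr_powr powr_power mult_ac)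
     finally show "V * 2 ^ (j * DIM('a)) \<le> (sqrt V * (2 powr \<alpha>) ^ j)^2"
      using V by (simp add: power_mult_distrib mult_left_mono)
    qed
    finally show "dyad_avg R g j x \<le> ennreal (sqrt V * (2 powr \<alpha>) ^ j)"
     by (rule ennreal_square_le_imp) (use V in auto)
   qed (use V \<alpha> in auto)
   then show ?thesis by (simp add: dyad_pot_def C0_def \<alpha>)
  qed
  show "AE x in lborel. x \<in> W --> dyad_pot R g x < \<infinity>"
   using fin
  proof eventually_elim
   fix x assume f: "x \<in> W --> dyad_max R g x \<noteq> \<infinity>"
   show "x \<in> W --> dyad_pot R g x < \<infinity>"
   proof
    assume "x \<in> W"
    then obtain m where "dyad_max R g x = ennreal m" "m \<ge> 0"
     using f by (cases "dyad_max R g x") auto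
    from pot[OF this] show "dyad_pot R g x < \<infinity>"
     by (rule le_less_trans) simp
   qed
  qed
  have "(\<integral>\<^sup>+x\<in>W. ennreal (enn2real (dyad_pot R g x) powr q) \<partial>lborel) \<le>
    (\<integral>\<^sup>+x. ennreal (C0 powr q) * (indicator W x + (dyad_max R g x)^2 * indicator W x) \<partial>lborel)"
  proof (rule nn_integral_mono_AE)
   show "AE x in lborel. ennreal (enn2real (dyad_pot R g x) powr q) * indicator W x
     \<le> ennreal (C0 powr q) * (indicator W x + (dyad_max R g x)^2 * indicator W x)"
    using fin
   proof eventually_elim
    fix x assume f: "x \<in> W --> dyad_max R g x \<noteq> \<infinity>"
    show "ennreal (enn2real (dyad_pot R g x) powr q) * indicator W x
     \<le> ennreal (C0 powr q) * (indicator W x + (dyad_max R g x)^2 * indicator W x)"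
    proof (cases "x \<in> W")
     case True
     then obtain m where m: "dyad_max R g x = ennreal m" "m \<ge> 0"
      using f by (cases "dyad_max R g x") auto
     have "enn2real (dyad_pot R g x) \<le> C0 * max 1 m powr (2 / q)"
      using pot[OF m] C0 by (intro enn2real_leI) auto
     then have "enn2real (dyad_pot R g x) powr q \<le> (C0 * max 1 m powr (2 / q)) powr q"
      using q by (intro powr_mono2) auto
     also have "\<dots> = C0 powr q * (max 1 m powr (2 / q)) powr q"
      using C0 by (simp add: powr_mult)
     also have "(max 1 m powr (2 / q)) powr q = (max 1 m)^2"
      using q by (simp add: powr_powr)
     also have "C0 powr q * (max 1 m)^2 \<le> C0 powr q * (1 + m^2)"
      by (intro mult_left_mono) (auto simp: max_def)
     finally have "ennreal (enn2real (dyad_pot R g x) powr q) \<le> ennreal (C0 powr q * (1 + m^2))"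
      by (rule ennreal_leI)
     also have "\<dots> = ennreal (C0 powr q) * (1 + (dyad_max R g x)^2)"
      using m by (simp add: ennreal_mult ennreal_power)
     finally show ?thesis using True by simp
    qed simp
   qed
  qed
  also have "\<dots> = ennreal (C0 powr q) * (emeasure lborel W + (\<integral>\<^sup>+x\<in>W. (dyad_max R g x)^2 \<partial>lborel))"
  proof -
   have "(\<integral>\<^sup>+x. indicator W x \<partial>lborel) = emeasure lborel W" using W by simp
   then show ?thesis by (simp add: nn_integral_cmult nn_integral_add)
  qed
  also have "\<dots> \<le> ennreal (C0 powr q) * (ennreal w + ennreal (w + D))"
   using max2 w by (intro mult_left_mono add_mono) auto
  also have "\<dots> = ennreal (C0 powr q * (2 * w + D))"
   using w D by (simp add: ennreal_mult[symmetric] ennreal_plus[symmetric] del: ennreal_plus)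
  finally show "(\<integral>\<^sup>+x\<in>W. ennreal (enn2real (dyad_pot R g x) powr q) \<partial>lborel)
    \<le> ennreal (C0 powr q * (2 * w + D))" .
 qed
qed

subsection \<open>Pointwise comparison with an average\<close>

text \<open>The derivative in the scale is at most R \<tau>^(-n) times the integral of |G| over the
  ball of radius R \<tau>. On the interval from a = 2^(-j-1) to b = 2^(-j) the power is estimated at
  a and the ball at b; this mismatch costs the factor 2^n.\<close>

lemma mol_telescope:
 fixes x :: "'a::euclidean_space"
 assumes w: "wgrad \<Omega> u G" and k: "k > 0"
  and sub: "\<And>s. 0 < s ==> s \<le> 1 ==> cball (x + s *\<^sub>R e) (s * k) \<subseteq> \<Omega>"
 defines "R \<equiv> norm e + k"
 shows "ennreal \<bar>mol e k u x ((1/2) ^ j) - mol e k u x ((1/2) ^ Suc j)\<bar> \<le>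
   ennreal (R * 2 ^ DIM('a)) * (ennreal ((1/2) ^ j) * dyad_avg R (\<lambda>y. ennreal (norm (G y))) j x)"
proof -
 have R: "R > 0" using k by (simp add: R_def add_nonneg_pos)
 have Gi: "integrable lborel G" using w by (simp add: wgrad_def)
 then have [measurable]: "G \<in> borel_measurable borel" by auto
 define a b :: real where "a = (1/2) ^ Suc j" and "b = (1/2) ^ j"
 have ab: "0 < a" "a \<le> b" "b \<le> 1" "b - a = a" "b = 2 * a" by (auto simp: a_def b_def power_le_one)
 define I where "I = (LINT y|lborel. norm (G y) * indicator (ball x (R * b)) y)"
 have Ii: "integrable lborel (\<lambda>y. norm (G y) * indicator (ball x (R * b)) y)"
  by (rule integrable_real_mult_indicator) (use Gi in auto)
 have I0: "I \<ge> 0" unfolding I_def by (rule Bochner_Integration.integral_nonneg) simp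
 define D where "D = (\<lambda>\<tau>. LINT y|lborel. (G y \<bullet> ((1 / \<tau>) *\<^sub>R (y - x))) * ker e k x \<tau> y)"
 define B where "B = R * (1 / a) ^ DIM('a) * I"
 have der: "((\<lambda>\<tau>. mol e k u x \<tau>) has_real_derivative D \<tau>) (at \<tau>)" if "a \<le> \<tau>" "\<tau> \<le> b" for \<tau>
  using mol_path_derivative[OF w k, of 0 \<tau> 1 x 0 e] sub[of \<tau>] that ab by (simp add: D_def)
 have bd: "\<bar>D \<tau>\<bar> \<le> B" if \<tau>: "a \<le> \<tau>" "\<tau> \<le> b" for \<tau>
 proof -
  have t: "\<tau> > 0" using \<tau> ab by simp
  have "\<bar>D \<tau>\<bar> \<le> R * (1 / \<tau>) ^ DIM('a) * (LINT y|lborel. norm (G y) * indicator (ball x (R * \<tau>)) y)"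
   unfolding D_def R_def
  proof (rule ker_integral_bound[OF k t Gi])
   fix y assume y: "y \<in> ball (x + \<tau> *\<^sub>R e) (\<tau> * k)"
   have "norm ((1 / \<tau>) *\<^sub>R (y - x)) \<le> norm e + k"
    using ker_ball_subset[OF t y] t by (simp add: pos_divide_le_eq mult.commute)
   then show "\<bar>G y \<bullet> ((1 / \<tau>) *\<^sub>R (y - x))\<bar> \<le> (norm e + k) * norm (G y)"
    unfolding mult.commute[of "norm e + k"] by (intro order_trans[OF Cauchy_Schwarz_ineq2] mult_left_mono) auto
  qed (use R in \<open>simp add: R_def\<close>)
  also have "\<dots> \<le> B"
   unfolding B_def I_def
  proof (intro mult_mono integral_mono power_mono Ii)
   show "integrable lborel (\<lambda>y. norm (G y) * indicator (ball x (R * \<tau>)) y)"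
    by (rule integrable_real_mult_indicator) (use Gi in auto)
   show "indicator (ball x (R * \<tau>)) y \<le> (indicator (ball x (R * b)) y :: real)" for y
    using mult_left_mono[OF \<tau>(2) less_imp_le[OF R]] by (auto split: split_indicator)
  qed (use R ab t \<tau> in \<open>auto simp: frac_le intro: Bochner_Integration.integral_nonneg\<close>)
  finally show ?thesis .
 qed
 have "norm (mol e k u x b - mol e k u x a) \<le> B * norm (b - a)"
  by (rule field_differentiable_bound[where S = "{a..b}" and f' = D])
   (use der bd ab in \<open>auto intro: has_field_derivative_at_within\<close>)
 also have "\<dots> = R * (1 / a) ^ DIM('a) * I * a" using ab by (simp add: B_def)
 also have "\<dots> \<le> R * (1 / a) ^ DIM('a) * I * b" using ab R I0 by (intro mult_left_mono) auto
 also have "(1 / a) ^ DIM('a) = 2 ^ DIM('a) * 2 ^ (j * DIM('a))"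
 proof -
  have "1 / a = 2 * 2 ^ j" by (simp add: a_def power_one_over)
  then show ?thesis by (simp only: power_mult_distrib power_mult)
 qed
 finally have "ennreal \<bar>mol e k u x b - mol e k u x a\<bar> \<le> ennreal (R * (2 ^ DIM('a) * 2 ^ (j * DIM('a))) * I * b)"
  by (intro ennreal_leI) simp
 also have "\<dots> = ennreal (R * 2 ^ DIM('a)) * (ennreal b * (2 ^ (j * DIM('a)) * ennreal I))"
  using R I0 ab by (simp add: ennreal_mult mult_ac ennreal_power[symmetric])
 also have "ennreal I = (\<integral>\<^sup>+y\<in>ball x (R * b). ennreal (norm (G y)) \<partial>lborel)"
  unfolding I_def by (subst nn_integral_eq_integral[OF Ii, symmetric])
   (auto intro!: nn_integral_cong split: split_indicator)
 finally show ?thesis by (simp add: dyad_avg_def a_def b_def)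
qed

text \<open>The limit L and the sequence r of scales are left open: almost everywhere convergence is
  available along a subsequence only, whereas for a function continuous up to the boundary the full
  sequence converges at every point of the closure.\<close>

lemma mol_limit_bound:
 fixes x :: "'a::euclidean_space"
 assumes w: "wgrad \<Omega> u G" and kp: "kp > 0"
  and sub: "\<And>s. 0 < s ==> s \<le> 1 ==> cball (x + s *\<^sub>R e) (s * kp) \<subseteq> \<Omega>"
  and lim: "(\<lambda>i. mol e kp u x ((1/2) ^ r i)) \<leadsto> L"
 defines "R \<equiv> norm e + kp"
 shows "ennreal \<bar>mol e kp u x 1 - L\<bar> \<le>
   ennreal (R * 2 ^ DIM('a)) * dyad_pot R (\<lambda>y. ennreal (norm (G y))) x"
proof -
 let ?c = "ennreal (R * 2 ^ DIM('a))"
 let ?t = "\<lambda>j. ennreal ((1/2) ^ j) * dyad_avg R (\<lambda>y. ennreal (norm (G y))) j x"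
 have part: "ennreal \<bar>mol e kp u x 1 - mol e kp u x ((1/2) ^ k)\<bar> \<le> ?c * (\<Sum>j<k. ?t j)" for k
 proof (induction k)
  case (Suc k)
  have "ennreal \<bar>mol e kp u x 1 - mol e kp u x ((1/2) ^ Suc k)\<bar> \<le>
    ennreal \<bar>mol e kp u x 1 - mol e kp u x ((1/2) ^ k)\<bar> +
    ennreal \<bar>mol e kp u x ((1/2) ^ k) - mol e kp u x ((1/2) ^ Suc k)\<bar>"
  proof -
   have "\<bar>a - c\<bar> \<le> \<bar>a - b\<bar> + \<bar>b - c\<bar>" for a b c :: real by simp
   from ennreal_leI[OF this] show ?thesis by (simp only: ennreal_plus abs_ge_zero)
  qed
  also have "\<dots> \<le> ?c * (\<Sum>j<k. ?t j) + ?c * ?t k"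
   using Suc mol_telescope[OF w kp sub] by (intro add_mono) (auto simp: R_def)
  finally show ?case by (simp add: distrib_left)
 qed simp
 have le: "ennreal \<bar>mol e kp u x 1 - mol e kp u x ((1/2) ^ r i)\<bar> \<le> ?c * dyad_pot R (\<lambda>y. ennreal (norm (G y))) x" for i
  unfolding dyad_pot_def
  by (rule order_trans[OF part]) (intro mult_left_mono sum_le_suminf, auto)
 have tl: "(\<lambda>i. ennreal \<bar>mol e kp u x 1 - mol e kp u x ((1/2) ^ r i)\<bar>) \<leadsto> ennreal \<bar>mol e kp u x 1 - L\<bar>"
  by (intro tendsto_intros lim)
 show ?thesis by (rule LIMSEQ_le_const2[OF tl]) (use le in blast)
qed

lemma mol_L1_seq:
 fixes u :: "'a::euclidean_space => real" and e :: 'a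
 assumes u: "integrable lborel u" and k: "k > 0"
 defines "d \<equiv> \<lambda>n x. mol e k u x ((1/2) ^ n) - kmass e k * u x"
 shows "\<exists>N. \<forall>n\<ge>N. integrable lborel (d n)" "(\<lambda>n. LINT x|lborel. \<bar>d n x\<bar>) \<leadsto> 0"
proof -
 have [measurable]: "u \<in> borel_measurable borel" using u by auto
 have dm[measurable]: "d n \<in> borel_measurable borel" for n unfolding d_def by measurable
 have conv: "\<exists>N. \<forall>n\<ge>N. (\<integral>\<^sup>+x. ennreal \<bar>d n x\<bar> \<partial>lborel) \<le> ennreal ep" if eps: "ep > 0" for ep
 proof -
  obtain dl where dl: "dl > 0" "\<forall>s\<in>{0<..<dl}. (\<integral>\<^sup>+x. ennreal \<bar>mol e k u x s - kmass e k * u x\<bar> \<partial>lborel) \<le> ennreal ep"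
   using mol_L1_converges[OF u k eps, of e] by blast
  obtain N where N: "(1/2) ^ N < dl" using real_arch_pow_inv[of dl "1/2"] dl by auto
  have "(1/2) ^ n \<in> {0<..<dl}" if "n \<ge> N" for n
  proof -
   have "(1/2::real) ^ n \<le> (1/2) ^ N" using that by (rule power_decreasing) auto
   with N have "(1/2) ^ n < dl" by linarith
   then show ?thesis by simp
  qed
  then show ?thesis using dl(2) unfolding d_def by blast
 qed
 obtain N where N: "\<And>n. n \<ge> N ==> (\<integral>\<^sup>+x. ennreal \<bar>d n x\<bar> \<partial>lborel) \<le> ennreal 1"
  using conv[of 1] by auto
 have int: "integrable lborel (d n)" if "n \<ge> N" for n
 proof (rule integrableI_bounded)
  have "(\<integral>\<^sup>+x. ennreal (norm (d n x)) \<partial>lborel) \<le> ennreal 1" using N[OF that] by simp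
  then show "(\<integral>\<^sup>+x. ennreal (norm (d n x)) \<partial>lborel) < \<infinity>" by (rule le_less_trans) simp
 qed simp
 then show "\<exists>N. \<forall>n\<ge>N. integrable lborel (d n)" by blast
 show "(\<lambda>n. LINT x|lborel. \<bar>d n x\<bar>) \<leadsto> 0"
 proof (rule LIMSEQ_I)
  fix ep :: real assume "ep > 0"
  then obtain M where M: "\<And>n. n \<ge> M ==> (\<integral>\<^sup>+x. ennreal \<bar>d n x\<bar> \<partial>lborel) \<le> ennreal (ep / 2)"
   using conv[of "ep / 2"] by auto
  have "norm ((LINT x|lborel. \<bar>d n x\<bar>) - 0) < ep" if "n \<ge> M" for n
  proof -
   have "enn2real (\<integral>\<^sup>+x. ennreal \<bar>d n x\<bar> \<partial>lborel) \<le> ep / 2" using M[OF that] \<open>ep > 0\<close> by (intro enn2real_leI) auto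
   then show ?thesis using \<open>ep > 0\<close> by (simp add: integral_eq_nn_integral)
  qed
  then show "\<exists>M. \<forall>n\<ge>M. norm ((LINT x|lborel. \<bar>d n x\<bar>) - 0) < ep" by blast
 qed
qed

lemma mol_AE_converges:
 fixes u :: "'a::euclidean_space => real"
 assumes u: "integrable lborel u" and k: "k > 0"
 shows "\<exists>r::nat => nat. strict_mono r \<and> (AE x in lborel. (\<lambda>i. mol e k u x ((1/2) ^ r i)) \<leadsto> kmass e k * u x)"
proof -
 define d where "d = (\<lambda>n x. mol e k u x ((1/2) ^ n) - kmass e k * u x)"
 obtain N where N: "\<And>n. n \<ge> N ==> integrable lborel (d n)"
  using mol_L1_seq(1)[OF u k, of e] unfolding d_def by blast
 have l: "(\<lambda>n. LINT x|lborel. \<bar>d n x\<bar>) \<leadsto> 0"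
  unfolding d_def by (rule mol_L1_seq(2)[OF u k])
 then have "(\<lambda>n. LINT x|lborel. norm (d (n + N) x)) \<leadsto> 0"
  using LIMSEQ_ignore_initial_segment[OF l, of N] by simp
 then obtain r where r: "strict_mono (r::nat => nat)" "AE x in lborel. (\<lambda>n. d (r n + N) x) \<leadsto> 0"
  using tendsto_L1_AE_subseq[of lborel "\<lambda>n. d (n + N)"] N by auto
 have "AE x in lborel. (\<lambda>i. mol e k u x ((1/2) ^ (r i + N))) \<leadsto> kmass e k * u x"
  using r(2) by eventually_elim (simp add: d_def LIM_zero_iff)
 moreover have "strict_mono (\<lambda>i. r i + N)" using r(1) by (auto simp: strict_mono_def)
 ultimately show ?thesis by (intro exI[of _ "\<lambda>i. r i + N"]) auto
qed

text \<open>The vertex x may lie on the boundary although u is extended by 0 outside \<Omega>: the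
  kernels see only the cone inside \<Omega>, so a limit c from within \<Omega> is enough.\<close>

lemma mol_converges_at:
 fixes u :: "'a::euclidean_space => real"
 assumes u: "integrable lborel u" and k: "k > 0"
  and sub: "\<And>s. 0 < s ==> s \<le> 1 ==> cball (x + s *\<^sub>R e) (s * k) \<subseteq> \<Omega>"
  and cont: "\<And>ep. ep > 0 ==> \<exists>d>0. \<forall>y\<in>\<Omega>. dist y x < d --> \<bar>u y - c\<bar> < ep"
 shows "(\<lambda>i. mol e k u x ((1/2) ^ i)) \<leadsto> kmass e k * c"
proof (rule LIMSEQ_I)
 fix ep :: real assume ep: "ep > 0"
 define m where "m = kmass e k"
 have m: "m > 0" using kmass_pos[OF k] by (simp add: m_def)
 obtain d where d: "d > 0" "\<And>y. y \<in> \<Omega> ==> dist y x < d ==> \<bar>u y - c\<bar> < ep / (2 * m)"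
  using cont[of "ep / (2 * m)"] ep m by auto
 define R where "R = norm e + k"
 have R: "R > 0" using k by (simp add: R_def add_nonneg_pos)
 obtain N where N: "(1/2) ^ N < d / R" using real_arch_pow_inv[of "d / R" "1/2"] d R by auto
 have "norm (mol e k u x ((1/2) ^ n) - m * c) < ep" if "n \<ge> N" for n
 proof -
  define s :: real where "s = (1/2) ^ n"
  have "s \<le> (1/2) ^ N" unfolding s_def using that by (intro power_decreasing) auto
  then have "s < d / R" using N by simp
  then have s: "s > 0" "s \<le> 1" "s * R < d"
   using pos_less_divide_eq[OF R, of s d] by (auto simp: s_def power_le_one)
  have e: "mol e k u x s - m * c = (LINT y|lborel. (u y - c) * ker e k x s y)"
   unfolding m_def by (rule mol_minus_const(2)[OF u k s(1)])
  have le: "norm (LINT y|lborel. (u y - c) * ker e k x s y) \<le> (LINT y|lborel. ep / (2 * m) * ker e k x s y)"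
  proof (rule Bochner_Integration.integral_norm_bound_integral)
   show "integrable lborel (\<lambda>y. (u y - c) * ker e k x s y)" by (rule mol_minus_const(1)[OF u k s(1)])
   show "integrable lborel (\<lambda>y. ep / (2 * m) * ker e k x s y)"
    using integral_ker(1)[OF k s(1), of e x] by simp
   fix y
   show "norm ((u y - c) * ker e k x s y) \<le> ep / (2 * m) * ker e k x s y"
   proof (cases "y \<in> ball (x + s *\<^sub>R e) (s * k)")
    case True
    have "dist y x < d" using ker_ball_subset[OF s(1) True] s by (simp add: dist_norm R_def)
    moreover have "y \<in> \<Omega>" using True sub[of s] s ball_subset_cball by blast
    ultimately have "\<bar>u y - c\<bar> \<le> ep / (2 * m)" using d(2) by force
    then have "\<bar>u y - c\<bar> * ker e k x s y \<le> ep / (2 * m) * ker e k x s y"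
     by (rule mult_right_mono) (rule ker_nonneg[OF s(1)])
    then show ?thesis using ker_nonneg[OF s(1), of e k x y] by (simp add: abs_mult)
   next
    case False
    then show ?thesis using ker_eq_0[OF k s(1) False] by simp
   qed
  qed
  have "(LINT y|lborel. ep / (2 * m) * ker e k x s y) = ep / 2"
   using integral_ker[OF k s(1), of e x] m by (simp add: m_def)
  then show ?thesis unfolding s_def[symmetric] e using le ep by linarith
 qed
 then show "\<exists>N. \<forall>n\<ge>N. norm (mol e k u x ((1/2) ^ n) - kmass e k * c) < ep"
  by (auto simp: m_def)
qed

section \<open>Hausdorff measure\<close>

lemma hausdorff_outer_mono: "A \<subseteq> B ==> hausdorff_outer m A \<le> hausdorff_outer m B"
 unfolding hausdorff_outer_def by (auto intro!: SUP_mono' hausdorff_content_mono)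

lemma hausdorff_outer_countably_subadditive:
 "hausdorff_outer m (\<Union>i. A i) \<le> (\<Sum>i::nat. hausdorff_outer m (A i))"
proof -
 have "hausdorff_content m d (\<Union>i. A i) \<le> (\<Sum>i. hausdorff_outer m (A i))" if "d > 0" for d
  using hausdorff_content_countably_subadditive
 proof (rule order_trans)
  show "(\<Sum>i. hausdorff_content m d (A i)) \<le> (\<Sum>i. hausdorff_outer m (A i))"
   using that by (intro suminf_le) (auto simp: hausdorff_outer_def intro!: SUP_upper)
 qed
 then show ?thesis
  by (subst hausdorff_outer_def) (auto intro!: SUP_least)
qed

lemma hausdorff_outer_empty: "hausdorff_outer m {} = 0"
 using outer_measure_space_hausdorff[of m] unfolding outer_measure_space_def positive_def by blast

lemma hausdorff_outer_Un: "hausdorff_outer m (A \<union> B) \<le> hausdorff_outer m A + hausdorff_outer m B"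
proof -
 have "hausdorff_outer m (\<Union>i. if i = 0 then A else if i = Suc 0 then B else {}) \<le>
   (\<Sum>i. hausdorff_outer m (if i = 0 then A else if i = Suc 0 then B else {}))"
  by (rule hausdorff_outer_countably_subadditive)
 also have "(\<Union>i::nat. if i = 0 then A else if i = Suc 0 then B else {}) = A \<union> B"
  by (auto split: if_splits intro: exI[of _ 0] exI[of _ "Suc 0"])
 also have "(\<Sum>i::nat. hausdorff_outer m (if i = 0 then A else if i = Suc 0 then B else {})) =
   (\<Sum>i\<in>{0, Suc 0}. hausdorff_outer m (if i = 0 then A else if i = Suc 0 then B else {}))"
  by (rule suminf_finite) (auto simp: hausdorff_outer_empty)
 also have "\<dots> = hausdorff_outer m A + hausdorff_outer m B" by simp
 finally show ?thesis .
qed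

lemma hausdorff_content_antimono:
 "d \<le> d' ==> hausdorff_content m d' A \<le> hausdorff_content m d A"
 unfolding hausdorff_content_def hausdorff_covers_def by (rule INF_superset_mono) (auto intro: order_trans)

text \<open>A covering set of diameter at most dl cannot meet both A and B, so a cover of the union
  sorts into a cover of A and one of B; sets of the other kind are replaced by the empty set, which
  costs nothing.\<close>

lemma hausdorff_content_separated:
 assumes sep: "\<And>x y. x \<in> A ==> y \<in> B ==> d < dist x y" and "dl \<le> d"
 shows "hausdorff_content m dl A + hausdorff_content m dl B \<le> hausdorff_content m dl (A \<union> B)"
proof (subst (3) hausdorff_content_def, rule INF_greatest)
 fix C assume C: "C \<in> hausdorff_covers dl (A \<union> B)"
 define CA where "CA = (\<lambda>i. if C i \<inter> A = {} then {} else C i)"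
 define CB where "CB = (\<lambda>i. if C i \<inter> B = {} then {} else C i)"
 have d0: "dl \<ge> 0" using C diameter_ge_0[of "C 0"] by (auto simp: hausdorff_covers_def intro: order_trans)
 have bd: "bounded (C i)" "diameter (C i) \<le> dl" for i using C by (auto simp: hausdorff_covers_def)
 have "CA \<in> hausdorff_covers dl A"
  using C d0 by (auto simp: hausdorff_covers_def CA_def diameter_def[of "{}"] split: if_splits) fastforce
 moreover have "CB \<in> hausdorff_covers dl B"
  using C d0 by (auto simp: hausdorff_covers_def CB_def diameter_def[of "{}"] split: if_splits) fastforce
 ultimately have "hausdorff_content m dl A + hausdorff_content m dl B \<le>
   (\<Sum>i. hausdorff_weight m (CA i)) + (\<Sum>i. hausdorff_weight m (CB i))"
  unfolding hausdorff_content_def by (intro add_mono INF_lower)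
 also have "\<dots> = (\<Sum>i. hausdorff_weight m (CA i) + hausdorff_weight m (CB i))"
  by (rule suminf_add) auto
 also have "\<dots> \<le> (\<Sum>i. hausdorff_weight m (C i))"
 proof (intro suminf_le)
  fix i
  have "C i \<inter> A = {} \<or> C i \<inter> B = {}"
  proof (rule ccontr)
   assume "\<not> ?thesis"
   then obtain x y where xy: "x \<in> C i" "x \<in> A" "y \<in> C i" "y \<in> B" by auto
   then have "dist x y \<le> dl" using diameter_bounded_bound[OF bd(1)[of i], of x y] bd(2)[of i] by simp
   then show False using sep[OF xy(2,4)] \<open>dl \<le> d\<close> by simp
  qed
  then show "hausdorff_weight m (CA i) + hausdorff_weight m (CB i) \<le> hausdorff_weight m (C i)"
   by (auto simp: CA_def CB_def hausdorff_weight_def)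
 qed auto
 finally show "hausdorff_content m dl A + hausdorff_content m dl B \<le> (\<Sum>i. hausdorff_weight m (C i))" .
qed

text \<open>The Hausdorff outer measure is a metric outer measure, as covers may be taken finer than
  the gap. This is what Caratheodory's criterion asks for.\<close>

lemma hausdorff_outer_separated:
 assumes sep: "\<And>x y. x \<in> A ==> y \<in> B ==> d < dist x y" and d: "d > 0"
 shows "hausdorff_outer m A + hausdorff_outer m B \<le> hausdorff_outer m (A \<union> B)"
proof -
 have le: "hausdorff_content m dl A + hausdorff_content m dl' B \<le> hausdorff_outer m (A \<union> B)"
  if "dl > 0" "dl' > 0" for dl dl'
 proof -
  define h where "h = min d (min dl dl')"
  have "hausdorff_content m dl A + hausdorff_content m dl' B \<le> hausdorff_content m h A + hausdorff_content m h B"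
   by (intro add_mono hausdorff_content_antimono) (auto simp: h_def)
  also have "\<dots> \<le> hausdorff_content m h (A \<union> B)"
   by (rule hausdorff_content_separated[OF sep]) (auto simp: h_def)
  also have "\<dots> \<le> hausdorff_outer m (A \<union> B)"
   unfolding hausdorff_outer_def using that d by (intro SUP_upper) (auto simp: h_def)
  finally show ?thesis .
 qed
 have "hausdorff_content m dl A + hausdorff_outer m B \<le> hausdorff_outer m (A \<union> B)" if "dl > 0" for dl
  unfolding hausdorff_outer_def[of m B]
  by (subst ennreal_SUP_add_right) (auto intro!: SUP_least le that)
 then show ?thesis
  unfolding hausdorff_outer_def[of m A]
  by (subst ennreal_SUP_add_left[symmetric]) (auto intro!: SUP_least)
qed

text \<open>Caratheodory's criterion. The shells \<open>R k\<close> of points whose distance to the closed set lies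
 between \<open>1/(k+2)\<close> and \<open>1/(k+1)\<close> have summable outer measure, since those of equal parity are
 separated.\<close>

lemma closed_in_hausdorff:
 fixes F :: "'a::metric_space set"
 assumes F: "closed F"
 shows "F \<in> lambda_system UNIV UNIV (hausdorff_outer m)"
proof (cases "F = {}")
 case True
 then show ?thesis by (simp add: lambda_system_def hausdorff_outer_empty)
next
 case False
 let ?\<mu> = "hausdorff_outer m"
 have "?\<mu> (F \<inter> T) + ?\<mu> ((UNIV - F) \<inter> T) \<le> ?\<mu> T" for T
 proof (cases "?\<mu> T = \<infinity>")
  case True
  then show ?thesis by simp
 next
  case fin: False
  define Tn where "Tn = (\<lambda>n::nat. {x \<in> T. infdist x F > 1 / (real n + 1)})"
  define R where "R = (\<lambda>n. Tn (Suc n) - Tn n)"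
  have incr: "Tn i \<subseteq> Tn j" if "i \<le> j" for i j
  proof -
   have "1 / (real j + 1) \<le> 1 / (real i + 1)" using that by (intro divide_left_mono) auto
   then show ?thesis by (auto simp: Tn_def)
  qed
  have gap: "\<exists>d>0. \<forall>x y. x \<in> Tn i \<and> y \<in> - Tn (Suc i) \<inter> T --> d < dist x y" for i
  proof -
   define d where "d = (1 / (real i + 1) - 1 / (real i + 2)) / 2"
   have "1 / (real i + 2) < 1 / (real i + 1)" by (intro divide_strict_left_mono) auto
   then have d: "d > 0" by (simp add: d_def)
   have "d < dist x y" if "x \<in> Tn i" "y \<in> - Tn (Suc i) \<inter> T" for x y
   proof -
    have "infdist y F \<le> 1 / (real i + 2)" using that by (auto simp: Tn_def add.commute)
    moreover have "infdist x F > 1 / (real i + 1)" using that by (auto simp: Tn_def)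
    moreover have "infdist x F \<le> infdist y F + dist x y" by (rule infdist_triangle)
    ultimately show ?thesis using d by (simp add: d_def)
   qed
   then show ?thesis using d by blast
  qed
  have sepF: "?\<mu> (F \<inter> T) + ?\<mu> (Tn n) \<le> ?\<mu> T" for n
  proof -
   have "?\<mu> (Tn n) + ?\<mu> (F \<inter> T) \<le> ?\<mu> (Tn n \<union> F \<inter> T)"
   proof (rule hausdorff_outer_separated)
    fix x y assume "x \<in> Tn n" "y \<in> F \<inter> T"
    then show "1 / (real n + 1) < dist x y"
     using infdist_le[of y F x] by (auto simp: Tn_def)
   qed simp
   also have "\<dots> \<le> ?\<mu> T" by (rule hausdorff_outer_mono) (auto simp: Tn_def)
   finally show ?thesis by (simp add: add.commute)
  qed
  have par: "(\<Sum>k<n. ?\<mu> (R (2 * k + p + 1))) \<le> ?\<mu> (Tn (2 * n + p))" for n p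
  proof (induction n)
   case (Suc n)
   obtain d where d: "d > 0" "\<And>x y. x \<in> Tn (2 * n + p) ==> y \<in> - Tn (Suc (2 * n + p)) \<inter> T ==> d < dist x y"
    using gap[of "2 * n + p"] by blast
   have "(\<Sum>k<Suc n. ?\<mu> (R (2 * k + p + 1))) \<le> ?\<mu> (Tn (2 * n + p)) + ?\<mu> (R (2 * n + p + 1))"
    using Suc by (simp add: add_right_mono)
   also have "\<dots> \<le> ?\<mu> (Tn (2 * n + p) \<union> R (2 * n + p + 1))"
   proof (rule hausdorff_outer_separated)
    fix x y assume x: "x \<in> Tn (2 * n + p)" and y: "y \<in> R (2 * n + p + 1)"
    then have "y \<in> - Tn (Suc (2 * n + p)) \<inter> T" by (auto simp: R_def Tn_def)
    with x show "d < dist x y" by (rule d(2))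
   qed (rule d(1))
   also have "\<dots> \<le> ?\<mu> (Tn (2 * Suc n + p))"
    using incr[of "2 * n + p" "2 * Suc n + p"] by (intro hausdorff_outer_mono) (auto simp: R_def)
   finally show ?case .
  qed (simp add: hausdorff_outer_empty)
  have TnT: "?\<mu> (Tn n) \<le> ?\<mu> T" for n by (rule hausdorff_outer_mono) (auto simp: Tn_def)
  have dbl: "(\<Sum>k<2 * n. ?\<mu> (R (k + 1))) = (\<Sum>k<n. ?\<mu> (R (2 * k + 0 + 1))) + (\<Sum>k<n. ?\<mu> (R (2 * k + 1 + 1)))" for n
   by (induction n) (auto simp: add_ac)
  have "(\<Sum>k. ?\<mu> (R (k + 1))) \<le> ?\<mu> T + ?\<mu> T"
  proof (rule suminf_le_const)
   fix n
   have "(\<Sum>k<n. ?\<mu> (R (k + 1))) \<le> (\<Sum>k<2 * n. ?\<mu> (R (k + 1)))" by (rule sum_mono2) auto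
   also have "\<dots> \<le> ?\<mu> T + ?\<mu> T" unfolding dbl by (intro add_mono order_trans[OF par TnT])
   finally show "(\<Sum>k<n. ?\<mu> (R (k + 1))) \<le> ?\<mu> T + ?\<mu> T" .
  qed (rule summableI)
  also have "\<dots> < top" using fin by (simp add: less_top)
  finally have sfin: "(\<Sum>k. ?\<mu> (R (k + 1))) \<noteq> top" by simp
  define r where "r = (\<lambda>k. enn2real (?\<mu> (R (k + 1))))"
  have r: "?\<mu> (R (k + 1)) = ennreal (r k)" "r k \<ge> 0" for k
   using ennreal_suminf_lessD[of "\<lambda>k. ?\<mu> (R (k + 1))" top k] sfin by (auto simp: r_def less_top)
  have rs: "summable r" using sfin r by (intro summable_suminf_not_top) auto
  have "?\<mu> (F \<inter> T) + ?\<mu> ((UNIV - F) \<inter> T) \<le> ?\<mu> T + ennreal e" if e: "e > 0" for e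
  proof -
   obtain N where N: "norm (\<Sum>i. r (i + N)) < e" using suminf_exist_split[OF e rs] by auto
   have cov: "(UNIV - F) \<inter> T \<subseteq> Tn (N + 1) \<union> (\<Union>k. R (k + N + 1))"
   proof
    fix x assume x: "x \<in> (UNIV - F) \<inter> T"
    then have "infdist x F > 0"
     using F False infdist_pos_not_in_closed[of F x] by auto
    then obtain n where "inverse (real (Suc n)) < infdist x F" using reals_Archimedean by blast
    then have n: "x \<in> Tn n" using x by (auto simp: Tn_def inverse_eq_divide add.commute)
    show "x \<in> Tn (N + 1) \<union> (\<Union>k. R (k + N + 1))"
    proof (cases "x \<in> Tn (N + 1)")
     case notin: False
     define j where "j = (LEAST j. x \<in> Tn j)"
     have j: "x \<in> Tn j" unfolding j_def using n by (rule LeastI)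
     have "\<not> j \<le> N + 1" using incr[of j "N + 1"] j notin by auto
     then obtain i where i: "j = Suc (i + N + 1)" by (metis add.commute add.left_commute less_imp_Suc_add not_le)
     have "x \<notin> Tn (i + N + 1)" using not_less_Least[of "i + N + 1" "\<lambda>j. x \<in> Tn j"] i by (auto simp: j_def[symmetric])
     then have "x \<in> R (i + N + 1)" using j i by (auto simp: R_def)
     then show ?thesis by blast
    qed simp
   qed
   have "?\<mu> ((UNIV - F) \<inter> T) \<le> ?\<mu> (Tn (N + 1)) + ?\<mu> (\<Union>k. R (k + N + 1))"
    using hausdorff_outer_mono[OF cov] hausdorff_outer_Un order_trans by blast
   also have "\<dots> \<le> ?\<mu> (Tn (N + 1)) + (\<Sum>k. ?\<mu> (R (k + N + 1)))"
    by (intro add_left_mono hausdorff_outer_countably_subadditive)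
   also have "(\<Sum>k. ?\<mu> (R (k + N + 1))) = ennreal (\<Sum>i. r (i + N))"
    unfolding r(1) using r(2) rs by (intro suminf_ennreal2) (auto simp: summable_iff_shift)
   also have "\<dots> \<le> ennreal e" using N by (intro ennreal_leI) simp
   finally have "?\<mu> (F \<inter> T) + ?\<mu> ((UNIV - F) \<inter> T) \<le> ?\<mu> (F \<inter> T) + (?\<mu> (Tn (N + 1)) + ennreal e)"
    by (simp add: add_left_mono)
   also have "\<dots> \<le> ?\<mu> T + ennreal e"
    using sepF[of "N + 1"] by (simp add: add.assoc[symmetric] add_right_mono)
   finally show ?thesis .
  qed
  note eps = this
  show ?thesis by (rule ennreal_le_epsilon) (rule eps)
 qed
 moreover have "?\<mu> T \<le> ?\<mu> (F \<inter> T) + ?\<mu> ((UNIV - F) \<inter> T)" for T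
 proof -
  have "(F \<inter> T) \<union> ((UNIV - F) \<inter> T) = T" by auto
  then show ?thesis using hausdorff_outer_Un[of m "F \<inter> T" "(UNIV - F) \<inter> T"] by (simp only:)
 qed
 ultimately show ?thesis
  by (auto simp: lambda_system_def intro: antisym)
qed

lemma borel_subset_hausdorff: "sets (borel :: 'a::metric_space measure) \<subseteq> sets (hausdorff_measure m)"
proof -
 have sp: "space (hausdorff_measure m :: 'a measure) = UNIV"
  using lambda_system_sets by (simp add: hausdorff_measure_def space_measure_of_conv)
 have "sigma_sets UNIV (Collect closed) \<subseteq> sets (hausdorff_measure m :: 'a measure)"
  using closed_in_hausdorff[where m = m] sp sets.sigma_sets_subset[of "Collect closed" "hausdorff_measure m :: 'a measure"]
  by (auto simp: sets_hausdorff_measure)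
 then show ?thesis by (simp add: borel_eq_closed)
qed

lemma space_hausdorff_measure: "space (hausdorff_measure m) = UNIV"
 by (simp add: hausdorff_measure_def space_measure_of_conv)

lemma measurable_ident_hausdorff: "(\<lambda>x. x) \<in> measurable (hausdorff_measure m) borel"
 using borel_subset_hausdorff by (auto simp: measurable_def space_hausdorff_measure)

subsection \<open>Upper Ahlfors regularity\<close>

text \<open>If \<open>S\<close> avoids the cones with vertex in \<open>S\<close>, then \<open>d\<close>-separated points of \<open>S\<close> can be shifted by
 multiples of \<open>d e\<close> without destroying the separation; comparing volumes bounds their number.\<close>

lemma separated_card_bound:
 fixes P :: "'a::euclidean_space set"
 assumes cone: "\<And>x x' t. x \<in> S ==> x' \<in> S ==> 0 < t ==> t \<le> 1 ==> x' \<notin> ball (x + t *\<^sub>R e) (t * kp)"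
  and kp: "kp > 0" and d: "0 < d" "d \<le> r" "r \<le> 1"
  and P: "finite P" "P \<subseteq> S" "P \<subseteq> ball y r" and sep: "\<And>p p'. p \<in> P ==> p' \<in> P ==> p \<noteq> p' ==> d \<le> dist p p'"
 shows "real (card P) \<le> 2 * (2 * (2 + norm e) / min kp 1) ^ DIM('a) * (r / d) ^ (DIM('a) - 1)"
proof -
 define c where "c = min kp 1"
 have c: "0 < c" "c \<le> 1" "c \<le> kp" using kp by (auto simp: c_def)
 \<comment> \<open>The number of shifts. J d \<le> r keeps all shifted points in a ball of radius
   comparable with r, while J \<ge> r / (2 d) copies of each point lower the volume count (r/d)^n
   for P to (r/d)^(n-1).\<close>
 define J where "J = nat \<lfloor>r / d\<rfloor>"
 have rd: "r / d \<ge> 1" using d by simp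
 have J: "real J \<le> r / d" "r / d \<le> 2 * real J" "J \<ge> 1"
 proof -
  define k where "k = \<lfloor>r / d\<rfloor>"
  have "k \<ge> 1" using rd by (simp add: k_def le_floor_iff)
  moreover have "r / d < of_int k + 1" "of_int k \<le> r / d" unfolding k_def by linarith+
  ultimately show "real J \<le> r / d" "r / d \<le> 2 * real J" "J \<ge> 1"
   unfolding J_def k_def[symmetric] by auto
 qed
 define q where "q = (\<lambda>(p, j::nat). p + (real j * d) *\<^sub>R e)"
 define I where "I = P \<times> {..<J}"
 have fI: "finite I" using P by (simp add: I_def)
 \<comment> \<open>For different shifts the distance is that of p + t e to p' with t a multiple of
   d, and the cone with vertex p keeps p' away by t kp. Equal shifts inherit the separation of
   P.\<close>
 have step: "c * d \<le> dist (q (p, j)) (q (p', j'))"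
  if "p \<in> P" "p' \<in> P" "j' < j" "j < J" for p p' j j'
 proof -
  define t where "t = real (j - j') * d"
  have "real (j - j') \<le> real J" using that by simp
  then have "t \<le> real J * d" unfolding t_def using d by (intro mult_right_mono) auto
  also have "\<dots> \<le> r" using J(1) d by (simp add: field_simps)
  finally have t1: "t \<le> 1" using d by simp
  have "1 * d \<le> t" unfolding t_def using that d by (intro mult_right_mono) auto
  then have t: "d \<le> t" "0 < t" using d by auto
  have "p' \<notin> ball (p + t *\<^sub>R e) (t * kp)" using cone t t1 P that by blast
  then have "t * kp \<le> dist (p + t *\<^sub>R e) p'" by simp
  also have "dist (p + t *\<^sub>R e) p' = dist (q (p, j)) (q (p', j'))"
   using that by (simp add: q_def t_def dist_norm of_nat_diff algebra_simps)
  finally have "t * kp \<le> dist (q (p, j)) (q (p', j'))" .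
  moreover have "c * d \<le> t * kp" using mult_mono[of c kp d t] c t d by (simp add: mult.commute)
  ultimately show ?thesis by simp
 qed
 have qsep: "c * d \<le> dist (q i) (q i')" if "i \<in> I" "i' \<in> I" "i \<noteq> i'" for i i'
 proof -
  obtain p j p' j' where i: "i = (p, j)" "i' = (p', j')" by (cases i, cases i')
  consider "j' < j" | "j < j'" | "j = j'" by linarith
  then show ?thesis
  proof cases
   case 1
   then show ?thesis using step[of p p' j' j] that by (simp add: i I_def)
  next
   case 2
   then show ?thesis using step[of p' p j j'] that by (simp add: i I_def dist_commute)
  next
   case 3
   then have "d \<le> dist p p'" using sep[of p p'] that by (auto simp: i I_def)
   moreover have "dist (q i) (q i') = dist p p'" using 3 by (simp add: i q_def dist_norm)
   moreover have "c * d \<le> d" using c d by (simp add: mult_left_le_one_le)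
   ultimately show ?thesis by simp
  qed
 qed
 define v where "v = unit_ball_vol (real DIM('a))"
 have v: "v > 0" by (simp add: v_def)
 let ?rh = "c * d / 2" and ?B = "ball y (r * (2 + norm e))"
 have rh: "?rh > 0" using c d by simp
 have sub: "(\<Union>i\<in>I. ball (q i) ?rh) \<subseteq> ?B"
 proof safe
  fix p j z assume pj: "(p, j) \<in> I" and z: "z \<in> ball (q (p, j)) ?rh"
  have "real j * d \<le> real J * d" using pj d by (intro mult_right_mono) (auto simp: I_def)
  also have "\<dots> \<le> r" using J(1) d by (simp add: field_simps)
  finally have jd: "real j * d * norm e \<le> r * norm e" by (rule mult_right_mono) simp
  have "dist y z \<le> dist y p + dist p (q (p, j)) + dist (q (p, j)) z"
   using dist_triangle[of y z p] dist_triangle[of p z "q (p, j)"] by simp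
  also have "dist p (q (p, j)) = real j * d * norm e" using d by (simp add: q_def dist_norm)
  also have "dist y p + real j * d * norm e + dist (q (p, j)) z < r + r * norm e + r"
  proof -
   have "c * d \<le> d" using c d by (simp add: mult_left_le_one_le)
   then have "?rh \<le> r" using d by linarith
   moreover have "dist y p < r" using pj P by (auto simp: I_def)
   ultimately show ?thesis using jd z by simp
  qed
  finally show "z \<in> ?B" by (simp add: algebra_simps)
 qed
 have "real (card I) * (v * ?rh ^ DIM('a)) \<le> v * (r * (2 + norm e)) ^ DIM('a)"
 proof -
  have disj: "disjoint_family_on (\<lambda>i. ball (q i) ?rh) I"
   unfolding disjoint_family_on_def
  proof (intro ballI impI)
   fix i i' assume ii: "i \<in> I" "i' \<in> I" "i \<noteq> i'"
   show "ball (q i) ?rh \<inter> ball (q i') ?rh = {}"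
   proof (rule ccontr)
    assume "\<not> ?thesis"
    then obtain z where "dist (q i) z < ?rh" "dist (q i') z < ?rh" by auto
    then have "dist (q i) (q i') < c * d"
     using dist_triangle[of "q i" "q i'" z] by (simp add: dist_commute)
    then show False using qsep[OF ii] by simp
   qed
  qed
  have "(\<Sum>i\<in>I. emeasure lborel (ball (q i) ?rh)) = emeasure lborel (\<Union>i\<in>I. ball (q i) ?rh)"
   by (rule sum_emeasure) (use disj fI in auto)
  also have "\<dots> \<le> emeasure lborel ?B" by (rule emeasure_mono[OF sub]) simp
  finally have "(\<Sum>i\<in>I. ennreal (v * ?rh ^ DIM('a))) \<le> ennreal (v * (r * (2 + norm e)) ^ DIM('a))"
   using rh d by (simp add: emeasure_ball v_def)
  also have "(\<Sum>i\<in>I. ennreal (v * ?rh ^ DIM('a))) = ennreal (real (card I) * (v * ?rh ^ DIM('a)))"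
   using v rh by (subst sum_ennreal) auto
  finally show ?thesis using v d by (simp add: ennreal_le_iff)
 qed
 then have "real (card P) * real J * ?rh ^ DIM('a) \<le> (r * (2 + norm e)) ^ DIM('a)"
  using v by (simp add: I_def card_cartesian_product mult_ac)
 then have "real (card P) * real J \<le> (r * (2 + norm e)) ^ DIM('a) / ?rh ^ DIM('a)"
  using rh by (simp add: pos_le_divide_eq)
 also have "\<dots> = ((r / d) * (2 * (2 + norm e) / c)) ^ DIM('a)"
  by (simp add: power_divide[symmetric] mult_ac)
 also have "\<dots> = (2 * (2 + norm e) / c) ^ DIM('a) * (r / d) ^ (DIM('a) - 1) * (r / d)"
 proof -
  obtain m where m: "DIM('a) = Suc m" using DIM_positive[where 'a = 'a] by (metis Suc_pred)
  have "(x * y) ^ Suc m = y ^ Suc m * x ^ m * x" for x y :: real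
   by (simp add: power_mult_distrib mult_ac)
  then show ?thesis by (simp only: m diff_Suc_1)
 qed
 finally have "real (card P) * real J \<le> (2 * (2 + norm e) / c) ^ DIM('a) * (r / d) ^ (DIM('a) - 1) * (r / d)" .
 also have "\<dots> \<le> (2 * (2 + norm e) / c) ^ DIM('a) * (r / d) ^ (DIM('a) - 1) * (2 * real J)"
  using J(2) rd c by (intro mult_left_mono) auto
 finally have "real (card P) * real J \<le> (2 * (2 * (2 + norm e) / c) ^ DIM('a) * (r / d) ^ (DIM('a) - 1)) * real J"
  by (simp add: mult_ac)
 then show ?thesis using J(3) by (simp add: c_def)
qed

text \<open>A d-separated subset of largest cardinality exists because
  \<open>separated_card_bound\<close> limits all of them, and it is a d-net. The balls of radius d
  about it weigh a multiple of d^(n-1) each, which cancels the power of d in their number.\<close>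

lemma hausdorff_ball_bound:
 fixes S :: "'a::euclidean_space set"
 assumes cone: "\<And>x x' t. x \<in> S ==> x' \<in> S ==> 0 < t ==> t \<le> 1 ==> x' \<notin> ball (x + t *\<^sub>R e) (t * k)"
  and k: "k > 0" and r: "0 < r" "r \<le> 1"
 defines "K \<equiv> 2 * (2 * (2 + norm e) / min k 1) ^ DIM('a)"
 shows "hausdorff_outer (DIM('a) - 1) (S \<inter> ball y r) \<le>
  ennreal (unit_ball_vol (real (DIM('a) - 1)) * K * r ^ (DIM('a) - 1))"
proof -
 let ?m = "DIM('a) - 1"
 define \<omega> where "\<omega> = unit_ball_vol (real ?m)"
 have \<omega>: "\<omega> > 0" by (simp add: \<omega>_def)
 have K: "K > 0" using k by (simp add: K_def add_pos_nonneg)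
 have main: "hausdorff_content ?m (2 * d) (S \<inter> ball y r) \<le> ennreal (\<omega> * K * r ^ ?m)"
  if d: "0 < d" "d \<le> r" for d
 proof -
  define good where "good = (\<lambda>P. finite P \<and> P \<subseteq> S \<inter> ball y r \<and> (\<forall>p\<in>P. \<forall>p'\<in>P. p \<noteq> p' --> d \<le> dist p p'))"
  have bound: "real (card P) \<le> K * (r / d) ^ ?m" if "good P" for P
   unfolding K_def by (rule separated_card_bound[OF cone k d r(2)]) (use that in \<open>auto simp: good_def\<close>)
  have "\<exists>P. good P \<and> (\<forall>Q. good Q --> card Q \<le> card P)"
  proof (rule ex_has_greatest_nat)
   show "good {}" by (simp add: good_def)
   show "\<forall>Q. good Q --> card Q < Suc (nat \<lfloor>K * (r / d) ^ ?m\<rfloor>)"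
    using bound by (auto simp: less_Suc_eq_le intro: le_nat_floor)
  qed
  then obtain P where P: "good P" "\<And>Q. good Q ==> card Q \<le> card P" by blast
  have fP: "finite P" using P by (simp add: good_def)
  have cov: "S \<inter> ball y r \<subseteq> (\<Union>p\<in>P. ball p d)"
  proof
   fix x assume x: "x \<in> S \<inter> ball y r"
   show "x \<in> (\<Union>p\<in>P. ball p d)"
   proof (rule ccontr)
    assume "x \<notin> (\<Union>p\<in>P. ball p d)"
    then have far: "d \<le> dist p x" if "p \<in> P" for p using that by auto
    then have "x \<notin> P" using d by force
    moreover have "good (insert x P)" using P(1) x far by (auto simp: good_def dist_commute)
    then have "card (insert x P) \<le> card P" by (rule P(2))
    ultimately show False using fP by simp
   qed
  qed
  obtain p where p: "bij_betw p {..<card P} P" using fP bij_betw_from_nat_into_finite by blast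
  define C where "C = (\<lambda>i. if i < card P then ball (p i) d else {})"
  have "C \<in> hausdorff_covers (2 * d) (S \<inter> ball y r)"
  proof -
   have "(\<Union>p\<in>P. ball p d) \<subseteq> (\<Union>i. C i)"
   proof safe
    fix z x assume z: "z \<in> P" and x: "x \<in> ball z d"
    obtain i where "i < card P" "z = p i" using p z by (auto simp: bij_betw_def)
    then show "x \<in> (\<Union>i. C i)" using x by (auto simp: C_def)
   qed
   then show ?thesis using cov d by (auto simp: hausdorff_covers_def C_def)
  qed
  then have "hausdorff_content ?m (2 * d) (S \<inter> ball y r) \<le> (\<Sum>i. hausdorff_weight ?m (C i))"
   unfolding hausdorff_content_def by (rule INF_lower)
  also have "\<dots> = (\<Sum>i<card P. hausdorff_weight ?m (C i))"
   by (rule suminf_finite) (auto simp: C_def hausdorff_weight_def)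
  also have "\<dots> = (\<Sum>i<card P. ennreal (\<omega> * d ^ ?m))"
   using d by (intro sum.cong) (auto simp: C_def hausdorff_weight_def \<omega>_def)
  also have "\<dots> = ennreal (real (card P) * (\<omega> * d ^ ?m))"
   using \<omega> d by (subst sum_ennreal) auto
  also have "\<dots> \<le> ennreal (\<omega> * K * r ^ ?m)"
  proof (rule ennreal_leI)
   have "real (card P) * (\<omega> * d ^ ?m) \<le> K * (r / d) ^ ?m * (\<omega> * d ^ ?m)"
    using bound[OF P(1)] \<omega> d by (intro mult_right_mono) auto
   also have "\<dots> = \<omega> * K * r ^ ?m" using d by (simp add: power_divide)
   finally show "real (card P) * (\<omega> * d ^ ?m) \<le> \<omega> * K * r ^ ?m" .
  qed
  finally show ?thesis .
 qed
 show ?thesis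
  unfolding hausdorff_outer_def
 proof (rule SUP_least)
  fix d' :: real assume d': "d' \<in> {0<..}"
  define d where "d = min (d' / 2) r"
  have "hausdorff_content ?m d' (S \<inter> ball y r) \<le> hausdorff_content ?m (2 * d) (S \<inter> ball y r)"
   by (rule hausdorff_content_antimono) (simp add: d_def)
  also have "\<dots> \<le> ennreal (\<omega> * K * r ^ ?m)" using d' r by (intro main) (auto simp: d_def)
  finally show "hausdorff_content ?m d' (S \<inter> ball y r) \<le> ennreal (unit_ball_vol (real ?m) * K * r ^ ?m)"
   by (simp add: \<omega>_def)
 qed
qed

section \<open>The cone condition\<close>

text \<open>A locally uniform interior cone condition: one axis e and one opening k serve all points
  of the closure near x0. The axis is not normalised, its length being the height of the cone; e = 0
  occurs at interior points.\<close>

definition cone_at :: "'a::euclidean_space set => 'a => real => 'a => real => bool" where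
 "cone_at \<Omega> x0 r e k \<longleftrightarrow> 0 < r \<and> 0 < k \<and>
   (\<forall>x\<in>ball x0 r \<inter> closure \<Omega>. \<forall>s::real. 0 < s \<and> s \<le> 1 --> cball (x + s *\<^sub>R e) (s * k) \<subseteq> \<Omega>)"

text \<open>At an interior point small balls do. At a boundary point the axis is the direction in
  which \<Omega> lies above the graph: going up outweighs the variation of a Lipschitz function if
  the opening is small compared with 1/L.\<close>

lemma lipschitz_domain_cone:
 assumes \<Omega>: "bounded_lipschitz_domain \<Omega>" and x0: "x0 \<in> closure (\<Omega> :: 'a::euclidean_space set)"
 shows "\<exists>r e k. cone_at \<Omega> x0 r e k"
proof (cases "x0 \<in> \<Omega>")
 case True
 have "open \<Omega>" using \<Omega> by (simp add: bounded_lipschitz_domain_def)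
 then obtain et where et: "et > 0" "ball x0 et \<subseteq> \<Omega>" using True open_contains_ball by blast
 have "cone_at \<Omega> x0 (et / 2) 0 (et / 4)"
  unfolding cone_at_def
 proof (intro conjI ballI allI impI)
  fix x :: 'a and s :: real assume x: "x \<in> ball x0 (et / 2) \<inter> closure \<Omega>" and s: "0 < s \<and> s \<le> 1"
  have "cball (x + s *\<^sub>R 0) (s * (et / 4)) \<subseteq> ball x0 et"
  proof
   fix y assume "y \<in> cball (x + s *\<^sub>R 0) (s * (et / 4))"
   then have "dist x y \<le> s * (et / 4)" by simp
   also have "\<dots> \<le> 1 * (et / 4)" using s et by (intro mult_right_mono) auto
   finally show "y \<in> ball x0 et" using x et dist_triangle[of x0 y x] by simp
  qed
  then show "cball (x + s *\<^sub>R 0) (s * (et / 4)) \<subseteq> \<Omega>" using et by blast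
 qed (use et in auto)
 then show ?thesis by blast
next
 case False
 have "open \<Omega>" using \<Omega> by (simp add: bounded_lipschitz_domain_def)
 then have "x0 \<in> frontier \<Omega>" using x0 False by (simp add: frontier_def interior_open)
 then obtain U e h L where U: "open U" "x0 \<in> U" "norm e = 1"
  and h: "L-lipschitz_on {z. z \<bullet> e = 0} (h :: 'a => real)"
  and gr: "\<And>y. y \<in> U ==> y \<in> \<Omega> \<longleftrightarrow> h (y - (y \<bullet> e) *\<^sub>R e) < y \<bullet> e"
  using \<Omega> unfolding bounded_lipschitz_domain_def by metis
 have L: "L \<ge> 0" using h by (rule lipschitz_on_nonneg)
 have ee: "e \<bullet> e = 1" using U(3) by (simp add: dot_square_norm)
 define P where "P = (\<lambda>y. y - (y \<bullet> e) *\<^sub>R e)"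
 \<comment> \<open>P annihilates e, so any multiple of e may be subtracted first. The factor 2 is
   the crude bound 1 + 1 for the norm of P.\<close>
 have hP: "\<bar>h (P x) - h (P y)\<bar> \<le> 2 * L * norm (x - y - t *\<^sub>R e)" for x y t
 proof -
  have "P x \<in> {z. z \<bullet> e = 0}" "P y \<in> {z. z \<bullet> e = 0}" by (auto simp: P_def inner_diff_left ee)
  from lipschitz_onD[OF h this] have lip: "\<bar>h (P x) - h (P y)\<bar> \<le> L * norm (P x - P y)"
   by (simp add: dist_real_def dist_norm)
  have "P x - P y = (x - y - t *\<^sub>R e) - ((x - y - t *\<^sub>R e) \<bullet> e) *\<^sub>R e"
   by (simp add: P_def inner_diff_left ee algebra_simps)
  also have "norm \<dots> \<le> norm (x - y - t *\<^sub>R e) + \<bar>(x - y - t *\<^sub>R e) \<bullet> e\<bar>"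
   using norm_triangle_ineq4[of "x - y - t *\<^sub>R e" "((x - y - t *\<^sub>R e) \<bullet> e) *\<^sub>R e"] U(3) by simp
  also have "\<dots> \<le> 2 * norm (x - y - t *\<^sub>R e)"
   using Cauchy_Schwarz_ineq2[of "x - y - t *\<^sub>R e" e] U(3) by simp
  finally have "L * norm (P x - P y) \<le> L * (2 * norm (x - y - t *\<^sub>R e))"
   using L by (rule mult_left_mono)
  with lip show ?thesis by (simp add: mult_ac)
 qed
 have below: "h (P x) \<le> x \<bullet> e" if x: "x \<in> U" "x \<in> closure \<Omega>" for x
 proof (rule ccontr)
  assume "\<not> ?thesis"
  then have pos: "h (P x) - x \<bullet> e > 0" by simp
  obtain et where et: "et > 0" "ball x et \<subseteq> U" using U(1) x(1) open_contains_ball by blast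
  define et' where "et' = min et ((h (P x) - x \<bullet> e) / (2 * L + 1))"
  have "et' > 0" using pos et L by (simp add: et'_def add_nonneg_pos)
  then obtain y where y: "y \<in> \<Omega>" "dist y x < et'" using x(2) closure_approachable by blast
  have yU: "y \<in> U" using y et by (auto simp: et'_def dist_commute)
  have "h (P y) < y \<bullet> e" using gr[OF yU] y(1) by (simp add: P_def)
  moreover have "\<bar>h (P y) - h (P x)\<bar> \<le> 2 * L * dist y x" using hP[of y x 0] by (simp add: dist_norm)
  moreover have "\<bar>y \<bullet> e - x \<bullet> e\<bar> \<le> dist y x"
   using Cauchy_Schwarz_ineq2[of "y - x" e] U(3) by (simp add: inner_diff_left dist_norm)
  ultimately have "h (P x) - x \<bullet> e < (2 * L + 1) * dist y x" by (simp add: algebra_simps)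
  also have "\<dots> < h (P x) - x \<bullet> e"
  proof -
   have "dist y x < (h (P x) - x \<bullet> e) / (2 * L + 1)" using y by (simp add: et'_def)
   then show ?thesis using L by (simp add: pos_less_divide_eq mult.commute)
  qed
  finally show False .
 qed
 obtain et where et: "et > 0" "ball x0 et \<subseteq> U" using U(1,2) open_contains_ball by blast
 \<comment> \<open>A quarter of the chart radius leaves room for the vertex, the shift and the
   perturbation. The opening k is chosen such that the loss, 2 L s k in the graph and s k in the
   height, stays below the gain s \<tau>.\<close>
 define \<tau> where "\<tau> = et / 4"
 define k where "k = \<tau> / (2 * L + 2)"
 have \<tau>: "\<tau> > 0" using et by (simp add: \<tau>_def)
 have k: "k > 0" "k \<le> \<tau>" "(2 * L + 1) * k < \<tau>"
  using \<tau> L by (auto simp: k_def field_simps add_nonneg_pos)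
 have "cone_at \<Omega> x0 \<tau> (\<tau> *\<^sub>R e) k"
  unfolding cone_at_def
 proof (intro conjI ballI allI impI)
  fix x :: 'a and s :: real assume x: "x \<in> ball x0 \<tau> \<inter> closure \<Omega>" and s: "0 < s \<and> s \<le> 1"
  show "cball (x + s *\<^sub>R (\<tau> *\<^sub>R e)) (s * k) \<subseteq> \<Omega>"
  proof
   fix y assume y: "y \<in> cball (x + s *\<^sub>R (\<tau> *\<^sub>R e)) (s * k)"
   define w where "w = y - x - (s * \<tau>) *\<^sub>R e"
   have w: "norm w \<le> s * k" using y by (simp add: w_def dist_norm norm_minus_commute algebra_simps)
   have xU: "x \<in> U" using x et by (auto simp: \<tau>_def)
   have "dist x y \<le> norm w + s * \<tau>"
    using norm_triangle_ineq[of w "(s * \<tau>) *\<^sub>R e"] U(3) s \<tau> by (simp add: w_def dist_norm norm_minus_commute)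
   also have "\<dots> \<le> 1 * \<tau> + 1 * \<tau>"
   proof -
    have "s * k \<le> 1 * \<tau>" using s k by (intro mult_mono) auto
    moreover have "s * \<tau> \<le> 1 * \<tau>" using s \<tau> by (intro mult_right_mono) auto
    ultimately show ?thesis using w by linarith
   qed
   finally have "dist x0 y < et" using x dist_triangle[of x0 y x] et by (simp add: \<tau>_def)
   then have yU: "y \<in> U" using et by auto
   have "h (P y) \<le> h (P x) + 2 * L * norm w" using hP[of y x "s * \<tau>"] by (simp add: w_def)
   also have "\<dots> \<le> x \<bullet> e + 2 * L * (s * k)"
    using below[OF xU] x w L by (intro add_mono mult_left_mono) auto
   also have "\<dots> < x \<bullet> e + s * \<tau> - s * k"
    using mult_strict_left_mono[OF k(3), of s] s by (simp add: algebra_simps)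
   also have "\<dots> \<le> x \<bullet> e + s * \<tau> + w \<bullet> e"
    using Cauchy_Schwarz_ineq2[of w e] U(3) w by simp
   also have "\<dots> = y \<bullet> e" by (simp add: w_def inner_diff_left ee)
   finally show "y \<in> \<Omega>" using gr[OF yU] by (simp add: P_def)
  qed
 qed (use \<tau> k in auto)
 then show ?thesis by blast
qed

section \<open>Representatives on the domain\<close>

lemma borel_measurable_lebesgue_AE:
 fixes f g :: "'a::euclidean_space => 'b::{second_countable_topology, metric_space}"
 assumes f: "f \<in> borel_measurable lebesgue" and ae: "AE x in lebesgue. f x = g x"
 shows "g \<in> borel_measurable lebesgue"
proof (rule measurableI)
 fix S :: "'b set" assume S: "S \<in> sets borel"
 have "f -` S \<inter> space lebesgue \<in> sets lebesgue" using f S by (rule measurable_sets)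
 then show "g -` S \<inter> space lebesgue \<in> sets lebesgue"
  by (rule completion.in_sets_AE[rotated]) (use ae in \<open>auto elim: eventually_mono\<close>)
qed auto

section \<open>Arithmetic of square integrable functions\<close>

lemma Lp2_iff:
 "f \<in> Lp 2 M \<longleftrightarrow> f \<in> borel_measurable M \<and> integrable M (\<lambda>x. (norm (f x))^2)"
 by (simp add: Lp_def powr_numeral)

lemma L2_integrable_mult:
 fixes f g :: "'a => real"
 assumes "f \<in> Lp 2 M" "g \<in> Lp 2 M"
 shows "integrable M (\<lambda>x. f x * g x)"
proof (rule Bochner_Integration.integrable_bound)
 show "integrable M (\<lambda>x. (norm (f x))^2 + (norm (g x))^2)" using assms by (auto simp: Lp2_iff)
 show "(\<lambda>x. f x * g x) \<in> borel_measurable M" using assms by (auto simp: Lp2_iff)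
 show "AE x in M. norm (f x * g x) \<le> norm ((norm (f x))^2 + (norm (g x))^2)"
 proof (rule AE_I2)
  fix x
  have "2 * (\<bar>f x\<bar> * \<bar>g x\<bar>) \<le> \<bar>f x\<bar>\<^sup>2 + \<bar>g x\<bar>\<^sup>2" using sum_squares_bound[of "\<bar>f x\<bar>" "\<bar>g x\<bar>"] by simp
  moreover have "0 \<le> \<bar>f x\<bar> * \<bar>g x\<bar>" by simp
  ultimately have "\<bar>f x\<bar> * \<bar>g x\<bar> \<le> \<bar>f x\<bar>\<^sup>2 + \<bar>g x\<bar>\<^sup>2" by linarith
  then show "norm (f x * g x) \<le> norm ((norm (f x))^2 + (norm (g x))^2)" by (simp add: abs_mult)
 qed
qed

lemma L2_integrable_inner:
 fixes f g :: "'a => 'b::euclidean_space"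
 assumes "f \<in> Lp 2 M" "g \<in> Lp 2 M"
 shows "integrable M (\<lambda>x. f x \<bullet> g x)"
proof (rule Bochner_Integration.integrable_bound)
 show "integrable M (\<lambda>x. norm (f x) * norm (g x))"
  by (rule L2_integrable_mult) (use assms in \<open>auto simp: Lp2_iff\<close>)
 show "(\<lambda>x. f x \<bullet> g x) \<in> borel_measurable M" using assms by (auto simp: Lp2_iff)
qed (auto simp: Cauchy_Schwarz_ineq2)

lemma L2_lincomb:
 fixes f g :: "'a => 'b::euclidean_space"
 assumes "f \<in> Lp 2 M" "g \<in> Lp 2 M"
 shows "(\<lambda>x. a *\<^sub>R f x + b *\<^sub>R g x) \<in> Lp 2 M"
proof -
 have "(norm (a *\<^sub>R f x + b *\<^sub>R g x))^2 = a^2 * (norm (f x))^2 + 2 * a * b * (f x \<bullet> g x) + b^2 * (norm (g x))^2" for x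
  unfolding power2_norm_eq_inner by (simp add: inner_add_left inner_add_right inner_commute power2_eq_square algebra_simps)
 then show ?thesis using assms L2_integrable_inner[OF assms] by (auto simp: Lp2_iff)
qed

lemma L2_bounded_mult:
 fixes f :: "'a => 'b::euclidean_space"
 assumes "f \<in> Lp 2 M" "h \<in> borel_measurable M" "\<And>x. x \<in> space M ==> \<bar>h x\<bar> \<le> B"
 shows "(\<lambda>x. h x *\<^sub>R f x) \<in> Lp 2 M"
proof -
 have "integrable M (\<lambda>x. (norm (h x *\<^sub>R f x))^2)"
 proof (rule Bochner_Integration.integrable_bound)
  show "integrable M (\<lambda>x. B^2 * (norm (f x))^2)" using assms by (auto simp: Lp2_iff)
  show "(\<lambda>x. (norm (h x *\<^sub>R f x))^2) \<in> borel_measurable M" using assms by (auto simp: Lp2_iff)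
  show "AE x in M. norm ((norm (h x *\<^sub>R f x))^2) \<le> norm (B^2 * (norm (f x))^2)"
   using assms(3) by (intro AE_I2) (auto simp: power_mult_distrib intro!: mult_right_mono abs_le_square_iff[THEN iffD1] order_trans[OF _ abs_ge_self])
 qed
 then show ?thesis using assms by (auto simp: Lp2_iff)
qed

lemma L2_minus:
 fixes f g :: "'a => 'b::euclidean_space"
 assumes "f \<in> Lp 2 M" "g \<in> Lp 2 M"
 shows "(\<lambda>x. f x - g x) \<in> Lp 2 M"
 using L2_lincomb[OF assms, of 1 "- 1"] by simp

lemma L2_inner_const:
 fixes f :: "'a => 'b::euclidean_space"
 assumes "f \<in> Lp 2 M" "b \<in> Basis"
 shows "(\<lambda>x. f x \<bullet> b) \<in> Lp 2 M"
proof -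
 have "integrable M (\<lambda>x. (norm (f x \<bullet> b))^2)"
 proof (rule Bochner_Integration.integrable_bound)
  show "integrable M (\<lambda>x. (norm (f x))^2)" using assms by (simp add: Lp2_iff)
  show "(\<lambda>x. (norm (f x \<bullet> b))^2) \<in> borel_measurable M" using assms by (auto simp: Lp2_iff)
  show "AE x in M. norm ((norm (f x \<bullet> b))^2) \<le> norm ((norm (f x))^2)"
  proof (rule AE_I2)
   fix x
   have "(norm (f x \<bullet> b))^2 \<le> (norm (f x))^2"
    using Basis_le_norm[OF assms(2), of "f x"] by (intro power_mono) auto
   then show "norm ((norm (f x \<bullet> b))^2) \<le> norm ((norm (f x))^2)" by simp
  qed
 qed
 then show ?thesis using assms by (auto simp: Lp2_iff)
qed

section \<open>The domain and Borel representatives of functions on it\<close>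

locale lipschitz_domain =
 fixes \<Omega> :: "'a::euclidean_space set"
 assumes lip: "bounded_lipschitz_domain \<Omega>"
begin

abbreviation Leb :: "'a measure" where
 "Leb \<equiv> lebesgue_on \<Omega>"

lemma open_dom: "open \<Omega>" and bounded_dom: "bounded \<Omega>" and connected_dom: "connected \<Omega>"
 and nonempty_dom: "\<Omega> \<noteq> {}"
 using lip by (auto simp: bounded_lipschitz_domain_def)

lemma dom_sets[measurable]: "\<Omega> \<in> sets borel" "\<Omega> \<in> sets lborel"
 using open_dom by auto

lemma dom_inter: "\<Omega> \<inter> space lebesgue \<in> sets lebesgue"
 using open_dom by simp

lemma dom_finite: "emeasure lborel \<Omega> < \<infinity>"
 using bounded_dom emeasure_bounded_finite by blast

lemma finite_measure_dom: "finite_measure Leb"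
proof
 show "emeasure Leb (space Leb) \<noteq> \<infinity>"
  using dom_finite open_dom by (simp add: emeasure_restrict_space space_restrict_space)
qed

lemma AE_dom: "(AE x in Leb. P x) \<longleftrightarrow> (AE x in lborel. x \<in> \<Omega> --> P x)"
 using open_dom by (simp add: AE_restrict_space_iff AE_completion_iff)

text \<open>Functions on \<Omega> are merely Lebesgue measurable and arbitrary outside \<Omega>. A
  Borel copy that vanishes outside makes translations and Fubini over \<open>lborel\<close>
  available.\<close>

definition is_rep :: "('a => 'b::euclidean_space) => ('a => 'b) => bool" where
 "is_rep f f' \<longleftrightarrow> f' \<in> borel_measurable borel \<and> (\<forall>x. x \<notin> \<Omega> --> f' x = 0) \<and>
   (AE x in lborel. x \<in> \<Omega> --> f x = f' x)"

lemma is_rep_AE: "is_rep f f' ==> AE x in lborel. indicator \<Omega> x *\<^sub>R f x = f' x"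
 unfolding is_rep_def by (auto elim!: eventually_mono split: split_indicator)

lemma is_rep_measurable:
 assumes "is_rep f f'"
 shows "f \<in> borel_measurable Leb"
proof -
 have "f' \<in> borel_measurable lebesgue" using assms by (auto simp: is_rep_def intro: measurable_completion)
 moreover have "AE x in lebesgue. f' x = indicator \<Omega> x *\<^sub>R f x"
  using is_rep_AE[OF assms] by (auto simp: AE_completion_iff elim: eventually_mono)
 ultimately have "(\<lambda>x. indicator \<Omega> x *\<^sub>R f x) \<in> borel_measurable lebesgue"
  by (rule borel_measurable_lebesgue_AE)
 then show ?thesis using borel_measurable_restrict_space_iff[OF dom_inter] by blast
qed

lemma is_rep_exists_real:
 fixes f :: "'a => real"
 assumes "f \<in> borel_measurable Leb"
 shows "\<exists>f'. is_rep f f'"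
proof -
 have "(\<lambda>x. indicator \<Omega> x *\<^sub>R f x) \<in> borel_measurable lebesgue"
  using assms borel_measurable_restrict_space_iff[OF dom_inter] by blast
 then obtain g where g: "g \<in> borel_measurable lborel" "AE x in lborel. indicator \<Omega> x *\<^sub>R f x = g x"
  using completion_ex_borel_measurable_real by blast
 have "is_rep f (\<lambda>x. indicator \<Omega> x *\<^sub>R g x)"
  unfolding is_rep_def
 proof (intro conjI)
  show "(\<lambda>x. indicator \<Omega> x *\<^sub>R g x) \<in> borel_measurable borel" using g(1) by measurable
  show "AE x in lborel. x \<in> \<Omega> --> f x = indicator \<Omega> x *\<^sub>R g x"
   using g(2) by (auto elim!: eventually_mono split: split_indicator)
 qed auto
 then show ?thesis by blast
qed

lemma is_rep_exists:
 fixes f :: "'a => 'b::euclidean_space"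
 assumes "f \<in> borel_measurable Leb"
 shows "\<exists>f'. is_rep f f'"
proof -
 have "\<exists>g. is_rep (\<lambda>x. f x \<bullet> b) g" for b
  by (rule is_rep_exists_real) (use assms in measurable)
 then obtain g where g: "\<And>b. is_rep (\<lambda>x. f x \<bullet> b) (g b)" by metis
 have "is_rep f (\<lambda>x. \<Sum>b\<in>Basis. g b x *\<^sub>R b)"
  unfolding is_rep_def
 proof (intro conjI)
  have "g b \<in> borel_measurable borel" for b using g by (simp add: is_rep_def)
  then show "(\<lambda>x. \<Sum>b\<in>Basis. g b x *\<^sub>R b) \<in> borel_measurable borel" by measurable
  show "\<forall>x. x \<notin> \<Omega> --> (\<Sum>b\<in>Basis. g b x *\<^sub>R b) = 0" using g by (simp add: is_rep_def)
  have "AE x in lborel. \<forall>b\<in>Basis. x \<in> \<Omega> --> f x \<bullet> b = g b x"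
   using g by (intro AE_finite_allI) (auto simp: is_rep_def)
  then show "AE x in lborel. x \<in> \<Omega> --> f x = (\<Sum>b\<in>Basis. g b x *\<^sub>R b)"
  proof eventually_elim
   fix x assume a: "\<forall>b\<in>Basis. x \<in> \<Omega> --> f x \<bullet> b = g b x"
   show "x \<in> \<Omega> --> f x = (\<Sum>b\<in>Basis. g b x *\<^sub>R b)"
   proof
    assume "x \<in> \<Omega>"
    then have "(\<Sum>b\<in>Basis. g b x *\<^sub>R b) = (\<Sum>b\<in>Basis. (f x \<bullet> b) *\<^sub>R b)" using a by (intro sum.cong) auto
    then show "f x = (\<Sum>b\<in>Basis. g b x *\<^sub>R b)" by (simp add: euclidean_representation)
   qed
  qed
 qed
 then show ?thesis by blast
qed

lemma is_rep_integral:
 assumes "is_rep f f'"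
 shows "integrable Leb f \<longleftrightarrow> integrable lborel f'"
  "(LINT x|Leb. f x) = (LINT x|lborel. f' x)"
proof -
 have f'[measurable]: "f' \<in> borel_measurable borel" using assms by (simp add: is_rep_def)
 have f[measurable]: "(\<lambda>x. indicator \<Omega> x *\<^sub>R f x) \<in> borel_measurable lebesgue"
  using is_rep_measurable[OF assms] borel_measurable_restrict_space_iff[OF dom_inter] by blast
 have ae: "AE x in lebesgue. indicator \<Omega> x *\<^sub>R f x = f' x"
  using is_rep_AE[OF assms] by (simp add: AE_completion_iff)
 have f'l: "f' \<in> borel_measurable lebesgue" by (auto intro: measurable_completion)
 have "integrable Leb f \<longleftrightarrow> integrable lebesgue (\<lambda>x. indicator \<Omega> x *\<^sub>R f x)"
  by (rule integrable_restrict_space[OF dom_inter])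
 also have "\<dots> \<longleftrightarrow> integrable lebesgue f'" using ae f f'l by (rule integrable_cong_AE[rotated 2])
 also have "\<dots> \<longleftrightarrow> integrable lborel f'" by (rule integrable_completion) simp
 finally show "integrable Leb f \<longleftrightarrow> integrable lborel f'" .
 have "(LINT x|Leb. f x) = (LINT x|lebesgue. indicator \<Omega> x *\<^sub>R f x)"
  by (rule integral_restrict_space[OF dom_inter])
 also have "\<dots> = (LINT x|lebesgue. f' x)" using ae f f'l by (rule integral_cong_AE[rotated 2])
 also have "\<dots> = (LINT x|lborel. f' x)" by (rule integral_completion) simp
 finally show "(LINT x|Leb. f x) = (LINT x|lborel. f' x)" .
qed

lemma is_rep_compose:
 assumes "is_rep f f'" "h \<in> borel_measurable borel" "h 0 = 0"
 shows "is_rep (\<lambda>x. h (f x)) (\<lambda>x. h (f' x))"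
 using assms unfolding is_rep_def
 by (auto intro: measurable_compose[OF _ assms(2)] elim: eventually_mono)

lemma is_rep_mult:
 fixes f :: "'a => real"
 assumes "is_rep f f'" "\<phi> \<in> borel_measurable borel"
 shows "is_rep (\<lambda>x. f x * \<phi> x) (\<lambda>x. f' x * \<phi> x)"
 using assms unfolding is_rep_def by (auto elim: eventually_mono)

lemma L2_integrable:
 fixes f :: "'a => 'b::euclidean_space"
 assumes "f \<in> Lp 2 Leb"
 shows "integrable Leb f"
proof (rule Bochner_Integration.integrable_bound)
 interpret finite_measure "Leb" by (rule finite_measure_dom)
 show "integrable Leb (\<lambda>x. 1 + (norm (f x))^2)" using assms by (auto simp: Lp2_iff)
 show "f \<in> borel_measurable Leb" using assms by (simp add: Lp2_iff)
 show "AE x in Leb. norm (f x) \<le> norm (1 + (norm (f x))^2)"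
 proof (rule AE_I2)
  fix x
  have "2 * norm (f x) \<le> 1 + (norm (f x))^2" using sum_squares_bound[of 1 "norm (f x)"] by simp
  then show "norm (f x) \<le> norm (1 + (norm (f x))^2)" using norm_ge_zero[of "f x"] unfolding real_norm_def by linarith
 qed
qed

lemma bounded_L2:
 fixes f :: "'a => 'b::euclidean_space"
 assumes "f \<in> borel_measurable Leb" "\<And>x. x \<in> \<Omega> ==> norm (f x) \<le> B"
 shows "f \<in> Lp 2 Leb"
proof -
 interpret finite_measure "Leb" by (rule finite_measure_dom)
 have "integrable Leb (\<lambda>x. (norm (f x))^2)"
  by (rule integrable_const_bound[where B = "B^2"])
   (use assms in \<open>auto simp: space_restrict_space intro!: AE_I2 power_mono\<close>)
 then show ?thesis using assms by (simp add: Lp2_iff)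
qed

lemma integrable_locally_integrable:
 fixes f :: "'a => 'b::euclidean_space"
 assumes "integrable Leb f"
 shows "locally_integrable \<Omega> f"
 unfolding locally_integrable_def
proof (intro allI impI)
 fix K assume K: "compact K" "K \<subseteq> \<Omega>"
 then have Ks: "K \<in> sets lebesgue" by (simp add: borel_compact)
 have "integrable lebesgue (\<lambda>x. indicator \<Omega> x *\<^sub>R f x)"
  using assms integrable_restrict_space[OF dom_inter] by blast
 moreover have "(\<lambda>x. indicator K x *\<^sub>R indicator \<Omega> x *\<^sub>R f x) = (\<lambda>x. indicator K x *\<^sub>R f x)"
  using K(2) by (auto simp: fun_eq_iff split: split_indicator)
 ultimately have "integrable lebesgue (\<lambda>x. indicator K x *\<^sub>R f x)"
  using integrable_mult_indicator[OF Ks] by metis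
 then show "integrable (lebesgue_on K) f"
  using Ks by (subst integrable_restrict_space) auto
qed

lemma L2_locally_integrable:
 fixes f :: "'a => 'b::euclidean_space"
 shows "f \<in> Lp 2 Leb ==> locally_integrable \<Omega> f"
 by (rule integrable_locally_integrable[OF L2_integrable])

section \<open>Weak gradients\<close>

text \<open>The kernels with e = 0 are themselves nonnegative test functions, so near each point the
  averages of F are nonnegative, and along a subsequence they converge almost everywhere to a
  positive multiple of F. As F is only locally integrable, it is first cut off to a compact ball;
  Lindelof's theorem collects the local null sets.\<close>

lemma nonneg_from_test_functions:
 fixes F :: "'a => real"
 assumes F: "locally_integrable \<Omega> F"
  and pos: "\<And>\<phi>. \<phi> \<in> test_functions \<Omega> ==> (\<And>x. 0 \<le> \<phi> x) ==> 0 \<le> (LINT x|Leb. F x * \<phi> x)"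
 shows "AE x in Leb. 0 \<le> F x"
proof -
 have loc: "\<exists>r>0. ball x0 r \<subseteq> \<Omega> \<and> (AE x in lborel. x \<in> ball x0 r --> 0 \<le> F x)" if x0: "x0 \<in> \<Omega>" for x0
 proof -
  obtain r0 where r0: "r0 > 0" "cball x0 r0 \<subseteq> \<Omega>" using open_dom x0 open_contains_cball by blast
  define r where "r = r0 / 2"
  have r: "r > 0" "cball x0 (2 * r) \<subseteq> \<Omega>" using r0 by (auto simp: r_def)
  define K where "K = cball x0 (2 * r)"
  have K: "compact K" "K \<subseteq> \<Omega>" "K \<in> sets lebesgue" using r by (auto simp: K_def)
  have "integrable (lebesgue_on K) F" using F K by (simp add: locally_integrable_def)
  then have FK: "integrable lebesgue (\<lambda>x. indicator K x *\<^sub>R F x)"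
   using K by (subst (asm) integrable_restrict_space) auto
  then obtain g where g: "g \<in> borel_measurable lborel" "AE x in lborel. indicator K x *\<^sub>R F x = g x"
   using completion_ex_borel_measurable_real borel_measurable_integrable by blast
  note gm[measurable] = g(1)
  have gl: "g \<in> borel_measurable lebesgue" using g(1) by (auto intro: measurable_completion)
  have ae: "AE x in lebesgue. indicator K x *\<^sub>R F x = g x" using g(2) by (simp add: AE_completion_iff)
  have "integrable lebesgue g"
   using integrable_cong_AE[OF _ gl ae] FK by auto
  then have gi: "integrable lborel g" using integrable_completion[OF g(1)] by simp
  have mp: "0 \<le> mol 0 r g x ((1/2) ^ i)" if x: "x \<in> ball x0 r" for x i
  proof -
   define s :: real where "s = (1/2) ^ i"
   have s: "0 < s" "s \<le> 1" by (auto simp: s_def power_le_one)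
   have sub: "cball (x + s *\<^sub>R 0) (s * r) \<subseteq> K"
   proof
    fix y assume "y \<in> cball (x + s *\<^sub>R 0) (s * r)"
    then have "dist x y \<le> s * r" by simp
    also have "\<dots> \<le> 1 * r" using s r by (intro mult_right_mono) auto
    finally show "y \<in> K" using x dist_triangle[of x0 y x] by (simp add: K_def)
   qed
   have t: "(\<lambda>y. 1 * ker 0 r x s y) \<in> test_functions \<Omega>"
    by (rule ker_test_function[OF r(1) s(1)]) (use sub K in auto)
   have "0 \<le> (LINT y|Leb. F y * (1 * ker 0 r x s y))"
    by (rule pos[OF t]) (simp add: ker_nonneg[OF s(1)])
   also have "\<dots> = (LINT y|Leb. F y * ker 0 r x s y)" by simp
   also have "\<dots> = (LINT y|lebesgue. indicator \<Omega> y *\<^sub>R (F y * ker 0 r x s y))"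
    by (rule integral_restrict_space[OF dom_inter])
   also have "\<dots> = (LINT y|lebesgue. (indicator K y *\<^sub>R F y) * ker 0 r x s y)"
   proof (rule Bochner_Integration.integral_cong[OF refl])
    fix y
    have "ker 0 r x s y = 0" if "y \<notin> K"
     by (rule ker_eq_0[OF r(1) s(1)]) (use that sub ball_subset_cball in blast)
    then show "indicator \<Omega> y *\<^sub>R (F y * ker 0 r x s y) = (indicator K y *\<^sub>R F y) * ker 0 r x s y"
     using K by (cases "y \<in> K") (auto split: split_indicator)
   qed
   also have "\<dots> = (LINT y|lebesgue. g y * ker 0 r x s y)"
   proof (rule integral_cong_AE)
    have kl: "ker 0 r x s \<in> borel_measurable lebesgue" by (auto intro: measurable_completion)
    show "(\<lambda>y. (indicator K y *\<^sub>R F y) * ker 0 r x s y) \<in> borel_measurable lebesgue"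
     using FK kl by (intro borel_measurable_times) auto
    show "(\<lambda>y. g y * ker 0 r x s y) \<in> borel_measurable lebesgue"
     using gl kl by (intro borel_measurable_times)
    show "AE y in lebesgue. (indicator K y *\<^sub>R F y) * ker 0 r x s y = g y * ker 0 r x s y"
     using ae by (auto elim: eventually_mono)
   qed
   also have "\<dots> = mol 0 r g x s" unfolding mol_def by (rule integral_completion) measurable
   finally show ?thesis by (simp add: s_def)
  qed
  obtain q where q: "AE x in lborel. (\<lambda>i. mol 0 r g x ((1/2) ^ q i)) \<leadsto> kmass (0::'a) r * g x"
   using mol_AE_converges[OF gi r(1), of 0] by auto
  have "AE x in lborel. x \<in> ball x0 r --> 0 \<le> F x"
   using q g(2)
  proof eventually_elim
   fix x assume l: "(\<lambda>i. mol 0 r g x ((1/2) ^ q i)) \<leadsto> kmass (0::'a) r * g x" and e: "indicator K x *\<^sub>R F x = g x"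
   show "x \<in> ball x0 r --> 0 \<le> F x"
   proof
    assume x: "x \<in> ball x0 r"
    have "0 \<le> kmass (0::'a) r * g x" by (rule LIMSEQ_le_const[OF l]) (use mp[OF x] in auto)
    then have "0 \<le> g x" using kmass_pos[OF r(1), of "0 :: 'a"] by (simp add: zero_le_mult_iff)
    moreover have "x \<in> K" using x r by (simp add: K_def)
    ultimately show "0 \<le> F x" using e by simp
   qed
  qed
  moreover have "ball x0 r \<subseteq> \<Omega>" using r by (auto simp: subset_eq)
  ultimately show ?thesis using r by blast
 qed
 then obtain r where r: "\<And>x. x \<in> \<Omega> ==> r x > 0" "\<And>x. x \<in> \<Omega> ==> ball x (r x) \<subseteq> \<Omega>"
  "\<And>x. x \<in> \<Omega> ==> AE y in lborel. y \<in> ball x (r x) --> 0 \<le> F y"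
  by metis
 obtain \<F>' where F': "\<F>' \<subseteq> (\<lambda>x. ball x (r x)) ` \<Omega>" "countable \<F>'" "\<Union>\<F>' = \<Union>((\<lambda>x. ball x (r x)) ` \<Omega>)"
  by (rule Lindelof[of "(\<lambda>x. ball x (r x)) ` \<Omega>"]) auto
 have "\<Omega> \<subseteq> \<Union>\<F>'" unfolding F'(3) using r(1) by force
 moreover have "AE y in lborel. \<forall>B\<in>\<F>'. y \<in> B --> 0 \<le> F y"
  using F'(2) by (subst AE_ball_countable) (use F'(1) r(3) in auto)
 ultimately show ?thesis unfolding AE_dom by (auto elim!: eventually_mono)
qed

lemma zero_from_test_functions:
 fixes F :: "'a => real"
 assumes F: "locally_integrable \<Omega> F"
  and zero: "\<And>\<phi>. \<phi> \<in> test_functions \<Omega> ==> (LINT x|Leb. F x * \<phi> x) = 0"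
 shows "AE x in Leb. F x = 0"
proof -
 have "AE x in Leb. 0 \<le> F x"
  by (rule nonneg_from_test_functions[OF F]) (simp add: zero)
 moreover have "AE x in Leb. 0 \<le> - F x"
  by (rule nonneg_from_test_functions) (use F zero in \<open>auto simp: locally_integrable_def\<close>)
 ultimately show ?thesis by eventually_elim auto
qed

lemma integrable_loc_times_test:
 fixes F :: "'a => real"
 assumes F: "locally_integrable \<Omega> F" and \<phi>: "\<phi> \<in> test_functions \<Omega>"
 shows "integrable Leb (\<lambda>x. F x * \<phi> x)"
proof -
 define K where "K = closure {x. \<phi> x \<noteq> 0}"
 have K: "compact K" "K \<subseteq> \<Omega>" using \<phi> by (auto simp: K_def test_functions_def)
 then have Ks: "K \<in> sets lebesgue" by (simp add: borel_compact)
 have "integrable (lebesgue_on K) F" using F K by (simp add: locally_integrable_def)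
 then have FK: "integrable lebesgue (\<lambda>x. indicator K x *\<^sub>R F x)"
  using Ks by (subst (asm) integrable_restrict_space) auto
 obtain B where B: "\<And>x. \<bar>\<phi> x\<bar> \<le> B" using test_function_bounded[OF \<phi>] by auto
 have "integrable lebesgue (\<lambda>x. indicator \<Omega> x *\<^sub>R (F x * \<phi> x))"
 proof (rule Bochner_Integration.integrable_bound)
  show "integrable lebesgue (\<lambda>x. (indicator K x *\<^sub>R F x) * B)" using FK by auto
  have eq: "indicator \<Omega> x *\<^sub>R (F x * \<phi> x) = (indicator K x *\<^sub>R F x) * \<phi> x" for x
  proof (cases "\<phi> x = 0")
   case False
   then have "x \<in> K" using closure_subset[of "{x. \<phi> x \<noteq> 0}"] by (auto simp: K_def)
   then show ?thesis using K by (auto split: split_indicator)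
  qed simp
  have "\<phi> \<in> borel_measurable lebesgue" using test_function_measurable[OF \<phi>] by (auto intro: measurable_completion)
  then show "(\<lambda>x. indicator \<Omega> x *\<^sub>R (F x * \<phi> x)) \<in> borel_measurable lebesgue"
   unfolding eq using FK by (intro borel_measurable_times) auto
  show "AE x in lebesgue. norm (indicator \<Omega> x *\<^sub>R (F x * \<phi> x)) \<le> norm ((indicator K x *\<^sub>R F x) * B)"
   unfolding eq norm_mult
   using B by (intro AE_I2 mult_left_mono) (auto intro: order_trans[OF _ abs_ge_self])
 qed
 then show ?thesis using integrable_restrict_space[OF dom_inter] by blast
qed

lemma locally_integrable_inner:
 "locally_integrable \<Omega> G ==> locally_integrable \<Omega> (\<lambda>x. G x \<bullet> b)"
 by (auto simp: locally_integrable_def)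

lemma weak_gradient_unique:
 assumes G: "has_weak_gradient \<Omega> u G" "has_weak_gradient \<Omega> u H"
 shows "AE x in Leb. G x = H x"
proof -
 have lG: "locally_integrable \<Omega> G" "locally_integrable \<Omega> H" using G by (auto simp: has_weak_gradient_def)
 have comp: "AE x in Leb. G x \<bullet> b - H x \<bullet> b = 0" if b: "b \<in> Basis" for b
 proof (rule zero_from_test_functions)
  show "locally_integrable \<Omega> (\<lambda>x. G x \<bullet> b - H x \<bullet> b)" using lG by (auto simp: locally_integrable_def)
  fix \<phi> assume \<phi>: "\<phi> \<in> test_functions \<Omega>"
  have i: "integrable Leb (\<lambda>x. (G x \<bullet> b) * \<phi> x)" "integrable Leb (\<lambda>x. (H x \<bullet> b) * \<phi> x)"
   using lG \<phi> by (auto intro!: integrable_loc_times_test locally_integrable_inner)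
  have "(LINT x|Leb. (G x \<bullet> b) * \<phi> x) = (LINT x|Leb. (H x \<bullet> b) * \<phi> x)"
  proof -
   have "(LINT x|Leb. u x * partial b \<phi> x) = - (LINT x|Leb. (G x \<bullet> b) * \<phi> x)"
    "(LINT x|Leb. u x * partial b \<phi> x) = - (LINT x|Leb. (H x \<bullet> b) * \<phi> x)"
    using G \<phi> b unfolding has_weak_gradient_def by blast+
   then show ?thesis by simp
  qed
  then show "(LINT x|Leb. (G x \<bullet> b - H x \<bullet> b) * \<phi> x) = 0"
   using i by (simp add: left_diff_distrib)
 qed
 have "AE x in Leb. \<forall>b\<in>Basis. G x \<bullet> b - H x \<bullet> b = 0"
  by (rule AE_finite_allI[OF finite_Basis comp])
 then show ?thesis
 proof eventually_elim
  fix x assume "\<forall>b\<in>Basis. G x \<bullet> b - H x \<bullet> b = 0"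
  then show "G x = H x" by (auto intro!: euclidean_eqI[where x = "G x" and y = "H x"])
 qed
qed

lemma measurable_AE_cong_dom:
 fixes f g :: "'a => 'b::euclidean_space"
 assumes "f \<in> borel_measurable Leb" "AE x in Leb. f x = g x"
 shows "g \<in> borel_measurable Leb"
proof -
 obtain f' where f': "is_rep f f'" using is_rep_exists[OF assms(1)] by blast
 have "AE x in lborel. x \<in> \<Omega> --> f x = f' x" using f' by (simp add: is_rep_def)
 moreover have "AE x in lborel. x \<in> \<Omega> --> f x = g x" using assms(2) by (simp add: AE_dom)
 ultimately have "AE x in lborel. x \<in> \<Omega> --> g x = f' x" by eventually_elim auto
 then have "is_rep g f'" using f' by (simp add: is_rep_def)
 then show ?thesis by (rule is_rep_measurable)
qed

lemma L2_AE_cong: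
 fixes f g :: "'a => 'b::euclidean_space"
 assumes "f \<in> Lp 2 Leb" "AE x in Leb. f x = g x"
 shows "g \<in> Lp 2 Leb"
proof -
 have f: "f \<in> borel_measurable Leb" using assms(1) by (simp add: Lp2_iff)
 have g: "g \<in> borel_measurable Leb" using measurable_AE_cong_dom[OF f assms(2)] .
 have "integrable Leb (\<lambda>x. (norm (f x))^2) \<longleftrightarrow> integrable Leb (\<lambda>x. (norm (g x))^2)"
  using f g assms(2) by (intro integrable_cong_AE) (auto elim: eventually_mono)
 then show ?thesis using assms(1) g by (simp add: Lp2_iff)
qed

abbreviation grad :: "('a => real) => 'a => 'a" where
 "grad \<equiv> weak_gradient \<Omega>"

lemma H1I:
 assumes u: "u \<in> Lp 2 Leb" and G: "G \<in> Lp 2 Leb"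
  and eq: "\<And>\<phi> b. \<phi> \<in> test_functions \<Omega> ==> b \<in> Basis ==>
   (LINT x|Leb. u x * partial b \<phi> x) = - (LINT x|Leb. (G x \<bullet> b) * \<phi> x)"
 shows "u \<in> H1 \<Omega>" "AE x in Leb. grad u x = G x"
proof -
 have hG: "has_weak_gradient \<Omega> u G"
  using eq L2_locally_integrable[OF u] L2_locally_integrable[OF G] by (simp add: has_weak_gradient_def)
 then show "u \<in> H1 \<Omega>" using u G by (auto simp: H1_def)
 have "has_weak_gradient \<Omega> u (grad u)"
  unfolding weak_gradient_def using hG by (rule someI[where P = "has_weak_gradient \<Omega> u"])
 then show "AE x in Leb. grad u x = G x" using hG by (rule weak_gradient_unique)
qed

lemma H1D:
 assumes "u \<in> H1 \<Omega>"
 shows "u \<in> Lp 2 Leb" "grad u \<in> Lp 2 Leb"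
  "\<And>\<phi> b. \<phi> \<in> test_functions \<Omega> ==> b \<in> Basis ==>
   (LINT x|Leb. u x * partial b \<phi> x) = - (LINT x|Leb. (grad u x \<bullet> b) * \<phi> x)"
proof -
 show "u \<in> Lp 2 Leb" using assms by (simp add: H1_def)
 obtain G where G: "G \<in> Lp 2 Leb" "has_weak_gradient \<Omega> u G" using assms by (auto simp: H1_def)
 have w: "has_weak_gradient \<Omega> u (grad u)"
  unfolding weak_gradient_def using G(2) by (rule someI[where P = "has_weak_gradient \<Omega> u"])
 show "grad u \<in> Lp 2 Leb"
  by (rule L2_AE_cong[OF G(1) weak_gradient_unique[OF G(2) w]])
 show "(LINT x|Leb. u x * partial b \<phi> x) = - (LINT x|Leb. (grad u x \<bullet> b) * \<phi> x)"
  if "\<phi> \<in> test_functions \<Omega>" "b \<in> Basis" for \<phi> b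
  using w that by (simp add: has_weak_gradient_def)
qed

lemma integrable_L2_times_test:
 fixes f :: "'a => real"
 assumes "f \<in> Lp 2 Leb" "\<phi> \<in> test_functions \<Omega>"
 shows "integrable Leb (\<lambda>x. f x * \<phi> x)"
 by (rule integrable_loc_times_test[OF L2_locally_integrable[OF assms(1)] assms(2)])

lemma H1_lincomb:
 assumes u: "u \<in> H1 \<Omega>" and v: "v \<in> H1 \<Omega>"
 shows "(\<lambda>x. a * u x + b * v x) \<in> H1 \<Omega>"
  "AE x in Leb. grad (\<lambda>x. a * u x + b * v x) x =
    a *\<^sub>R grad u x + b *\<^sub>R grad v x"
proof -
 note u' = H1D[OF u] and v' = H1D[OF v]
 have L: "(\<lambda>x. a * u x + b * v x) \<in> Lp 2 Leb" using L2_lincomb[OF u'(1) v'(1), of a b] by simp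
 have LG: "(\<lambda>x. a *\<^sub>R grad u x + b *\<^sub>R grad v x) \<in> Lp 2 Leb"
  by (rule L2_lincomb[OF u'(2) v'(2)])
 have eq: "(LINT x|Leb. (a * u x + b * v x) * partial c \<phi> x) =
   - (LINT x|Leb. ((a *\<^sub>R grad u x + b *\<^sub>R grad v x) \<bullet> c) * \<phi> x)"
  if \<phi>: "\<phi> \<in> test_functions \<Omega>" and c: "c \<in> Basis" for \<phi> c
 proof -
  note i = integrable_L2_times_test[OF u'(1) test_function_partial[OF \<phi> c]]
   integrable_L2_times_test[OF v'(1) test_function_partial[OF \<phi> c]]
   integrable_L2_times_test[OF L2_inner_const[OF u'(2) c] \<phi>]
   integrable_L2_times_test[OF L2_inner_const[OF v'(2) c] \<phi>]
  have "(LINT x|Leb. (a * u x + b * v x) * partial c \<phi> x) =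
    a * (LINT x|Leb. u x * partial c \<phi> x) + b * (LINT x|Leb. v x * partial c \<phi> x)"
   using i by (simp add: distrib_right mult.assoc)
  also have "\<dots> = - (a * (LINT x|Leb. (grad u x \<bullet> c) * \<phi> x)
    + b * (LINT x|Leb. (grad v x \<bullet> c) * \<phi> x))"
   using u'(3)[OF \<phi> c] v'(3)[OF \<phi> c] by simp
  also have "\<dots> = - (LINT x|Leb. ((a *\<^sub>R grad u x + b *\<^sub>R grad v x) \<bullet> c) * \<phi> x)"
   using i by (simp add: inner_add_left distrib_right mult.assoc)
  finally show ?thesis .
 qed
 show "(\<lambda>x. a * u x + b * v x) \<in> H1 \<Omega>"
  "AE x in Leb. grad (\<lambda>x. a * u x + b * v x) x =
    a *\<^sub>R grad u x + b *\<^sub>R grad v x"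
  using H1I[OF L LG eq] by auto
qed

lemma H1_wgrad:
 assumes u: "u \<in> H1 \<Omega>" and r: "is_rep u u'" "is_rep (grad u) G'"
 shows "wgrad \<Omega> u' G'"
 unfolding wgrad_def
proof (intro conjI ballI)
 note u' = H1D[OF u]
 show "integrable lborel u'" using L2_integrable[OF u'(1)] is_rep_integral(1)[OF r(1)] by simp
 show "integrable lborel G'" using L2_integrable[OF u'(2)] is_rep_integral(1)[OF r(2)] by simp
 fix \<phi> b assume \<phi>: "\<phi> \<in> test_functions \<Omega>" and b: "b \<in> (Basis :: 'a set)"
 have "(LINT x|lborel. u' x * partial b \<phi> x) = (LINT x|Leb. u x * partial b \<phi> x)"
  by (rule is_rep_integral(2)[symmetric, OF is_rep_mult[OF r(1)]])
   (rule test_function_measurable[OF test_function_partial[OF \<phi> b]])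
 also have "\<dots> = - (LINT x|Leb. (grad u x \<bullet> b) * \<phi> x)" by (rule u'(3)[OF \<phi> b])
 also have "(LINT x|Leb. (grad u x \<bullet> b) * \<phi> x) = (LINT x|lborel. (G' x \<bullet> b) * \<phi> x)"
  by (rule is_rep_integral(2)[OF is_rep_mult[OF is_rep_compose[OF r(2), where h = "\<lambda>z. z \<bullet> b"]]])
   (use test_function_measurable[OF \<phi>] in auto)
 finally show "(LINT x|lborel. u' x * partial b \<phi> x) = - (LINT x|lborel. (G' x \<bullet> b) * \<phi> x)" .
qed

end

section \<open>Local comparison of Sobolev functions with averages\<close>

text \<open>The discriminant inequality. C = 0 has to be covered because it is applied to
  semidefinite forms.\<close>

lemma quadratic_nonneg_imp:
 fixes A B C :: real
 assumes "\<And>t. 0 \<le> A + 2 * t * B + t^2 * C" "0 \<le> A" "0 \<le> C"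
 shows "B^2 \<le> A * C"
proof (cases "C = 0")
 case True
 have "B = 0"
 proof (rule ccontr)
  assume "B \<noteq> 0"
  \<comment> \<open>For C = 0 this t gives the value -1.\<close>
  then show False using assms(1)[of "- (A + 1) / (2 * B)"] True assms(2) by (simp add: field_simps)
 qed
 then show ?thesis using True by simp
next
 case False
 then have C: "C > 0" using assms(3) by simp
 have "0 \<le> A + 2 * (- B / C) * B + (- B / C)^2 * C" by (rule assms(1))
 then have "0 \<le> C * (A + 2 * (- B / C) * B + (- B / C)^2 * C)" using C by (intro mult_nonneg_nonneg) simp_all
 also have "\<dots> = A * C - B^2" using C by (simp add: field_simps power2_eq_square)
 finally show ?thesis by simp
qed

lemma L2_Cauchy_Schwarz:
 fixes f g :: "'a => real"
 assumes f: "f \<in> Lp 2 M" and g: "g \<in> Lp 2 M" and fg: "integrable M (\<lambda>x. f x * g x)"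
 shows "(LINT x|M. f x * g x)^2 \<le> (LINT x|M. (f x)^2) * (LINT x|M. (g x)^2)"
proof (rule quadratic_nonneg_imp)
 have i: "integrable M (\<lambda>x. (f x)^2)" "integrable M (\<lambda>x. (g x)^2)" using f g by (auto simp: Lp2_iff)
 fix t :: real
 have "0 \<le> (LINT x|M. (f x + t * g x)^2)" by (rule Bochner_Integration.integral_nonneg) simp
 also have "\<dots> = (LINT x|M. (f x)^2 + 2 * t * (f x * g x) + t^2 * (g x)^2)"
  by (intro Bochner_Integration.integral_cong) (auto simp: power2_sum power_mult_distrib)
 also have "\<dots> = (LINT x|M. (f x)^2) + 2 * t * (LINT x|M. f x * g x) + t^2 * (LINT x|M. (g x)^2)"
  using i fg by simp
 finally show "0 \<le> (LINT x|M. (f x)^2) + 2 * t * (LINT x|M. f x * g x) + t^2 * (LINT x|M. (g x)^2)" .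
qed (auto intro: Bochner_Integration.integral_nonneg)

context lipschitz_domain
begin

definition mass :: "('a => real) => real" where
 "mass u = (LINT x|Leb. (u x)^2)"

definition energy :: "('a => real) => real" where
 "energy u = (LINT x|Leb. (norm (grad u x))^2)"

definition vol :: real where
 "vol = measure lborel \<Omega>"

lemma mass_nonneg: "0 \<le> mass u" and energy_nonneg: "0 \<le> energy u"
 by (auto simp: mass_def energy_def intro: Bochner_Integration.integral_nonneg)

lemma vol_nonneg: "0 \<le> vol"
 by (simp add: vol_def)

lemma integral_1_dom: "(LINT x|Leb. (1::real)) = vol"
proof -
 have r: "is_rep (\<lambda>x. 1::real) (indicator \<Omega>)" by (auto simp: is_rep_def)
 show ?thesis using is_rep_integral(2)[OF r] by (simp add: vol_def)
qed

lemma L1_norm_square_le: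
 fixes f :: "'a => 'b::euclidean_space"
 assumes f: "f \<in> Lp 2 Leb"
 shows "(LINT x|Leb. norm (f x))^2 \<le> vol * (LINT x|Leb. (norm (f x))^2)"
proof -
 have n: "(\<lambda>x. norm (f x)) \<in> Lp 2 Leb" using f by (auto simp: Lp2_iff)
 have o: "(\<lambda>x. 1::real) \<in> Lp 2 Leb" by (rule bounded_L2[where B = 1]) auto
 show ?thesis
  using L2_Cauchy_Schwarz[OF n o] L2_integrable_mult[OF n o] integral_1_dom by (simp add: mult.commute)
qed

lemma is_rep_continuous:
 assumes "continuous_on (closure \<Omega>) u"
 shows "is_rep u (\<lambda>x. if x \<in> \<Omega> then u x else (0::real))"
proof -
 have "continuous_on \<Omega> u" using assms closure_subset continuous_on_subset by blast
 then have "(\<lambda>x. indicator \<Omega> x *\<^sub>R u x) \<in> borel_measurable borel"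
  using open_dom by (intro borel_measurable_continuous_on_indicator) auto
 moreover have "(\<lambda>x. indicator \<Omega> x *\<^sub>R u x) = (\<lambda>x. if x \<in> \<Omega> then u x else 0)"
  by (auto simp: fun_eq_iff)
 ultimately show ?thesis by (simp add: is_rep_def)
qed

text \<open>The condition r \<le> k / 2 leaves room to move the vertex to any point of the ball,
  even outside the closure of \<Omega>, at scale 1 and with half the opening. The condition r \<le>
  1 fits the range of radii in \<open>hausdorff_ball_bound\<close>.\<close>

lemma cone_exists:
 assumes "x0 \<in> closure \<Omega>"
 shows "\<exists>r e k. cone_at \<Omega> x0 r e k \<and> r \<le> 1 \<and> r \<le> k / 2"
proof -
 obtain r e k where c: "cone_at \<Omega> x0 r e k" using lipschitz_domain_cone[OF lip assms] by blast
 then have "cone_at \<Omega> x0 (min r (min 1 (k / 2))) e k"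
  unfolding cone_at_def by (auto simp del: cball_subset_cball_iff)
 then show ?thesis by (intro exI[of _ "min r (min 1 (k / 2))"] exI[of _ e] exI[of _ k]) auto
qed

text \<open>In \<open>local_average\<close>, m is the average at scale 1 and g is |grad u| extended
  by 0. The bound of m by \<open>mass u\<close> serves embedding and trace, the bound of its
  oscillation by \<open>energy u\<close> alone the Poincare inequality. The pointwise estimate is
  needed twice: almost everywhere for the volume, and everywhere on the closure for the surface,
  which the volume does not see.\<close>

definition avg_bounds ::
 "'a => real => real => real => ('a => real) => ('a => real) => ('a => ennreal) => bool" where
 "avg_bounds x0 r R C u m g \<longleftrightarrow>
   g \<in> borel_measurable borel \<and>
   (\<integral>\<^sup>+y. (g y)^2 \<partial>lborel) = ennreal (energy u) \<and>
   (\<forall>x\<in>ball x0 r. (m x)^2 \<le> C * mass u) \<and>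
   (\<forall>x\<in>ball x0 r. \<forall>y\<in>ball x0 r. (m x - m y)^2 \<le> C * energy u) \<and>
   (AE x in lborel. x \<in> \<Omega> \<inter> ball x0 r --> ennreal \<bar>u x - m x\<bar> \<le> ennreal C * dyad_pot R g x) \<and>
   (continuous_on (closure \<Omega>) u -->
    (\<forall>x\<in>closure \<Omega> \<inter> ball x0 r. ennreal \<bar>u x - m x\<bar> \<le> ennreal C * dyad_pot R g x))"

lemma local_average:
 assumes c: "cone_at \<Omega> x0 rh e kp" and rh: "rh \<le> kp / 2" and x0: "x0 \<in> closure \<Omega>"
 defines "R \<equiv> norm e + kp / 2"
 shows "\<exists>C\<ge>0. \<forall>u\<in>H1 \<Omega>. \<exists>m g. avg_bounds x0 rh R C u m g"
proof -
 define k where "k = kmass e (kp / 2)"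
 have kp: "kp / 2 > 0" "rh > 0" using c by (auto simp: cone_at_def)
 have k: "k > 0" unfolding k_def by (rule kmass_pos[OF kp(1)])
 have R: "R > 0" using kp by (simp add: R_def add_nonneg_pos)
 have cone: "cball (x + s *\<^sub>R e) (s * (kp / 2)) \<subseteq> \<Omega>"
  if "x \<in> ball x0 rh" "x \<in> closure \<Omega>" "0 < s" "s \<le> 1" for x s
 proof -
  have "cball (x + s *\<^sub>R e) (s * (kp / 2)) \<subseteq> cball (x + s *\<^sub>R e) (s * kp)"
   using kp that by (intro subset_cball mult_left_mono) auto
  also have "\<dots> \<subseteq> \<Omega>" using c that unfolding cone_at_def by blast
  finally show ?thesis .
 qed
 \<comment> \<open>At scale 1 the ball with half the opening at x lies inside the ball with full
   opening at x0. So averages at scale 1 can be compared along segments of the ball about x0, even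
   where these leave \<Omega>.\<close>
 have cone1: "cball (x + 1 *\<^sub>R e) (1 * (kp / 2)) \<subseteq> \<Omega>" if x: "x \<in> ball x0 rh" for x
 proof -
  have "cball (x + 1 *\<^sub>R e) (1 * (kp / 2)) \<subseteq> cball (x0 + 1 *\<^sub>R e) (1 * kp)"
  proof
   fix y assume y: "y \<in> cball (x + 1 *\<^sub>R e) (1 * (kp / 2))"
   have "dist (x0 + e) y \<le> dist (x0 + e) (x + e) + dist (x + e) y" by (rule dist_triangle)
   also have "\<dots> \<le> kp" using x y rh by (simp add: dist_norm)
   finally show "y \<in> cball (x0 + 1 *\<^sub>R e) (1 * kp)" by simp
  qed
  also have "\<dots> \<subseteq> \<Omega>"
  proof -
   have "x0 \<in> ball x0 rh \<inter> closure \<Omega>" using x0 kp by simp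
   moreover have "(0::real) < 1 \<and> (1::real) \<le> 1" by simp
   ultimately show ?thesis using c unfolding cone_at_def by blast
  qed
  finally show ?thesis .
 qed
 define C where "C = vol / k^2 + 4 * rh^2 * vol / k^2 + R * 2 ^ DIM('a) / k"
 have C: "C \<ge> 0" "vol / k^2 \<le> C" "4 * rh^2 * vol / k^2 \<le> C" "R * 2 ^ DIM('a) / k \<le> C"
  using R k vol_nonneg by (auto simp: C_def)
 show ?thesis
 proof (intro exI[of _ C] conjI C(1) ballI)
  fix u assume u: "u \<in> H1 \<Omega>"
  note u1 = H1D[OF u]
  \<comment> \<open>If u is continuous on the closure, the representative has to agree with u at
    every point of \<Omega>, because \<open>mol_converges_at\<close> refers to all of them.\<close>
  have "\<exists>u'. is_rep u u' \<and> (continuous_on (closure \<Omega>) u --> (\<forall>x\<in>\<Omega>. u' x = u x))"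
  proof (cases "continuous_on (closure \<Omega>) u")
   case True
   show ?thesis
    by (intro exI[of _ "\<lambda>x. if x \<in> \<Omega> then u x else 0"] conjI is_rep_continuous[OF True]) auto
  next
   case False
   then show ?thesis using is_rep_exists[of u] u1(1) by (auto simp: Lp2_iff)
  qed
  then obtain u' where u': "is_rep u u'" "continuous_on (closure \<Omega>) u --> (\<forall>x\<in>\<Omega>. u' x = u x)" by blast
  obtain G' where G': "is_rep (grad u) G'"
   using is_rep_exists[of "grad u"] u1(2) by (auto simp: Lp2_iff)
  have G'm[measurable]: "G' \<in> borel_measurable borel" using G' by (simp add: is_rep_def)
  have w: "wgrad \<Omega> u' G'" by (rule H1_wgrad[OF u u'(1) G'])
  have u'i: "integrable lborel u'" and G'i: "integrable lborel G'" using w by (auto simp: wgrad_def)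
  have iu: "(LINT y|lborel. \<bar>u' y\<bar>)^2 \<le> vol * mass u"
  proof -
   have "(LINT y|lborel. norm (u' y)) = (LINT y|Leb. norm (u y))"
    by (rule is_rep_integral(2)[symmetric, OF is_rep_compose[OF u'(1)]]) auto
   then show ?thesis using L1_norm_square_le[OF u1(1)] by (simp add: mass_def)
  qed
  have iG: "(LINT y|lborel. norm (G' y))^2 \<le> vol * energy u"
  proof -
   have "(LINT y|lborel. norm (G' y)) = (LINT y|Leb. norm (grad u y))"
    by (rule is_rep_integral(2)[symmetric, OF is_rep_compose[OF G']]) auto
   then show ?thesis using L1_norm_square_le[OF u1(2)] by (simp add: energy_def)
  qed
  define M where "M = (\<lambda>x. mol e (kp / 2) u' x 1)"
  define m where "m = (\<lambda>x. M x / k)"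
  define g where "g = (\<lambda>y. ennreal (norm (G' y)))"
  have g: "g \<in> borel_measurable borel" by (simp add: g_def)
  have "(\<integral>\<^sup>+y. (g y)^2 \<partial>lborel) = (\<integral>\<^sup>+y. ennreal ((norm (G' y))^2) \<partial>lborel)"
   by (simp add: g_def ennreal_power)
  also have "\<dots> = ennreal (LINT y|lborel. (norm (G' y))^2)"
  proof (rule nn_integral_eq_integral)
   have "is_rep (\<lambda>x. (norm (grad u x))^2) (\<lambda>x. (norm (G' x))^2)"
    by (rule is_rep_compose[OF G']) auto
   from is_rep_integral(1)[OF this] show "integrable lborel (\<lambda>x. (norm (G' x))^2)"
    using u1(2) by (simp add: Lp2_iff)
  qed simp
  also have "(LINT y|lborel. (norm (G' y))^2) = energy u"
   unfolding energy_def
   by (rule is_rep_integral(2)[symmetric, OF is_rep_compose[OF G']]) auto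
  finally have g2: "(\<integral>\<^sup>+y. (g y)^2 \<partial>lborel) = ennreal (energy u)" .
  have m1: "(m x)^2 \<le> C * mass u" for x
  proof -
   have "norm (M x) \<le> (LINT y|lborel. \<bar>u' y\<bar>)"
    using ker_integral_bound'[OF kp(1) zero_less_one u'i, of 1 u' e x] by (simp add: M_def mol_def)
   then have "(M x)^2 \<le> (LINT y|lborel. \<bar>u' y\<bar>)^2"
    by (intro abs_le_square_iff[THEN iffD1]) simp
   also have "\<dots> \<le> vol * mass u" by (rule iu)
   finally have "(m x)^2 \<le> vol * mass u / k^2"
    using k by (simp add: m_def power_divide divide_right_mono)
   also have "\<dots> = (vol / k^2) * mass u" by simp
   also have "\<dots> \<le> C * mass u" by (rule mult_right_mono[OF C(2) mass_nonneg])
   finally show ?thesis .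
  qed
  have m2: "(m x - m y)^2 \<le> C * energy u" if x: "x \<in> ball x0 rh" and y: "y \<in> ball x0 rh" for x y
  proof -
   define d where "d = y - x"
   have nd: "norm d \<le> 2 * rh"
    using x y dist_triangle[of x y x0] by (simp add: d_def dist_norm norm_minus_commute)
   define Dv where "Dv = (\<lambda>t. LINT z|lborel. (G' z \<bullet> d) * ker e (kp / 2) (x + t *\<^sub>R d) 1 z)"
   have der: "((\<lambda>t. M (x + t *\<^sub>R d)) has_real_derivative Dv t) (at t)" if t: "0 \<le> t" "t \<le> 1" for t
   proof -
    have "x + t *\<^sub>R d = (1 - t) *\<^sub>R x + t *\<^sub>R y" by (simp add: d_def algebra_simps)
    then have "x + t *\<^sub>R d \<in> ball x0 rh"
     using convexD[OF convex_ball x y, of "1 - t" t] t by simp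
    from mol_path_derivative[OF w kp(1), of 1 t 0 x d e] cone1[OF this]
    show ?thesis by (simp add: M_def Dv_def)
   qed
   have bd: "norm (Dv t) \<le> 2 * rh * (LINT z|lborel. norm (G' z))" for t
   proof -
    have "\<bar>G' z \<bullet> d\<bar> \<le> 2 * rh * norm (G' z)" for z
     using mult_left_mono[OF nd norm_ge_zero[of "G' z"]] Cauchy_Schwarz_ineq2[of "G' z" d] by (simp add: mult.commute)
    from ker_integral_bound'[OF kp(1) zero_less_one G'i _ this] show ?thesis
     using kp by (simp add: Dv_def)
   qed
   have "norm (M (x + 1 *\<^sub>R d) - M (x + 0 *\<^sub>R d)) \<le> 2 * rh * (LINT z|lborel. norm (G' z)) * norm (1 - 0 :: real)"
    by (rule field_differentiable_bound[where S = "{0..1}" and f' = Dv])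
     (use der bd in \<open>auto intro: has_field_derivative_at_within\<close>)
   then have "\<bar>M x - M y\<bar> \<le> 2 * rh * (LINT z|lborel. norm (G' z))"
    by (simp add: d_def abs_minus_commute)
   moreover have "0 \<le> 2 * rh * (LINT z|lborel. norm (G' z))"
    using kp by (intro mult_nonneg_nonneg Bochner_Integration.integral_nonneg) auto
   ultimately have "(M x - M y)^2 \<le> (2 * rh * (LINT z|lborel. norm (G' z)))^2"
    by (intro abs_le_square_iff[THEN iffD1]) simp
   also have "\<dots> = 4 * rh^2 * (LINT z|lborel. norm (G' z))^2" by (simp add: power_mult_distrib)
   also have "\<dots> \<le> 4 * rh^2 * (vol * energy u)" by (intro mult_left_mono iG) auto
   finally have "(m x - m y)^2 \<le> 4 * rh^2 * (vol * energy u) / k^2"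
    using k by (simp add: m_def diff_divide_distrib[symmetric] power_divide divide_right_mono)
   also have "\<dots> = (4 * rh^2 * vol / k^2) * energy u" by simp
   also have "\<dots> \<le> C * energy u" by (rule mult_right_mono[OF C(3) energy_nonneg])
   finally show ?thesis .
  qed
  have pot: "ennreal \<bar>b - m x\<bar> \<le> ennreal C * dyad_pot R g x"
   if x: "x \<in> ball x0 rh" "x \<in> closure \<Omega>" and l: "(\<lambda>i. mol e (kp / 2) u' x ((1/2) ^ r i)) \<leadsto> k * b" for x b r
  proof -
   have "\<bar>b - m x\<bar> = \<bar>(M x - k * b) / k\<bar>" using k by (simp add: m_def diff_divide_distrib)
   then have "ennreal \<bar>b - m x\<bar> = ennreal (1 / k) * ennreal \<bar>M x - k * b\<bar>" using k by (simp add: ennreal_mult[symmetric])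
   also have "ennreal \<bar>M x - k * b\<bar> \<le> ennreal (R * 2 ^ DIM('a)) * dyad_pot R g x"
    unfolding M_def R_def g_def by (rule mol_limit_bound[OF w kp(1) cone[OF x] l])
   also have "ennreal (1 / k) * (ennreal (R * 2 ^ DIM('a)) * dyad_pot R g x) = ennreal (R * 2 ^ DIM('a) / k) * dyad_pot R g x"
    using k R by (simp add: mult.assoc[symmetric] ennreal_mult[symmetric])
   also have "\<dots> \<le> ennreal C * dyad_pot R g x" by (intro mult_right_mono ennreal_leI C(4)) simp
   finally show ?thesis by (simp add: mult_left_mono)
  qed
  obtain r :: "nat => nat" where r: "AE x in lborel. (\<lambda>i. mol e (kp / 2) u' x ((1/2) ^ r i)) \<leadsto> k * u' x"
   using mol_AE_converges[OF u'i kp(1), of e] unfolding k_def by auto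
  have ae: "AE x in lborel. x \<in> \<Omega> --> u x = u' x" using u'(1) by (simp add: is_rep_def)
  have pAE: "AE x in lborel. x \<in> \<Omega> \<inter> ball x0 rh --> ennreal \<bar>u x - m x\<bar> \<le> ennreal C * dyad_pot R g x"
   using r ae
  proof eventually_elim
   fix x assume l: "(\<lambda>i. mol e (kp / 2) u' x ((1/2) ^ r i)) \<leadsto> k * u' x" and e: "x \<in> \<Omega> --> u x = u' x"
   show "x \<in> \<Omega> \<inter> ball x0 rh --> ennreal \<bar>u x - m x\<bar> \<le> ennreal C * dyad_pot R g x"
   proof
    assume x: "x \<in> \<Omega> \<inter> ball x0 rh"
    then have "ennreal \<bar>u' x - m x\<bar> \<le> ennreal C * dyad_pot R g x"
     using closure_subset[of \<Omega>] by (intro pot[OF _ _ l]) auto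
    then show "ennreal \<bar>u x - m x\<bar> \<le> ennreal C * dyad_pot R g x" using e x by simp
   qed
  qed
  have pC: "ennreal \<bar>u x - m x\<bar> \<le> ennreal C * dyad_pot R g x"
   if cont: "continuous_on (closure \<Omega>) u" and x: "x \<in> closure \<Omega> \<inter> ball x0 rh" for x
  proof (rule pot)
   show "x \<in> ball x0 rh" "x \<in> closure \<Omega>" using x by auto
   show "(\<lambda>i. mol e (kp / 2) u' x ((1/2) ^ i)) \<leadsto> k * u x"
    unfolding k_def
   proof (rule mol_converges_at[OF u'i kp(1)])
    show "cball (x + s *\<^sub>R e) (s * (kp / 2)) \<subseteq> \<Omega>" if "0 < s" "s \<le> 1" for s
     using cone[of x s] x that by auto
    fix ep :: real assume "ep > 0"
    then obtain dl where "dl > 0" "\<And>y. y \<in> closure \<Omega> ==> dist y x < dl ==> dist (u y) (u x) < ep"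
     using cont x unfolding continuous_on_iff by blast
    then show "\<exists>dl>0. \<forall>y\<in>\<Omega>. dist y x < dl --> \<bar>u' y - u x\<bar> < ep"
     using u'(2) cont closure_subset[of \<Omega>] by (intro exI[of _ dl]) (auto simp: dist_real_def)
   qed
  qed
  show "\<exists>m g. avg_bounds x0 rh R C u m g"
   unfolding avg_bounds_def
   by (intro exI[of _ m] exI[of _ g] conjI g g2 ballI m1 m2 pAE impI pC) auto
 qed
qed

end

section \<open>Embedding, trace and Poincare inequalities\<close>

lemma powr_add_le:
 fixes a b :: real
 assumes "a \<ge> 0" "b \<ge> 0" "q \<ge> 0"
 shows "(a + b) powr q \<le> 2 powr q * (a powr q + b powr q)"
proof -
 have "(a + b) powr q \<le> (2 * max a b) powr q" using assms by (intro powr_mono2) auto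
 also have "\<dots> = 2 powr q * max a b powr q" by (simp add: powr_mult)
 also have "max a b powr q \<le> a powr q + b powr q" by (auto simp: max_def)
 finally show ?thesis by (simp add: mult_left_mono)
qed

lemma enn2real_le_mult:
 assumes "ennreal x \<le> ennreal C * p" "p < \<infinity>" "0 \<le> C" "0 \<le> x"
 shows "x \<le> C * enn2real p"
proof -
 obtain r where r: "p = ennreal r" "r \<ge> 0" using assms(2) by (cases p) auto
 then show ?thesis using assms by (simp add: ennreal_mult[symmetric] ennreal_le_iff)
qed

lemma nn_square_add:
 fixes a b :: "'b => real"
 assumes "a \<in> borel_measurable M" "b \<in> borel_measurable M" "A \<in> sets M"
 shows "(\<integral>\<^sup>+x\<in>A. ennreal ((a x + b x)^2) \<partial>M) \<le>
  2 * (\<integral>\<^sup>+x\<in>A. ennreal ((a x)^2) \<partial>M) + 2 * (\<integral>\<^sup>+x\<in>A. ennreal ((b x)^2) \<partial>M)"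
proof -
 note assms[measurable]
 have "(\<integral>\<^sup>+x\<in>A. ennreal ((a x + b x)^2) \<partial>M) \<le>
  (\<integral>\<^sup>+x. 2 * (ennreal ((a x)^2) * indicator A x) + 2 * (ennreal ((b x)^2) * indicator A x) \<partial>M)"
 proof (rule nn_integral_mono)
  fix x
  have "(a x + b x)^2 \<le> 2 * (a x)^2 + 2 * (b x)^2"
   using zero_le_power2[of "a x - b x"] by (simp add: power2_eq_square algebra_simps)
  then have "ennreal ((a x + b x)^2) \<le> 2 * ennreal ((a x)^2) + 2 * ennreal ((b x)^2)"
   by (simp add: ennreal_plus[symmetric] ennreal_mult'[symmetric] ennreal_numeral[symmetric] ennreal_leI
     del: ennreal_plus ennreal_numeral)
  then show "ennreal ((a x + b x)^2) * indicator A x \<le>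
    2 * (ennreal ((a x)^2) * indicator A x) + 2 * (ennreal ((b x)^2) * indicator A x)"
   by (auto split: split_indicator)
 qed
 then show ?thesis by (simp add: nn_integral_add nn_integral_cmult)
qed

context lipschitz_domain
begin

text \<open>A finite subcover of the compact closure adds up the local bounds; the constants are
  chosen before i, so uniformity in the family is preserved. The measure is arbitrary, which lets
  volume and surface inequalities be assembled by the same argument.\<close>

lemma closure_localize:
 fixes F :: "'i => 'a => ennreal"
 assumes id: "(\<lambda>x. x) \<in> M \<rightarrow>\<^sub>M borel" and sp: "space M \<subseteq> closure \<Omega>"
  and F[measurable]: "\<And>i. i \<in> H ==> F i \<in> borel_measurable M"
  and loc: "\<And>x0. x0 \<in> closure \<Omega> ==> \<exists>r>0. \<exists>C\<ge>0. \<forall>i\<in>H.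
   (\<integral>\<^sup>+x\<in>ball x0 r. F i x \<partial>M) \<le> ennreal C * N i"
 shows "\<exists>C\<ge>0. \<forall>i\<in>H. (\<integral>\<^sup>+x. F i x \<partial>M) \<le> ennreal C * N i"
proof -
 define Q where "Q = (\<lambda>A. \<exists>C\<ge>0. \<forall>i\<in>H. (\<integral>\<^sup>+x\<in>A. F i x \<partial>M) \<le> ennreal C * N i)"
 have "\<forall>x\<in>closure \<Omega>. \<exists>r. r > 0 \<and> Q (ball x r)" using loc unfolding Q_def by blast
 from bchoice[OF this] obtain r where r: "\<And>x. x \<in> closure \<Omega> ==> r x > 0" "\<And>x. x \<in> closure \<Omega> ==> Q (ball x (r x))"
  by auto
 have comp: "compact (closure \<Omega>)" using bounded_dom by (simp add: compact_closure)
 obtain X where X: "X \<subseteq> closure \<Omega>" "finite X" "closure \<Omega> \<subseteq> (\<Union>x\<in>X. ball x (r x))"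
  by (rule compactE_image[OF comp, of "closure \<Omega>" "\<lambda>x. ball x (r x)"]) (use r(1) in auto)
 have "Q (\<Union>x\<in>X. ball x (r x))" using X(2,1)
 proof (induction X)
  case (insert y Y)
  let ?A = "ball y (r y)" and ?B = "\<Union>x\<in>Y. ball x (r x)"
  have "Q ?A" "Q ?B" using insert r(2) by auto
  then obtain C D where C: "C \<ge> 0" "\<And>i. i \<in> H ==> (\<integral>\<^sup>+x\<in>?A. F i x \<partial>M) \<le> ennreal C * N i"
   and D: "D \<ge> 0" "\<And>i. i \<in> H ==> (\<integral>\<^sup>+x\<in>?B. F i x \<partial>M) \<le> ennreal D * N i"
   unfolding Q_def by auto
  have [measurable]: "indicator ?A \<in> borel_measurable M"
   by (rule measurable_compose[OF id borel_measurable_indicator]) simp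
  have [measurable]: "indicator ?B \<in> borel_measurable M"
   by (rule measurable_compose[OF id borel_measurable_indicator]) (intro borel_open open_UN ballI open_ball)
  have "(\<integral>\<^sup>+x\<in>?A \<union> ?B. F i x \<partial>M) \<le> ennreal (C + D) * N i" if [simp]: "i \<in> H" for i
  proof -
   have "(\<integral>\<^sup>+x\<in>?A \<union> ?B. F i x \<partial>M) \<le> (\<integral>\<^sup>+x. F i x * indicator ?A x + F i x * indicator ?B x \<partial>M)"
    by (rule nn_integral_mono) (auto split: split_indicator)
   also have "\<dots> = (\<integral>\<^sup>+x\<in>?A. F i x \<partial>M) + (\<integral>\<^sup>+x\<in>?B. F i x \<partial>M)"
    by (rule nn_integral_add) auto
   also have "\<dots> \<le> ennreal C * N i + ennreal D * N i" by (intro add_mono C D) auto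
   finally show ?thesis using C D by (simp add: distrib_right)
  qed
  then show ?case using C D unfolding Q_def by (intro exI[of _ "C + D"]) auto
 qed (auto simp: Q_def)
 then obtain C where C: "C \<ge> 0" "\<And>i. i \<in> H ==> (\<integral>\<^sup>+x. F i x * indicator (\<Union>x\<in>X. ball x (r x)) x \<partial>M) \<le> ennreal C * N i"
  unfolding Q_def by auto
 have "(\<integral>\<^sup>+x. F i x * indicator (\<Union>x\<in>X. ball x (r x)) x \<partial>M) = (\<integral>\<^sup>+x. F i x \<partial>M)" for i
  using sp X(3) by (intro nn_integral_cong) (auto split: split_indicator)
 then show ?thesis using C by auto
qed

lemma id_Leb: "(\<lambda>x. x) \<in> Leb \<rightarrow>\<^sub>M borel"
 by (intro measurable_restrict_space1 measurable_completion) simp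

lemma space_Leb: "space Leb \<subseteq> closure \<Omega>"
 using closure_subset by (auto simp: space_restrict_space)

text \<open>The case \<open>M = lborel\<close> gives the local Poincare inequality, a surface measure the trace inequality.\<close>

lemma local_L2_bound:
 fixes M :: "'a measure"
 assumes R: "R > 0" and M: "finite_measure M" "(\<lambda>x. x) \<in> M \<rightarrow>\<^sub>M borel" and c: "c \<ge> 0" and C: "C \<ge> 0"
  and growth: "\<And>y r. 0 < r ==> r \<le> R ==> emeasure M (ball y r \<inter> space M) \<le> ennreal (c * r ^ (DIM('a) - 1))"
 shows "\<exists>K\<ge>0. \<forall>f m g b D. g \<in> borel_measurable borel --> D \<ge> 0 --> (\<forall>x\<in>space M. (m x - b)^2 \<le> D) -->
  (AE x in M. ennreal \<bar>f x - m x\<bar> \<le> ennreal C * dyad_pot R g x) -->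
  (\<integral>\<^sup>+x. ennreal ((f x - b)^2) \<partial>M) \<le> ennreal K * (ennreal D + (\<integral>\<^sup>+y. (g y)^2 \<partial>lborel))"
proof -
 interpret M: finite_measure M by (rule M(1))
 define K where "K = 21 * unit_ball_vol (real DIM('a)) * R ^ DIM('a) * c * R ^ (DIM('a) - 1)"
 have K: "K \<ge> 0" using R c by (simp add: K_def)
 define s where "s = measure M (space M)"
 have s: "emeasure M (space M) = ennreal s" "s \<ge> 0" by (auto simp: s_def M.emeasure_eq_measure)
 have "(\<integral>\<^sup>+x. ennreal ((f x - b)^2) \<partial>M) \<le> ennreal (2 * (s + C^2 * K)) * (ennreal D + (\<integral>\<^sup>+y. (g y)^2 \<partial>lborel))"
  if g: "g \<in> borel_measurable borel" and D: "D \<ge> 0" and mb: "\<forall>x\<in>space M. (m x - b)^2 \<le> D"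
   and ae: "AE x in M. ennreal \<bar>f x - m x\<bar> \<le> ennreal C * dyad_pot R g x" for f m g b D
 proof -
  have pm[measurable]: "dyad_pot R g \<in> borel_measurable M"
   using measurable_compose[OF M(2) dyad_pot_measurable[OF g, of R]] by simp
  define I where "I = (\<integral>\<^sup>+y. (g y)^2 \<partial>lborel)"
  have "(\<integral>\<^sup>+x. ennreal ((f x - b)^2) \<partial>M) \<le> (\<integral>\<^sup>+x. 2 * (ennreal D + (ennreal C)^2 * (dyad_pot R g x)^2) \<partial>M)"
  proof (rule nn_integral_mono_AE, use ae AE_space in eventually_elim)
   fix x assume le: "ennreal \<bar>f x - m x\<bar> \<le> ennreal C * dyad_pot R g x" and x: "x \<in> space M"
   have "(f x - b)^2 \<le> 2 * ((m x - b)^2 + \<bar>f x - m x\<bar>\<^sup>2)"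
    using zero_le_power2[of "(m x - b) - (f x - m x)"] by (simp add: power2_eq_square algebra_simps)
   also have "\<dots> \<le> 2 * (D + \<bar>f x - m x\<bar>\<^sup>2)" using mb x by simp
   finally have "ennreal ((f x - b)^2) \<le> ennreal (2 * (D + \<bar>f x - m x\<bar>\<^sup>2))" by (rule ennreal_leI)
   also have "\<dots> = 2 * (ennreal D + (ennreal \<bar>f x - m x\<bar>)^2)" using D by (simp add: ennreal_mult ennreal_power)
   also have "\<dots> \<le> 2 * (ennreal D + (ennreal C * dyad_pot R g x)^2)"
    using le by (intro mult_left_mono add_mono power_mono) auto
   finally show "ennreal ((f x - b)^2) \<le> 2 * (ennreal D + (ennreal C)^2 * (dyad_pot R g x)^2)"
    by (simp add: power_mult_distrib)
  qed
  also have "\<dots> = 2 * (ennreal D * ennreal s + (ennreal C)^2 * (\<integral>\<^sup>+x. (dyad_pot R g x)^2 \<partial>M))"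
   by (simp add: nn_integral_cmult nn_integral_add s distrib_left mult.assoc)
  also have "\<dots> \<le> 2 * (ennreal D * ennreal s + (ennreal C)^2 * (ennreal K * I))"
   unfolding K_def I_def
   by (intro mult_left_mono add_mono dyad_pot_L2[OF g R M.sigma_finite_measure_axioms M(2) c growth]) auto
  also have "\<dots> = ennreal (2 * s) * ennreal D + ennreal (2 * (C^2 * K)) * I"
   using C K s D by (simp add: ennreal_mult ennreal_power algebra_simps)
  also have "\<dots> \<le> ennreal (2 * (s + C^2 * K)) * ennreal D + ennreal (2 * (s + C^2 * K)) * I"
   using s K by (intro add_mono mult_right_mono ennreal_leI) auto
  finally show ?thesis by (simp add: I_def distrib_left)
 qed
 moreover have "2 * (s + C^2 * K) \<ge> 0" using s K by simp
 ultimately show ?thesis by blast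
qed

lemma H1_scale_energy:
 assumes "u \<in> H1 \<Omega>"
 shows "(\<lambda>x. c * u x) \<in> H1 \<Omega>" "mass (\<lambda>x. c * u x) = c^2 * mass u" "energy (\<lambda>x. c * u x) = c^2 * energy u"
proof -
 have h: "(\<lambda>x. c * u x) \<in> H1 \<Omega>"
  "AE x in Leb. grad (\<lambda>x. c * u x) x = c *\<^sub>R grad u x"
  using H1_lincomb[OF assms assms, of c 0] by auto
 show "(\<lambda>x. c * u x) \<in> H1 \<Omega>" by (rule h(1))
 show "mass (\<lambda>x. c * u x) = c^2 * mass u" by (simp add: mass_def power_mult_distrib)
 have "energy (\<lambda>x. c * u x) = (LINT x|Leb. c^2 * (norm (grad u x))^2)"
  unfolding energy_def
 proof (rule integral_cong_AE)
  show "(\<lambda>x. (norm (grad (\<lambda>x. c * u x) x))^2) \<in> borel_measurable Leb"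
   using H1D(2)[OF h(1)] by (auto simp: Lp2_iff)
  show "(\<lambda>x. c^2 * (norm (grad u x))^2) \<in> borel_measurable Leb"
   using H1D(2)[OF assms] by (auto simp: Lp2_iff)
  show "AE x in Leb. (norm (grad (\<lambda>x. c * u x) x))^2 = c^2 * (norm (grad u x))^2"
   using h(2) by eventually_elim (simp add: power_mult_distrib)
 qed
 then show "energy (\<lambda>x. c * u x) = c^2 * energy u" by (simp add: energy_def)
qed

subsection \<open>Sobolev embedding\<close>

text \<open>The factor 1 at the end is the constant choice of N in
  \<open>closure_localize\<close>.\<close>

lemma Sobolev_local:
 assumes x0: "x0 \<in> closure \<Omega>" and q: "q > 2" "real DIM('a) * (q - 2) \<le> 2 * q"
 shows "\<exists>r>0. \<exists>C\<ge>0. \<forall>u\<in>{u \<in> H1 \<Omega>. mass u + energy u \<le> 1}.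
  (\<integral>\<^sup>+x\<in>ball x0 r. ennreal (\<bar>u x\<bar> powr q) \<partial>Leb) \<le> ennreal C * 1"
proof -
 obtain r e k where c: "cone_at \<Omega> x0 r e k" and r: "r \<le> 1" "r \<le> k / 2" using cone_exists[OF x0] by blast
 have pos: "r > 0" "k > 0" using c by (auto simp: cone_at_def)
 define R where "R = norm e + k / 2"
 have R: "R > 0" using pos by (simp add: R_def add_nonneg_pos)
 obtain C where C: "C \<ge> 0" and loc: "\<forall>u\<in>H1 \<Omega>. \<exists>m g. avg_bounds x0 r R C u m g"
  using local_average[OF c r(2) x0] unfolding R_def by blast
 define W where "W = \<Omega> \<inter> ball x0 r"
 have W[measurable]: "W \<in> sets lborel" by (simp add: W_def)
 have Wf: "emeasure lborel W < \<infinity>"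
  using dom_finite by (rule le_less_trans[rotated]) (auto simp: W_def intro: emeasure_mono)
 obtain D where D: "D \<ge> 0" and pot: "\<And>g::'a => ennreal. g \<in> borel_measurable borel ==>
   (\<integral>\<^sup>+y. (g y)^2 \<partial>lborel) \<le> 1 ==>
   (AE x in lborel. x \<in> W --> dyad_pot R g x < \<infinity>) \<and>
   (\<integral>\<^sup>+x\<in>W. ennreal (enn2real (dyad_pot R g x) powr q) \<partial>lborel) \<le> ennreal D"
  using dyad_pot_Lq[OF R q W Wf] by blast
 define w where "w = measure lborel W"
 have w: "emeasure lborel W = ennreal w" "w \<ge> 0"
  using Wf by (auto simp: w_def emeasure_eq_ennreal_measure)
 define E where "E = 2 powr q * (sqrt C powr q * w + C powr q * D)"
 have E: "E \<ge> 0" using w D by (simp add: E_def)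
 have "(\<integral>\<^sup>+x\<in>ball x0 r. ennreal (\<bar>u x\<bar> powr q) \<partial>Leb) \<le> ennreal E"
  if u: "u \<in> H1 \<Omega>" and n: "mass u + energy u \<le> 1" for u
 proof -
  from loc u obtain m g where a: "avg_bounds x0 r R C u m g" by blast
  then have g[measurable]: "g \<in> borel_measurable borel"
   and g2: "(\<integral>\<^sup>+y. (g y)^2 \<partial>lborel) = ennreal (energy u)"
   and m: "\<And>x. x \<in> ball x0 r ==> (m x)^2 \<le> C * mass u"
   and ae: "AE x in lborel. x \<in> \<Omega> \<inter> ball x0 r --> ennreal \<bar>u x - m x\<bar> \<le> ennreal C * dyad_pot R g x"
   unfolding avg_bounds_def by simp_all
  have "energy u \<le> 1" "mass u \<le> 1" using n mass_nonneg[of u] energy_nonneg[of u] by auto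
  then have g1: "(\<integral>\<^sup>+y. (g y)^2 \<partial>lborel) \<le> 1" unfolding g2 by (simp add: ennreal_le_1)
  note p = pot[OF g g1]
  have mb: "\<bar>m x\<bar> \<le> sqrt C" if "x \<in> ball x0 r" for x
  proof -
   have "(m x)^2 \<le> C * 1" using m[OF that] \<open>mass u \<le> 1\<close> C by (meson mult_left_mono order_trans)
   then show ?thesis using real_le_rsqrt[of "\<bar>m x\<bar>" C] by simp
  qed
  have pt: "AE x in lborel. x \<in> W --> \<bar>u x\<bar> powr q \<le> 2 powr q * (sqrt C powr q + C powr q * enn2real (dyad_pot R g x) powr q)"
   using ae p[THEN conjunct1]
  proof eventually_elim
   fix x assume a: "x \<in> \<Omega> \<inter> ball x0 r --> ennreal \<bar>u x - m x\<bar> \<le> ennreal C * dyad_pot R g x"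
    and f: "x \<in> W --> dyad_pot R g x < \<infinity>"
   show "x \<in> W --> \<bar>u x\<bar> powr q \<le> 2 powr q * (sqrt C powr q + C powr q * enn2real (dyad_pot R g x) powr q)"
   proof
    assume x: "x \<in> W"
    have "\<bar>u x - m x\<bar> \<le> C * enn2real (dyad_pot R g x)"
     using a f x C by (intro enn2real_le_mult) (auto simp: W_def)
    then have "\<bar>u x\<bar> \<le> sqrt C + C * enn2real (dyad_pot R g x)" using mb[of x] x by (auto simp: W_def)
    then have "\<bar>u x\<bar> powr q \<le> (sqrt C + C * enn2real (dyad_pot R g x)) powr q"
     using q by (intro powr_mono2) auto
    also have "\<dots> \<le> 2 powr q * (sqrt C powr q + (C * enn2real (dyad_pot R g x)) powr q)"
     using C q by (intro powr_add_le) auto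
    also have "(C * enn2real (dyad_pot R g x)) powr q = C powr q * enn2real (dyad_pot R g x) powr q"
     by (simp add: powr_mult)
    finally show "\<bar>u x\<bar> powr q \<le> 2 powr q * (sqrt C powr q + C powr q * enn2real (dyad_pot R g x) powr q)" .
   qed
  qed
  have "(\<integral>\<^sup>+x\<in>ball x0 r. ennreal (\<bar>u x\<bar> powr q) \<partial>Leb) =
    (\<integral>\<^sup>+x\<in>\<Omega>. ennreal (\<bar>u x\<bar> powr q) * indicator (ball x0 r) x \<partial>lborel)"
   using open_dom by (simp add: nn_integral_restrict_space nn_integral_completion)
  also have "\<dots> \<le> (\<integral>\<^sup>+x. ennreal (2 powr q) * (ennreal (sqrt C powr q) * indicator W x +
    ennreal (C powr q) * (ennreal (enn2real (dyad_pot R g x) powr q) * indicator W x)) \<partial>lborel)"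
  proof (rule nn_integral_mono_AE, use pt in eventually_elim)
   fix x assume a: "x \<in> W --> \<bar>u x\<bar> powr q \<le> 2 powr q * (sqrt C powr q + C powr q * enn2real (dyad_pot R g x) powr q)"
   show "ennreal (\<bar>u x\<bar> powr q) * indicator (ball x0 r) x * indicator \<Omega> x \<le>
    ennreal (2 powr q) * (ennreal (sqrt C powr q) * indicator W x +
    ennreal (C powr q) * (ennreal (enn2real (dyad_pot R g x) powr q) * indicator W x))"
   proof (cases "x \<in> W")
    case True
    then have "ennreal (\<bar>u x\<bar> powr q) \<le> ennreal (2 powr q * (sqrt C powr q + C powr q * enn2real (dyad_pot R g x) powr q))"
     using a by (intro ennreal_leI) auto
    then show ?thesis using True by (simp add: ennreal_mult W_def)
   qed (auto simp: W_def split: split_indicator)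
  qed
  also have "\<dots> = ennreal (2 powr q) * (ennreal (sqrt C powr q) * emeasure lborel W +
    ennreal (C powr q) * (\<integral>\<^sup>+x\<in>W. ennreal (enn2real (dyad_pot R g x) powr q) \<partial>lborel))"
  proof -
   have "(\<integral>\<^sup>+x\<in>W. ennreal (sqrt C powr q) \<partial>lborel) = ennreal (sqrt C powr q) * emeasure lborel W"
    using W by (simp add: nn_integral_cmult)
   then show ?thesis by (simp add: nn_integral_cmult nn_integral_add)
  qed
  also have "\<dots> \<le> ennreal (2 powr q) * (ennreal (sqrt C powr q) * ennreal w + ennreal (C powr q) * ennreal D)"
   using p w by (intro mult_left_mono add_mono) auto
  also have "\<dots> = ennreal E"
   using w D by (simp add: E_def ennreal_mult)
  finally show ?thesis .
 qed
 then show ?thesis using pos E by (intro exI[of _ r] conjI exI[of _ E]) auto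
qed

lemma Sobolev_embedding:
 assumes q: "q > 2" "real DIM('a) * (q - 2) \<le> 2 * q"
 shows "\<exists>C\<ge>0. \<forall>u\<in>H1 \<Omega>. mass u + energy u \<le> 1 -->
  (\<integral>\<^sup>+x. ennreal (\<bar>u x\<bar> powr q) \<partial>Leb) \<le> ennreal C"
proof -
 have "(\<lambda>x. ennreal (\<bar>u x\<bar> powr q)) \<in> borel_measurable Leb" if "u \<in> {u \<in> H1 \<Omega>. mass u + energy u \<le> 1}" for u
  using that H1D(1)[of u] by (auto simp: Lp2_iff)
 from closure_localize[OF id_Leb space_Leb this Sobolev_local[OF _ q]] show ?thesis by auto
qed

subsection \<open>Poincare inequality\<close>

lemma local_Poincare:
 assumes x0: "x0 \<in> closure \<Omega>"
 shows "\<exists>rh>0. \<exists>C\<ge>0. \<forall>u\<in>H1 \<Omega>. \<exists>b.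
  (\<integral>\<^sup>+x\<in>ball x0 rh. ennreal ((u x - b)^2) \<partial>Leb) \<le> ennreal (C * energy u)"
proof -
 obtain rh e kp where c: "cone_at \<Omega> x0 rh e kp" and rh: "rh \<le> 1" "rh \<le> kp / 2" using cone_exists[OF x0] by blast
 have pos: "rh > 0" "kp > 0" using c by (auto simp: cone_at_def)
 define R where "R = norm e + kp / 2"
 have R: "R > 0" using pos by (simp add: R_def add_nonneg_pos)
 obtain C where C: "C \<ge> 0" and loc: "\<forall>u\<in>H1 \<Omega>. \<exists>m g. avg_bounds x0 rh R C u m g"
  using local_average[OF c rh(2) x0] unfolding R_def by blast
 define W where "W = \<Omega> \<inter> ball x0 rh"
 have W: "W \<in> sets lborel" by (simp add: W_def)
 define M where "M = restrict_space lborel W"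
 have spM: "space M = W" by (simp add: M_def space_restrict_space)
 have emM: "emeasure M A = emeasure lborel A" if "A \<subseteq> W" for A
  unfolding M_def using W that by (intro emeasure_restrict_space) auto
 have "emeasure lborel W < \<infinity>"
  using dom_finite by (rule le_less_trans[rotated]) (auto simp: W_def intro: emeasure_mono)
 then have fin: "finite_measure M" by (intro finite_measureI) (simp add: spM emM)
 define v where "v = unit_ball_vol (real DIM('a)) * R"
 have v: "v \<ge> 0" using R by (simp add: v_def)
 \<comment> \<open>Since r^n \<le> R r^(n-1) for r \<le> R, the volume also satisfies the growth
   condition that is natural for the surface measure.\<close>
 have growth: "emeasure M (ball y r \<inter> space M) \<le> ennreal (v * r ^ (DIM('a) - 1))" if r: "0 < r" "r \<le> R" for y r
 proof -
  obtain k where k: "DIM('a) = Suc k" using DIM_positive[where 'a = 'a] by (metis Suc_pred)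
  have "emeasure M (ball y r \<inter> space M) \<le> ennreal (unit_ball_vol (real DIM('a)) * r ^ DIM('a))"
   using r emeasure_mono[of "ball y r \<inter> W" "ball y r" lborel] by (simp add: spM emM emeasure_ball)
  also have "\<dots> \<le> ennreal (v * r ^ (DIM('a) - 1))"
   using r by (intro ennreal_leI) (simp add: k v_def mult_left_mono mult_right_mono mult.assoc)
  finally show ?thesis .
 qed
 have idM: "(\<lambda>x. x) \<in> M \<rightarrow>\<^sub>M borel" unfolding M_def by (intro measurable_restrict_space1) simp
 obtain K where K: "K \<ge> 0" and est: "\<And>f m g b D. g \<in> borel_measurable borel ==> D \<ge> 0 ==> (\<forall>x\<in>space M. (m x - b)^2 \<le> D) ==>
  (AE x in M. ennreal \<bar>f x - m x\<bar> \<le> ennreal C * dyad_pot R g x) ==>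
  (\<integral>\<^sup>+x. ennreal ((f x - b)^2) \<partial>M) \<le> ennreal K * (ennreal D + (\<integral>\<^sup>+y. (g y)^2 \<partial>lborel))"
  using local_L2_bound[OF R fin idM v C growth] by blast
 have "\<exists>b. (\<integral>\<^sup>+x\<in>ball x0 rh. ennreal ((u x - b)^2) \<partial>Leb) \<le> ennreal (K * (C + 1) * energy u)"
  if u: "u \<in> H1 \<Omega>" for u
 proof -
  from loc u obtain m g where a: "avg_bounds x0 rh R C u m g" by blast
  then have g: "g \<in> borel_measurable borel"
   and g2: "(\<integral>\<^sup>+y. (g y)^2 \<partial>lborel) = ennreal (energy u)"
   and m: "\<And>x y. x \<in> ball x0 rh ==> y \<in> ball x0 rh ==> (m x - m y)^2 \<le> C * energy u"
   and ae: "AE x in lborel. x \<in> W --> ennreal \<bar>u x - m x\<bar> \<le> ennreal C * dyad_pot R g x"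
   unfolding avg_bounds_def W_def by simp_all
  have "(\<integral>\<^sup>+x\<in>ball x0 rh. ennreal ((u x - m x0)^2) \<partial>Leb) = (\<integral>\<^sup>+x. ennreal ((u x - m x0)^2) \<partial>M)"
   using open_dom W unfolding M_def
   by (simp add: nn_integral_restrict_space nn_integral_completion W_def indicator_inter_arith mult.assoc mult.commute[of "indicator \<Omega> _"])
  also have "\<dots> \<le> ennreal K * (ennreal (C * energy u) + ennreal (energy u))"
   unfolding g2[symmetric]
  proof (rule est[OF g])
   show "AE x in M. ennreal \<bar>u x - m x\<bar> \<le> ennreal C * dyad_pot R g x"
    unfolding M_def using ae W by (simp add: AE_restrict_space_iff)
   show "\<forall>x\<in>space M. (m x - m x0)^2 \<le> C * energy u" using m pos by (auto simp: spM W_def)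
  qed (use C energy_nonneg[of u] in simp)
  also have "\<dots> = ennreal (K * (C + 1) * energy u)"
   using K C energy_nonneg[of u] by (simp add: ennreal_mult[symmetric] ennreal_plus[symmetric] algebra_simps del: ennreal_plus)
  finally show ?thesis by blast
 qed
 then show ?thesis using pos K C by (intro exI[of _ rh] conjI exI[of _ "K * (C + 1)"]) auto
qed

lemma ball_measurable_dom[measurable]: "indicator (ball z r) \<in> borel_measurable Leb"
 by (rule measurable_compose[OF id_Leb borel_measurable_indicator]) simp

text \<open>A bound of \<open>u\<close> on a small open set \<open>W\<close> controls the constant \<open>b\<close> of the local inequality, and thereby
 \<open>u\<close> on the whole ball.\<close>

lemma Poincare_propagate:
 assumes C: "C \<ge> 0" and loc: "\<forall>u\<in>H1 \<Omega>. \<exists>b.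
   (\<integral>\<^sup>+x\<in>ball y r. ennreal ((u x - b)^2) \<partial>Leb) \<le> ennreal (C * energy u)"
  and W: "open W" "W \<noteq> {}" "W \<subseteq> ball y r \<inter> \<Omega>"
 shows "\<exists>K\<ge>0. \<forall>u\<in>H1 \<Omega>. \<forall>c. (\<integral>\<^sup>+x\<in>ball y r. ennreal ((u x - c)^2) \<partial>Leb) \<le>
  ennreal K * (ennreal (energy u) + (\<integral>\<^sup>+x\<in>W. ennreal ((u x - c)^2) \<partial>Leb))"
proof -
 have Wl: "W \<in> sets Leb" using W open_dom by (auto simp: sets_restrict_space_iff)
 have eW: "emeasure Leb W = emeasure lborel W" using W open_dom by (simp add: emeasure_restrict_space)
 have "emeasure lborel W \<le> emeasure lborel \<Omega>" using W open_dom by (intro emeasure_mono) auto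
 then have "emeasure lborel W < \<infinity>" using dom_finite by (rule le_less_trans)
 then obtain w where w: "emeasure Leb W = ennreal w" "w \<ge> 0" unfolding eW by (cases "emeasure lborel W") auto
 have w0: "w > 0"
 proof (rule ccontr)
  assume "\<not> w > 0"
  then have "emeasure lborel W = 0" using w eW by simp
  then have "negligible W" using W(1) by (simp add: negligible_iff_null_sets null_sets_def emeasure_completion)
  then show False using open_not_negligible[OF W(1,2)] by simp
 qed
 have B: "ball y r \<inter> \<Omega> \<in> sets Leb" using open_dom by (auto simp: sets_restrict_space_iff)
 have ind: "indicator (ball y r) x = (indicator (ball y r \<inter> \<Omega>) x :: ennreal)" if "x \<in> space Leb" for x
  using that by (auto simp: space_restrict_space split: split_indicator)
 define K where "K = (2 * C + 4 * (vol / w) * C) + 4 * (vol / w)"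
 have "2 * C + 4 * (vol / w) * C \<ge> 0" "4 * (vol / w) \<ge> 0" using C w0 vol_nonneg by simp_all
 then have K: "K \<ge> 0" "2 * C + 4 * (vol / w) * C \<le> K" "4 * (vol / w) \<le> K"
  unfolding K_def by linarith+
 have "(\<integral>\<^sup>+x\<in>ball y r. ennreal ((u x - c)^2) \<partial>Leb) \<le>
  ennreal K * (ennreal (energy u) + (\<integral>\<^sup>+x\<in>W. ennreal ((u x - c)^2) \<partial>Leb))" (is "_ \<le> _ * (_ + ?I)")
  if u: "u \<in> H1 \<Omega>" for u c
 proof -
  have [measurable]: "u \<in> borel_measurable Leb" using H1D(1)[OF u] by (simp add: Lp2_iff)
  obtain b where b: "(\<integral>\<^sup>+x\<in>ball y r. ennreal ((u x - b)^2) \<partial>Leb) \<le> ennreal (C * energy u)" (is "?J \<le> _")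
   using loc u by blast
  have J: "?J = (\<integral>\<^sup>+x\<in>ball y r \<inter> \<Omega>. ennreal ((u x - b)^2) \<partial>Leb)"
   by (intro nn_integral_cong) (simp add: ind)
  have "ennreal ((b - c)^2) * ennreal w = (\<integral>\<^sup>+x\<in>W. ennreal (((b - u x) + (u x - c))^2) \<partial>Leb)"
   using Wl by (simp add: nn_integral_cmult_indicator w)
  also have "\<dots> \<le> 2 * (\<integral>\<^sup>+x\<in>W. ennreal ((b - u x)^2) \<partial>Leb) + 2 * ?I"
   by (rule nn_square_add) (use Wl in auto)
  also have "(\<integral>\<^sup>+x\<in>W. ennreal ((b - u x)^2) \<partial>Leb) \<le> ?J"
   using W(3) by (intro nn_integral_mono) (auto simp: power2_commute split: split_indicator)
  also note b
  finally have "ennreal ((b - c)^2) * ennreal w \<le> 2 * ennreal (C * energy u) + 2 * ?I"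
   by (simp add: mult_left_mono add_right_mono)
  from mult_left_mono[OF this, of "ennreal (vol / w)"]
  have bc: "ennreal ((b - c)^2) * ennreal vol \<le> ennreal (vol / w) * (2 * ennreal (C * energy u) + 2 * ?I)"
   using w0 vol_nonneg by (simp add: ennreal_mult[symmetric] mult.commute)
  have "(\<integral>\<^sup>+x\<in>ball y r. ennreal ((u x - c)^2) \<partial>Leb) =
    (\<integral>\<^sup>+x\<in>ball y r \<inter> \<Omega>. ennreal (((u x - b) + (b - c))^2) \<partial>Leb)"
   by (intro nn_integral_cong) (simp add: ind)
  also have "\<dots> \<le> 2 * ?J + 2 * (\<integral>\<^sup>+x\<in>ball y r \<inter> \<Omega>. ennreal ((b - c)^2) \<partial>Leb)"
   unfolding J by (rule nn_square_add) (use B in auto)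
  also have "(\<integral>\<^sup>+x\<in>ball y r \<inter> \<Omega>. ennreal ((b - c)^2) \<partial>Leb) \<le> ennreal ((b - c)^2) * ennreal vol"
  proof -
   have "emeasure Leb (ball y r \<inter> \<Omega>) \<le> emeasure lborel \<Omega>"
    using open_dom by (simp add: emeasure_restrict_space emeasure_mono)
   also have "\<dots> = ennreal vol" using dom_finite by (simp add: vol_def emeasure_eq_ennreal_measure)
   finally show ?thesis using B by (simp add: nn_integral_cmult_indicator mult_left_mono)
  qed
  also note b
  also note bc
  finally have "(\<integral>\<^sup>+x\<in>ball y r. ennreal ((u x - c)^2) \<partial>Leb) \<le>
    2 * ennreal (C * energy u) + 2 * (ennreal (vol / w) * (2 * ennreal (C * energy u) + 2 * ?I))"
   by (simp add: mult_left_mono add_mono)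
  also have "\<dots> = ennreal (2 * C + 4 * (vol / w) * C) * ennreal (energy u) + ennreal (4 * (vol / w)) * ?I"
   using C w0 vol_nonneg energy_nonneg[of u] by (simp add: ennreal_mult ennreal_plus distrib_left distrib_right mult_ac del: times_divide_eq_left times_divide_eq_right)
  also have "\<dots> \<le> ennreal K * ennreal (energy u) + ennreal K * ?I"
   by (intro add_mono mult_right_mono ennreal_leI K) auto
  finally show ?thesis by (simp add: distrib_left)
 qed
 then show ?thesis using K(1) by blast
qed

text \<open>No compactness of embeddings: the points near which u - c is controlled by the energy
  together with the L2 norm of u - c on one fixed ball form an open and closed subset of the
  connected closure of \<Omega>. For the constant c that belongs to the fixed ball, that norm is
  itself bounded by the energy.\<close>

lemma Poincare:
 "\<exists>C\<ge>0. \<forall>u\<in>H1 \<Omega>. \<exists>c. mass (\<lambda>x. u x - c) \<le> C * energy u"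
proof -
 define loc where "loc = (\<lambda>y rh. rh > 0 \<and> (\<exists>C\<ge>0. \<forall>u\<in>H1 \<Omega>. \<exists>b.
  (\<integral>\<^sup>+x\<in>ball y rh. ennreal ((u x - b)^2) \<partial>Leb) \<le> ennreal (C * energy u)))"
 have "\<forall>y\<in>closure \<Omega>. \<exists>rh. loc y rh" using local_Poincare unfolding loc_def by blast
 from bchoice[OF this] obtain rh where rh: "\<And>y. y \<in> closure \<Omega> ==> loc y (rh y)" by auto
 obtain x1 where "x1 \<in> \<Omega>" using nonempty_dom by blast
 then have x1: "x1 \<in> closure \<Omega>" using closure_subset by blast
 \<comment> \<open>The reference quantity involves the pair of u and c, so that one and the same
   constant c is carried from ball to ball.\<close>
 define N where "N = (\<lambda>(u, c). ennreal (energy u) + (\<integral>\<^sup>+x\<in>ball x1 (rh x1). ennreal ((u x - c)^2) \<partial>Leb))"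
 define bdd where "bdd = (\<lambda>W. \<exists>K\<ge>0. \<forall>(u, c)\<in>H1 \<Omega> \<times> UNIV.
  (\<integral>\<^sup>+x\<in>W. ennreal ((u x - c)^2) \<partial>Leb) \<le> ennreal K * N (u, c))"
 have mono: "bdd W" if "bdd W'" "W \<subseteq> W'" for W W'
 proof -
  from that(1) obtain K where K: "K \<ge> 0" "\<And>u c. u \<in> H1 \<Omega> ==>
   (\<integral>\<^sup>+x. ennreal ((u x - c)^2) * indicator W' x \<partial>Leb) \<le> ennreal K * N (u, c)"
   unfolding bdd_def by auto
  have "(\<integral>\<^sup>+x\<in>W. F x \<partial>Leb) \<le> (\<integral>\<^sup>+x. F x * indicator W' x \<partial>Leb)" for F
   using that(2) by (intro nn_integral_mono) (auto split: split_indicator)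
  from order_trans[OF this K(2)] show ?thesis using K(1) unfolding bdd_def by auto
 qed
 define good where "good = (\<lambda>x. \<exists>r>0. bdd (ball x r))"
 have step: "bdd (ball y (rh y))" if y: "y \<in> closure \<Omega>" and x: "x \<in> closure \<Omega>" "x \<in> ball y (rh y)" "good x" for x y
 proof -
  obtain r K where r: "r > 0" "K \<ge> 0" and K: "\<And>u c. u \<in> H1 \<Omega> ==>
   (\<integral>\<^sup>+x'\<in>ball x r. ennreal ((u x' - c)^2) \<partial>Leb) \<le> ennreal K * N (u, c)"
   using x(3) unfolding good_def bdd_def by auto
  define W where "W = ball x r \<inter> ball y (rh y) \<inter> \<Omega>"
  have W: "open W" "W \<subseteq> ball y (rh y) \<inter> \<Omega>" using open_dom by (auto simp: W_def)
  have "open (ball x r \<inter> ball y (rh y))" "x \<in> ball x r \<inter> ball y (rh y)" using x r by auto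
  then have W0: "W \<noteq> {}" using x(1) unfolding W_def by (metis closure_iff_nhds_not_empty inf_commute subset_refl)
  obtain C where C: "C \<ge> 0" "\<forall>u\<in>H1 \<Omega>. \<exists>b. (\<integral>\<^sup>+x\<in>ball y (rh y). ennreal ((u x - b)^2) \<partial>Leb) \<le> ennreal (C * energy u)"
   using rh[OF y] unfolding loc_def by blast
  obtain L where L: "L \<ge> 0" "\<And>u c. u \<in> H1 \<Omega> ==> (\<integral>\<^sup>+x\<in>ball y (rh y). ennreal ((u x - c)^2) \<partial>Leb) \<le>
   ennreal L * (ennreal (energy u) + (\<integral>\<^sup>+x\<in>W. ennreal ((u x - c)^2) \<partial>Leb))"
   using Poincare_propagate[OF C W(1) W0 W(2)] by auto
  have "(\<integral>\<^sup>+x\<in>ball y (rh y). ennreal ((u x - c)^2) \<partial>Leb) \<le> ennreal (L * (1 + K)) * N (u, c)"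
   if u: "u \<in> H1 \<Omega>" for u c
  proof -
   have "(\<integral>\<^sup>+x\<in>W. ennreal ((u x - c)^2) \<partial>Leb) \<le> ennreal K * N (u, c)"
    by (rule order_trans[OF nn_integral_mono K[OF u]]) (auto simp: W_def split: split_indicator)
   moreover have "ennreal (energy u) \<le> N (u, c)" by (simp add: N_def)
   ultimately have "ennreal (energy u) + (\<integral>\<^sup>+x\<in>W. ennreal ((u x - c)^2) \<partial>Leb) \<le> N (u, c) + ennreal K * N (u, c)"
    by (rule add_mono[rotated])
   from order_trans[OF L(2)[OF u] mult_left_mono[OF this]] show ?thesis
    using L(1) r(2) by (simp add: ennreal_mult algebra_simps)
  qed
  then show ?thesis using L(1) r(2) unfolding bdd_def by (intro exI[of _ "L * (1 + K)"]) auto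
 qed
 have near: "good z" if "y \<in> closure \<Omega>" "x \<in> closure \<Omega>" "x \<in> ball y (rh y)" "good x" and z: "z \<in> ball y (rh y)" for x y z
 proof -
  obtain d where "d > 0" "ball z d \<subseteq> ball y (rh y)" using z openE[OF open_ball] by blast
  then show ?thesis using mono[OF step[OF that(1-4)]] unfolding good_def by blast
 qed
 have self: "y \<in> ball y (rh y)" if "y \<in> closure \<Omega>" for y using rh[OF that] by (simp add: loc_def)
 \<comment> \<open>Used for \<open>good\<close> and for its negation: a good point makes every ball
   of the local inequality that contains it good, so such a ball about a bad point contains no good
   point of the closure.\<close>
 have op: "openin (top_of_set (closure \<Omega>)) {x \<in> closure \<Omega>. Q x}"
  if "\<And>x y. x \<in> closure \<Omega> ==> Q x ==> y \<in> closure \<Omega> ==> y \<in> ball x (rh x) ==> Q y" for Q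
  unfolding openin_contains_ball using that rh unfolding loc_def by (intro conjI ballI) blast+
 define A where "A = {x \<in> closure \<Omega>. good x}"
 have "openin (top_of_set (closure \<Omega>)) A" unfolding A_def by (rule op) (use near self in blast)
 moreover have o: "openin (top_of_set (closure \<Omega>)) {x \<in> closure \<Omega>. \<not> good x}" by (rule op) (use near self in blast)
 have "closure \<Omega> - {x \<in> closure \<Omega>. \<not> good x} = A" by (auto simp: A_def)
 then have "closedin (top_of_set (closure \<Omega>)) A"
  using openin_closedin_eq[of "top_of_set (closure \<Omega>)"] o
  by (metis closedin_def double_diff openin_imp_subset subset_refl topspace_euclidean_subtopology Diff_subset)
 moreover have "bdd (ball x1 (rh x1))" unfolding bdd_def by (intro exI[of _ 1]) (auto simp: N_def)
 then have "x1 \<in> A" using x1 rh[OF x1] by (auto simp: A_def good_def loc_def)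
 moreover have "connected (closure \<Omega>)" by (rule connected_imp_connected_closure[OF connected_dom])
 ultimately have "A = closure \<Omega>" unfolding connected_clopen by blast
 then have "\<exists>r>0. bdd (ball x r)" if "x \<in> closure \<Omega>" for x using that unfolding A_def good_def by blast
 then have "\<exists>r>0. \<exists>K\<ge>0. \<forall>i\<in>H1 \<Omega> \<times> UNIV. (\<integral>\<^sup>+x\<in>ball x0 r. ennreal ((fst i x - snd i)^2) \<partial>Leb) \<le> ennreal K * N i"
  if "x0 \<in> closure \<Omega>" for x0 using that unfolding bdd_def by (simp add: case_prod_beta)
 from closure_localize[OF id_Leb space_Leb _ this] obtain K where K: "K \<ge> 0"
  "\<And>u c. u \<in> H1 \<Omega> ==> (\<integral>\<^sup>+x. ennreal ((u x - c)^2) \<partial>Leb) \<le> ennreal K * N (u, c)"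
  using H1D(1) by (force simp: Lp2_iff)
 obtain C where C: "C \<ge> 0" "\<forall>u\<in>H1 \<Omega>. \<exists>b. (\<integral>\<^sup>+x\<in>ball x1 (rh x1). ennreal ((u x - b)^2) \<partial>Leb) \<le> ennreal (C * energy u)"
  using rh[OF x1] unfolding loc_def by blast
 have "\<exists>c. mass (\<lambda>x. u x - c) \<le> K * (1 + C) * energy u" if u: "u \<in> H1 \<Omega>" for u
 proof -
  have um: "u \<in> borel_measurable Leb" using H1D(1)[OF u] by (simp add: Lp2_iff)
  obtain c where c: "(\<integral>\<^sup>+x\<in>ball x1 (rh x1). ennreal ((u x - c)^2) \<partial>Leb) \<le> ennreal (C * energy u)"
   using C u by blast
  have "(\<integral>\<^sup>+x. ennreal ((u x - c)^2) \<partial>Leb) \<le> ennreal K * (ennreal (energy u) + ennreal (C * energy u))"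
   using c by (intro order_trans[OF K(2)[OF u]] mult_left_mono) (auto simp: N_def)
  also have "\<dots> = ennreal (K * (1 + C) * energy u)"
   using K(1) C(1) energy_nonneg[of u] by (simp add: ennreal_mult[symmetric] ennreal_plus[symmetric] algebra_simps del: ennreal_plus)
  finally have "(\<integral>\<^sup>+x. ennreal ((u x - c)^2) \<partial>Leb) \<le> ennreal (K * (1 + C) * energy u)" .
  moreover have "mass (\<lambda>x. u x - c) = enn2real (\<integral>\<^sup>+x. ennreal ((u x - c)^2) \<partial>Leb)"
   unfolding mass_def by (rule integral_eq_nn_integral) (use um in auto)
  ultimately show ?thesis using K(1) C(1) energy_nonneg[of u] by (intro exI[of _ c]) (simp add: enn2real_leI)
 qed
 then show ?thesis using K(1) C(1) by (intro exI[of _ "K * (1 + C)"]) auto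
qed

subsection \<open>Trace inequality\<close>

lemma frontier_sets[measurable]: "frontier \<Omega> \<in> sets (surface_measure :: 'a measure)"
 using borel_subset_hausdorff unfolding surface_measure_def by (metis borel_closed frontier_closed subsetD)

lemma borel_sets_surface: "A \<in> sets borel ==> A \<in> sets (surface_measure :: 'a measure)"
 using borel_subset_hausdorff unfolding surface_measure_def by blast

text \<open>Cones with vertex on the frontier lie in the open set \<Omega> and therefore miss the
  frontier. This is the hypothesis of \<open>hausdorff_ball_bound\<close>, which yields the growth
  r^(n-1) of the surface measure near x0 that the potential estimate needs.\<close>

lemma trace_local:
 assumes x0: "x0 \<in> closure \<Omega>"
 shows "\<exists>rh>0. \<exists>C\<ge>0. \<forall>u\<in>{u \<in> H1 \<Omega>. continuous_on (closure \<Omega>) u}.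
  (\<integral>\<^sup>+x\<in>ball x0 rh. ennreal ((u x)^2) \<partial>restrict_space surface_measure (frontier \<Omega>)) \<le> ennreal C * ennreal (mass u + energy u)"
proof -
 obtain rh e k where c: "cone_at \<Omega> x0 rh e k" and rh: "rh \<le> 1" "rh \<le> k / 2" using cone_exists[OF x0] by blast
 have pos: "rh > 0" "k > 0" using c by (auto simp: cone_at_def)
 define R where "R = norm e + k / 2"
 have R: "R > 0" using pos by (simp add: R_def add_nonneg_pos)
 obtain C where C: "C \<ge> 0" and loc: "\<forall>u\<in>H1 \<Omega>. \<exists>m g. avg_bounds x0 rh R C u m g"
  using local_average[OF c rh(2) x0] unfolding R_def by blast
 define S where "S = frontier \<Omega> \<inter> ball x0 rh"
 have Sm: "S \<in> sets (surface_measure :: 'a measure)"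
  unfolding S_def by (intro borel_sets_surface) (auto intro: borel_closed)
 have SO: "S \<inter> \<Omega> = {}" using open_dom by (auto simp: S_def frontier_def interior_open)
 have cone: "x' \<notin> ball (x + t *\<^sub>R e) (t * k)" if "x \<in> S" "x' \<in> S" "0 < t" "t \<le> 1" for x x' t
 proof -
  have "x \<in> ball x0 rh \<inter> closure \<Omega>" using that by (auto simp: S_def frontier_def)
  then have "cball (x + t *\<^sub>R e) (t * k) \<subseteq> \<Omega>" using c that unfolding cone_at_def by blast
  then show ?thesis using SO that ball_subset_cball by blast
 qed
 define c0 where "c0 = unit_ball_vol (real (DIM('a) - 1)) * (2 * (2 * (2 + norm e) / min k 1) ^ DIM('a))"
 have c0: "c0 \<ge> 0" using pos by (simp add: c0_def)
 define M where "M = restrict_space (surface_measure :: 'a measure) S"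
 have spM: "space M = S" by (simp add: M_def space_restrict_space surface_measure_def space_hausdorff_measure)
 have hb: "hausdorff_outer (DIM('a) - 1) (S \<inter> ball y r) \<le> ennreal (c0 * r ^ (DIM('a) - 1))" if "0 < r" "r \<le> 1" for y r
  using hausdorff_ball_bound[OF cone pos(2) that] by (simp add: c0_def)
 have growth: "emeasure M (ball y r \<inter> space M) \<le> ennreal (c0 * r ^ (DIM('a) - 1))" if r: "0 < r" for y r
 proof -
  have bs: "ball y r \<inter> S \<in> sets (surface_measure :: 'a measure)"
   using Sm borel_sets_surface[of "ball y r"] by auto
  have "emeasure M (ball y r \<inter> space M) = emeasure surface_measure (ball y r \<inter> S)"
   unfolding spM unfolding M_def using Sm by (intro emeasure_restrict_space) auto
  also have "\<dots> = hausdorff_outer (DIM('a) - 1) (S \<inter> ball y r)"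
   using bs unfolding surface_measure_def by (simp add: emeasure_hausdorff_measure Int_commute)
  also have "\<dots> \<le> ennreal (c0 * r ^ (DIM('a) - 1))"
  proof (cases "r \<le> 1")
   case True
   then show ?thesis using hb[OF r] by simp
  next
   \<comment> \<open>Radii above 1 add nothing, because S lies in the unit ball about x0.\<close>
   case False
   have "hausdorff_outer (DIM('a) - 1) (S \<inter> ball y r) \<le> hausdorff_outer (DIM('a) - 1) (S \<inter> ball x0 1)"
    using rh by (intro hausdorff_outer_mono) (auto simp: S_def)
   also have "\<dots> \<le> ennreal (c0 * 1 ^ (DIM('a) - 1))" by (rule hb) auto
   also have "\<dots> \<le> ennreal (c0 * r ^ (DIM('a) - 1))"
    using False c0 by (intro ennreal_leI mult_left_mono power_mono) auto
   finally show ?thesis .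
  qed
  finally show ?thesis .
 qed
 have Mfin: "emeasure M (space M) < \<infinity>"
 proof -
  have "emeasure M (ball x0 1 \<inter> space M) \<le> ennreal (c0 * 1 ^ (DIM('a) - 1))" by (rule growth) simp
  moreover have "ball x0 1 \<inter> space M = space M" using rh by (auto simp: spM S_def)
  ultimately show ?thesis by (simp add: le_less_trans)
 qed
 interpret M: finite_measure M using Mfin by (intro finite_measureI) auto
 have idM: "(\<lambda>x. x) \<in> measurable M borel"
  unfolding M_def surface_measure_def by (rule measurable_restrict_space1[OF measurable_ident_hausdorff])
 obtain K where K: "K \<ge> 0" and est: "\<And>f m g b D. g \<in> borel_measurable borel ==> D \<ge> 0 ==> (\<forall>x\<in>space M. (m x - b)^2 \<le> D) ==>
  (AE x in M. ennreal \<bar>f x - m x\<bar> \<le> ennreal C * dyad_pot R g x) ==>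
  (\<integral>\<^sup>+x. ennreal ((f x - b)^2) \<partial>M) \<le> ennreal K * (ennreal D + (\<integral>\<^sup>+y. (g y)^2 \<partial>lborel))"
  using local_L2_bound[OF R M.finite_measure_axioms idM c0 C growth] by blast
 have "(\<integral>\<^sup>+x\<in>ball x0 rh. ennreal ((u x)^2) \<partial>restrict_space surface_measure (frontier \<Omega>)) \<le> ennreal (K * (C + 1)) * ennreal (mass u + energy u)"
  if u: "u \<in> H1 \<Omega>" and cont: "continuous_on (closure \<Omega>) u" for u
 proof -
  from loc u obtain m g where a: "avg_bounds x0 rh R C u m g" by blast
  then have g: "g \<in> borel_measurable borel"
   and g2: "(\<integral>\<^sup>+y. (g y)^2 \<partial>lborel) = ennreal (energy u)"
   and m: "\<And>x. x \<in> ball x0 rh ==> (m x)^2 \<le> C * mass u"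
   and ae: "\<And>x. x \<in> closure \<Omega> \<inter> ball x0 rh ==> ennreal \<bar>u x - m x\<bar> \<le> ennreal C * dyad_pot R g x"
   using cont unfolding avg_bounds_def by simp_all
  have Sx: "x \<in> ball x0 rh \<and> x \<in> closure \<Omega>" if "x \<in> S" for x using that by (auto simp: S_def frontier_def)
  have "(\<integral>\<^sup>+x\<in>ball x0 rh. ennreal ((u x)^2) \<partial>restrict_space surface_measure (frontier \<Omega>)) = (\<integral>\<^sup>+x. ennreal ((u x - 0)^2) \<partial>M)"
   unfolding M_def using Sm frontier_sets
   by (simp add: nn_integral_restrict_space S_def indicator_inter_arith mult.assoc mult.commute[of "indicator (frontier \<Omega>) _"])
  also have "\<dots> \<le> ennreal K * (ennreal (C * mass u) + ennreal (energy u))"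
   unfolding g2[symmetric]
   by (rule est[OF g, of _ m]) (use C mass_nonneg[of u] m ae Sx in \<open>auto simp: spM\<close>)
  also have "\<dots> \<le> ennreal (K * (C + 1)) * ennreal (mass u + energy u)"
   using K C energy_nonneg[of u] mass_nonneg[of u]
   by (auto simp: ennreal_mult[symmetric] ennreal_plus[symmetric] mult.assoc algebra_simps simp del: ennreal_plus intro!: ennreal_leI mult_left_mono)
  finally show ?thesis .
 qed
 then show ?thesis using pos K C by (intro exI[of _ rh] conjI exI[of _ "K * (C + 1)"]) auto
qed

lemma continuous_measurable_surface:
 fixes w :: "'a => real"
 assumes "continuous_on (closure \<Omega>) w"
 shows "w \<in> borel_measurable (restrict_space surface_measure (frontier \<Omega>))"
proof -
 have "w \<in> borel_measurable (restrict_space borel (frontier \<Omega>))"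
  by (rule borel_measurable_continuous_on_restrict[OF continuous_on_subset[OF assms]])
   (simp add: frontier_def)
 moreover have "(\<lambda>x. x) \<in> restrict_space surface_measure (frontier \<Omega>) \<rightarrow>\<^sub>M restrict_space borel (frontier \<Omega>)"
 proof (rule measurable_restrict_space3)
  show "(\<lambda>x. x) \<in> (surface_measure :: 'a measure) \<rightarrow>\<^sub>M borel"
   unfolding surface_measure_def by (rule measurable_ident_hausdorff)
 qed auto
 ultimately show ?thesis by (rule measurable_compose[rotated])
qed

lemma trace_inequality:
 "\<exists>C\<ge>0. \<forall>u\<in>H1 \<Omega>. continuous_on (closure \<Omega>) u -->
  (\<integral>\<^sup>+x. ennreal ((u x)^2) \<partial>restrict_space surface_measure (frontier \<Omega>)) \<le> ennreal (C * (mass u + energy u))"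
proof -
 let ?H = "{u \<in> H1 \<Omega>. continuous_on (closure \<Omega>) u}"
 have "(\<lambda>x. ennreal ((u x)^2)) \<in> borel_measurable (restrict_space surface_measure (frontier \<Omega>))" if "u \<in> ?H" for u
  using continuous_measurable_surface[of u] that by auto
 moreover have "(\<lambda>x. x) \<in> restrict_space surface_measure (frontier \<Omega>) \<rightarrow>\<^sub>M (borel :: 'a measure)"
  unfolding surface_measure_def by (rule measurable_restrict_space1[OF measurable_ident_hausdorff])
 moreover have "space (restrict_space (surface_measure :: 'a measure) (frontier \<Omega>)) \<subseteq> closure \<Omega>"
  by (auto simp: space_restrict_space frontier_def)
 ultimately have "\<exists>C\<ge>0. \<forall>u\<in>?H. (\<integral>\<^sup>+x. ennreal ((u x)^2) \<partial>restrict_space surface_measure (frontier \<Omega>)) \<le> ennreal C * ennreal (mass u + energy u)"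
  by (intro closure_localize trace_local)
 then show ?thesis using mass_nonneg energy_nonneg by (auto simp: ennreal_mult)
qed

end

section \<open>Completeness and the chain rule\<close>

abbreviation minus_fun (infixl "\<ominus>" 65) where "u \<ominus> v \<equiv> (\<lambda>x. u x - v x)"

lemma squeeze_0:
 fixes f g :: "nat => 'a::{linorder_topology, zero}"
 assumes "g \<leadsto> 0" "\<And>k. f k \<le> g k" "\<And>k. 0 \<le> f k"
 shows "f \<leadsto> 0"
 by (rule tendsto_sandwich[OF _ _ tendsto_const assms(1)]) (use assms in auto)

text \<open>Meaningful for square integrable functions only: a Bochner integral without
  integrability would be 0.\<close>

abbreviation L2_lim :: "'a measure => (nat => 'a => 'b::euclidean_space) => ('a => 'b) => bool" where
 "L2_lim M f g \<equiv> (\<lambda>k. LINT x|M. (norm (f k x - g x))^2) \<leadsto> 0"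

section \<open>Convergence in L2 and completeness\<close>

lemma L2_square_add_le:
 fixes f g :: "'a => 'b::euclidean_space"
 assumes "f \<in> Lp 2 M" "g \<in> Lp 2 M"
 shows "(LINT x|M. (norm (f x + g x))^2) \<le> 2 * (LINT x|M. (norm (f x))^2) + 2 * (LINT x|M. (norm (g x))^2)"
proof -
 have i: "integrable M (\<lambda>x. (norm (f x))^2)" "integrable M (\<lambda>x. (norm (g x))^2)"
  using assms by (auto simp: Lp2_iff)
 have "(LINT x|M. (norm (f x + g x))^2) \<le> (LINT x|M. 2 * (norm (f x))^2 + 2 * (norm (g x))^2)"
 proof (rule integral_mono')
  show "integrable M (\<lambda>x. 2 * (norm (f x))^2 + 2 * (norm (g x))^2)" using i by simp
  fix x
  have "(norm (f x + g x))^2 \<le> (norm (f x) + norm (g x))^2"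
   by (intro power_mono norm_triangle_ineq) simp
  also have "\<dots> \<le> 2 * (norm (f x))^2 + 2 * (norm (g x))^2"
   using zero_le_power2[of "norm (f x) - norm (g x)"] by (simp add: power2_eq_square algebra_simps)
  finally show "(norm (f x + g x))^2 \<le> 2 * (norm (f x))^2 + 2 * (norm (g x))^2" .
 qed simp
 then show ?thesis using i by simp
qed

text \<open>Riesz-Fischer: on a finite measure space the sequence is Cauchy in L1, a subsequence
  converges almost everywhere, and Fatou's lemma recovers the L2 distance to its limit. The Cauchy
  condition is put on a majorant h, so that one condition on \<open>hsq\<close> serves functions and
  gradients alike.\<close>

lemma L2_complete:
 fixes f :: "nat => 'a => 'b::euclidean_space"
 assumes fin: "finite_measure M" and f: "\<And>k. f k \<in> Lp 2 M"
  and h: "\<And>m n. (LINT x|M. (norm (f m x - f n x))^2) \<le> h m n"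
  and cauchy: "\<And>ep. ep > 0 ==> \<exists>N. \<forall>m\<ge>N. \<forall>n\<ge>N. h m n < ep"
 shows "\<exists>g\<in>Lp 2 M. L2_lim M f g"
proof -
 have cauchy: "\<exists>N. \<forall>m\<ge>N. \<forall>n\<ge>N. (LINT x|M. (norm (f m x - f n x))^2) < ep" if "ep > 0" for ep
  using cauchy[OF that] le_less_trans[OF h] by meson
 interpret finite_measure M by (rule fin)
 have fm[measurable]: "f k \<in> borel_measurable M" for k using f[of k] by (simp add: Lp2_iff)
 have d: "(f m \<ominus> f n) \<in> Lp 2 M" for m n by (rule L2_minus[OF f f])
 define \<mu> where "\<mu> = (LINT x|M. (1::real))"
 have \<mu>: "\<mu> \<ge> 0" unfolding \<mu>_def by (rule Bochner_Integration.integral_nonneg) simp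
 have one: "(\<lambda>x. 1::real) \<in> Lp 2 M" by (simp add: Lp2_iff)
 have L1: "(LINT x|M. norm (h x))^2 \<le> (LINT x|M. (norm (h x))^2) * \<mu>" and L1i: "integrable M h"
  if h: "h \<in> Lp 2 M" for h :: "'a => 'b"
 proof -
  have n: "(\<lambda>x. norm (h x)) \<in> Lp 2 M" using h by (auto simp: Lp2_iff)
  have i: "integrable M (\<lambda>x. norm (h x) * 1)" by (rule L2_integrable_mult[OF n one])
  show "(LINT x|M. norm (h x))^2 \<le> (LINT x|M. (norm (h x))^2) * \<mu>"
   using L2_Cauchy_Schwarz[OF n one i] by (simp add: \<mu>_def)
  show "integrable M h" using i h by (simp add: Lp2_iff integrable_norm_iff)
 qed
 have c1: "\<exists>N. \<forall>i\<ge>N. \<forall>j\<ge>N. (LINT x|M. norm (f i x - f j x)) < e" if e: "e > 0" for e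
 proof -
  have "e^2 / (\<mu> + 1) > 0" using e \<mu> by simp
  from cauchy[OF this] obtain N where N: "\<forall>m\<ge>N. \<forall>n\<ge>N. (LINT x|M. (norm (f m x - f n x))^2) < e^2 / (\<mu> + 1)" by blast
  have "(LINT x|M. norm (f i x - f j x)) < e" if "i \<ge> N" "j \<ge> N" for i j
  proof (rule power2_less_imp_less)
   have "(LINT x|M. norm (f i x - f j x))^2 \<le> (LINT x|M. (norm (f i x - f j x))^2) * \<mu>" by (rule L1[OF d])
   also have "\<dots> \<le> e^2 / (\<mu> + 1) * \<mu>" using N that \<mu> by (intro mult_right_mono) (auto intro: less_imp_le)
   also have "\<dots> < e^2" using e \<mu> by (simp add: field_simps)
   finally show "(LINT x|M. norm (f i x - f j x))^2 < e^2" .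
  qed (use e in simp)
  then show ?thesis by blast
 qed
 obtain r where r: "strict_mono r" "AE x in M. Cauchy (\<lambda>i. f (r i) x)"
  by (rule cauchy_L1_AE_cauchy_subseq[OF L1i[OF f] c1])
 define g where "g = (\<lambda>x. lim (\<lambda>i. f (r i) x))"
 have gm[measurable]: "g \<in> borel_measurable M" unfolding g_def by measurable
 have lim: "AE x in M. (\<lambda>i. f (r i) x) \<leadsto> g x"
  using r(2) by eventually_elim (simp add: g_def Cauchy_convergent_iff convergent_LIMSEQ_iff)
 have le: "(\<integral>\<^sup>+x. ennreal ((norm (f n x - g x))^2) \<partial>M) \<le> ennreal ep"
  if N: "\<forall>m\<ge>N. \<forall>n\<ge>N. (LINT x|M. (norm (f m x - f n x))^2) < ep" and n: "n \<ge> N" for n N ep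
 proof -
  have "(\<integral>\<^sup>+x. ennreal ((norm (f n x - g x))^2) \<partial>M) \<le>
    (\<integral>\<^sup>+x. liminf (\<lambda>i. ennreal ((norm (f n x - f (r i) x))^2)) \<partial>M)"
  proof (rule nn_integral_mono_AE, use lim in eventually_elim)
   fix x assume "(\<lambda>i. f (r i) x) \<leadsto> g x"
   then have "(\<lambda>i. ennreal ((norm (f n x - f (r i) x))^2)) \<leadsto> ennreal ((norm (f n x - g x))^2)"
    by (intro tendsto_intros)
   then show "ennreal ((norm (f n x - g x))^2) \<le> liminf (\<lambda>i. ennreal ((norm (f n x - f (r i) x))^2))"
    using lim_imp_Liminf[OF sequentially_bot] by fastforce
  qed
  also have "\<dots> \<le> liminf (\<lambda>i. \<integral>\<^sup>+x. ennreal ((norm (f n x - f (r i) x))^2) \<partial>M)"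
   by (rule nn_integral_liminf) measurable
  also have "\<dots> \<le> limsup (\<lambda>i. \<integral>\<^sup>+x. ennreal ((norm (f n x - f (r i) x))^2) \<partial>M)"
   by (rule Liminf_le_Limsup) simp
  also have "\<dots> \<le> ennreal ep"
  proof (rule Limsup_bounded)
   show "\<forall>\<^sub>F i in sequentially. (\<integral>\<^sup>+x. ennreal ((norm (f n x - f (r i) x))^2) \<partial>M) \<le> ennreal ep"
    using eventually_ge_at_top[of N]
   proof eventually_elim
    case (elim i)
    have "r i \<ge> N" using seq_suble[OF r(1), of i] elim by simp
    then have "(LINT x|M. (norm (f n x - f (r i) x))^2) < ep" using N n by blast
    moreover have "(\<integral>\<^sup>+x. ennreal ((norm (f n x - f (r i) x))^2) \<partial>M) = ennreal (LINT x|M. (norm (f n x - f (r i) x))^2)"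
     by (rule nn_integral_eq_integral) (use d[of n "r i"] in \<open>auto simp: Lp2_iff\<close>)
    ultimately show ?case by (simp add: ennreal_leI)
   qed
  qed
  finally show ?thesis .
 qed
 have dL: "(f n \<ominus> g) \<in> Lp 2 M"
  if N: "\<forall>m\<ge>N. \<forall>n\<ge>N. (LINT x|M. (norm (f m x - f n x))^2) < ep" and n: "n \<ge> N" for n N ep
 proof -
  have "(\<integral>\<^sup>+x. ennreal ((norm (f n x - g x))^2) \<partial>M) < \<infinity>" using le[OF N n] by (rule le_less_trans) simp
  then have "integrable M (\<lambda>x. (norm (f n x - g x))^2)" by (intro integrableI_nonneg) auto
  then show ?thesis by (simp add: Lp2_iff)
 qed
 obtain N where N: "\<forall>m\<ge>N. \<forall>n\<ge>N. (LINT x|M. (norm (f m x - f n x))^2) < 1" using cauchy[of 1] by auto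
 have gL: "g \<in> Lp 2 M" using L2_minus[OF f[of N] dL[OF N order_refl]] by simp
 moreover have "(\<lambda>k. LINT x|M. (norm (f k x - g x))^2) \<leadsto> 0"
 proof (rule LIMSEQ_I)
  fix ep :: real assume "ep > 0"
  then obtain N where N: "\<forall>m\<ge>N. \<forall>n\<ge>N. (LINT x|M. (norm (f m x - f n x))^2) < ep / 2" using cauchy[of "ep / 2"] by auto
  have "norm ((LINT x|M. (norm (f n x - g x))^2) - 0) < ep" if n: "n \<ge> N" for n
  proof -
   have "(LINT x|M. (norm (f n x - g x))^2) = enn2real (\<integral>\<^sup>+x. ennreal ((norm (f n x - g x))^2) \<partial>M)"
    by (rule integral_eq_nn_integral) auto
   also have "\<dots> \<le> ep / 2" using le[OF N n] \<open>ep > 0\<close> by (intro enn2real_leI) auto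
   moreover have "(LINT x|M. (norm (f n x - g x))^2) \<ge> 0" by (rule Bochner_Integration.integral_nonneg) simp
   ultimately show ?thesis using \<open>ep > 0\<close> by simp
  qed
  then show "\<exists>N. \<forall>n\<ge>N. norm ((LINT x|M. (norm (f n x - g x))^2) - 0) < ep" by blast
 qed
 ultimately show ?thesis by blast
qed

lemma L2_tendsto_integral:
 fixes f :: "nat => 'a => 'b::euclidean_space"
 assumes f: "\<And>k. f k \<in> Lp 2 M" and g: "g \<in> Lp 2 M" and h: "h \<in> Lp 2 M"
  and lim: "L2_lim M f g"
 shows "(\<lambda>k. LINT x|M. f k x \<bullet> h x) \<leadsto> (LINT x|M. g x \<bullet> h x)"
proof -
 have d: "(\<lambda>x. norm (f k x - g x)) \<in> Lp 2 M" for k using L2_minus[OF f g, of k] by (auto simp: Lp2_iff)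
 have h': "(\<lambda>x. norm (h x)) \<in> Lp 2 M" using h by (auto simp: Lp2_iff)
 have "(\<lambda>k. (LINT x|M. f k x \<bullet> h x) - (LINT x|M. g x \<bullet> h x)) \<leadsto> 0"
 proof (rule tendsto_0_le[where K = 1])
  show "(\<lambda>k. sqrt ((LINT x|M. (norm (f k x - g x))^2) * (LINT x|M. (norm (h x))^2))) \<leadsto> 0"
   using tendsto_real_sqrt[OF tendsto_mult_left_zero[OF lim, of "LINT x|M. (norm (h x))^2"]] by simp
  show "\<forall>\<^sub>F k in sequentially. norm ((LINT x|M. f k x \<bullet> h x) - (LINT x|M. g x \<bullet> h x))
    \<le> norm (sqrt ((LINT x|M. (norm (f k x - g x))^2) * (LINT x|M. (norm (h x))^2))) * 1"
  proof (intro always_eventually allI)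
   fix k
   note i = L2_integrable_inner[OF f h, of k] L2_integrable_inner[OF g h]
   have "norm ((LINT x|M. f k x \<bullet> h x) - (LINT x|M. g x \<bullet> h x)) = norm (LINT x|M. (f k x - g x) \<bullet> h x)"
    using i by (simp add: inner_diff_left)
   also have "\<dots> \<le> (LINT x|M. norm (f k x - g x) * norm (h x))"
    by (rule order_trans[OF integral_norm_bound integral_mono])
     (use i L2_integrable_mult[OF d h'] Cauchy_Schwarz_ineq2[of "f k _ - g _"] in \<open>auto simp: inner_diff_left\<close>)
   also have "\<dots> \<le> sqrt ((LINT x|M. (norm (f k x - g x))^2) * (LINT x|M. (norm (h x))^2))"
    using L2_Cauchy_Schwarz[OF d h' L2_integrable_mult[OF d h']] by (rule real_le_rsqrt)
   finally show "norm ((LINT x|M. f k x \<bullet> h x) - (LINT x|M. g x \<bullet> h x))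
    \<le> norm (sqrt ((LINT x|M. (norm (f k x - g x))^2) * (LINT x|M. (norm (h x))^2))) * 1" by simp
  qed
 qed
 then show ?thesis by (simp add: LIM_zero_iff)
qed

lemma L2_bound:
 fixes f :: "'a => 'b::euclidean_space" and g :: "'a => 'c::euclidean_space"
 assumes g: "g \<in> Lp 2 M" and f: "f \<in> borel_measurable M" and le: "\<And>x. norm (f x) \<le> B * norm (g x)"
 shows "f \<in> Lp 2 M" "(LINT x|M. (norm (f x))^2) \<le> B^2 * (LINT x|M. (norm (g x))^2)"
proof -
 have i: "integrable M (\<lambda>x. B^2 * (norm (g x))^2)" using g by (simp add: Lp2_iff)
 have le2: "(norm (f x))^2 \<le> B^2 * (norm (g x))^2" for x
  by (simp add: power_mult_distrib[symmetric] power_mono[OF le norm_ge_zero])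
 have "integrable M (\<lambda>x. (norm (f x))^2)"
  by (rule Bochner_Integration.integrable_bound[OF i]) (use f le2 in auto)
 then show "f \<in> Lp 2 M" using f by (simp add: Lp2_iff)
 show "(LINT x|M. (norm (f x))^2) \<le> B^2 * (LINT x|M. (norm (g x))^2)"
  using integral_mono'[OF i le2] by simp
qed

lemma L2_tendsto_0_add:
 fixes f g :: "nat => 'a => 'b::euclidean_space"
 assumes "\<And>k. f k \<in> Lp 2 M" "\<And>k. g k \<in> Lp 2 M"
  and "(\<lambda>k. LINT x|M. (norm (f k x))^2) \<leadsto> 0" "(\<lambda>k. LINT x|M. (norm (g k x))^2) \<leadsto> 0"
 shows "(\<lambda>k. LINT x|M. (norm (f k x + g k x))^2) \<leadsto> 0"
 by (rule squeeze_0[OF tendsto_add_zero[OF tendsto_mult_right_zero tendsto_mult_right_zero] L2_square_add_le[OF assms(1,2)]])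
  (use assms in auto)

lemma L2_dominated:
 fixes f :: "nat => 'a => 'b::euclidean_space" and g :: "'a => 'c::euclidean_space"
 assumes g: "g \<in> Lp 2 M" and f: "\<And>k. f k \<in> borel_measurable M"
  and le: "\<And>k x. norm (f k x) \<le> B * norm (g x)" and lim: "AE x in M. (\<lambda>k. f k x) \<leadsto> 0"
 shows "(\<lambda>k. LINT x|M. (norm (f k x))^2) \<leadsto> 0"
proof -
 have "(\<lambda>k. LINT x|M. (norm (f k x))^2) \<leadsto> (LINT x|M. 0::real)"
 proof (rule integral_dominated_convergence[where w = "\<lambda>x. B^2 * (norm (g x))^2"])
  show "integrable M (\<lambda>x. B^2 * (norm (g x))^2)" using g by (simp add: Lp2_iff)
  show "AE x in M. (\<lambda>k. (norm (f k x))^2) \<leadsto> 0"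
   using lim
  proof eventually_elim
   fix x assume "(\<lambda>k. f k x) \<leadsto> 0"
   from tendsto_power[OF tendsto_norm[OF this], of 2] show "(\<lambda>k. (norm (f k x))^2) \<leadsto> 0" by simp
  qed
  show "AE x in M. norm ((norm (f k x))^2) \<le> B^2 * (norm (g x))^2" for k
   unfolding real_norm_def by (rule AE_I2) (simp add: power_mult_distrib[symmetric] power_mono[OF le norm_ge_zero])
 qed (use f in measurable)
 then show ?thesis by simp
qed

lemma L2_tendsto_AE_subseq:
 fixes f :: "nat => 'a => real"
 assumes f: "\<And>k. f k \<in> Lp 2 M" and g: "g \<in> Lp 2 M" and lim: "L2_lim M f g"
 shows "\<exists>r::nat=>nat. strict_mono r \<and> (AE x in M. (\<lambda>k. f (r k) x) \<leadsto> g x)"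
proof -
 have d: "(f k \<ominus> g) \<in> Lp 2 M" for k by (rule L2_minus[OF f g])
 have "\<exists>r::nat=>nat. strict_mono r \<and> (AE x in M. (\<lambda>k. (f (r k) x - g x)^2) \<leadsto> 0)"
  by (rule tendsto_L1_AE_subseq) (use d lim in \<open>auto simp: Lp2_iff\<close>)
 then obtain r :: "nat => nat" where r: "strict_mono r" "AE x in M. (\<lambda>k. (f (r k) x - g x)^2) \<leadsto> 0" by auto
 have "AE x in M. (\<lambda>k. f (r k) x) \<leadsto> g x"
  using r(2) by eventually_elim (simp add: LIM_zero_iff)
 then show ?thesis using r(1) by blast
qed

section \<open>Composition with C1 functions of bounded derivative\<close>

definition C1_bounded :: "(real => real) => (real => real) => real => bool" where
 "C1_bounded h h' B \<longleftrightarrow> (\<forall>t. (h has_real_derivative h' t) (at t)) \<and> continuous_on UNIV h' \<and> (\<forall>t. \<bar>h' t\<bar> \<le> B)"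

lemma C1_bounded_lipschitz:
 assumes "C1_bounded h h' B"
 shows "\<bar>h s - h t\<bar> \<le> B * \<bar>s - t\<bar>" "h \<in> borel_measurable borel" "h' \<in> borel_measurable borel" "0 \<le> B"
  "continuous_on S h"
proof -
 show "\<bar>h s - h t\<bar> \<le> B * \<bar>s - t\<bar>"
  using field_differentiable_bound[of UNIV h h' B t s] assms
  by (auto simp: C1_bounded_def abs_minus_commute)
 show c: "continuous_on S h" for S
  using assms by (auto simp: C1_bounded_def intro!: continuous_at_imp_continuous_on DERIV_isCont)
 show "h \<in> borel_measurable borel" by (rule borel_measurable_continuous_onI[OF c])
 show "h' \<in> borel_measurable borel" using assms by (auto simp: C1_bounded_def intro: borel_measurable_continuous_onI)
 show "0 \<le> B" using assms abs_ge_zero order_trans unfolding C1_bounded_def by blast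
qed

lemma test_function_directional:
 assumes "\<phi> \<in> test_functions \<Omega>"
 shows "((\<lambda>t. \<phi> (y + t *\<^sub>R b)) has_real_derivative partial b \<phi> y) (at 0)"
proof -
 have "Ck (Suc 0) \<phi>" using assms unfolding test_functions_def by blast
 then have d: "(\<phi> has_derivative frechet_derivative \<phi> (at y)) (at y)"
  by (simp add: frechet_derivative_works)
 have "((\<lambda>t. \<phi> (y + t *\<^sub>R b)) has_derivative (\<lambda>t. frechet_derivative \<phi> (at y) (t *\<^sub>R b))) (at 0)"
  by (rule has_derivative_compose[of "\<lambda>t. y + t *\<^sub>R b" "\<lambda>t. t *\<^sub>R b" 0 UNIV \<phi>])
   (use d in \<open>auto intro!: derivative_eq_intros\<close>)
 then show ?thesis
  using linear_scale[OF has_derivative_linear[OF d]]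
  by (simp add: has_field_derivative_def partial_def mult_commute_abs)
qed

lemma test_function_integrable:
 fixes \<phi> :: "'a::euclidean_space => real"
 assumes "\<phi> \<in> test_functions \<Omega>"
 shows "integrable lborel \<phi>"
proof -
 let ?K = "closure {x. \<phi> x \<noteq> 0}"
 have K: "compact ?K" using assms by (simp add: test_functions_def)
 obtain B where B: "\<And>x. \<bar>\<phi> x\<bar> \<le> B" using test_function_bounded[OF assms] by auto
 show ?thesis
 proof (rule Bochner_Integration.integrable_bound)
  show "integrable lborel (\<lambda>x. B * indicator ?K x)"
   using emeasure_compact_finite[OF K] K by (intro integrable_mult_right integrable_real_indicator) (auto intro: borel_compact)
  show "\<phi> \<in> borel_measurable lborel" using test_function_measurable[OF assms] by simp
  show "AE x in lborel. norm (\<phi> x) \<le> norm (B * indicator ?K x)"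
  proof (rule AE_I2)
   fix x
   show "norm (\<phi> x) \<le> norm (B * indicator ?K x)"
    using B[of x] closure_subset[of "{x. \<phi> x \<noteq> 0}"] by (cases "\<phi> x = 0") (auto split: split_indicator)
  qed
 qed
qed

lemma integrable_bounded_mult:
 fixes f h :: "'a => real"
 assumes "integrable M f" "h \<in> borel_measurable M" "\<And>x. \<bar>h x\<bar> \<le> B"
 shows "integrable M (\<lambda>x. h x * f x)"
proof (rule Bochner_Integration.integrable_bound)
 show "integrable M (\<lambda>x. B * f x)" using assms by auto
 show "(\<lambda>x. h x * f x) \<in> borel_measurable M" using assms by auto
 show "AE x in M. norm (h x * f x) \<le> norm (B * f x)"
  unfolding norm_mult using assms(3) by (intro AE_I2 mult_right_mono) (auto intro: order_trans[OF _ abs_ge_self])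
qed

text \<open>Differentiability of f is asked only on the support of \<phi>, since near any other
  point the product vanishes. Averages of a weakly differentiable function offer no more: their
  derivative is known only where the ball of the kernel stays in \<Omega>.\<close>

lemma test_function_by_parts:
 fixes f :: "'a::euclidean_space => real"
 assumes \<phi>: "\<phi> \<in> test_functions \<Omega>" and b: "b \<in> Basis"
  and d: "\<And>y. y \<in> closure {x. \<phi> x \<noteq> 0} ==> ((\<lambda>t. f (y + t *\<^sub>R b)) has_real_derivative f' y) (at 0)"
  and [measurable]: "f \<in> borel_measurable borel" "f' \<in> borel_measurable borel"
  and P: "\<And>x. \<bar>f x\<bar> \<le> P" and Q: "\<And>x. \<bar>f' x\<bar> \<le> Q"
 shows "(LINT x|lborel. f x * partial b \<phi> x) = - (LINT x|lborel. f' x * \<phi> x)"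
proof -
 define K where "K = closure {x. \<phi> x \<noteq> 0}"
 have K: "compact K" using \<phi> by (simp add: K_def test_functions_def)
 note \<psi> = test_function_partial[OF \<phi> b]
 note [measurable] = test_function_measurable[OF \<phi>] test_function_measurable[OF \<psi>]
 obtain R where R: "\<And>x. \<bar>\<phi> x\<bar> \<le> R" using test_function_bounded[OF \<phi>] by auto
 obtain S where S: "\<And>x. \<bar>partial b \<phi> x\<bar> \<le> S" using test_function_bounded[OF \<psi>] by auto
 have out: "\<phi> x = 0" "partial b \<phi> x = 0" if "x \<notin> K" for x
  using that partial_support[of b \<phi>] closure_subset[of "{x. \<phi> x \<noteq> 0}"] by (auto simp: K_def)
 obtain r where r: "\<And>x. x \<in> K ==> norm x \<le> r" using compact_imp_bounded[OF K] unfolding bounded_iff by auto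
 have i: "integrable lborel (\<lambda>x. f x * partial b \<phi> x)" "integrable lborel (\<lambda>x. f' x * \<phi> x)" "integrable lborel (\<lambda>x. f x * \<phi> x)"
  using integrable_bounded_mult[OF test_function_integrable[OF \<psi>] _ P] integrable_bounded_mult[OF test_function_integrable[OF \<phi>] _ P]
   integrable_bounded_mult[OF test_function_integrable[OF \<phi>] _ Q] by simp_all
 have "(LINT x|lborel. f x * partial b \<phi> x + f' x * \<phi> x) = 0"
 proof (rule integral_directional_derivative_0[where F = "\<lambda>x. f x * \<phi> x" and b = b])
  show "((\<lambda>t. f (y + t *\<^sub>R b) * \<phi> (y + t *\<^sub>R b)) has_real_derivative f y * partial b \<phi> y + f' y * \<phi> y) (at 0)" for y
  proof (cases "y \<in> K")
   case True
   from DERIV_mult[OF d[OF this[unfolded K_def]] test_function_directional[OF \<phi>, of y b]]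
   show ?thesis by (simp add: algebra_simps)
  next
   case False
   have "open (- K)" by (rule open_Compl) (simp add: K_def)
   moreover have "((\<lambda>t. y + t *\<^sub>R b) \<longlongrightarrow> y + 0 *\<^sub>R b) (at 0)" by (intro tendsto_intros)
   ultimately have "\<forall>\<^sub>F t in at 0. y + t *\<^sub>R b \<in> - K" using False by (intro topological_tendstoD) auto
   then have "\<forall>\<^sub>F t in nhds 0. y + t *\<^sub>R b \<in> - K" using False by (simp add: eventually_nhds_conv_at)
   then have "\<forall>\<^sub>F t in nhds 0. 0 = f (y + t *\<^sub>R b) * \<phi> (y + t *\<^sub>R b)"
    by eventually_elim (simp add: out)
   from DERIV_cong_ev[OF refl this refl, THEN iffD1, OF DERIV_const] show ?thesis
    using out[OF False] by simp
  qed
  show "\<bar>f y * partial b \<phi> y + f' y * \<phi> y\<bar> \<le> P * S + Q * R" for y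
   by (rule order_trans[OF abs_triangle_ineq], rule add_mono; subst abs_mult, rule mult_mono)
    (use P Q R S order_trans[OF abs_ge_zero P] order_trans[OF abs_ge_zero Q] in auto)
  show "norm y \<le> r" if "f y * \<phi> y \<noteq> 0" for y using that out(1)[of y] r[of y] by auto
 qed (use i in auto)
 then show ?thesis using i by simp
qed

lemma L1_dominated_tendsto_0:
 fixes H F :: "nat => 'a => real"
 assumes F: "\<And>n. integrable M (F n)" "(\<lambda>n. LINT x|M. \<bar>F n x\<bar>) \<leadsto> 0"
  and H: "\<And>n. H n \<in> borel_measurable M" "\<And>n x. \<bar>H n x\<bar> \<le> C * \<bar>F n x\<bar>"
 shows "integrable M (H n)" "(\<lambda>n. LINT x|M. H n x) \<leadsto> 0"
proof -
 show i: "integrable M (H n)" for n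
  by (rule Bochner_Integration.integrable_bound[of M "\<lambda>x. C * \<bar>F n x\<bar>"])
   (use F H in \<open>auto intro!: AE_I2 order_trans[OF H(2) abs_ge_self]\<close>)
 show "(\<lambda>n. LINT x|M. H n x) \<leadsto> 0"
 proof (rule tendsto_0_le[OF F(2), where K = C], intro always_eventually allI)
  fix n
  have "norm (LINT x|M. H n x) \<le> (LINT x|M. C * \<bar>F n x\<bar>)"
   by (rule order_trans[OF integral_norm_bound integral_mono]) (use i F H in auto)
  then show "norm (LINT x|M. H n x) \<le> norm (LINT x|M. \<bar>F n x\<bar>) * C" by (simp add: mult.commute)
 qed
qed

text \<open>Mollification reduces the chain rule to the classical one: the averages converge in \<open>L\<^sup>1\<close> together
 with their gradients, and \<open>h'\<close> is bounded and continuous.\<close>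

lemma wgrad_chain:
 fixes u :: "'a::euclidean_space => real"
 assumes w: "wgrad \<Omega> u G" and h: "C1_bounded h h' B" and op: "open \<Omega>"
  and \<phi>: "\<phi> \<in> test_functions \<Omega>" and b: "b \<in> Basis"
 shows "(LINT x|lborel. h (u x) * partial b \<phi> x) = - (LINT x|lborel. (h' (u x) * (G x \<bullet> b)) * \<phi> x)"
proof -
 have u: "integrable lborel u" and G: "integrable lborel G" using w by (auto simp: wgrad_def)
 note hm[measurable] = C1_bounded_lipschitz(2,3)[OF h]
 have hB: "\<bar>h' t\<bar> \<le> B" "B \<ge> 0" for t using h C1_bounded_lipschitz(4)[OF h] by (auto simp: C1_bounded_def)
 define K where "K = closure {x. \<phi> x \<noteq> 0}"
 have K: "compact K" "K \<subseteq> \<Omega>" using \<phi> by (auto simp: K_def test_functions_def)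
 note \<psi> = test_function_partial[OF \<phi> b]
 note [measurable] = test_function_measurable[OF \<phi>] test_function_measurable[OF \<psi>]
 obtain P where P: "\<And>x. \<bar>\<phi> x\<bar> \<le> P" using test_function_bounded[OF \<phi>] by auto
 obtain Q where Q: "\<And>x. \<bar>partial b \<phi> x\<bar> \<le> Q" using test_function_bounded[OF \<psi>] by auto
 \<comment> \<open>Half the distance from the support of \<phi> to the complement of \<Omega>:
   kernels of this radius with e = 0 stay in \<Omega> at all scales up to 1.\<close>
 obtain rh where rh: "rh > 0" "\<And>x. x \<in> K ==> cball x rh \<subseteq> \<Omega>"
 proof -
  have "K \<inter> - \<Omega> = {}" using K(2) by blast
  then obtain d where d: "d > 0" "\<forall>x\<in>K. \<forall>y\<in>- \<Omega>. d \<le> dist x y"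
   using separate_compact_closed[OF K(1), of "- \<Omega>"] op by (auto simp: closed_Compl)
  show ?thesis
  proof (rule that[of "d / 2"])
   fix x assume "x \<in> K"
   then show "cball x (d / 2) \<subseteq> \<Omega>" using d by force
  qed (use d in simp)
 qed
 define k where "k = kmass (0::'a) rh"
 have k: "k > 0" unfolding k_def by (rule kmass_pos[OF rh(1)])
 define g where "g = (\<lambda>x. G x \<bullet> b)"
 have g: "integrable lborel g" using G by (simp add: g_def)
 have [measurable]: "u \<in> borel_measurable borel" "g \<in> borel_measurable borel" using u g by auto
 define A where "A = (\<lambda>f n (x::'a). mol 0 rh f x ((1/2) ^ n) / k)"
 have Ab: "\<exists>c. \<forall>x. \<bar>A f n x\<bar> \<le> c" and Ai: "\<exists>N. \<forall>n\<ge>N. integrable lborel (\<lambda>x. A f n x - f x)"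
  and Al: "(\<lambda>n. LINT x|lborel. \<bar>A f n x - f x\<bar>) \<leadsto> 0" if f: "integrable lborel f" for f :: "'a => real" and n :: nat
 proof -
  have e: "A f n x - f x = (mol 0 rh f x ((1/2) ^ n) - kmass (0::'a) rh * f x) / k" for n x
   using k by (simp add: A_def k_def diff_divide_distrib)
  have "\<bar>mol 0 rh f x ((1/2) ^ n)\<bar> \<le> (1 / (1/2) ^ n) ^ DIM('a) * (LINT y|lborel. norm (f y))" for x
   using ker_integral_bound'[OF rh(1) _ f, of "(1/2) ^ n" 1 f] by (simp add: mol_def)
  from divide_right_mono[OF this, of k] show "\<exists>c. \<forall>x. \<bar>A f n x\<bar> \<le> c"
   using k unfolding A_def by (intro exI allI) (simp add: abs_divide)
  show "(\<lambda>n. LINT x|lborel. \<bar>A f n x - f x\<bar>) \<leadsto> 0"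
   using tendsto_divide[OF mol_L1_seq(2)[OF f rh(1), of 0] tendsto_const[of k]] k by (simp add: e abs_divide)
  show "\<exists>N. \<forall>n\<ge>N. integrable lborel (\<lambda>x. A f n x - f x)"
   using mol_L1_seq(1)[OF f rh(1), of 0] unfolding e by (auto intro!: integrable_divide)
 qed
 obtain N1 N2 where N: "\<And>n. n \<ge> N1 ==> integrable lborel (\<lambda>x. A u n x - u x)"
  "\<And>n. n \<ge> N2 ==> integrable lborel (\<lambda>x. A g n x - g x)" using Ai[OF u] Ai[OF g] by blast
 obtain r :: "nat => nat" where r: "strict_mono r" and rl: "AE x in lborel. (\<lambda>i. mol 0 rh u x ((1/2) ^ r i)) \<leadsto> k * u x"
  using mol_AE_converges[OF u rh(1), of 0] unfolding k_def by auto
 \<comment> \<open>Along r the averages of u converge almost everywhere; starting at N1 + N2 makes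
   all differences integrable.\<close>
 define q where "q = (\<lambda>n. r (n + (N1 + N2)))"
 have q: "strict_mono q" using r by (simp add: q_def strict_mono_def)
 have qN: "q n \<ge> N1" "q n \<ge> N2" for n
  using seq_suble[OF r, of "n + (N1 + N2)"] unfolding q_def by linarith+
 define U where "U = (\<lambda>n. A u (q n))"
 define W where "W = (\<lambda>n. A g (q n))"
 have [measurable]: "U n \<in> borel_measurable borel" "W n \<in> borel_measurable borel" for n
  unfolding U_def W_def A_def by measurable
 have iU: "integrable lborel (U n \<ominus> u)" and iW: "integrable lborel (W n \<ominus> g)" for n
  using N qN by (simp_all add: U_def W_def)
 have Ul: "(\<lambda>n. LINT x|lborel. \<bar>U n x - u x\<bar>) \<leadsto> 0" and Wl: "(\<lambda>n. LINT x|lborel. \<bar>W n x - g x\<bar>) \<leadsto> 0"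
  using LIMSEQ_subseq_LIMSEQ[OF Al[OF u] q] LIMSEQ_subseq_LIMSEQ[OF Al[OF g] q] by (simp_all add: U_def W_def o_def)
 have Uae: "AE x in lborel. (\<lambda>n. U n x) \<leadsto> u x"
  using rl
 proof eventually_elim
  fix x assume "(\<lambda>i. mol 0 rh u x ((1/2) ^ r i)) \<leadsto> k * u x"
  from tendsto_divide[OF LIMSEQ_ignore_initial_segment[OF this] tendsto_const[of k]]
  show "(\<lambda>n. U n x) \<leadsto> u x" using k by (simp add: U_def A_def q_def)
 qed
 have UW: "\<exists>c. \<forall>x. \<bar>h (U n x)\<bar> \<le> c" "\<exists>c. \<forall>x. \<bar>h' (U n x) * W n x\<bar> \<le> c" for n
 proof -
  obtain c d where c: "\<And>x. \<bar>U n x\<bar> \<le> c" and d: "\<And>x. \<bar>W n x\<bar> \<le> d" using Ab[OF u] Ab[OF g] unfolding U_def W_def by meson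
  have "\<bar>h (U n x)\<bar> \<le> \<bar>h 0\<bar> + B * c" for x
   using C1_bounded_lipschitz(1)[OF h, of "U n x" 0] mult_left_mono[OF c[of x] hB(2)] by simp
  moreover have "\<bar>h' (U n x) * W n x\<bar> \<le> B * d" for x unfolding abs_mult using hB d by (intro mult_mono) auto
  ultimately show "\<exists>c. \<forall>x. \<bar>h (U n x)\<bar> \<le> c" "\<exists>c. \<forall>x. \<bar>h' (U n x) * W n x\<bar> \<le> c" by blast+
 qed
 have ibp: "(LINT x|lborel. h (U n x) * partial b \<phi> x) = - (LINT x|lborel. (h' (U n x) * W n x) * \<phi> x)" for n
 proof -
  obtain c d where cd: "\<And>x. \<bar>h (U n x)\<bar> \<le> c" "\<And>x. \<bar>h' (U n x) * W n x\<bar> \<le> d" using UW by meson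
  show ?thesis
  proof (rule test_function_by_parts[OF \<phi> b _ _ _ cd])
   fix y assume "y \<in> closure {x. \<phi> x \<noteq> 0}"
   then have y: "cball y rh \<subseteq> \<Omega>" using rh(2) by (simp add: K_def)
   have "(1/2) ^ q n * rh \<le> rh" using rh(1) by (intro mult_left_le_one_le) (auto simp: power_le_one)
   then have "cball (y + 0 *\<^sub>R b + ((1/2) ^ q n + 0 * 0) *\<^sub>R 0) (((1/2) ^ q n + 0 * 0) * rh) \<subseteq> cball y rh"
    by (simp add: subset_cball)
   from mol_path_derivative[OF w rh(1), of "(1/2) ^ q n" 0 0 y b 0, OF _ order_trans[OF this y]]
   have "((\<lambda>t. mol 0 rh u (y + t *\<^sub>R b) ((1/2) ^ q n)) has_real_derivative mol 0 rh g y ((1/2) ^ q n)) (at 0)"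
    by (simp add: mol_def g_def)
   then have dU: "((\<lambda>t. U n (y + t *\<^sub>R b)) has_real_derivative W n y) (at 0)"
    unfolding U_def W_def A_def by (rule DERIV_cdivide)
   have "(h has_real_derivative h' (U n (y + 0 *\<^sub>R b))) (at (U n (y + 0 *\<^sub>R b)))"
    using h by (auto simp: C1_bounded_def)
   from DERIV_chain2[OF this dU]
   show "((\<lambda>t. h (U n (y + t *\<^sub>R b))) has_real_derivative h' (U n y) * W n y) (at 0)" by simp
  qed measurable
 qed
 have i1: "integrable lborel (\<lambda>x. h (U n x) * partial b \<phi> x)" and i2: "integrable lborel (\<lambda>x. (h' (U n x) * W n x) * \<phi> x)" for n
 proof -
  obtain c d where cd: "\<And>x. \<bar>h (U n x)\<bar> \<le> c" "\<And>x. \<bar>h' (U n x) * W n x\<bar> \<le> d" using UW by meson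
  show "integrable lborel (\<lambda>x. h (U n x) * partial b \<phi> x)" "integrable lborel (\<lambda>x. (h' (U n x) * W n x) * \<phi> x)"
   using integrable_bounded_mult[OF test_function_integrable[OF \<psi>] _ cd(1)]
    integrable_bounded_mult[OF test_function_integrable[OF \<phi>] _ cd(2)] by simp_all
 qed
 have "\<bar>(h (U n x) - h (u x)) * partial b \<phi> x\<bar> \<le> (B * Q) * \<bar>U n x - u x\<bar>" for n x
  using mult_mono[OF C1_bounded_lipschitz(1)[OF h, of "U n x" "u x"] Q[of x]] hB by (simp add: abs_mult mult_ac)
 then have D1: "integrable lborel (\<lambda>x. (h (U n x) - h (u x)) * partial b \<phi> x)"
  "(\<lambda>n. LINT x|lborel. (h (U n x) - h (u x)) * partial b \<phi> x) \<leadsto> 0" for n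
  by (rule L1_dominated_tendsto_0[OF iU Ul, rotated]; measurable)+
 have iu: "integrable lborel (\<lambda>x. h (u x) * partial b \<phi> x)"
  using Bochner_Integration.integrable_diff[OF i1[of 0] D1(1)[of 0]] by (simp add: algebra_simps)
 have "(LINT x|lborel. (h (U n x) - h (u x)) * partial b \<phi> x) =
   (LINT x|lborel. h (U n x) * partial b \<phi> x) - (LINT x|lborel. h (u x) * partial b \<phi> x)" for n
  using i1[of n] iu by (simp add: left_diff_distrib)
 with D1(2) have "(\<lambda>n. LINT x|lborel. h (U n x) * partial b \<phi> x) \<leadsto> (LINT x|lborel. h (u x) * partial b \<phi> x)"
  by (simp add: LIM_zero_cancel)
 from tendsto_minus[OF this]
 have "(\<lambda>n. LINT x|lborel. (h' (U n x) * W n x) * \<phi> x) \<leadsto> - (LINT x|lborel. h (u x) * partial b \<phi> x)"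
  by (simp add: ibp)
 moreover have "(\<lambda>n. LINT x|lborel. (h' (U n x) * W n x) * \<phi> x) \<leadsto> (LINT x|lborel. (h' (u x) * g x) * \<phi> x)"
 proof -
  have "\<bar>(h' (U n x) * \<phi> x) * (W n x - g x)\<bar> \<le> (B * P) * \<bar>W n x - g x\<bar>" for n x
   unfolding abs_mult using hB P by (intro mult_right_mono mult_mono) auto
  then have D2: "integrable lborel (\<lambda>x. (h' (U n x) * \<phi> x) * (W n x - g x))"
   "(\<lambda>n. LINT x|lborel. (h' (U n x) * \<phi> x) * (W n x - g x)) \<leadsto> 0" for n
   by (rule L1_dominated_tendsto_0[OF iW Wl, rotated]; measurable)+
  have "(\<lambda>n. LINT x|lborel. (h' (U n x) * g x) * \<phi> x) \<leadsto> (LINT x|lborel. (h' (u x) * g x) * \<phi> x)"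
  proof (rule integral_dominated_convergence[where w = "\<lambda>x. B * \<bar>g x * \<phi> x\<bar>"])
   show "integrable lborel (\<lambda>x. B * \<bar>g x * \<phi> x\<bar>)" using integrable_times_test_function[OF g \<phi>] by simp
   show "AE x in lborel. (\<lambda>i. (h' (U i x) * g x) * \<phi> x) \<leadsto> (h' (u x) * g x) * \<phi> x"
    using Uae
   proof eventually_elim
    fix x assume l: "(\<lambda>i. U i x) \<leadsto> u x"
    have "isCont h' (u x)" using h by (auto simp: C1_bounded_def continuous_on_eq_continuous_at)
    from isCont_tendsto_compose[OF this l] show "(\<lambda>i. (h' (U i x) * g x) * \<phi> x) \<leadsto> (h' (u x) * g x) * \<phi> x"
     by (intro tendsto_intros)
   qed
   show "AE x in lborel. norm ((h' (U i x) * g x) * \<phi> x) \<le> B * \<bar>g x * \<phi> x\<bar>" for i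
    using hB by (auto simp: abs_mult mult.assoc intro!: mult_right_mono)
  qed measurable
  moreover have "(LINT x|lborel. (h' (U n x) * \<phi> x) * (W n x - g x)) =
    (LINT x|lborel. (h' (U n x) * W n x) * \<phi> x) - (LINT x|lborel. (h' (U n x) * g x) * \<phi> x)" for n
  proof -
   have e: "(h' (U n x) * \<phi> x) * (W n x - g x) = (h' (U n x) * W n x) * \<phi> x - (h' (U n x) * g x) * \<phi> x" for x
    by (simp add: algebra_simps)
   have "integrable lborel (\<lambda>x. (h' (U n x) * g x) * \<phi> x)"
    using Bochner_Integration.integrable_diff[OF i2 D2(1), of n n] by (simp add: e)
   then show ?thesis unfolding e using i2 by simp
  qed
  ultimately show ?thesis using tendsto_add[OF D2(2)] by fastforce
 qed
 ultimately have "- (LINT x|lborel. h (u x) * partial b \<phi> x) = (LINT x|lborel. (h' (u x) * g x) * \<phi> x)"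
  by (rule LIMSEQ_unique)
 then show ?thesis by (simp add: g_def)
qed

section \<open>H1 as a complete space, and the chain rule in it\<close>

context lipschitz_domain
begin

text \<open>The square of the H1 norm. It avoids roots at the price of the factor 2 in
  \<open>hsq_triangle\<close>.\<close>

definition hsq :: "('a => real) => real" where
 "hsq u = mass u + energy u"

lemma hsq_nonneg: "0 \<le> hsq u"
 using mass_nonneg energy_nonneg by (simp add: hsq_def)

lemma H1_norm_eq:
 assumes "u \<in> H1 \<Omega>"
 shows "H1_norm \<Omega> u = sqrt (hsq u)"
 using H1D(1,2)[OF assms] by (simp add: H1_norm_def hsq_def mass_def energy_def Lp2_iff power2_norm_eq_inner)

lemma energy_eqI:
 assumes u: "u \<in> H1 \<Omega>" and G: "AE x in Leb. grad u x = G x"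
 shows "energy u = (LINT x|Leb. (norm (G x))^2)"
proof -
 have "grad u \<in> borel_measurable Leb" using H1D(2)[OF u] by (simp add: Lp2_iff)
 then show ?thesis
  using measurable_AE_cong_dom[OF _ G] G unfolding energy_def by (intro integral_cong_AE) (auto elim: eventually_mono)
qed

lemma H1_minus:
 assumes u: "u \<in> H1 \<Omega>" and v: "v \<in> H1 \<Omega>"
 shows "(u \<ominus> v) \<in> H1 \<Omega>"
  "AE x in Leb. grad (u \<ominus> v) x = grad u x - grad v x"
  "energy (u \<ominus> v) = (LINT x|Leb. (norm (grad u x - grad v x))^2)"
proof -
 show 1: "(u \<ominus> v) \<in> H1 \<Omega>"
  and 2: "AE x in Leb. grad (u \<ominus> v) x = grad u x - grad v x"
  using H1_lincomb[OF u v, of 1 "-1"] by auto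
 show "energy (u \<ominus> v) = (LINT x|Leb. (norm (grad u x - grad v x))^2)"
  by (rule energy_eqI[OF 1 2])
qed

lemma hsq_lincomb:
 assumes u: "u \<in> H1 \<Omega>" and v: "v \<in> H1 \<Omega>"
 shows "hsq (\<lambda>x. a * u x + b * v x) \<le> 2 * a^2 * hsq u + 2 * b^2 * hsq v"
proof -
 note u' = H1D(1,2)[OF u] and v' = H1D(1,2)[OF v]
 have "mass (\<lambda>x. a * u x + b * v x) \<le> 2 * a^2 * mass u + 2 * b^2 * mass v"
  using L2_square_add_le[OF L2_lincomb[OF u'(1) u'(1), of a 0] L2_lincomb[OF v'(1) v'(1), of b 0]]
  by (simp add: mass_def power_mult_distrib)
 moreover have "energy (\<lambda>x. a * u x + b * v x) \<le> 2 * a^2 * energy u + 2 * b^2 * energy v"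
  using L2_square_add_le[OF L2_lincomb[OF u'(2) u'(2), of a 0] L2_lincomb[OF v'(2) v'(2), of b 0]]
  by (simp add: energy_eqI[OF H1_lincomb[OF u v, of a b]] energy_def power_mult_distrib)
 ultimately show ?thesis by (simp add: hsq_def algebra_simps)
qed

lemma hsq_minus:
 assumes u: "u \<in> H1 \<Omega>" and v: "v \<in> H1 \<Omega>"
 shows "hsq (u \<ominus> v) \<le> 2 * hsq u + 2 * hsq v"
 using hsq_lincomb[OF u v, of 1 "-1"] by simp

lemma hsq_triangle:
 assumes "u \<in> H1 \<Omega>" "v \<in> H1 \<Omega>" "w \<in> H1 \<Omega>"
 shows "hsq (u \<ominus> w) \<le> 2 * hsq (u \<ominus> v) + 2 * hsq (v \<ominus> w)"
 using hsq_lincomb[OF H1_minus(1)[OF assms(1,2)] H1_minus(1)[OF assms(2,3)], of 1 1] by simp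

text \<open>The weak gradient is a closed operator: both sides of its defining identity are
  continuous in L2, because test functions are bounded and \<Omega> has finite measure.\<close>

lemma H1_limit:
 assumes w: "\<And>k. w k \<in> H1 \<Omega>" and v: "v \<in> Lp 2 Leb" and G: "G \<in> Lp 2 Leb"
  and l: "L2_lim Leb w v" and lG: "L2_lim Leb (\<lambda>k. grad (w k)) G"
 shows "v \<in> H1 \<Omega>" "AE x in Leb. grad v x = G x" "(\<lambda>k. hsq (w k \<ominus> v)) \<leadsto> 0"
proof -
 note w' = H1D[OF w]
 have eq: "(LINT x|Leb. v x * partial b \<phi> x) = - (LINT x|Leb. (G x \<bullet> b) * \<phi> x)"
  if \<phi>: "\<phi> \<in> test_functions \<Omega>" and b: "b \<in> Basis" for \<phi> b
 proof -
  have tL: "\<psi> \<in> Lp 2 Leb" if t: "\<psi> \<in> test_functions \<Omega>" for \<psi>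
  proof -
   obtain B where "\<And>x. \<bar>\<psi> x\<bar> \<le> B" using test_function_bounded[OF t] by auto
   then show ?thesis
    by (intro bounded_L2[where B = B]) (use test_function_measurable[OF t] in \<open>auto intro!: measurable_restrict_space1 measurable_completion\<close>)
  qed
  have \<phi>b: "(\<lambda>x. \<phi> x *\<^sub>R b) \<in> Lp 2 Leb"
   by (rule L2_bound(1)[OF tL[OF \<phi>], where B = 1]) (use tL[OF \<phi>] b in \<open>auto simp: Lp2_iff\<close>)
  have "(\<lambda>k. LINT x|Leb. w k x \<bullet> partial b \<phi> x) \<leadsto> (LINT x|Leb. v x \<bullet> partial b \<phi> x)"
   by (rule L2_tendsto_integral[OF w'(1) v tL[OF test_function_partial[OF \<phi> b]] l])
  moreover have "(\<lambda>k. - (LINT x|Leb. grad (w k) x \<bullet> (\<phi> x *\<^sub>R b))) \<leadsto> - (LINT x|Leb. G x \<bullet> (\<phi> x *\<^sub>R b))"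
   by (rule tendsto_minus[OF L2_tendsto_integral[OF w'(2) G \<phi>b lG]])
  moreover have "(LINT x|Leb. w k x \<bullet> partial b \<phi> x) = - (LINT x|Leb. grad (w k) x \<bullet> (\<phi> x *\<^sub>R b))" for k
   using w'(3)[OF \<phi> b, of k] by (simp add: mult.commute)
  ultimately have "(LINT x|Leb. v x \<bullet> partial b \<phi> x) = - (LINT x|Leb. G x \<bullet> (\<phi> x *\<^sub>R b))"
   using LIMSEQ_unique by simp
  then show ?thesis by (simp add: mult.commute)
 qed
 show v1: "v \<in> H1 \<Omega>" and v2: "AE x in Leb. grad v x = G x" using H1I[OF v G eq] by auto
 have "energy (w k \<ominus> v) = (LINT x|Leb. (norm (grad (w k) x - G x))^2)" for k
  by (rule energy_eqI[OF H1_minus(1)[OF w v1]]) (use H1_minus(2)[OF w v1, of k] v2 in \<open>eventually_elim; simp\<close>)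
 then show "(\<lambda>k. hsq (w k \<ominus> v)) \<leadsto> 0"
  using tendsto_add[OF l lG] by (simp add: hsq_def mass_def)
qed

lemma H1_complete:
 assumes w: "\<And>k::nat. w k \<in> H1 \<Omega>"
  and cauchy: "\<And>e. e > 0 ==> \<exists>N. \<forall>m\<ge>N. \<forall>n\<ge>N. hsq (w m \<ominus> w n) < e"
 shows "\<exists>v\<in>H1 \<Omega>. (\<lambda>k. hsq (w k \<ominus> v)) \<leadsto> 0"
proof -
 note w' = H1D(1,2)[OF w]
 have le: "(LINT x|Leb. (norm (w m x - w n x))^2) \<le> hsq (w m \<ominus> w n)"
  "(LINT x|Leb. (norm (grad (w m) x - grad (w n) x))^2) \<le> hsq (w m \<ominus> w n)" for m n
  using H1_minus(3)[OF w w, of m n] mass_nonneg energy_nonneg by (auto simp: hsq_def mass_def)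
 obtain v where v: "v \<in> Lp 2 Leb" "L2_lim Leb w v"
  using L2_complete[OF finite_measure_dom w'(1) le(1) cauchy] by auto
 obtain G where G: "G \<in> Lp 2 Leb" "L2_lim Leb (\<lambda>k. grad (w k)) G"
  using L2_complete[OF finite_measure_dom w'(2) le(2) cauchy] by auto
 show ?thesis using H1_limit[OF w v(1) G(1) v(2) G(2)] by blast
qed

lemma H1_smooth:
 assumes d: "\<And>y b. b \<in> Basis ==> ((\<lambda>t. f (y + t *\<^sub>R b)) has_real_derivative G y \<bullet> b) (at 0)"
  and m: "f \<in> borel_measurable borel" "G \<in> borel_measurable borel"
  and P: "\<And>x. \<bar>f x\<bar> \<le> P" and Q: "\<And>x. norm (G x) \<le> Q"
 shows "f \<in> H1 \<Omega>" "AE x in Leb. grad f x = G x"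
proof -
 note m' = measurable_compose[OF id_Leb m(1)] measurable_compose[OF id_Leb m(2)]
 have fL: "f \<in> Lp 2 Leb" by (rule bounded_L2[where B = P]) (use P m' in auto)
 have GL: "G \<in> Lp 2 Leb" by (rule bounded_L2[where B = Q]) (use Q m' in auto)
 have eq: "(LINT x|Leb. f x * partial b \<phi> x) = - (LINT x|Leb. (G x \<bullet> b) * \<phi> x)"
  if \<phi>: "\<phi> \<in> test_functions \<Omega>" and b: "b \<in> Basis" for \<phi> b
 proof -
  have out: "\<phi> x = 0" "partial b \<phi> x = 0" if "x \<notin> \<Omega>" for x
   using that \<phi> partial_support[of b \<phi>] closure_subset[of "{x. \<phi> x \<noteq> 0}"] by (auto simp: test_functions_def)
  note [measurable] = m test_function_measurable[OF \<phi>] test_function_measurable[OF test_function_partial[OF \<phi> b]]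
  have dom: "(LINT x|Leb. g x) = (LINT x|lborel. g x)"
   if "g \<in> borel_measurable borel" "\<And>x. x \<notin> \<Omega> ==> g x = 0" for g :: "'a => real"
   by (rule is_rep_integral(2)) (use that in \<open>auto simp: is_rep_def\<close>)
  have "\<bar>G x \<bullet> b\<bar> \<le> Q" for x using order_trans[OF Basis_le_norm[OF b] Q] .
  then have "(LINT x|lborel. f x * partial b \<phi> x) = - (LINT x|lborel. (G x \<bullet> b) * \<phi> x)"
   by (intro test_function_by_parts[OF \<phi> b d[OF b] _ _ P]) auto
  then show ?thesis using dom[of "\<lambda>x. f x * partial b \<phi> x"] dom[of "\<lambda>x. (G x \<bullet> b) * \<phi> x"] by (simp add: out)
 qed
 show "f \<in> H1 \<Omega>" "AE x in Leb. grad f x = G x" using H1I[OF fL GL eq] by auto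
qed

lemma H1_test_function:
 assumes \<psi>: "\<psi> \<in> test_functions \<Omega>"
 shows "\<psi> \<in> H1 \<Omega>"
proof -
 note tm = test_function_measurable[OF test_function_partial[OF \<psi>]] test_function_measurable[OF \<psi>]
 obtain P where P: "\<And>x. \<bar>\<psi> x\<bar> \<le> P" using test_function_bounded[OF \<psi>] by auto
 have "\<forall>b\<in>Basis. \<exists>Q. \<forall>x. \<bar>partial b \<psi> x\<bar> \<le> Q"
  using test_function_bounded[OF test_function_partial[OF \<psi>]] by auto
 from bchoice[OF this] obtain Q where Q: "\<And>b x. b \<in> Basis ==> \<bar>partial b \<psi> x\<bar> \<le> Q b" by auto
 show ?thesis
 proof (rule H1_smooth(1)[where G = "\<lambda>x. \<Sum>b\<in>Basis. partial b \<psi> x *\<^sub>R b", OF _ tm(2) _ P])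
  show "norm (\<Sum>b\<in>Basis. partial b \<psi> x *\<^sub>R b) \<le> (\<Sum>b\<in>Basis. Q b)" for x
   using Q by (auto intro!: order_trans[OF norm_sum sum_mono])
  show "((\<lambda>t. \<psi> (y + t *\<^sub>R b)) has_real_derivative (\<Sum>b\<in>Basis. partial b \<psi> y *\<^sub>R b) \<bullet> b) (at 0)" if b: "b \<in> Basis" for y b
   unfolding inner_sum_left_Basis[OF b] by (rule test_function_directional[OF \<psi>])
 qed (use tm in \<open>auto intro!: borel_measurable_sum borel_measurable_scaleR\<close>)
qed

lemma H1_const: "(\<lambda>x. c) \<in> H1 \<Omega>" "AE x in Leb. grad (\<lambda>x. c) x = 0" "energy (\<lambda>x. c) = 0"
proof -
 have d: "((\<lambda>t. c) has_real_derivative (0::'a) \<bullet> b) (at 0)" for b by simp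
 show 1: "(\<lambda>x. c) \<in> H1 \<Omega>" by (rule H1_smooth(1)[OF d _ _ order_refl order_refl]) auto
 show 2: "AE x in Leb. grad (\<lambda>x. c) x = 0" by (rule H1_smooth(2)[OF d _ _ order_refl order_refl]) auto
 show "energy (\<lambda>x. c) = 0" using energy_eqI[OF 1 2] by simp
qed

lemma H1_chain:
 assumes h: "C1_bounded h h' B" "h 0 = 0" and u: "u \<in> H1 \<Omega>"
 shows "(\<lambda>x. h (u x)) \<in> H1 \<Omega>" "AE x in Leb. grad (\<lambda>x. h (u x)) x = h' (u x) *\<^sub>R grad u x"
proof -
 note u' = H1D(1,2)[OF u] and m = C1_bounded_lipschitz[OF h(1)]
 have um: "u \<in> borel_measurable Leb" "grad u \<in> borel_measurable Leb" using u' by (auto simp: Lp2_iff)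
 obtain v where v: "is_rep u v" using is_rep_exists[OF um(1)] ..
 obtain G where G: "is_rep (grad u) G" using is_rep_exists[OF um(2)] ..
 have vG[measurable]: "v \<in> borel_measurable borel" "G \<in> borel_measurable borel" using v G by (auto simp: is_rep_def)
 note [measurable] = m(2,3)
 have 1: "(\<lambda>x. h (u x)) \<in> Lp 2 Leb"
  by (rule L2_bound(1)[OF u'(1), of _ B]) (use m(1)[of _ 0] h(2) measurable_compose[OF um(1) m(2)] in auto)
 have 2: "(\<lambda>x. h' (u x) *\<^sub>R grad u x) \<in> Lp 2 Leb"
  by (rule L2_bounded_mult[OF u'(2), of _ B]) (use h(1) measurable_compose[OF um(1) m(3)] in \<open>auto simp: C1_bounded_def\<close>)
 have 3: "(LINT x|Leb. h (u x) * partial b \<phi> x) = - (LINT x|Leb. ((h' (u x) *\<^sub>R grad u x) \<bullet> b) * \<phi> x)"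
  if \<phi>: "\<phi> \<in> test_functions \<Omega>" and b: "b \<in> Basis" for \<phi> b
 proof -
  note [measurable] = test_function_measurable[OF \<phi>] test_function_measurable[OF test_function_partial[OF \<phi> b]]
  have out: "\<phi> x = 0" "partial b \<phi> x = 0" if "x \<notin> \<Omega>" for x
   using that \<phi> partial_support[of b \<phi>] closure_subset[of "{x. \<phi> x \<noteq> 0}"] by (auto simp: test_functions_def)
  have ae: "AE x in lborel. x \<in> \<Omega> --> u x = v x" "AE x in lborel. x \<in> \<Omega> --> grad u x = G x"
   using v G by (auto simp: is_rep_def)
  have r1: "is_rep (\<lambda>x. h (u x) * partial b \<phi> x) (\<lambda>x. h (v x) * partial b \<phi> x)"
   unfolding is_rep_def by (intro conjI) (use out ae(1) in \<open>auto elim: eventually_mono\<close>)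
  have "AE x in lborel. x \<in> \<Omega> --> ((h' (u x) *\<^sub>R grad u x) \<bullet> b) * \<phi> x = (h' (v x) * (G x \<bullet> b)) * \<phi> x"
   using ae by eventually_elim auto
  then have r2: "is_rep (\<lambda>x. ((h' (u x) *\<^sub>R grad u x) \<bullet> b) * \<phi> x) (\<lambda>x. (h' (v x) * (G x \<bullet> b)) * \<phi> x)"
   unfolding is_rep_def by (intro conjI) (use out in auto)
  show ?thesis
   unfolding is_rep_integral(2)[OF r1] is_rep_integral(2)[OF r2]
   by (rule wgrad_chain[OF H1_wgrad[OF u v G] h(1) open_dom \<phi> b])
 qed
 show "(\<lambda>x. h (u x)) \<in> H1 \<Omega>"
  "AE x in Leb. grad (\<lambda>x. h (u x)) x = h' (u x) *\<^sub>R grad u x"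
  using H1I[OF 1 2 3] by auto
qed

text \<open>Outer and inner function vary together, so that one proof covers a fixed h along
  approximants, as in \<open>V_chain\<close>, and varying h at a fixed u, as in
  \<open>H1_chain_limit\<close>. The factor d stands in for the derivative of \<zeta>, which need
  not exist everywhere; for the positive part it is the indicator of t > 0.\<close>

lemma H1_chain_seq:
 assumes h: "\<And>k::nat. C1_bounded (h k) (h' k) B" "\<And>k. h k 0 = 0"
  and w: "\<And>k. w k \<in> H1 \<Omega>" and v: "v \<in> H1 \<Omega>" and lw: "(\<lambda>k. hsq (w k \<ominus> v)) \<leadsto> 0"
  and \<zeta>: "\<zeta> \<in> borel_measurable borel" "\<And>t. \<bar>\<zeta> t\<bar> \<le> B * \<bar>t\<bar>" "\<And>t. (\<lambda>k. h k t) \<leadsto> \<zeta> t"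
  and d: "d \<in> borel_measurable borel" "\<And>t. \<bar>d t\<bar> \<le> B" "AE x in Leb. (\<lambda>k. h' k (w k x)) \<leadsto> d (v x)"
 shows "(\<lambda>x. \<zeta> (v x)) \<in> H1 \<Omega>" "AE x in Leb. grad (\<lambda>x. \<zeta> (v x)) x = d (v x) *\<^sub>R grad v x"
  "(\<lambda>k. hsq (\<lambda>x. h k (w k x) - \<zeta> (v x))) \<leadsto> 0"
proof -
 note m = C1_bounded_lipschitz[OF h(1)]
 note w' = H1D(1,2)[OF w] and v' = H1D(1,2)[OF v]
 have c: "(\<lambda>x. h k (w k x)) \<in> H1 \<Omega>"
  "AE x in Leb. grad (\<lambda>x. h k (w k x)) x = h' k (w k x) *\<^sub>R grad (w k) x" for k
  by (rule H1_chain[OF h w])+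
 have me[measurable]: "w k \<in> borel_measurable Leb" "grad (w k) \<in> borel_measurable Leb"
  "v \<in> borel_measurable Leb" "grad v \<in> borel_measurable Leb" for k
  using w' v' by (auto simp: Lp2_iff)
 have hB: "\<bar>h' k t\<bar> \<le> B" for k t using h(1)[of k] by (auto simp: C1_bounded_def)
 note [measurable] = measurable_compose[OF me(1) m(2)] measurable_compose[OF me(3) m(2)]
  measurable_compose[OF me(1) m(3)] measurable_compose[OF me(3) \<zeta>(1)] measurable_compose[OF me(3) d(1)]
 have L: "(\<lambda>x. \<zeta> (v x)) \<in> Lp 2 Leb" by (rule L2_bound(1)[OF v'(1), of _ B]) (use \<zeta>(2) in auto)
 have LG: "(\<lambda>x. d (v x) *\<^sub>R grad v x) \<in> Lp 2 Leb"
  by (rule L2_bounded_mult[OF v'(2), of _ B]) (use d(2) in auto)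
 have mass: "(\<lambda>k. LINT x|Leb. (norm (w k x - v x))^2) \<leadsto> 0"
  and energy: "(\<lambda>k. LINT x|Leb. (norm (grad (w k) x - grad v x))^2) \<leadsto> 0"
  using squeeze_0[OF lw, of "\<lambda>k. mass (w k \<ominus> v)"] squeeze_0[OF lw, of "\<lambda>k. energy (w k \<ominus> v)"]
   mass_nonneg energy_nonneg H1_minus(3)[OF w v] by (simp_all add: hsq_def mass_def)
 have l: "L2_lim Leb (\<lambda>k x. h k (w k x)) (\<lambda>x. \<zeta> (v x))"
 proof -
  \<comment> \<open>E collects the change of the inner function, controlled by the Lipschitz
    constant B, and D the change of the outer function, controlled by dominated convergence. The
    gradients below are split in the same way.\<close>
  define E where "E = (\<lambda>k x. h k (w k x) - h k (v x))"
  define D where "D = (\<lambda>k x. h k (v x) - \<zeta> (v x))"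
  have [measurable]: "E k \<in> borel_measurable Leb" "D k \<in> borel_measurable Leb" for k unfolding E_def D_def by measurable
  have Db: "norm (D k x) \<le> 2 * B * norm (v x)" for k x
   using m(1)[of k "v x" 0] h(2)[of k] \<zeta>(2)[of "v x"] by (simp add: D_def)
  have E: "E k \<in> Lp 2 Leb" "(LINT x|Leb. (norm (E k x))^2) \<le> B^2 * (LINT x|Leb. (norm (w k x - v x))^2)" for k
   by (rule L2_bound[OF L2_minus[OF w'(1) v'(1)]]; use m(1) in \<open>auto simp: E_def\<close>)+
  have "(\<lambda>k. LINT x|Leb. (norm (E k x + D k x))^2) \<leadsto> 0"
  proof (rule L2_tendsto_0_add[OF E(1)])
   show "D k \<in> Lp 2 Leb" for k by (rule L2_bound(1)[OF v'(1) _ Db]) simp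
   show "(\<lambda>k. LINT x|Leb. (norm (E k x))^2) \<leadsto> 0"
    by (rule squeeze_0[OF tendsto_mult_right_zero[OF mass] E(2)]) simp
   show "(\<lambda>k. LINT x|Leb. (norm (D k x))^2) \<leadsto> 0"
    by (rule L2_dominated[OF v'(1) _ Db]) (simp_all add: D_def LIM_zero_iff \<zeta>(3))
  qed
  then show ?thesis by (simp add: E_def D_def)
 qed
 have lG: "L2_lim Leb (\<lambda>k. grad (\<lambda>x. h k (w k x))) (\<lambda>x. d (v x) *\<^sub>R grad v x)"
 proof -
  define E where "E = (\<lambda>k x. h' k (w k x) *\<^sub>R (grad (w k) x - grad v x))"
  define D where "D = (\<lambda>k x. (h' k (w k x) - d (v x)) *\<^sub>R grad v x)"
  have [measurable]: "E k \<in> borel_measurable Leb" "D k \<in> borel_measurable Leb" for k unfolding E_def D_def by measurable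
  have Db: "norm (D k x) \<le> 2 * B * norm (grad v x)" for k x
   unfolding D_def norm_scaleR using hB[of k "w k x"] d(2)[of "v x"] by (intro mult_right_mono) auto
  have Eb: "norm (E k x) \<le> B * norm (grad (w k) x - grad v x)" for k x
   unfolding E_def norm_scaleR by (intro mult_right_mono hB) simp
  have E: "E k \<in> Lp 2 Leb"
   "(LINT x|Leb. (norm (E k x))^2) \<le> B^2 * (LINT x|Leb. (norm (grad (w k) x - grad v x))^2)" for k
   by (rule L2_bound[OF L2_minus[OF w'(2) v'(2)] _ Eb], simp)+
  have ED: "(\<lambda>k. LINT x|Leb. (norm (E k x + D k x))^2) \<leadsto> 0"
  proof (rule L2_tendsto_0_add[OF E(1)])
   show "D k \<in> Lp 2 Leb" for k by (rule L2_bound(1)[OF v'(2) _ Db]) simp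
   show "(\<lambda>k. LINT x|Leb. (norm (E k x))^2) \<leadsto> 0"
    by (rule squeeze_0[OF tendsto_mult_right_zero[OF energy] E(2)]) simp
   show "(\<lambda>k. LINT x|Leb. (norm (D k x))^2) \<leadsto> 0"
   proof (rule L2_dominated[OF v'(2) _ Db])
    show "AE x in Leb. (\<lambda>k. D k x) \<leadsto> 0"
     using d(3)
    proof eventually_elim
     fix x assume "(\<lambda>k. h' k (w k x)) \<leadsto> d (v x)"
     from tendsto_scaleR[OF LIM_zero[OF this] tendsto_const] show "(\<lambda>k. D k x) \<leadsto> 0" by (simp add: D_def)
    qed
   qed simp
  qed
  have g: "grad (\<lambda>x. h k (w k x)) \<in> borel_measurable Leb" for k using H1D(2)[OF c(1)] by (simp add: Lp2_iff)
  have "AE x in Leb. (norm (grad (\<lambda>x. h k (w k x)) x - d (v x) *\<^sub>R grad v x))^2 = (norm (E k x + D k x))^2" for k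
   using c(2)[of k] by eventually_elim (simp add: E_def D_def algebra_simps)
  then have "(LINT x|Leb. (norm (grad (\<lambda>x. h k (w k x)) x - d (v x) *\<^sub>R grad v x))^2) =
    (LINT x|Leb. (norm (E k x + D k x))^2)" for k
   by (rule integral_cong_AE[rotated 2]) (use g in measurable)
  with ED show ?thesis by simp
 qed
 show "(\<lambda>x. \<zeta> (v x)) \<in> H1 \<Omega>" "AE x in Leb. grad (\<lambda>x. \<zeta> (v x)) x = d (v x) *\<^sub>R grad v x"
  "(\<lambda>k. hsq (\<lambda>x. h k (w k x) - \<zeta> (v x))) \<leadsto> 0"
  using H1_limit[OF c(1) L LG l lG] by auto
qed

lemma H1_chain_limit:
 assumes h: "\<And>k::nat. C1_bounded (h k) (h' k) B" "\<And>k. h k 0 = 0"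
  and lim: "\<And>t. (\<lambda>k. h k t) \<leadsto> \<zeta> t" "\<And>t. (\<lambda>k. h' k t) \<leadsto> d t" and u: "u \<in> H1 \<Omega>"
 shows "(\<lambda>x. \<zeta> (u x)) \<in> H1 \<Omega>" "AE x in Leb. grad (\<lambda>x. \<zeta> (u x)) x = d (u x) *\<^sub>R grad u x"
  "(\<lambda>k. hsq (\<lambda>x. h k (u x) - \<zeta> (u x))) \<leadsto> 0"
proof -
 note m = C1_bounded_lipschitz[OF h(1)]
 have b: "\<bar>\<zeta> t\<bar> \<le> B * \<bar>t\<bar>" "\<bar>d t\<bar> \<le> B" for t
  using LIMSEQ_le_const2[OF tendsto_rabs[OF lim(1)[of t]], of "B * \<bar>t\<bar>"] LIMSEQ_le_const2[OF tendsto_rabs[OF lim(2)[of t]], of B]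
   m(1)[of _ t 0] h by (auto simp: C1_bounded_def)
 have \<zeta>: "\<zeta> \<in> borel_measurable borel" and d: "d \<in> borel_measurable borel"
  by (rule borel_measurable_LIMSEQ_real[OF lim(1)], rule m(2)) (rule borel_measurable_LIMSEQ_real[OF lim(2)], rule m(3))
 have 0: "(\<lambda>k. hsq (u \<ominus> u)) \<leadsto> 0" using H1_const(3)[of 0] by (simp add: hsq_def mass_def)
 have "AE x in Leb. (\<lambda>k. h' k (u x)) \<leadsto> d (u x)" using lim(2) by simp
 from H1_chain_seq[OF h u u 0 \<zeta> b(1) lim(1) d b(2) this]
 show "(\<lambda>x. \<zeta> (u x)) \<in> H1 \<Omega>" "AE x in Leb. grad (\<lambda>x. \<zeta> (u x)) x = d (u x) *\<^sub>R grad u x"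
  "(\<lambda>k. hsq (\<lambda>x. h k (u x) - \<zeta> (u x))) \<leadsto> 0" .
qed

end

section \<open>Traces and the space V\<close>

locale dirichlet_domain = lipschitz_domain \<Omega> for \<Omega> :: "'a::euclidean_space set" +
 fixes \<Gamma> :: "'a set"
 assumes \<Gamma>_sub: "\<Gamma> \<subseteq> frontier \<Omega>" and \<Gamma>_borel: "\<Gamma> \<in> sets borel"
begin

abbreviation Sur :: "'a measure" where
 "Sur \<equiv> restrict_space surface_measure (frontier \<Omega>)"

abbreviation V :: "('a => real) set" where
 "V \<equiv> V_space \<Omega> \<Gamma>"

text \<open>Finiteness of the surface is the trace inequality for the constant function 1.\<close>

lemma finite_measure_Sur: "finite_measure Sur"
proof
 obtain C where "\<forall>u\<in>H1 \<Omega>. continuous_on (closure \<Omega>) u -->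
  (\<integral>\<^sup>+x. ennreal ((u x)^2) \<partial>Sur) \<le> ennreal (C * (mass u + energy u))"
  using trace_inequality by blast
 from bspec[OF this H1_const(1)[of 1]]
 have "(\<integral>\<^sup>+x. ennreal (1^2) \<partial>Sur) \<le> ennreal (C * (mass (\<lambda>x. 1) + energy (\<lambda>x. 1)))" by auto
 then have "emeasure Sur (space Sur) \<le> ennreal (C * (mass (\<lambda>x. 1) + energy (\<lambda>x. 1)))" by simp
 then show "emeasure Sur (space Sur) \<noteq> \<infinity>" by (auto simp: top_unique)
qed

lemma V_H1: "v \<in> V ==> v \<in> H1 \<Omega>"
 by (simp add: V_space_def)

lemma \<Gamma>_Sur[measurable]: "\<Gamma> \<in> sets Sur"
 using borel_sets_surface[OF \<Gamma>_borel] \<Gamma>_sub by (auto simp: sets_restrict_space)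

abbreviation bd_sq :: "('a => real) => ennreal" where
 "bd_sq w \<equiv> (\<integral>\<^sup>+x\<in>\<Gamma>. ennreal ((w x)^2) \<partial>Sur)"

text \<open>Membership in V without the trace: the approximants become small on \<Gamma>, so no
  boundary function has to be carried along.\<close>

definition V_approx :: "(nat => 'a => real) => ('a => real) => bool" where
 "V_approx w v \<longleftrightarrow> (\<forall>k. w k \<in> H1 \<Omega> \<and> continuous_on (closure \<Omega>) (w k)) \<and>
   (\<lambda>k. hsq (w k \<ominus> v)) \<leadsto> 0 \<and> (\<lambda>k. bd_sq (w k)) \<leadsto> 0"

lemma V_has_approx:
 assumes "v \<in> V"
 shows "\<exists>w. V_approx w v"
proof -
 obtain g w where g: "AE x in surface_measure. x \<in> \<Gamma> --> g x = 0"
  and w: "\<And>k::nat. w k \<in> H1 \<Omega>" "\<And>k. continuous_on (closure \<Omega>) (w k)"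
  and l: "(\<lambda>k. H1_norm \<Omega> (w k \<ominus> v)) \<leadsto> 0"
  and lS: "(\<lambda>k. \<integral>\<^sup>+x. ennreal ((w k x - g x)^2) \<partial>Sur) \<leadsto> 0"
  using assms by (auto simp: V_space_def has_trace_def)
 have "(\<lambda>k. (H1_norm \<Omega> (w k \<ominus> v))^2) \<leadsto> 0^2" by (rule tendsto_power[OF l])
 moreover have "(H1_norm \<Omega> (w k \<ominus> v))^2 = hsq (w k \<ominus> v)" for k
  by (simp add: H1_norm_eq[OF H1_minus(1)[OF w(1) V_H1[OF assms]]] hsq_nonneg)
 ultimately have l': "(\<lambda>k. hsq (w k \<ominus> v)) \<leadsto> 0" by simp
 have g': "AE x in Sur. x \<in> \<Gamma> --> g x = 0" using g by (subst AE_restrict_space_iff) auto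
 have "bd_sq (w k) \<le> (\<integral>\<^sup>+x. ennreal ((w k x - g x)^2) \<partial>Sur)" for k
  by (rule nn_integral_mono_AE, use g' in eventually_elim) (auto split: split_indicator)
 then have "(\<lambda>k. bd_sq (w k)) \<leadsto> 0"
  by (rule squeeze_0[OF lS]) simp
 then show ?thesis using w l' unfolding V_approx_def by blast
qed

text \<open>By the trace inequality the boundary values of the approximants form a Cauchy sequence
  in L2 of the surface. Its limit is the trace of v, and it vanishes on \<Gamma> because the
  approximants become small there.\<close>

lemma V_approx_V:
 assumes v: "v \<in> H1 \<Omega>" and w: "V_approx w v"
 shows "v \<in> V"
proof -
 have wH: "w k \<in> H1 \<Omega>" and wc: "continuous_on (closure \<Omega>) (w k)" for k using w by (auto simp: V_approx_def)
 have l: "(\<lambda>k. hsq (w k \<ominus> v)) \<leadsto> 0" using w by (simp add: V_approx_def)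
 obtain C where C: "C \<ge> 0" "\<And>u. u \<in> H1 \<Omega> ==> continuous_on (closure \<Omega>) u ==>
  (\<integral>\<^sup>+x. ennreal ((u x)^2) \<partial>Sur) \<le> ennreal (C * hsq u)"
  using trace_inequality unfolding hsq_def by auto
 have L: "u \<in> Lp 2 Sur" "(LINT x|Sur. (norm (u x))^2) \<le> C * hsq u"
  if "u \<in> H1 \<Omega>" "continuous_on (closure \<Omega>) u" for u
 proof -
  note [measurable] = continuous_measurable_surface[OF that(2)]
  note le = C(2)[OF that]
  have "integrable Sur (\<lambda>x. (u x)^2)"
   by (rule integrableI_nonneg) (use le in \<open>auto intro: le_less_trans\<close>)
  then show "u \<in> Lp 2 Sur" by (simp add: Lp2_iff)
  have "(LINT x|Sur. (u x)^2) = enn2real (\<integral>\<^sup>+x. ennreal ((u x)^2) \<partial>Sur)" by (rule integral_eq_nn_integral) auto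
  also have "\<dots> \<le> C * hsq u" using C(1) hsq_nonneg[of u] le by (intro enn2real_leI) auto
  finally show "(LINT x|Sur. (norm (u x))^2) \<le> C * hsq u" by simp
 qed
 have "\<exists>g\<in>Lp 2 Sur. L2_lim Sur w g"
 proof (rule L2_complete[OF finite_measure_Sur L(1)[OF wH wc]])
  let ?h = "\<lambda>k. 2 * C * hsq (w k \<ominus> v)"
  show "(LINT x|Sur. (norm (w m x - w n x))^2) \<le> ?h m + ?h n" for m n
   using L(2)[OF H1_minus(1)[OF wH wH] continuous_on_diff[OF wc wc], of m n]
    mult_left_mono[OF hsq_minus[OF H1_minus(1)[OF wH v] H1_minus(1)[OF wH v], of m n] C(1)] by (simp add: algebra_simps)
  fix e :: real assume "e > 0"
  then have "\<forall>\<^sub>F k in sequentially. ?h k < e / 2"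
   by (intro order_tendstoD(2)[OF tendsto_mult_right_zero[OF l]]) simp
  then obtain N where N: "\<And>k. k \<ge> N ==> ?h k < e / 2" unfolding eventually_sequentially by blast
  show "\<exists>N. \<forall>m\<ge>N. \<forall>n\<ge>N. ?h m + ?h n < e"
  proof (intro exI allI impI)
   fix m n assume "m \<ge> N" "n \<ge> N"
   from add_strict_mono[OF N[OF this(1)] N[OF this(2)]] show "?h m + ?h n < e" by simp
  qed
 qed
 then obtain g where g: "g \<in> Lp 2 Sur" "L2_lim Sur w g" by auto
 have gm[measurable]: "g \<in> borel_measurable Sur" using g(1) by (simp add: Lp2_iff)
 note wm[measurable] = continuous_measurable_surface[OF wc]
 have nn: "(\<integral>\<^sup>+x. ennreal ((w k x - g x)^2) \<partial>Sur) = ennreal (LINT x|Sur. (norm (w k x - g x))^2)" for k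
  using L2_minus[OF L(1)[OF wH wc, of k] g(1)] by (subst nn_integral_eq_integral) (auto simp: Lp2_iff)
 have lS: "(\<lambda>k. \<integral>\<^sup>+x. ennreal ((w k x - g x)^2) \<partial>Sur) \<leadsto> 0"
  unfolding nn using tendsto_ennrealI[OF g(2)] by simp
 have "(\<lambda>k. H1_norm \<Omega> (w k \<ominus> v)) \<leadsto> 0"
  using tendsto_real_sqrt[OF l] by (simp add: H1_norm_eq[OF H1_minus(1)[OF wH v]])
 then have tr: "has_trace \<Omega> v g" using v g(1) lS wH wc unfolding has_trace_def by blast
 have lw: "(\<lambda>k. bd_sq (w k)) \<leadsto> 0" using w by (simp add: V_approx_def)
 have "bd_sq g \<le> 2 * (\<integral>\<^sup>+x. ennreal ((w k x - g x)^2) \<partial>Sur) + 2 * bd_sq (w k)" for k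
 proof -
  have le: "(\<integral>\<^sup>+x\<in>\<Gamma>. ennreal ((g x - w k x)^2) \<partial>Sur) \<le> (\<integral>\<^sup>+x. ennreal ((w k x - g x)^2) \<partial>Sur)"
   by (rule nn_integral_mono) (auto simp: power2_commute split: split_indicator)
  have "bd_sq g \<le> 2 * (\<integral>\<^sup>+x\<in>\<Gamma>. ennreal ((g x - w k x)^2) \<partial>Sur) + 2 * bd_sq (w k)"
   using nn_square_add[of "\<lambda>x. g x - w k x" Sur "w k" \<Gamma>] by simp
  from this add_right_mono[OF mult_left_mono[OF le zero_le]] show ?thesis by (rule order_trans)
 qed
 moreover have "(\<lambda>k. 2 * (\<integral>\<^sup>+x. ennreal ((w k x - g x)^2) \<partial>Sur) + 2 * bd_sq (w k)) \<leadsto> 0"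
  using tendsto_add[OF ennreal_tendsto_cmult[OF _ lS, of 2] ennreal_tendsto_cmult[OF _ lw, of 2]] by simp
 ultimately have "bd_sq g \<le> 0" by (intro LIMSEQ_le_const) auto
 then have "AE x in Sur. ennreal ((g x)^2) * indicator \<Gamma> x = 0"
  by (subst nn_integral_0_iff_AE[symmetric]) auto
 then have "AE x in Sur. x \<in> \<Gamma> --> g x = 0" by eventually_elim (auto split: split_indicator_asm)
 then have "AE x in surface_measure. x \<in> frontier \<Omega> --> x \<in> \<Gamma> --> g x = 0"
  by (subst (asm) AE_restrict_space_iff) auto
 then have "AE x in surface_measure. x \<in> \<Gamma> --> g x = 0" by eventually_elim (use \<Gamma>_sub in auto)
 then show ?thesis using v tr by (auto simp: V_space_def)
qed

lemma V_lincomb: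
 assumes u: "u \<in> V" and v: "v \<in> V"
 shows "(\<lambda>x. a * u x + b * v x) \<in> V"
proof -
 obtain y z where y: "V_approx y u" and z: "V_approx z v" using V_has_approx[OF u] V_has_approx[OF v] by auto
 note uv = V_H1[OF u] V_H1[OF v]
 have yz: "y k \<in> H1 \<Omega>" "z k \<in> H1 \<Omega>" "continuous_on (closure \<Omega>) (y k)" "continuous_on (closure \<Omega>) (z k)" for k
  using y z by (auto simp: V_approx_def)
 note [measurable] = continuous_measurable_surface[OF yz(3)] continuous_measurable_surface[OF yz(4)]
 have "V_approx (\<lambda>k x. a * y k x + b * z k x) (\<lambda>x. a * u x + b * v x)"
  unfolding V_approx_def
 proof (intro conjI allI)
  show "(\<lambda>x. a * y k x + b * z k x) \<in> H1 \<Omega>" for k by (rule H1_lincomb(1)[OF yz(1,2)])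
  show "continuous_on (closure \<Omega>) (\<lambda>x. a * y k x + b * z k x)" for k by (intro continuous_intros yz)
  show "(\<lambda>k. hsq (\<lambda>x. (a * y k x + b * z k x) - (a * u x + b * v x))) \<leadsto> 0"
  proof (rule squeeze_0[OF _ _ hsq_nonneg])
   show "(\<lambda>k. 2 * a^2 * hsq (y k \<ominus> u) + 2 * b^2 * hsq (z k \<ominus> v)) \<leadsto> 0"
    using y z by (auto simp: V_approx_def intro!: tendsto_add_zero tendsto_mult_right_zero)
   show "hsq (\<lambda>x. (a * y k x + b * z k x) - (a * u x + b * v x)) \<le>
    2 * a^2 * hsq (y k \<ominus> u) + 2 * b^2 * hsq (z k \<ominus> v)" for k
    using hsq_lincomb[OF H1_minus(1)[OF yz(1) uv(1)] H1_minus(1)[OF yz(2) uv(2)], of a k b k]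
    by (simp add: algebra_simps)
  qed
  show "(\<lambda>k. bd_sq (\<lambda>x. a * y k x + b * z k x)) \<leadsto> 0"
  proof (rule squeeze_0)
   have l: "(\<lambda>k. 2 * (ennreal c * F k)) \<leadsto> 0" if "F \<leadsto> 0" for F and c :: real
    using ennreal_tendsto_cmult[OF _ ennreal_tendsto_cmult[OF _ that, of "ennreal c"], of 2] by simp
   show "(\<lambda>k. 2 * (ennreal (a^2) * bd_sq (y k)) + 2 * (ennreal (b^2) * bd_sq (z k))) \<leadsto> 0"
    using tendsto_add[OF l l] y z by (auto simp: V_approx_def)
   have "bd_sq (\<lambda>x. c * F x) = ennreal (c^2) * bd_sq F" if [measurable]: "F \<in> borel_measurable Sur" for c F
    by (subst nn_integral_cmult[symmetric]) (auto simp: power_mult_distrib ennreal_mult mult.assoc)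
   then show "bd_sq (\<lambda>x. a * y k x + b * z k x) \<le> 2 * (ennreal (a^2) * bd_sq (y k)) + 2 * (ennreal (b^2) * bd_sq (z k))" for k
    using nn_square_add[of "\<lambda>x. a * y k x" Sur "\<lambda>x. b * z k x" \<Gamma>] by auto
  qed simp
 qed
 then show ?thesis by (rule V_approx_V[OF H1_lincomb(1)[OF uv]])
qed

text \<open>A diagonal sequence: for each k an approximant of \<open>v k\<close> with error below
  1/(k+1), both in H1 and on \<Gamma>.\<close>

lemma V_closed:
 assumes v: "\<And>k::nat. v k \<in> V" and u: "u \<in> H1 \<Omega>" and lim: "(\<lambda>k. hsq (v k \<ominus> u)) \<leadsto> 0"
 shows "u \<in> V"
proof -
 note vH = V_H1[OF v]
 have "\<exists>w. w \<in> H1 \<Omega> \<and> continuous_on (closure \<Omega>) w \<and> hsq (w \<ominus> v k) < inverse (real (Suc k)) \<and>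
  bd_sq w < ennreal (inverse (real (Suc k)))" for k
 proof -
  obtain w where w: "V_approx w (v k)" using V_has_approx[OF v] by auto
  have "eventually (\<lambda>n. hsq (w n \<ominus> v k) < inverse (real (Suc k)) \<and>
    bd_sq (w n) < ennreal (inverse (real (Suc k)))) sequentially"
   using w unfolding V_approx_def by (intro eventually_conj order_tendstoD(2)) auto
  then obtain n where "hsq (w n \<ominus> v k) < inverse (real (Suc k))"
    "bd_sq (w n) < ennreal (inverse (real (Suc k)))"
   using eventually_happens'[OF sequentially_bot] by blast
  then show ?thesis using w unfolding V_approx_def by blast
 qed
 then obtain w where w: "\<And>k. w k \<in> H1 \<Omega>" "\<And>k. continuous_on (closure \<Omega>) (w k)"
  "\<And>k. hsq (w k \<ominus> v k) < inverse (real (Suc k))"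
  "\<And>k. bd_sq (w k) < ennreal (inverse (real (Suc k)))"
  using choice[of "\<lambda>k w. w \<in> H1 \<Omega> \<and> continuous_on (closure \<Omega>) w \<and> hsq (w \<ominus> v k) < inverse (real (Suc k)) \<and>
  bd_sq w < ennreal (inverse (real (Suc k)))"] by auto
 have "V_approx w u"
  unfolding V_approx_def
 proof (intro conjI allI)
  show "(\<lambda>k. hsq (w k \<ominus> u)) \<leadsto> 0"
  proof (rule squeeze_0[OF _ _ hsq_nonneg])
   show "(\<lambda>k. 2 * inverse (real (Suc k)) + 2 * hsq (v k \<ominus> u)) \<leadsto> 0"
    using LIMSEQ_inverse_real_of_nat lim by (intro tendsto_add_zero tendsto_mult_right_zero)
   show "hsq (w k \<ominus> u) \<le> 2 * inverse (real (Suc k)) + 2 * hsq (v k \<ominus> u)" for k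
    using hsq_triangle[OF w(1) vH u, of k k] w(3)[of k] by simp
  qed
  have "(\<lambda>k. ennreal (inverse (real (Suc k)))) \<leadsto> 0"
   using tendsto_ennrealI[OF LIMSEQ_inverse_real_of_nat] by simp
  then show "(\<lambda>k. bd_sq (w k)) \<leadsto> 0"
   by (rule squeeze_0[OF _ less_imp_le[OF w(4)]]) simp
 qed (use w in auto)
 then show ?thesis by (rule V_approx_V[OF u])
qed

lemma V_complete:
 assumes w: "\<And>k::nat. w k \<in> V"
  and cauchy: "\<And>e. e > 0 ==> \<exists>N. \<forall>m\<ge>N. \<forall>n\<ge>N. hsq (w m \<ominus> w n) < e"
 shows "\<exists>v\<in>V. (\<lambda>k. hsq (w k \<ominus> v)) \<leadsto> 0"
proof -
 obtain v where v: "v \<in> H1 \<Omega>" "(\<lambda>k. hsq (w k \<ominus> v)) \<leadsto> 0"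
  using H1_complete[OF V_H1[OF w] cauchy] by auto
 then show ?thesis using V_closed[OF w v] by auto
qed

lemma V_test_function:
 assumes \<phi>: "\<phi> \<in> test_functions \<Omega>"
 shows "\<phi> \<in> V"
proof (rule V_approx_V[of _ "\<lambda>k. \<phi>"])
 have z: "\<phi> x = 0" if "x \<in> \<Gamma>" for x
  using that \<Gamma>_sub open_dom \<phi> closure_subset[of "{x. \<phi> x \<noteq> 0}"] by (auto simp: test_functions_def frontier_def interior_open)
 have "(\<integral>\<^sup>+x\<in>\<Gamma>. ennreal ((\<phi> x)^2) \<partial>Sur) = (\<integral>\<^sup>+x. 0 \<partial>Sur)"
  by (rule nn_integral_cong) (use z in \<open>auto split: split_indicator\<close>)
 then show "V_approx (\<lambda>k. \<phi>) \<phi>"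
  using H1_test_function[OF \<phi>] test_function_continuous[OF \<phi>] H1_const(3)[of 0]
  by (auto simp: V_approx_def hsq_def mass_def intro: continuous_on_subset)
qed (rule H1_test_function[OF \<phi>])

text \<open>Smallness on \<Gamma> survives the composition since |h t| \<le> B |t|, which is where h
  0 = 0 enters. Passing to approximants that converge almost everywhere makes the factors h' (w k)
  converge.\<close>

lemma V_chain:
 assumes h: "C1_bounded h h' B" "h 0 = 0" and v: "v \<in> V"
 shows "(\<lambda>x. h (v x)) \<in> V"
proof -
 obtain w0 where w0: "V_approx w0 v" using V_has_approx[OF v] by auto
 note m = C1_bounded_lipschitz[OF h(1)] and vH = V_H1[OF v]
 have w0': "w0 k \<in> H1 \<Omega>" "(\<lambda>k. hsq (w0 k \<ominus> v)) \<leadsto> 0" for k using w0 by (auto simp: V_approx_def)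
 have "L2_lim Leb w0 v"
  using squeeze_0[OF w0'(2), of "\<lambda>k. mass (w0 k \<ominus> v)"] mass_nonneg energy_nonneg by (simp add: hsq_def mass_def)
 from L2_tendsto_AE_subseq[OF H1D(1)[OF w0'(1)] H1D(1)[OF vH] this]
 obtain r :: "nat => nat" where r: "strict_mono r" "AE x in Leb. (\<lambda>k. w0 (r k) x) \<leadsto> v x" by auto
 define w where "w = (\<lambda>k. w0 (r k))"
 have w: "w k \<in> H1 \<Omega>" "continuous_on (closure \<Omega>) (w k)" for k using w0 by (auto simp: w_def V_approx_def)
 have wl: "(\<lambda>k. hsq (w k \<ominus> v)) \<leadsto> 0" "(\<lambda>k. bd_sq (w k)) \<leadsto> 0"
  using w0 LIMSEQ_subseq_LIMSEQ[OF _ r(1)] unfolding w_def V_approx_def o_def by auto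
 note [measurable] = continuous_measurable_surface[OF w(2)]
 have b: "\<bar>h t\<bar> \<le> B * \<bar>t\<bar>" "\<bar>h' t\<bar> \<le> B" for t using m(1)[of t 0] h by (auto simp: C1_bounded_def)
 have "AE x in Leb. (\<lambda>k. h' (w k x)) \<leadsto> h' (v x)"
  using r(2)
 proof eventually_elim
  fix x assume l: "(\<lambda>k. w0 (r k) x) \<leadsto> v x"
  have "isCont h' (v x)" using h(1) by (auto simp: C1_bounded_def continuous_on_eq_continuous_at)
  from isCont_tendsto_compose[OF this l] show "(\<lambda>k. h' (w k x)) \<leadsto> h' (v x)" by (simp add: w_def)
 qed
 note c = H1_chain_seq[OF h w(1) vH wl(1) m(2) b(1) tendsto_const m(3) b(2) this]
 have "(\<lambda>k. bd_sq (\<lambda>x. h (w k x))) \<leadsto> 0"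
 proof (rule squeeze_0)
  show "(\<lambda>k. ennreal (B^2) * bd_sq (w k)) \<leadsto> 0"
   using ennreal_tendsto_cmult[OF _ wl(2), of "ennreal (B^2)"] by simp
  have "(h t)^2 \<le> B^2 * t^2" for t using power_mono[OF b(1)[of t], of 2] by (simp add: power_mult_distrib)
  then have "bd_sq (\<lambda>x. h (w k x)) \<le> (\<integral>\<^sup>+x. ennreal (B^2) * (ennreal ((w k x)^2) * indicator \<Gamma> x) \<partial>Sur)" for k
   by (intro nn_integral_mono) (auto simp: ennreal_mult[symmetric] ennreal_leI split: split_indicator)
  then show "bd_sq (\<lambda>x. h (w k x)) \<le> ennreal (B^2) * bd_sq (w k)" for k by (simp add: nn_integral_cmult)
 qed simp
 then have "V_approx (\<lambda>k x. h (w k x)) (\<lambda>x. h (v x))"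
  using c H1_chain(1)[OF h w(1)] continuous_on_compose2[OF m(5)[of UNIV] w(2)] unfolding V_approx_def by auto
 then show ?thesis by (rule V_approx_V[OF c(1)])
qed

lemma V_chain_limit:
 assumes h: "\<And>k::nat. C1_bounded (h k) (h' k) B" "\<And>k. h k 0 = 0"
  and lim: "\<And>t. (\<lambda>k. h k t) \<leadsto> \<zeta> t" "\<And>t. (\<lambda>k. h' k t) \<leadsto> d t" and u: "u \<in> V"
 shows "(\<lambda>x. \<zeta> (u x)) \<in> V"
 using V_closed[OF V_chain[OF h u] H1_chain_limit(1,3)[OF h lim V_H1[OF u]]] .

end

section \<open>Truncations, pairing and coercivity\<close>

lemma has_derivative_max_square:
 "((\<lambda>t. (max 0 t)^2) has_real_derivative 2 * max 0 t) (at (t::real))"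
proof -
 consider "t > 0" | "t < 0" | "t = 0" by linarith
 then show ?thesis
 proof cases
  case 1
  have d: "((\<lambda>t. t^2) has_real_derivative 2 * max 0 t) (at t)"
   using 1 by (auto intro!: derivative_eq_intros)
  have e: "\<forall>\<^sub>F x in nhds t. x^2 = (max 0 x)^2"
   by (rule eventually_mono[OF eventually_nhds_in_open[of "{0<..}" t]]) (use 1 in auto)
  show ?thesis using DERIV_cong_ev[OF refl e refl, THEN iffD1, OF d] .
 next
  case 2
  have d: "((\<lambda>t. 0) has_real_derivative 2 * max 0 t) (at t)" using 2 by simp
  have e: "\<forall>\<^sub>F x in nhds t. 0 = (max 0 x)^2"
   by (rule eventually_mono[OF eventually_nhds_in_open[of "{..<0}" t]]) (use 2 in auto)
  show ?thesis using DERIV_cong_ev[OF refl e refl, THEN iffD1, OF d] .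
 next
  case 3
  have "((\<lambda>h. ((max 0 (0 + h))^2 - (max 0 0)^2) / h) \<longlongrightarrow> 0) (at (0::real))"
   by (rule tendsto_0_le[where K = 1 and f = "\<lambda>h. h"])
    (auto intro!: always_eventually simp: max_def power2_eq_square)
  then show ?thesis using 3 by (simp add: DERIV_def)
 qed
qed

text \<open>The usual regularisation of the positive part. It is C1 because the square of max 0 t
  is, it vanishes for t \<le> 0, and its derivative stays in [0, 1].\<close>

definition smooth_max :: "nat => real => real" where
 "smooth_max k t = sqrt ((max 0 t)^2 + (inverse (real (Suc k)))^2) - inverse (real (Suc k))"

lemma smooth_max_C1_bounded:
 "C1_bounded (smooth_max k) (\<lambda>t. max 0 t / sqrt ((max 0 t)^2 + (inverse (real (Suc k)))^2)) 1"
proof -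
 define e where "e = inverse (real (Suc k))"
 have e: "e > 0" by (simp add: e_def)
 have p: "(max 0 t)^2 + e^2 > 0" for t :: real using e by (simp add: add_nonneg_pos)
 have "((\<lambda>t. sqrt ((max 0 t)^2 + e^2) - e) has_real_derivative max 0 t / sqrt ((max 0 t)^2 + e^2)) (at t)" for t
 proof -
  have "((\<lambda>t. (max 0 t)^2 + e^2) has_real_derivative 2 * max 0 t) (at t)"
   by (rule DERIV_cong[OF DERIV_add[OF has_derivative_max_square DERIV_const]]) simp
  then have "((\<lambda>t. sqrt ((max 0 t)^2 + e^2)) has_real_derivative inverse (sqrt ((max 0 t)^2 + e^2)) / 2 * (2 * max 0 t)) (at t)"
   by (rule DERIV_chain2[where f = sqrt and g = "\<lambda>t. (max 0 t)^2 + e^2" and x = t, OF DERIV_real_sqrt[OF p]])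
  from DERIV_diff[OF this DERIV_const[of e]] show ?thesis
   by (rule DERIV_cong) (simp add: field_simps)
 qed
 moreover have "continuous_on UNIV (\<lambda>t. max 0 t / sqrt ((max 0 t)^2 + e^2))"
  using p by (intro continuous_intros) (auto simp: less_imp_neq[symmetric])
 moreover have "\<bar>max 0 t / sqrt ((max 0 t)^2 + e^2)\<bar> \<le> 1" for t
 proof -
  have "max 0 t \<le> sqrt ((max 0 t)^2 + e^2)" by (rule real_le_rsqrt) simp
  then show ?thesis using p[of t] by (simp add: abs_divide)
 qed
 ultimately show ?thesis unfolding C1_bounded_def smooth_max_def e_def by blast
qed

lemma smooth_max_limit:
 "smooth_max k 0 = 0" "(\<lambda>k. smooth_max k t) \<leadsto> max 0 t"
 "(\<lambda>k. max 0 t / sqrt ((max 0 t)^2 + (inverse (real (Suc k)))^2)) \<leadsto> (if t > 0 then 1 else 0)"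
proof -
 show "smooth_max k 0 = 0" by (simp add: smooth_max_def)
 have s: "(\<lambda>k. sqrt ((max 0 t)^2 + (inverse (real (Suc k)))^2)) \<leadsto> sqrt ((max 0 t)^2 + 0^2)"
  by (intro tendsto_intros LIMSEQ_inverse_real_of_nat)
 show "(\<lambda>k. smooth_max k t) \<leadsto> max 0 t"
  using tendsto_diff[OF s LIMSEQ_inverse_real_of_nat] by (simp add: smooth_max_def)
 show "(\<lambda>k. max 0 t / sqrt ((max 0 t)^2 + (inverse (real (Suc k)))^2)) \<leadsto> (if t > 0 then 1 else 0)"
 proof (cases "t > 0")
  case True
  then show ?thesis using tendsto_divide[OF tendsto_const[of t] s] by simp
 qed simp
qed

text \<open>The arctangent instead of a sharp cut-off: it is bounded and C1 with derivative at most
  1, so the chain rule applies directly. The bound 2 (k + 1) uses pi / 2 < 2.\<close>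

definition truncate :: "nat => real => real" where
 "truncate k t = real (Suc k) * arctan (t / real (Suc k))"

lemma truncate_C1_bounded: "C1_bounded (truncate k) (\<lambda>t. 1 / (1 + (t / real (Suc k))^2)) 1"
proof -
 define c where "c = real (Suc k)"
 have c: "c > 0" by (simp add: c_def)
 have p: "1 + (t / c)^2 > 0" for t by (simp add: add_pos_nonneg)
 have "((\<lambda>t. c * arctan (t / c)) has_real_derivative 1 / (1 + (t / c)^2)) (at t)" for t
  by (rule derivative_eq_intros refl)+ (use c in \<open>auto simp: divide_inverse\<close>)
 moreover have "continuous_on UNIV (\<lambda>t. 1 / (1 + (t / c)^2))"
  using p c by (intro continuous_intros) (auto simp: less_imp_neq[symmetric])
 moreover have "\<bar>1 / (1 + (t / c)^2)\<bar> \<le> 1" for t using p[of t] by (simp add: abs_divide)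
 ultimately show ?thesis unfolding C1_bounded_def truncate_def c_def by blast
qed

lemma truncate_limit:
 "truncate k 0 = 0" "(\<lambda>k. truncate k t) \<leadsto> t" "(\<lambda>k. 1 / (1 + (t / real (Suc k))^2)) \<leadsto> 1"
 "\<bar>truncate k t\<bar> \<le> \<bar>t\<bar>" "\<bar>truncate k t\<bar> \<le> 2 * real (Suc k)"
proof -
 show z: "truncate k 0 = 0" for k by (simp add: truncate_def)
 have l: "(\<lambda>k. t / real (Suc k)) \<leadsto> 0"
  using tendsto_mult_right_zero[OF LIMSEQ_inverse_real_of_nat, of t] by (simp add: divide_inverse)
 show "(\<lambda>k. 1 / (1 + (t / real (Suc k))^2)) \<leadsto> 1"
  using tendsto_divide[OF tendsto_const[of 1] tendsto_add[OF tendsto_const[of 1] tendsto_power[OF l, of 2]]] by simp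
 show "\<bar>truncate k t\<bar> \<le> \<bar>t\<bar>" using C1_bounded_lipschitz(1)[OF truncate_C1_bounded, of k t 0] z by simp
 show "\<bar>truncate k t\<bar> \<le> 2 * real (Suc k)"
 proof -
  have "\<bar>arctan (t / real (Suc k))\<bar> \<le> 2"
   using arctan_bounded[of "t / real (Suc k)"] pi_less_4 by (auto simp: abs_le_iff)
  from mult_left_mono[OF this, of "real (Suc k)"] show ?thesis unfolding truncate_def abs_mult by (simp add: mult.commute)
 qed
 show "(\<lambda>k. truncate k t) \<leadsto> t"
 proof (cases "t = 0")
  case False
  have "((\<lambda>h. arctan h / h) \<longlongrightarrow> 1) (at 0)" using DERIV_arctan[of 0] by (simp add: DERIV_def)
  moreover have "filterlim (\<lambda>k. t / real (Suc k)) (at 0) sequentially"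
   using l False by (simp add: filterlim_at)
  ultimately have "(\<lambda>k. arctan (t / real (Suc k)) / (t / real (Suc k))) \<leadsto> 1" by (rule filterlim_compose)
  from tendsto_mult_left[OF this, of t] show ?thesis using False by (simp add: truncate_def mult.commute)
 qed (simp add: z)
qed

lemma Lp_abs_le:
 assumes f: "f \<in> Lp p M" and g: "g \<in> Lp p M" and p: "p > 1" and h: "h \<in> borel_measurable M"
  and le: "AE x in M. \<bar>h x\<bar> \<le> \<bar>f x\<bar> + \<bar>g x :: real\<bar>"
 shows "(h :: 'a => real) \<in> Lp p M"
proof -
 have "integrable M (\<lambda>x. \<bar>h x\<bar> powr p)"
 proof (rule Bochner_Integration.integrable_bound)
  show "integrable M (\<lambda>x. 2 powr p * (\<bar>f x\<bar> powr p + \<bar>g x\<bar> powr p))" using f g by (simp add: Lp_def)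
  show "AE x in M. norm (\<bar>h x\<bar> powr p) \<le> norm (2 powr p * (\<bar>f x\<bar> powr p + \<bar>g x\<bar> powr p))"
   using le
  proof eventually_elim
   fix x assume "\<bar>h x\<bar> \<le> \<bar>f x\<bar> + \<bar>g x\<bar>"
   then have "\<bar>h x\<bar> powr p \<le> (\<bar>f x\<bar> + \<bar>g x\<bar>) powr p" using p by (intro powr_mono2) auto
   also have "\<dots> \<le> 2 powr p * (\<bar>f x\<bar> powr p + \<bar>g x\<bar> powr p)" using p by (intro powr_add_le) auto
   finally show "norm (\<bar>h x\<bar> powr p) \<le> norm (2 powr p * (\<bar>f x\<bar> powr p + \<bar>g x\<bar> powr p))" by simp
  qed
 qed (use h in measurable)
 then show ?thesis using h by (simp add: Lp_def)
qed

section \<open>Pairing with loads in L^p, and the bilinear form\<close>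

context lipschitz_domain
begin

text \<open>Young's inequality bounds the pairing on the unit ball of H1, where the integral of
  |v|^q is bounded: by the Sobolev embedding if the conjugate exponent q exceeds 2, and by |v|^q
  \<le> 1 + v^2 otherwise. Homogeneity turns this into a norm bound. The lower bound on p amounts to
  n (q - 2) \<le> 2 q.\<close>

lemma Lp_pairing:
 assumes p: "1 < p" "p \<ge> 2 * real DIM('a) / (real DIM('a) + 2)" and f: "f \<in> Lp p Leb"
 shows "\<exists>C\<ge>0. \<forall>v\<in>H1 \<Omega>. integrable Leb (\<lambda>x. f x * v x) \<and> (LINT x|Leb. \<bar>f x * v x\<bar>)^2 \<le> C * hsq v"
proof -
 define q where "q = p / (p - 1)"
 have q: "q > 1" "1 / p + 1 / q = 1" using p(1) by (auto simp: q_def field_simps)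
 have "\<exists>D\<ge>0. \<forall>v\<in>H1 \<Omega>. hsq v \<le> 1 --> (\<integral>\<^sup>+x. ennreal (\<bar>v x\<bar> powr q) \<partial>Leb) \<le> ennreal D"
 proof (cases "q > 2")
  case True
  have "real DIM('a) * (2 - p) \<le> 2 * p" using p(2) by (simp add: field_simps)
  then have "real DIM('a) * (2 - p) / (p - 1) \<le> 2 * p / (p - 1)" using p(1) by (intro divide_right_mono) auto
  moreover have "q - 2 = (2 - p) / (p - 1)" using p(1) by (simp add: q_def field_simps)
  ultimately have "real DIM('a) * (q - 2) \<le> 2 * q" by (simp add: q_def)
  from Sobolev_embedding[OF True this] show ?thesis unfolding hsq_def .
 next
  case False
  show ?thesis
  proof (intro exI[of _ "vol + 1"] conjI ballI impI)
   show "0 \<le> vol + 1" using vol_nonneg by simp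
   fix v assume v: "v \<in> H1 \<Omega>" "hsq v \<le> 1"
   have i: "integrable Leb (\<lambda>x. 1 + (v x)^2)"
    using H1D(1)[OF v(1)] finite_measure.integrable_const[OF finite_measure_dom]
    by (auto simp: Lp2_iff intro!: Bochner_Integration.integrable_add)
   have "(\<integral>\<^sup>+x. ennreal (\<bar>v x\<bar> powr q) \<partial>Leb) \<le> (\<integral>\<^sup>+x. ennreal (1 + (v x)^2) \<partial>Leb)"
   proof (intro nn_integral_mono ennreal_leI)
    fix x
    show "\<bar>v x\<bar> powr q \<le> 1 + (v x)^2"
    proof (cases "\<bar>v x\<bar> \<le> 1")
     case True
     then have "\<bar>v x\<bar> powr q \<le> 1 powr q" using q by (intro powr_mono2) auto
     then show ?thesis by (simp add: add_increasing2)
    next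
     case F: False
     then have "\<bar>v x\<bar> powr q \<le> \<bar>v x\<bar> powr 2" using False by (intro powr_mono) auto
     then show ?thesis using F by (simp add: powr_numeral)
    qed
   qed
   also have "\<dots> = ennreal (LINT x|Leb. 1 + (v x)^2)" by (rule nn_integral_eq_integral[OF i]) simp
   also have "(LINT x|Leb. 1 + (v x)^2) = vol + mass v"
    unfolding mass_def integral_1_dom[symmetric]
    by (rule Bochner_Integration.integral_add)
     (use H1D(1)[OF v(1)] finite_measure.integrable_const[OF finite_measure_dom] in \<open>auto simp: Lp2_iff\<close>)
   finally show "(\<integral>\<^sup>+x. ennreal (\<bar>v x\<bar> powr q) \<partial>Leb) \<le> ennreal (vol + 1)"
    by (rule order_trans[OF _ ennreal_leI]) (use v(2) energy_nonneg[of v] in \<open>simp add: hsq_def\<close>)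
  qed
 qed
 then obtain D where D: "D \<ge> 0" "\<And>v. v \<in> H1 \<Omega> ==> hsq v \<le> 1 ==> (\<integral>\<^sup>+x. ennreal (\<bar>v x\<bar> powr q) \<partial>Leb) \<le> ennreal D"
  by auto
 have fm: "f \<in> borel_measurable Leb" and fi: "integrable Leb (\<lambda>x. \<bar>f x\<bar> powr p)" using f by (auto simp: Lp_def)
 define I where "I = (LINT x|Leb. \<bar>f x\<bar> powr p)"
 have unit: "integrable Leb (\<lambda>x. f x * v x)" "(LINT x|Leb. \<bar>f x * v x\<bar>) \<le> I + D"
  if v: "v \<in> H1 \<Omega>" "hsq v \<le> 1" for v
 proof -
  have vm: "v \<in> borel_measurable Leb" using H1D(1)[OF v(1)] by (simp add: Lp2_iff)
  have vi: "integrable Leb (\<lambda>x. \<bar>v x\<bar> powr q)"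
   using D(2)[OF v] vm by (intro integrableI_nonneg) (auto intro: le_less_trans)
  have vI: "(LINT x|Leb. \<bar>v x\<bar> powr q) \<le> D"
   using D(2)[OF v] D(1) nn_integral_eq_integral[OF vi] by (simp add: ennreal_le_iff)
  have y: "\<bar>f x * v x\<bar> \<le> \<bar>f x\<bar> powr p + \<bar>v x\<bar> powr q" for x
  proof -
   have "\<bar>f x\<bar> * \<bar>v x\<bar> \<le> \<bar>f x\<bar> powr p / p + \<bar>v x\<bar> powr q / q"
    using p(1) q by (intro Youngs_inequality) auto
   also have "\<dots> \<le> \<bar>f x\<bar> powr p + \<bar>v x\<bar> powr q"
    using p(1) q by (intro add_mono) (auto simp: divide_le_eq mult_le_cancel_left1)
   finally show ?thesis by (simp add: abs_mult)
  qed
  show i: "integrable Leb (\<lambda>x. f x * v x)"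
   by (rule Bochner_Integration.integrable_bound[OF Bochner_Integration.integrable_add[OF fi vi]])
    (use y fm vm in \<open>auto intro: order_trans[OF _ abs_ge_self]\<close>)
  have "(LINT x|Leb. \<bar>f x * v x\<bar>) \<le> (LINT x|Leb. \<bar>f x\<bar> powr p + \<bar>v x\<bar> powr q)"
   by (rule integral_mono) (use i fi vi y in auto)
  then show "(LINT x|Leb. \<bar>f x * v x\<bar>) \<le> I + D" using fi vi vI by (simp add: I_def)
 qed
 define K where "K = I + D + 1"
 have "0 \<le> I" unfolding I_def by (rule Bochner_Integration.integral_nonneg) simp
 then have K: "K > 0" using D(1) by (simp add: K_def)
 have scaled: "integrable Leb (\<lambda>x. f x * v x)" "(LINT x|Leb. \<bar>f x * v x\<bar>) \<le> s * K"
  if v: "v \<in> H1 \<Omega>" and s: "s > 0" "hsq v \<le> s^2" for v s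
 proof -
  have w: "(\<lambda>x. inverse s * v x) \<in> H1 \<Omega>" by (rule H1_scale_energy(1)[OF v])
  have "hsq (\<lambda>x. inverse s * v x) = hsq v / s^2"
   using H1_scale_energy(2,3)[OF v, of "inverse s"] by (simp add: hsq_def power_inverse divide_inverse algebra_simps)
  then have hw: "hsq (\<lambda>x. inverse s * v x) \<le> 1" using s by (simp add: divide_le_eq)
  have eq: "f x * v x = s * (f x * (inverse s * v x))" for x using s by (simp add: field_simps)
  show "integrable Leb (\<lambda>x. f x * v x)" unfolding eq[of _] using unit(1)[OF w hw] by (rule integrable_mult_right)
  have "(LINT x|Leb. \<bar>f x * v x\<bar>) = s * (LINT x|Leb. \<bar>f x * (inverse s * v x)\<bar>)"
   unfolding integral_mult_right_zero[symmetric] using s(1)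
   by (intro Bochner_Integration.integral_cong refl) (simp add: abs_mult)
  then show "(LINT x|Leb. \<bar>f x * v x\<bar>) \<le> s * K" using unit(2)[OF w hw] s by (simp add: K_def mult_left_mono)
 qed
 have "integrable Leb (\<lambda>x. f x * v x) \<and> (LINT x|Leb. \<bar>f x * v x\<bar>)^2 \<le> K^2 * hsq v" if v: "v \<in> H1 \<Omega>" for v
 proof -
  \<comment> \<open>The scaling factor has to be positive even when \<open>hsq v\<close> is 0, hence
    the additional e, which is removed at the end.\<close>
  have s: "sqrt (hsq v) + e > 0" "hsq v \<le> (sqrt (hsq v) + e)^2" if "e > 0" for e
   using that hsq_nonneg[of v] by (auto simp: power2_sum add_nonneg_pos)
  have "(LINT x|Leb. \<bar>f x * v x\<bar>) \<le> sqrt (hsq v) * K"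
  proof (rule field_le_epsilon)
   fix e :: real assume "e > 0"
   then have "e / K > 0" using K by simp
   from scaled(2)[OF v s[OF this]] show "(LINT x|Leb. \<bar>f x * v x\<bar>) \<le> sqrt (hsq v) * K + e"
    using K by (simp add: distrib_right)
  qed
  from power_mono[OF this, of 2] show ?thesis
   using scaled(1)[OF v s[OF zero_less_one]] hsq_nonneg[of v]
   by (simp add: Bochner_Integration.integral_nonneg power_mult_distrib mult.commute)
 qed
 then show ?thesis by (intro exI[of _ "K^2"]) auto
qed

lemma bilin_a_eq:
 assumes u: "u \<in> H1 \<Omega>" and v: "v \<in> H1 \<Omega>"
 shows "integrable Leb (\<lambda>x. grad u x \<bullet> grad v x + \<sigma> * u x * v x)"
  "bilin_a \<Omega> \<sigma> u v = (LINT x|Leb. grad u x \<bullet> grad v x) + \<sigma> * (LINT x|Leb. u x * v x)"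
 using L2_integrable_inner[OF H1D(2)[OF u] H1D(2)[OF v]] L2_integrable_mult[OF H1D(1)[OF u] H1D(1)[OF v]]
 by (auto simp: bilin_a_def mult.assoc)

lemma bilin_a_self: "u \<in> H1 \<Omega> ==> bilin_a \<Omega> \<sigma> u u = energy u + \<sigma> * mass u"
 by (simp add: bilin_a_eq energy_def mass_def power2_norm_eq_inner) (simp add: power2_eq_square)

lemma bilin_a_sym: "bilin_a \<Omega> \<sigma> u v = bilin_a \<Omega> \<sigma> v u"
 by (simp add: bilin_a_def inner_commute mult_ac)

lemma bilin_a_lincomb:
 assumes u: "u \<in> H1 \<Omega>" and v: "v \<in> H1 \<Omega>" and w: "w \<in> H1 \<Omega>"
 shows "bilin_a \<Omega> \<sigma> (\<lambda>x. s * u x + t * v x) w = s * bilin_a \<Omega> \<sigma> u w + t * bilin_a \<Omega> \<sigma> v w"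
proof -
 have m: "g \<in> H1 \<Omega> ==> grad g \<in> borel_measurable Leb \<and> g \<in> borel_measurable Leb" for g
  using H1D(1,2)[of g] by (simp add: Lp2_iff)
 note [measurable] = m[OF u, THEN conjunct1] m[OF v, THEN conjunct1] m[OF w, THEN conjunct1]
  m[OF u, THEN conjunct2] m[OF v, THEN conjunct2] m[OF w, THEN conjunct2] m[OF H1_lincomb(1)[OF u v], THEN conjunct1]
 have "bilin_a \<Omega> \<sigma> (\<lambda>x. s * u x + t * v x) w =
   (LINT x|Leb. s * (grad u x \<bullet> grad w x + \<sigma> * u x * w x) +
    t * (grad v x \<bullet> grad w x + \<sigma> * v x * w x))"
  unfolding bilin_a_def
 proof (rule integral_cong_AE)
  show "AE x in Leb. grad (\<lambda>x. s * u x + t * v x) x \<bullet> grad w x + \<sigma> * (s * u x + t * v x) * w x =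
   s * (grad u x \<bullet> grad w x + \<sigma> * u x * w x) +
    t * (grad v x \<bullet> grad w x + \<sigma> * v x * w x)"
   using H1_lincomb(2)[OF u v, of s t] by eventually_elim (simp add: inner_add_left algebra_simps)
 qed measurable
 then show ?thesis using bilin_a_eq(1)[OF u w, of \<sigma>] bilin_a_eq(1)[OF v w, of \<sigma>] by (simp add: bilin_a_def)
qed

end

section \<open>Positive parts in V, and coercivity\<close>

context dirichlet_domain
begin

lemma V_pos_part:
 assumes "u \<in> V"
 shows "(\<lambda>x. max 0 (u x)) \<in> V" "AE x in Leb. grad (\<lambda>x. max 0 (u x)) x = (if u x > 0 then 1 else 0) *\<^sub>R grad u x"
 using V_chain_limit[OF smooth_max_C1_bounded smooth_max_limit assms]
  H1_chain_limit(2)[OF smooth_max_C1_bounded smooth_max_limit V_H1[OF assms]] .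

lemma V_truncate:
 assumes "u \<in> V"
 shows "(\<lambda>x. truncate k (u x)) \<in> V" "(\<lambda>k. hsq (\<lambda>x. truncate k (u x) - u x)) \<leadsto> 0"
 using V_chain[OF truncate_C1_bounded truncate_limit(1) assms]
  H1_chain_limit(3)[OF truncate_C1_bounded truncate_limit(1-3) V_H1[OF assms]] .

text \<open>Only the set where u > 0 contributes, and there u and its positive part have the same
  value and the same gradient.\<close>

lemma bilin_a_pos_part:
 assumes u: "u \<in> V"
 shows "bilin_a \<Omega> \<sigma> u (\<lambda>x. max 0 (u x)) = bilin_a \<Omega> \<sigma> (\<lambda>x. max 0 (u x)) (\<lambda>x. max 0 (u x))"
proof -
 note H = V_H1[OF V_pos_part(1)[OF u]] V_H1[OF u]
 have "grad g \<in> borel_measurable Leb \<and> g \<in> borel_measurable Leb" if "g \<in> H1 \<Omega>" for g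
  using H1D(1,2)[OF that] by (simp add: Lp2_iff)
 from this[OF H(1)] this[OF H(2)] have m: "grad (\<lambda>x. max 0 (u x)) \<in> borel_measurable Leb"
  "grad u \<in> borel_measurable Leb" "u \<in> borel_measurable Leb" by auto
 have ae: "AE x in Leb. grad u x \<bullet> grad (\<lambda>x. max 0 (u x)) x + \<sigma> * u x * max 0 (u x) =
  grad (\<lambda>x. max 0 (u x)) x \<bullet> grad (\<lambda>x. max 0 (u x)) x + \<sigma> * max 0 (u x) * max 0 (u x)"
  using V_pos_part(2)[OF u] by eventually_elim (auto simp: max_def)
 show ?thesis unfolding bilin_a_def by (rule integral_cong_AE[OF _ _ ae]) (use m in auto)
qed

text \<open>The Poincare inequality bounds v - c, so it remains to bound the constant c. On \<Gamma>
  the function v vanishes, hence v - c equals -c there, and the trace inequality bounds c^2 times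
  the measure of \<Gamma>. As traces are given by approximation, this is carried out for
  approximants of v.\<close>

lemma Poincare_Friedrichs:
 assumes \<Gamma>: "emeasure surface_measure \<Gamma> \<noteq> 0"
 shows "\<exists>C\<ge>0. \<forall>v\<in>V. mass v \<le> C * energy v"
proof -
 obtain C1 where C1: "C1 \<ge> 0" "\<And>u. u \<in> H1 \<Omega> ==> \<exists>c. mass (\<lambda>x. u x - c) \<le> C1 * energy u"
  using Poincare by auto
 obtain C2 where C2: "C2 \<ge> 0" "\<And>u. u \<in> H1 \<Omega> ==> continuous_on (closure \<Omega>) u ==>
  (\<integral>\<^sup>+x. ennreal ((u x)^2) \<partial>Sur) \<le> ennreal (C2 * hsq u)"
  using trace_inequality unfolding hsq_def by auto
 interpret Sur: finite_measure Sur by (rule finite_measure_Sur)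
 define s where "s = measure Sur \<Gamma>"
 have "emeasure Sur \<Gamma> = emeasure surface_measure \<Gamma>"
  using \<Gamma>_sub frontier_sets by (intro emeasure_restrict_space) (auto simp: sets.Int_space_eq2)
 then have s: "s > 0" "emeasure Sur \<Gamma> = ennreal s"
  using \<Gamma> by (auto simp: s_def Sur.emeasure_eq_measure zero_less_measure_iff)
 define \<mu> where "\<mu> = mass (\<lambda>x. 1)"
 have \<mu>: "\<mu> \<ge> 0" by (simp add: \<mu>_def mass_nonneg)
 have "mass v \<le> (2 * C1 + 2 * (\<mu> * (4 * C2 * (C1 + 1)) / s)) * energy v" if v: "v \<in> V" for v
 proof -
  note vH = V_H1[OF v]
  obtain c where c: "mass (\<lambda>x. v x - c) \<le> C1 * energy v" using C1(2)[OF vH] by auto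
  obtain w where w: "V_approx w v" using V_has_approx[OF v] by auto
  have wH: "w k \<in> H1 \<Omega>" "continuous_on (closure \<Omega>) (w k)" for k using w by (auto simp: V_approx_def)
  note [measurable] = continuous_measurable_surface[OF wH(2)]
  have "energy (\<lambda>x. v x - c) = energy v"
   unfolding energy_def[of v]
   by (rule energy_eqI[OF H1_minus(1)[OF vH H1_const(1)]])
    (use H1_minus(2)[OF vH H1_const(1)[of c]] H1_const(2)[of c] in \<open>eventually_elim; simp\<close>)
  then have hc: "hsq (\<lambda>x. v x - c) \<le> (C1 + 1) * energy v" using c by (simp add: hsq_def algebra_simps)
  define T where "T = (\<lambda>t. C2 * (2 * t + 2 * ((C1 + 1) * energy v)))"
  have le: "ennreal (c^2 * s) \<le> 2 * ennreal (T (hsq (w k \<ominus> v))) + 2 * bd_sq (w k)" for k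
  proof -
   note d = H1_minus(1)[OF wH(1) H1_const(1)]
   have "(\<integral>\<^sup>+x\<in>\<Gamma>. ennreal ((c - w k x)^2) \<partial>Sur) \<le> (\<integral>\<^sup>+x. ennreal ((w k x - c)^2) \<partial>Sur)"
    by (rule nn_integral_mono) (auto simp: power2_commute split: split_indicator)
   also have "\<dots> \<le> ennreal (C2 * hsq (\<lambda>x. w k x - c))" by (rule C2(2)[OF d continuous_on_diff[OF wH(2) continuous_on_const]])
   also have "\<dots> \<le> ennreal (T (hsq (w k \<ominus> v)))"
    using hsq_triangle[OF wH(1) vH H1_const(1), of k c] hc C2(1) unfolding T_def by (intro ennreal_leI mult_left_mono) auto
   finally have 1: "(\<integral>\<^sup>+x\<in>\<Gamma>. ennreal ((c - w k x)^2) \<partial>Sur) \<le> ennreal (T (hsq (w k \<ominus> v)))" .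
   have "ennreal (c^2 * s) = (\<integral>\<^sup>+x\<in>\<Gamma>. ennreal (c^2) \<partial>Sur)"
    by (subst nn_integral_cmult_indicator) (use s in \<open>auto simp: ennreal_mult\<close>)
   also have "\<dots> \<le> 2 * (\<integral>\<^sup>+x\<in>\<Gamma>. ennreal ((c - w k x)^2) \<partial>Sur) + 2 * bd_sq (w k)"
    using nn_square_add[of "\<lambda>x. c - w k x" Sur "w k" \<Gamma>] by simp
   finally show ?thesis using add_right_mono[OF mult_left_mono[OF 1 zero_le]] by (rule order_trans)
  qed
  have "(\<lambda>k. 2 * ennreal (T (hsq (w k \<ominus> v))) + 2 * bd_sq (w k)) \<leadsto> 2 * ennreal (T 0) + 2 * 0"
   using w unfolding T_def V_approx_def by (intro tendsto_add ennreal_tendsto_cmult tendsto_ennrealI tendsto_intros) auto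
  from LIMSEQ_le_const[OF this] le have "ennreal (c^2 * s) \<le> 2 * ennreal (T 0) + 2 * 0" by blast
  also have "\<dots> = ennreal (4 * C2 * (C1 + 1) * energy v)"
   using C1(1) C2(1) energy_nonneg[of v]
   by (simp add: T_def ennreal_numeral[symmetric] ennreal_mult'[symmetric] mult_ac del: ennreal_numeral)
  finally have "c^2 * s \<le> 4 * C2 * (C1 + 1) * energy v"
   using C1(1) C2(1) energy_nonneg[of v] by (simp add: ennreal_le_iff)
  then have "c^2 \<le> 4 * C2 * (C1 + 1) * energy v / s" using s(1) by (simp add: le_divide_eq)
  then have "\<mu> * c^2 \<le> \<mu> * (4 * C2 * (C1 + 1) * energy v / s)" using \<mu> by (rule mult_left_mono)
  moreover have "mass v \<le> 2 * mass (\<lambda>x. v x - c) + 2 * (\<mu> * c^2)"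
   using L2_square_add_le[OF H1D(1)[OF H1_minus(1)[OF vH H1_const(1)]] H1D(1)[OF H1_const(1)], of c c]
   by (simp add: mass_def \<mu>_def mult.commute)
  ultimately have "mass v \<le> 2 * (C1 * energy v) + 2 * (\<mu> * (4 * C2 * (C1 + 1) * energy v / s))" using c by linarith
  then show ?thesis by (simp add: algebra_simps)
 qed
 then show ?thesis using C1(1) C2(1) \<mu> s(1)
  by (intro exI[of _ "2 * C1 + 2 * (\<mu> * (4 * C2 * (C1 + 1)) / s)"]) auto
qed

lemma bilin_a_coercive:
 assumes \<sigma>: "\<sigma> \<ge> 0" "emeasure surface_measure \<Gamma> = 0 --> \<sigma> > 0"
 shows "\<exists>c>0. \<forall>v\<in>V. c * hsq v \<le> bilin_a \<Omega> \<sigma> v v"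
proof (cases "\<sigma> > 0")
 case True
 have "min 1 \<sigma> * hsq v \<le> bilin_a \<Omega> \<sigma> v v" if "v \<in> V" for v
  unfolding bilin_a_self[OF V_H1[OF that]] hsq_def distrib_left
  using mult_right_mono[of "min 1 \<sigma>" 1 "energy v"] mult_right_mono[of "min 1 \<sigma>" \<sigma> "mass v"] mass_nonneg energy_nonneg by auto
 then show ?thesis using True by (intro exI[of _ "min 1 \<sigma>"]) auto
next
 case False
 then obtain C where C: "C \<ge> 0" "\<And>v. v \<in> V ==> mass v \<le> C * energy v" using Poincare_Friedrichs \<sigma> by auto
 have "1 / (C + 1) * hsq v \<le> bilin_a \<Omega> \<sigma> v v" if "v \<in> V" for v
 proof -
  have "hsq v \<le> (C + 1) * energy v" using C(2)[OF that] by (simp add: hsq_def algebra_simps)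
  then have "1 / (C + 1) * hsq v \<le> energy v" using C(1) by (simp add: divide_le_eq mult.commute)
  also have "\<dots> \<le> bilin_a \<Omega> \<sigma> v v" using \<sigma>(1) mass_nonneg by (simp add: bilin_a_self[OF V_H1[OF that]])
  finally show ?thesis .
 qed
 then show ?thesis using C(1) by (intro exI[of _ "1 / (C + 1)"]) auto
qed

end

section \<open>Minimisation of quadratic functionals\<close>

lemma square_bounded_tendsto_0:
 fixes G F :: "nat => real"
 assumes "\<And>k. (G k)^2 \<le> c * F k" "F \<leadsto> 0"
 shows "G \<leadsto> 0"
proof -
 have "(\<lambda>k. (G k)^2) \<leadsto> 0"
  by (rule squeeze_0[OF tendsto_mult_right_zero[OF assms(2)] assms(1)]) simp
 from tendsto_real_sqrt[OF this] show ?thesis by (simp add: tendsto_rabs_zero_iff)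
qed

text \<open>Only semidefiniteness and a functional dominated by the form are assumed: functions
  stand for classes modulo null sets, and the weighted space W of \<open>c_imp_h\<close> is not
  known to be complete. Completeness, where available, is supplied from outside as in
  \<open>VI_exists\<close>.\<close>

locale quadratic_form =
 fixes S :: "('x => real) set" and a :: "('x => real) => ('x => real) => real"
  and l :: "('x => real) => real" and C :: real
 assumes lin: "\<And>u v s t. u \<in> S ==> v \<in> S ==> (\<lambda>x. s * u x + t * v x) \<in> S"
  and a_lin: "\<And>u v w s t. u \<in> S ==> v \<in> S ==> w \<in> S ==> a (\<lambda>x. s * u x + t * v x) w = s * a u w + t * a v w"
  and a_sym: "\<And>u v. a u v = a v u"
  and a_nonneg: "\<And>u. u \<in> S ==> 0 \<le> a u u"
  and l_lin: "\<And>u v s t. u \<in> S ==> v \<in> S ==> l (\<lambda>x. s * u x + t * v x) = s * l u + t * l v"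
  and l_bound: "\<And>u. u \<in> S ==> (l u)^2 \<le> C * a u u" and C_nonneg: "0 \<le> C"
begin

lemma a_lin2: "u \<in> S ==> v \<in> S ==> w \<in> S ==> a w (\<lambda>x. s * u x + t * v x) = s * a w u + t * a w v"
 using a_lin[of u v w s t] by (simp add: a_sym)

lemma minus_mem: "u \<in> S ==> v \<in> S ==> (u \<ominus> v) \<in> S"
 using lin[of u v 1 "-1"] by simp

lemma plus_mem: "u \<in> S ==> v \<in> S ==> (\<lambda>x. u x + v x) \<in> S"
 using lin[of u v 1 1] by simp

lemma a_minus: "u \<in> S ==> v \<in> S ==> w \<in> S ==> a w (u \<ominus> v) = a w u - a w v"
 using a_lin2[of u v w 1 "-1"] by simp

lemma a_minus': "u \<in> S ==> v \<in> S ==> w \<in> S ==> a (u \<ominus> v) w = a u w - a v w"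
 using a_minus by (simp add: a_sym)

lemma a_plus: "u \<in> S ==> v \<in> S ==> w \<in> S ==> a (\<lambda>x. u x + v x) w = a u w + a v w"
 using a_lin[of u v w 1 1] by simp

lemma l_minus: "u \<in> S ==> v \<in> S ==> l (u \<ominus> v) = l u - l v"
 using l_lin[of u v 1 "-1"] by simp

lemma a_diff_self: "u \<in> S ==> v \<in> S ==> a (u \<ominus> v) (u \<ominus> v) = a u u - 2 * a u v + a v v"
 using a_sym[of u v] by (simp add: a_minus a_minus' minus_mem)

lemma a_Cauchy_Schwarz:
 assumes u: "u \<in> S" and v: "v \<in> S"
 shows "(a u v)^2 \<le> a u u * a v v"
proof (rule quadratic_nonneg_imp)
 fix t
 have "0 \<le> a (\<lambda>x. 1 * u x + t * v x) (\<lambda>x. 1 * u x + t * v x)" by (rule a_nonneg[OF lin[OF u v]])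
 also have "\<dots> = a u u + 2 * t * a u v + t^2 * a v v"
  unfolding a_lin[OF u v lin[OF u v]] a_lin2[OF u v u] a_lin2[OF u v v]
  using a_sym[of u v] by (simp add: power2_eq_square algebra_simps)
 finally show "0 \<le> a u u + 2 * t * a u v + t^2 * a v v" .
qed (use a_nonneg u v in auto)

definition E :: "('x => real) => real" where
 "E v = 1 / 2 * a v v - l v"

definition convex_in :: "('x => real) set => bool" where
 "convex_in K \<longleftrightarrow> K \<subseteq> S \<and> (\<forall>u\<in>K. \<forall>v\<in>K. \<forall>t\<in>{0..1}. (\<lambda>x. (1 - t) * u x + t * v x) \<in> K)"

text \<open>E is quadratic, so its second order expansion along a segment is exact. First variation
  and Cauchy property are both read off from it.\<close>

lemma E_convex_combination:
 assumes u: "u \<in> S" and v: "v \<in> S"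
 shows "E (\<lambda>x. (1 - t) * u x + t * v x) = E u + t * (a u (v \<ominus> u) - l (v \<ominus> u))
  + t^2 / 2 * a (v \<ominus> u) (v \<ominus> u)"
 unfolding E_def a_lin[OF u v lin[OF u v]] a_lin2[OF u v u] a_lin2[OF u v v] l_lin[OF u v]
  a_diff_self[OF v u] a_minus[OF v u u] l_minus[OF v u]
 using a_sym[of u v] by (simp add: power2_eq_square field_simps)

lemma minimizer_iff:
 assumes K: "convex_in K" and u: "u \<in> K"
 shows "(\<forall>v\<in>K. E u \<le> E v) \<longleftrightarrow> (\<forall>v\<in>K. l (v \<ominus> u) \<le> a u (v \<ominus> u))"
proof (intro iffI ballI)
 have uS: "u \<in> S" and vS: "\<And>v. v \<in> K ==> v \<in> S" using K u by (auto simp: convex_in_def)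
 fix v assume v: "v \<in> K"
 {
  assume "\<forall>v\<in>K. l (v \<ominus> u) \<le> a u (v \<ominus> u)"
  from bspec[OF this v] a_nonneg[OF minus_mem[OF vS[OF v] uS]] E_convex_combination[OF uS vS[OF v], of 1]
  show "E u \<le> E v" by simp
 }
 assume min: "\<forall>v\<in>K. E u \<le> E v"
 define B where "B = a u (v \<ominus> u) - l (v \<ominus> u)"
 define A where "A = a (v \<ominus> u) (v \<ominus> u)"
 have ge: "- (t / 2 * A) \<le> B" if t: "0 < t" "t \<le> 1" for t
 proof -
  have "(\<lambda>x. (1 - t) * u x + t * v x) \<in> K" using K u v t by (auto simp: convex_in_def)
  from bspec[OF min this] have "0 \<le> t * B + t^2 / 2 * A"
   using E_convex_combination[OF uS vS[OF v], of t] by (simp add: A_def B_def)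
  then have "0 \<le> t * (B + t / 2 * A)" by (simp add: power2_eq_square algebra_simps)
  then show ?thesis using t by (simp add: zero_le_mult_iff)
 qed
 have lim: "(\<lambda>n. - (inverse (real (Suc n)) / 2 * A)) \<leadsto> - (0 / 2 * A)"
  by (intro tendsto_intros LIMSEQ_inverse_real_of_nat) simp
 have "- (inverse (real (Suc n)) / 2 * A) \<le> B" for n
  by (rule ge) (auto simp: inverse_eq_divide)
 then have "0 \<le> B" using LIMSEQ_le_const2[OF lim, of B] by simp
 then show "l (v \<ominus> u) \<le> a u (v \<ominus> u)" by (simp add: B_def)
qed

definition minimizing :: "('x => real) set => (nat => 'x => real) => bool" where
 "minimizing K w \<longleftrightarrow> (\<forall>k. w k \<in> K) \<and> (\<forall>k. \<forall>v\<in>K. E (w k) \<le> E v + inverse (real (Suc k)))"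

lemma minimizing_exists:
 assumes K: "K \<subseteq> S" "K \<noteq> {}"
 shows "\<exists>w. minimizing K w"
proof -
 have below: "- (C / 2) \<le> E v" if "v \<in> K" for v
 proof -
  have v: "v \<in> S" using that K by auto
  \<comment> \<open>The arithmetic-geometric mean inequality for C and a v v bounds l v, and E stays
    above -C/2.\<close>
  have "(l v)^2 \<le> ((C + a v v) / 2)^2"
   using l_bound[OF v] zero_le_power2[of "C - a v v"] by (simp add: power2_eq_square field_simps)
  then have "l v \<le> (C + a v v) / 2"
   by (rule power2_le_imp_le) (use C_nonneg a_nonneg[OF v] in simp)
  then show ?thesis by (simp add: E_def field_simps)
 qed
 define m where "m = Inf (E ` K)"
 have m: "m \<le> E v" if "v \<in> K" for v
  unfolding m_def using below that by (intro cInf_lower bdd_belowI2[of _ "- (C / 2)"]) auto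
 have "\<exists>w. w \<in> K \<and> (\<forall>v\<in>K. E w \<le> E v + inverse (real (Suc k)))" for k
 proof -
  obtain w where "w \<in> K" "E w < m + inverse (real (Suc k))"
   using cInf_lessD[of "E ` K" "m + inverse (real (Suc k))"] K(2) by (auto simp: m_def)
  then show ?thesis using m by force
 qed
 then have "\<forall>k. \<exists>w. w \<in> K \<and> (\<forall>v\<in>K. E w \<le> E v + inverse (real (Suc k)))" ..
 from choice[OF this] show ?thesis by (auto simp: minimizing_def)
qed

text \<open>The parallelogram identity at the midpoint m: E (w i) + E (w j) - 2 E m is a quarter of
  the squared distance A. Errors below ep / 8 for both members therefore give A < ep.\<close>

lemma minimizing_Cauchy:
 assumes w: "minimizing K w" and K: "convex_in K" and e: "ep > 0"
 shows "\<exists>N. \<forall>i\<ge>N. \<forall>j\<ge>N. a (w i \<ominus> w j) (w i \<ominus> w j) < ep"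
proof -
 have "\<forall>\<^sub>F k in sequentially. inverse (real (Suc k)) < ep / 8"
  by (rule order_tendstoD(2)[OF LIMSEQ_inverse_real_of_nat]) (use e in simp)
 then obtain N where N: "\<And>k. k \<ge> N ==> inverse (real (Suc k)) < ep / 8" unfolding eventually_sequentially by blast
 have "a (w i \<ominus> w j) (w i \<ominus> w j) < ep" if ij: "i \<ge> N" "j \<ge> N" for i j
 proof -
  have wK: "w k \<in> K" for k using w by (simp add: minimizing_def)
  then have wS: "w k \<in> S" for k using K by (auto simp: convex_in_def)
  define A where "A = a (w i \<ominus> w j) (w i \<ominus> w j)"
  define B where "B = a (w j) (w i \<ominus> w j) - l (w i \<ominus> w j)"
  define m where "m = (\<lambda>x. (1 - 1/2) * w j x + 1/2 * w i x)"
  have "m \<in> K" using K[unfolded convex_in_def, THEN conjunct2, rule_format, OF wK wK, of "1/2" j i] by (simp add: m_def)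
  then have "E (w i) \<le> E m + inverse (real (Suc i))" "E (w j) \<le> E m + inverse (real (Suc j))"
   using w by (auto simp: minimizing_def)
  moreover have "E m = E (w j) + B / 2 + A / 8"
   unfolding m_def E_convex_combination[OF wS wS] by (simp add: A_def B_def power2_eq_square)
  moreover have "E (w i) = E (w j) + B + A / 2"
   using E_convex_combination[OF wS[of j] wS[of i], of 1] by (simp add: A_def B_def)
  ultimately show ?thesis using N[OF ij(1)] N[OF ij(2)] unfolding A_def[symmetric] by linarith
 qed
 then show ?thesis by blast
qed

lemma minimizing_limit:
 assumes w: "minimizing K w" and K: "convex_in K" and u: "u \<in> K"
  and lim: "(\<lambda>k. a (w k \<ominus> u) (w k \<ominus> u)) \<leadsto> 0"
 shows "\<forall>v\<in>K. l (v \<ominus> u) \<le> a u (v \<ominus> u)"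
proof -
 have S: "u \<in> S" "w k \<in> S" for k using u w K by (auto simp: minimizing_def convex_in_def)
 note d = minus_mem[OF S(2,1)]
 have e: "E (w k) = E u + (a u (w k \<ominus> u) - l (w k \<ominus> u)) + 1 / 2 * a (w k \<ominus> u) (w k \<ominus> u)" for k
  using E_convex_combination[OF S, of 1 k] by simp
 have lE: "(\<lambda>k. E (w k)) \<leadsto> E u + (0 - 0) + 1 / 2 * 0"
  unfolding e by (intro tendsto_add tendsto_diff tendsto_mult tendsto_const lim
    square_bounded_tendsto_0[OF a_Cauchy_Schwarz[OF S(1) d] lim] square_bounded_tendsto_0[OF l_bound[OF d] lim])
 have "E u \<le> E v" if v: "v \<in> K" for v
 proof -
  have "(\<lambda>k. E v + inverse (real (Suc k))) \<leadsto> E v + 0" by (intro tendsto_intros LIMSEQ_inverse_real_of_nat)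
  from LIMSEQ_le[OF lE this] show ?thesis using w v by (auto simp: minimizing_def)
 qed
 then show ?thesis using minimizer_iff[OF K u] by blast
qed

text \<open>The Euler equation without a minimiser, which may fail to exist in an incomplete space:
  near minimality of \<open>w k\<close> along the line through \<open>w k\<close> in direction
  \<phi> is a nonnegative quadratic polynomial, and its discriminant bounds the defect.\<close>

lemma minimizing_weak_limit:
 assumes w: "minimizing S w" and \<phi>: "\<phi> \<in> S"
 shows "(\<lambda>k. a (w k) \<phi>) \<leadsto> l \<phi>"
proof -
 have wS: "w k \<in> S" for k using w by (simp add: minimizing_def)
 have "(a (w k) \<phi> - l \<phi>)^2 \<le> (2 * inverse (real (Suc k))) * a \<phi> \<phi>" for k
 proof (rule quadratic_nonneg_imp)
  fix t
  have "E (w k) \<le> E (\<lambda>x. 1 * w k x + t * \<phi> x) + inverse (real (Suc k))"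
   using w lin[OF wS \<phi>, of 1 k t] by (auto simp: minimizing_def)
  also have "E (\<lambda>x. 1 * w k x + t * \<phi> x) = E (w k) + t * (a (w k) \<phi> - l \<phi>) + t^2 / 2 * a \<phi> \<phi>"
   unfolding E_def a_lin[OF wS \<phi> lin[OF wS \<phi>]] a_lin2[OF wS \<phi> wS] a_lin2[OF wS \<phi> \<phi>] l_lin[OF wS \<phi>]
   using a_sym[of \<phi> "w k"] by (simp add: power2_eq_square field_simps)
  finally show "0 \<le> 2 * inverse (real (Suc k)) + 2 * t * (a (w k) \<phi> - l \<phi>) + t^2 * a \<phi> \<phi>" by (simp add: algebra_simps)
 qed (use a_nonneg[OF \<phi>] in auto)
 then have "(a (w k) \<phi> - l \<phi>)^2 \<le> (2 * a \<phi> \<phi>) * inverse (real (Suc k))" for k by (simp add: mult_ac)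
 from square_bounded_tendsto_0[OF this LIMSEQ_inverse_real_of_nat] show ?thesis by (simp add: LIM_zero_iff)
qed

end

section \<open>The obstacle problem\<close>

context lipschitz_domain
begin

text \<open>Common to the loads in L^p of the theorem and the auxiliary loads in L2, such as the
  violation of the obstacle in \<open>d_imp_c\<close>.\<close>

definition admissible :: "('a => real) => bool" where
 "admissible g \<longleftrightarrow> g \<in> borel_measurable Leb \<and>
   (\<exists>C\<ge>0. \<forall>v\<in>H1 \<Omega>. integrable Leb (\<lambda>x. g x * v x) \<and> (LINT x|Leb. \<bar>g x * v x\<bar>)^2 \<le> C * hsq v)"

lemma Lp_admissible:
 assumes "1 < p" "p \<ge> 2 * real DIM('a) / (real DIM('a) + 2)" "g \<in> Lp p Leb"
 shows "admissible g"
 using Lp_pairing[OF assms] assms(3) by (simp add: admissible_def Lp_def)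

lemma L2_admissible: "g \<in> Lp 2 Leb ==> admissible g"
 by (rule Lp_admissible[of 2]) (auto simp: divide_le_eq)

lemma admissible_integrable: "admissible g ==> v \<in> H1 \<Omega> ==> integrable Leb (\<lambda>x. g x * v x)"
 by (auto simp: admissible_def)

lemma admissible_bound:
 assumes "admissible g"
 shows "\<exists>C\<ge>0. \<forall>v\<in>H1 \<Omega>. (Lp_functional \<Omega> g v)^2 \<le> C * hsq v"
proof -
 obtain C where C: "C \<ge> 0" "\<And>v. v \<in> H1 \<Omega> ==> (LINT x|Leb. \<bar>g x * v x\<bar>)^2 \<le> C * hsq v"
  using assms by (auto simp: admissible_def)
 have "(Lp_functional \<Omega> g v)^2 \<le> C * hsq v" if v: "v \<in> H1 \<Omega>" for v
 proof -
  have "\<bar>Lp_functional \<Omega> g v\<bar> \<le> (LINT x|Leb. \<bar>g x * v x\<bar>)"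
   unfolding Lp_functional_def by (rule integral_abs_bound)
  from power_mono[OF this, of 2] C(2)[OF v] show ?thesis by simp
 qed
 then show ?thesis using C(1) by blast
qed

lemma functional_mono:
 assumes g: "admissible g" "admissible h" and v: "v \<in> H1 \<Omega>" "AE x in Leb. 0 \<le> v x"
  and le: "\<And>x. g x \<le> h x"
 shows "Lp_functional \<Omega> g v \<le> Lp_functional \<Omega> h v"
 unfolding Lp_functional_def
proof (rule integral_mono_AE[OF admissible_integrable[OF g(1) v(1)] admissible_integrable[OF g(2) v(1)]])
 show "AE x in Leb. g x * v x \<le> h x * v x"
  using v(2) by eventually_elim (rule mult_right_mono[OF le])
qed

lemma null_AE:
 assumes x: "x \<in> H1 \<Omega>" "hsq x \<le> 0"
 shows "AE t in Leb. x t = 0"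
proof -
 have "mass x = 0" using x(2) mass_nonneg[of x] energy_nonneg[of x] by (simp add: hsq_def)
 then have "AE t in Leb. (x t)^2 = 0"
  unfolding mass_def using H1D(1)[OF x(1)] by (subst (asm) integral_nonneg_eq_0_iff_AE) (auto simp: Lp2_iff)
 then show ?thesis by simp
qed

end

section \<open>Variational inequalities on V\<close>

locale obstacle_problem = dirichlet_domain \<Omega> \<Gamma> for \<Omega> \<Gamma> :: "'a::euclidean_space set" +
 fixes \<sigma> p :: real and f \<psi> fh :: "'a => real"
 assumes \<sigma>: "\<sigma> \<ge> 0" "emeasure surface_measure \<Gamma> = 0 --> \<sigma> > 0"
  and p: "1 < p" "p \<ge> 2 * real DIM('a) / (real DIM('a) + 2)"
  and f: "f \<in> Lp p (lebesgue_on \<Omega>)" and \<psi>: "\<psi> \<in> V_space \<Omega> \<Gamma>"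
  and fh: "fh \<in> Lp p (lebesgue_on \<Omega>)"
  and fh_density: "\<And>v. v \<in> V_space \<Omega> \<Gamma> ==> bilin_a \<Omega> \<sigma> \<psi> v = Lp_functional \<Omega> fh v"
begin

abbreviation "a \<equiv> bilin_a \<Omega> \<sigma>"
abbreviation "L \<equiv> Lp_functional \<Omega>"

definition c\<^sub>0 :: real where
 "c\<^sub>0 = (SOME c. c > 0 \<and> (\<forall>v\<in>V. c * hsq v \<le> a v v))"

lemma coercive: "c\<^sub>0 > 0" "v \<in> V ==> c\<^sub>0 * hsq v \<le> a v v"
 using someI_ex[of "\<lambda>c. c > 0 \<and> (\<forall>v\<in>V. c * hsq v \<le> a v v)"] bilin_a_coercive[OF \<sigma>]
 unfolding c\<^sub>0_def[symmetric] by auto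

lemma V_form:
 assumes g: "admissible g"
 shows "\<exists>C. quadratic_form V a (L g) C"
proof -
 obtain C where C: "C \<ge> 0" "\<And>v. v \<in> H1 \<Omega> ==> (L g v)^2 \<le> C * hsq v" using admissible_bound[OF g] by auto
 have "quadratic_form V a (L g) (C / c\<^sub>0)"
 proof
  fix u v w :: "'a => real" and s t
  assume u: "u \<in> V" and v: "v \<in> V"
  show "(\<lambda>x. s * u x + t * v x) \<in> V" by (rule V_lincomb[OF u v])
  show "L g (\<lambda>x. s * u x + t * v x) = s * L g u + t * L g v"
   using admissible_integrable[OF g V_H1[OF u]] admissible_integrable[OF g V_H1[OF v]]
   by (simp add: Lp_functional_def distrib_left mult.left_commute)
  show "w \<in> V ==> a (\<lambda>x. s * u x + t * v x) w = s * a u w + t * a v w"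
   by (rule bilin_a_lincomb[OF V_H1[OF u] V_H1[OF v] V_H1])
 next
  fix u assume u: "u \<in> V"
  have h: "c\<^sub>0 * hsq u \<le> a u u" by (rule coercive(2)[OF u])
  then show "0 \<le> a u u" using mult_nonneg_nonneg[OF less_imp_le[OF coercive(1)] hsq_nonneg[of u]] by linarith
  have "C * hsq u \<le> C * (a u u / c\<^sub>0)"
   using h coercive(1) by (intro mult_left_mono C(1)) (simp add: le_divide_eq mult.commute)
  then show "(L g u)^2 \<le> C / c\<^sub>0 * a u u" using C(2)[OF V_H1[OF u]] by simp
 qed (use C(1) coercive(1) bilin_a_sym in auto)
 then show ?thesis ..
qed

text \<open>With load 0 the locale provides the algebra of \<open>a\<close> on V independently of
  any particular load.\<close>

lemma zero_form: "quadratic_form V a (\<lambda>_. 0) 0"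
proof -
 have "admissible (\<lambda>_. 0)" using H1D(1)[OF H1_const(1)[of 0]] by (rule L2_admissible)
 then obtain C where "quadratic_form V a (L (\<lambda>_. 0)) C" using V_form by blast
 then show ?thesis by (auto simp: quadratic_form_def)
qed

interpretation Q: quadratic_form V a "\<lambda>_. 0" 0
 by (rule zero_form)

lemma L_minus:
 assumes "admissible g" "u \<in> V" "v \<in> V"
 shows "L g (u \<ominus> v) = L g u - L g v"
proof -
 obtain C where "quadratic_form V a (L g) C" using V_form[OF assms(1)] ..
 from quadratic_form.l_minus[OF this assms(2,3)] show ?thesis .
qed

lemma a_le_hsq: "u \<in> V ==> a u u \<le> (1 + \<sigma>) * hsq u"
 using mult_nonneg_nonneg[OF \<sigma>(1) energy_nonneg[of u]] mass_nonneg[of u]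
 by (simp add: bilin_a_self[OF V_H1] hsq_def algebra_simps)

text \<open>Solutions are unique only up to null functions; these facts allow one solution to be
  replaced by another in every condition.\<close>

lemma null:
 assumes x: "x \<in> V" "a x x \<le> 0"
 shows "AE t in Leb. x t = 0" "v \<in> V ==> a x v = 0" "L g x = 0"
proof -
 have "c\<^sub>0 * hsq x \<le> 0" using coercive(2)[OF x(1)] x(2) by linarith
 then have "hsq x \<le> 0" using coercive(1) by (simp add: mult_le_0_iff)
 then show ae: "AE t in Leb. x t = 0" by (rule null_AE[OF V_H1[OF x(1)]])
 show "a x v = 0" if v: "v \<in> V"
 proof -
  have "(a x v)^2 \<le> a x x * a v v" by (rule Q.a_Cauchy_Schwarz[OF x(1) v])
  also have "\<dots> \<le> 0" using x(2) Q.a_nonneg[OF v] by (simp add: mult_nonpos_nonneg)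
  finally show ?thesis by simp
 qed
 show "L g x = 0" unfolding Lp_functional_def
  by (rule integral_eq_zero_AE) (use ae in \<open>eventually_elim; simp\<close>)
qed

text \<open>A subsequence converges almost everywhere. The lower obstacle \<psi> and the upper
  obstacle in the Lewy--Stampacchia argument are constraints of this form.\<close>

lemma AE_closed:
 fixes w :: "nat => 'a => real"
 assumes w: "\<And>k. w k \<in> V" "\<And>k. AE x in Leb. w k x \<in> F x" and u: "u \<in> V"
  and lim: "(\<lambda>k. hsq (w k \<ominus> u)) \<leadsto> 0" and cl: "\<And>x. closed (F x)"
 shows "AE x in Leb. u x \<in> F x"
proof -
 have "L2_lim Leb w u"
  using squeeze_0[OF lim, of "\<lambda>k. mass (w k \<ominus> u)"] mass_nonneg energy_nonneg by (simp add: hsq_def mass_def)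
 from L2_tendsto_AE_subseq[OF H1D(1)[OF V_H1[OF w(1)]] H1D(1)[OF V_H1[OF u]] this]
 obtain r where r: "AE x in Leb. (\<lambda>k. w (r k) x) \<leadsto> u x" by auto
 have "AE x in Leb. \<forall>k. w k x \<in> F x" using w(2) by (simp add: AE_all_countable)
 with r show ?thesis
 proof eventually_elim
  case (elim x)
  show ?case by (rule closed_sequentially[OF cl _ elim(1)]) (use elim(2) in simp)
 qed
qed

text \<open>The symmetric case of the theorem of Lions and Stampacchia, obtained by minimisation:
  coercivity turns the Cauchy property in the energy into one in H1, and completeness of V supplies
  the limit.\<close>

lemma VI_exists:
 assumes g: "admissible g" and K: "Q.convex_in K" "K \<noteq> {}"
  and cl: "\<And>w u. (\<And>k. w k \<in> K) ==> u \<in> V ==> (\<lambda>k. hsq (w k \<ominus> u)) \<leadsto> 0 ==> u \<in> K"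
 shows "\<exists>u\<in>K. \<forall>v\<in>K. L g (v \<ominus> u) \<le> a u (v \<ominus> u)"
proof -
 obtain C where "quadratic_form V a (L g) C" using V_form[OF g] ..
 then interpret G: quadratic_form V a "L g" C .
 have KV: "K \<subseteq> V" using K(1) by (simp add: Q.convex_in_def)
 have GK: "G.convex_in K" using K(1) by (simp add: G.convex_in_def Q.convex_in_def)
 obtain w where w: "G.minimizing K w" using G.minimizing_exists[OF KV K(2)] ..
 note cauchy = G.minimizing_Cauchy[OF w GK]
 have wK: "w k \<in> K" for k using w by (simp add: G.minimizing_def)
 have wV: "w k \<in> V" for k using wK KV by auto
 have "\<exists>u\<in>V. (\<lambda>k. hsq (w k \<ominus> u)) \<leadsto> 0"
 proof (rule V_complete[OF wV])
  fix e :: real assume "e > 0"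
  then obtain N where N: "\<forall>m\<ge>N. \<forall>n\<ge>N. a (w m \<ominus> w n) (w m \<ominus> w n) < c\<^sub>0 * e"
   using cauchy[of "c\<^sub>0 * e"] coercive(1) by auto
  have "hsq (w m \<ominus> w n) < e" if mn: "m \<ge> N" "n \<ge> N" for m n
  proof -
   have "c\<^sub>0 * hsq (w m \<ominus> w n) < c\<^sub>0 * e"
    using coercive(2)[OF Q.minus_mem[OF wV wV], of m n] N mn by fastforce
   then show ?thesis using coercive(1) by simp
  qed
  then show "\<exists>N. \<forall>m\<ge>N. \<forall>n\<ge>N. hsq (w m \<ominus> w n) < e" by (intro exI[of _ N]) auto
 qed
 then obtain u where u: "u \<in> V" "(\<lambda>k. hsq (w k \<ominus> u)) \<leadsto> 0" by auto
 have "(\<lambda>k. a (w k \<ominus> u) (w k \<ominus> u)) \<leadsto> 0"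
  by (rule squeeze_0[OF tendsto_mult_right_zero[OF u(2)] a_le_hsq Q.a_nonneg]; rule Q.minus_mem[OF wV u(1)])
 from G.minimizing_limit[OF w GK cl[OF wK u] this] cl[OF wK u] show ?thesis by blast
qed

lemma convex_V: "Q.convex_in V"
 by (auto simp: Q.convex_in_def intro: V_lincomb)

text \<open>On all of V the variational inequality is an equation, as seen from the competitors z +
  v and z - v.\<close>

lemma Riesz:
 assumes g: "admissible g"
 shows "\<exists>z\<in>V. \<forall>v\<in>V. a z v = L g v"
proof -
 have "V \<noteq> {}" using \<psi> by auto
 from VI_exists[OF g convex_V this] obtain z where z: "z \<in> V" "\<And>v. v \<in> V ==> L g (v \<ominus> z) \<le> a z (v \<ominus> z)" by auto
 have "a z v = L g v" if v: "v \<in> V" for v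
 proof -
  have 1: "L g v \<le> a z v" using z(2)[OF Q.plus_mem[OF z(1) v]] by simp
  have "L g ((z \<ominus> v) \<ominus> z) \<le> a z ((z \<ominus> v) \<ominus> z)" by (rule z(2)[OF Q.minus_mem[OF z(1) v]])
  then have "- L g v \<le> - a z v"
   by (simp only: L_minus[OF g Q.minus_mem[OF z(1) v] z(1)] L_minus[OF g z(1) v]
     Q.a_minus[OF Q.minus_mem[OF z(1) v] z(1) z(1)] Q.a_minus[OF z(1) v z(1)])
  with 1 show ?thesis by linarith
 qed
 then show ?thesis using z(1) by blast
qed

lemma f_adm: "admissible f" and fh_adm: "admissible fh"
 using Lp_admissible[OF p] f fh by auto

definition M :: "'a => real" where
 "M x = max (f x) (fh x)"

lemma M_Lp: "M \<in> Lp p Leb" and M_adm: "admissible M" and M_ge: "f x \<le> M x" "fh x \<le> M x"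
proof -
 have m: "f \<in> borel_measurable Leb" "fh \<in> borel_measurable Leb" using f fh by (auto simp: Lp_def)
 show 1: "M \<in> Lp p Leb"
  by (rule Lp_abs_le[OF f fh p(1)]) (use m in \<open>auto simp: M_def[abs_def] max_def\<close>)
 show "admissible M" by (rule Lp_admissible[OF p 1])
qed (auto simp: M_def)

lemma mem_K0: "u \<in> K0 \<Omega> \<Gamma> \<psi> \<longleftrightarrow> u \<in> V \<and> (AE x in Leb. \<psi> x \<le> u x)"
 by (simp add: K0_def)

lemma mem_K1: "u \<in> K1 \<Omega> \<Gamma> \<sigma> f \<longleftrightarrow> u \<in> V \<and> (\<forall>\<phi>\<in>V. (AE x in Leb. 0 \<le> \<phi> x) --> L f \<phi> \<le> a u \<phi>)"
 by (simp add: K1_def dual_le_def A_op_def)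

lemma mem_K2: "u \<in> K2 \<Omega> \<Gamma> \<sigma> f fh \<longleftrightarrow> u \<in> K1 \<Omega> \<Gamma> \<sigma> f \<and> (\<forall>\<phi>\<in>V. (AE x in Leb. 0 \<le> \<phi> x) --> a u \<phi> \<le> L M \<phi>)"
 by (auto simp: K2_def K1_def dual_le_def A_op_def M_def[abs_def])

abbreviation "KO \<equiv> K0 \<Omega> \<Gamma> \<psi>"
abbreviation "KA \<equiv> K1 \<Omega> \<Gamma> \<sigma> f"
abbreviation "KB \<equiv> K2 \<Omega> \<Gamma> \<sigma> f fh"

lemma convex_KO: "Q.convex_in KO"
 unfolding Q.convex_in_def
proof (intro conjI subsetI ballI)
 fix u v t assume u: "u \<in> KO" and v: "v \<in> KO" and t: "t \<in> {0..1::real}"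
 have "AE x in Leb. \<psi> x \<le> u x" "AE x in Leb. \<psi> x \<le> v x" using u v by (auto simp: mem_K0)
 then have "AE x in Leb. \<psi> x \<le> (1 - t) * u x + t * v x"
 proof eventually_elim
  case (elim x)
  then have "(1 - t) * \<psi> x + t * \<psi> x \<le> (1 - t) * u x + t * v x" using t by (intro add_mono mult_left_mono) auto
  then show ?case by (simp add: algebra_simps)
 qed
 then show "(\<lambda>x. (1 - t) * u x + t * v x) \<in> KO" using u v V_lincomb by (auto simp: mem_K0)
qed (auto simp: mem_K0)

lemma convex_combination_le: "(1 - t) * x + t * x = (x::real)"
 by (simp add: algebra_simps)

lemma convex_KA: "Q.convex_in KA" and convex_KB: "Q.convex_in KB"
proof -
 have m: "u \<in> KA ==> u \<in> V" "u \<in> KB ==> u \<in> KA" for u by (auto simp: mem_K1 mem_K2)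
 have 1: "(\<lambda>x. (1 - t) * u x + t * v x) \<in> KA" if u: "u \<in> KA" and v: "v \<in> KA" and t: "t \<in> {0..1}" for u v t
  unfolding mem_K1
 proof (intro conjI ballI impI)
  fix \<phi> assume \<phi>: "\<phi> \<in> V" "AE x in Leb. 0 \<le> \<phi> x"
  have "(1 - t) * L f \<phi> + t * L f \<phi> \<le> (1 - t) * a u \<phi> + t * a v \<phi>"
   using u v t \<phi> by (intro add_mono mult_left_mono) (auto simp: mem_K1)
  then show "L f \<phi> \<le> a (\<lambda>x. (1 - t) * u x + t * v x) \<phi>"
   unfolding Q.a_lin[OF m(1)[OF u] m(1)[OF v] \<phi>(1)] convex_combination_le .
 qed (rule V_lincomb[OF m(1)[OF u] m(1)[OF v]])
 have 2: "(\<lambda>x. (1 - t) * u x + t * v x) \<in> KB" if u: "u \<in> KB" and v: "v \<in> KB" and t: "t \<in> {0..1}" for u v t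
  unfolding mem_K2
 proof (intro conjI ballI impI)
  fix \<phi> assume \<phi>: "\<phi> \<in> V" "AE x in Leb. 0 \<le> \<phi> x"
  have "(1 - t) * a u \<phi> + t * a v \<phi> \<le> (1 - t) * L M \<phi> + t * L M \<phi>"
   using u v t \<phi> by (intro add_mono mult_left_mono) (auto simp: mem_K2)
  then show "a (\<lambda>x. (1 - t) * u x + t * v x) \<phi> \<le> L M \<phi>"
   unfolding Q.a_lin[OF m(1)[OF m(2)[OF u]] m(1)[OF m(2)[OF v]] \<phi>(1)] convex_combination_le .
 qed (rule 1[OF m(2)[OF u] m(2)[OF v] t])
 show "Q.convex_in KA" unfolding Q.convex_in_def by (intro conjI ballI 1 subsetI m(1))
 show "Q.convex_in KB" unfolding Q.convex_in_def by (intro conjI ballI 2 subsetI m(1)[OF m(2)])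
qed

lemma J_minimizer_iff:
 assumes g: "admissible g" and K: "Q.convex_in K" and u: "u \<in> K"
 shows "(\<forall>v\<in>K. J \<Omega> \<sigma> g u \<le> J \<Omega> \<sigma> g v) \<longleftrightarrow> (\<forall>v\<in>K. L g (v \<ominus> u) \<le> a u (v \<ominus> u))"
proof -
 obtain C where "quadratic_form V a (L g) C" using V_form[OF g] ..
 then interpret G: quadratic_form V a "L g" C .
 have "J \<Omega> \<sigma> g = G.E" by (simp add: fun_eq_iff J_def G.E_def)
 then show ?thesis using G.minimizer_iff[OF K u] by simp
qed

section \<open>Equivalence of the conditions\<close>

definition sol_b :: "('a => real) => bool" where
 "sol_b u \<longleftrightarrow> u \<in> KO \<and> (\<forall>v\<in>KO. L f (v \<ominus> u) \<le> a u (v \<ominus> u))"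

definition sol_c :: "('a => real) => bool" where
 "sol_c u \<longleftrightarrow> u \<in> KO \<and> u \<in> KA \<and> a u (u \<ominus> \<psi>) = L f (u \<ominus> \<psi>)"

definition sol_d :: "('a => real) => bool" where
 "sol_d u \<longleftrightarrow> u \<in> KA \<and> (\<forall>v\<in>KA. L fh (v \<ominus> u) \<le> a u (v \<ominus> u))"

definition sol_g :: "('a => real) => bool" where
 "sol_g u \<longleftrightarrow> u \<in> KB \<and> (\<forall>v\<in>KB. L fh (v \<ominus> u) \<le> a u (v \<ominus> u))"

definition sol_h :: "('a => real) => bool" where
 "sol_h u \<longleftrightarrow> u \<in> KO \<and> u \<in> KB \<and>
   (\<exists>g\<in>Lp p Leb. (\<forall>v\<in>V. a u v = L g v) \<and> (AE x in Leb. (g x - f x) * (u x - \<psi> x) = 0))"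

text \<open>The competitors u + \<phi> give A u \<ge> f, and the competitor \<psi> gives the missing
  half of complementarity. Conversely A u \<ge> f is tested with v - \<psi>, and complementarity
  replaces \<psi> by u.\<close>

lemma b_iff_c: "sol_b u \<longleftrightarrow> sol_c u"
proof
 assume "sol_b u"
 then have u: "u \<in> KO" and vi: "\<And>v. v \<in> KO ==> L f (v \<ominus> u) \<le> a u (v \<ominus> u)" by (auto simp: sol_b_def)
 have uV: "u \<in> V" and ge: "AE x in Leb. \<psi> x \<le> u x" using u by (auto simp: mem_K0)
 have KA: "u \<in> KA"
  unfolding mem_K1
 proof (intro conjI ballI impI)
  fix \<phi> assume \<phi>: "\<phi> \<in> V" "AE x in Leb. 0 \<le> \<phi> x"
  have "AE x in Leb. \<psi> x \<le> u x + \<phi> x" using ge \<phi>(2) by eventually_elim simp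
  then have "(\<lambda>x. u x + \<phi> x) \<in> KO" using Q.plus_mem[OF uV \<phi>(1)] by (simp add: mem_K0)
  from vi[OF this] show "L f \<phi> \<le> a u \<phi>" by simp
 qed (rule uV)
 have "L f (\<psi> \<ominus> u) \<le> a u (\<psi> \<ominus> u)" by (rule vi) (use \<psi> in \<open>simp add: mem_K0\<close>)
 moreover have "AE x in Leb. 0 \<le> u x - \<psi> x" using ge by eventually_elim simp
 then have "L f (u \<ominus> \<psi>) \<le> a u (u \<ominus> \<psi>)" using KA Q.minus_mem[OF uV \<psi>] by (simp add: mem_K1)
 ultimately have "a u (u \<ominus> \<psi>) = L f (u \<ominus> \<psi>)"
  by (simp add: L_minus[OF f_adm] Q.a_minus uV \<psi>)
 then show "sol_c u" using u KA by (simp add: sol_c_def)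
next
 assume "sol_c u"
 then have u: "u \<in> KO" "u \<in> KA" and eq: "a u (u \<ominus> \<psi>) = L f (u \<ominus> \<psi>)" by (auto simp: sol_c_def)
 have uV: "u \<in> V" using u by (simp add: mem_K0)
 have "L f (v \<ominus> u) \<le> a u (v \<ominus> u)" if v: "v \<in> KO" for v
 proof -
  have vV: "v \<in> V" using v by (simp add: mem_K0)
  have "AE x in Leb. \<psi> x \<le> v x" using v by (simp add: mem_K0)
  then have "AE x in Leb. 0 \<le> v x - \<psi> x" by eventually_elim simp
  then have "L f (v \<ominus> \<psi>) \<le> a u (v \<ominus> \<psi>)" using u(2) Q.minus_mem[OF vV \<psi>] by (simp add: mem_K1)
  then show ?thesis using eq by (simp add: L_minus[OF f_adm] Q.a_minus uV vV \<psi>)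
 qed
 then show "sol_b u" using u by (simp add: sol_b_def)
qed

text \<open>Constraint and test function change places: A v \<ge> f is tested with u - \<psi> \<ge>
  0 and compared with complementarity for u. Symmetry of \<open>a\<close> and fh = A \<psi> turn the
  result into the inequality for fh.\<close>

lemma c_imp_d:
 assumes "sol_c u"
 shows "sol_d u"
proof -
 have u: "u \<in> KO" "u \<in> KA" and eq: "a u (u \<ominus> \<psi>) = L f (u \<ominus> \<psi>)" using assms by (auto simp: sol_c_def)
 have uV: "u \<in> V" using u by (simp add: mem_K0)
 have "AE x in Leb. \<psi> x \<le> u x" using u by (simp add: mem_K0)
 then have ge: "AE x in Leb. 0 \<le> u x - \<psi> x" by eventually_elim simp
 have "L fh (v \<ominus> u) \<le> a u (v \<ominus> u)" if v: "v \<in> KA" for v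
 proof -
  have vV: "v \<in> V" using v by (simp add: mem_K1)
  have "L f (u \<ominus> \<psi>) \<le> a v (u \<ominus> \<psi>)" using v ge Q.minus_mem[OF uV \<psi>] by (simp add: mem_K1)
  with eq have "a u u - a u \<psi> \<le> a v u - a v \<psi>" by (simp add: Q.a_minus uV vV \<psi>)
  then have "a \<psi> v - a \<psi> u \<le> a u v - a u u" using bilin_a_sym[of \<sigma> u v] bilin_a_sym[of \<sigma> u \<psi>] bilin_a_sym[of \<sigma> v \<psi>] by linarith
  then show ?thesis by (simp add: fh_density[symmetric] Q.minus_mem Q.a_minus uV vV \<psi>)
 qed
 then show ?thesis using u by (simp add: sol_d_def)
qed

text \<open>The obstacle condition follows by using its own violation g, the positive part of \<psi>
  - u, as a load: for A z = g \<ge> 0 the competitor u + z lies in \<open>KA\<close>, and the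
  inequality reads \<open>mass g\<close> \<le> 0. The competitor y with A y = f then yields the
  remaining half of complementarity.\<close>

lemma d_imp_c:
 assumes "sol_d u"
 shows "sol_c u"
proof -
 have u: "u \<in> KA" and vi: "\<And>v. v \<in> KA ==> L fh (v \<ominus> u) \<le> a u (v \<ominus> u)" using assms by (auto simp: sol_d_def)
 have uV: "u \<in> V" using u by (simp add: mem_K1)
 note s = bilin_a_sym[of \<sigma>]
 define g where "g = (\<lambda>x. max 0 (\<psi> x - u x))"
 have gV: "g \<in> V" unfolding g_def using V_pos_part(1)[OF Q.minus_mem[OF \<psi> uV]] .
 have g2: "g \<in> Lp 2 Leb" by (rule H1D(1)[OF V_H1[OF gV]])
 have ga: "admissible g" by (rule L2_admissible[OF g2])
 obtain z where z: "z \<in> V" "\<And>v. v \<in> V ==> a z v = L g v" using Riesz[OF ga] by auto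
 have "(\<lambda>x. u x + z x) \<in> KA"
  unfolding mem_K1
 proof (intro conjI ballI impI)
  show "(\<lambda>x. u x + z x) \<in> V" by (rule Q.plus_mem[OF uV z(1)])
  fix \<phi> assume \<phi>: "\<phi> \<in> V" "AE x in Leb. 0 \<le> \<phi> x"
  have "0 \<le> L g \<phi>" unfolding Lp_functional_def
   by (rule integral_nonneg_AE) (use \<phi>(2) in \<open>eventually_elim; simp add: g_def\<close>)
  moreover have "L f \<phi> \<le> a u \<phi>" using u \<phi> by (simp add: mem_K1)
  ultimately show "L f \<phi> \<le> a (\<lambda>x. u x + z x) \<phi>" by (simp add: Q.a_plus uV z \<phi>)
 qed
 from vi[OF this] have "L fh z \<le> a u z" by simp
 then have "L g \<psi> \<le> L g u" using s[of \<psi> z] s[of u z] z by (simp add: fh_density[symmetric] \<psi> uV)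
 then have "L g (\<psi> \<ominus> u) \<le> 0" by (simp add: L_minus[OF ga] \<psi> uV)
 moreover have "L g (\<psi> \<ominus> u) = mass g" unfolding Lp_functional_def mass_def
  by (rule Bochner_Integration.integral_cong[OF refl]) (auto simp: g_def max_def power2_eq_square)
 ultimately have "mass g = 0" using mass_nonneg[of g] by simp
 then have "AE x in Leb. (g x)^2 = 0"
  unfolding mass_def using g2 by (subst (asm) integral_nonneg_eq_0_iff_AE) (auto simp: Lp2_iff)
 then have ge: "AE x in Leb. \<psi> x \<le> u x" by eventually_elim (simp add: g_def max_def split: if_splits)
 then have KO: "u \<in> KO" using uV by (simp add: mem_K0)
 have "AE x in Leb. 0 \<le> u x - \<psi> x" using ge by eventually_elim simp
 then have 1: "L f (u \<ominus> \<psi>) \<le> a u (u \<ominus> \<psi>)" using u Q.minus_mem[OF uV \<psi>] by (simp add: mem_K1)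
 obtain y where y: "y \<in> V" "\<And>v. v \<in> V ==> a y v = L f v" using Riesz[OF f_adm] by auto
 have "y \<in> KA" using y by (simp add: mem_K1)
 from vi[OF this] have "a \<psi> y - a \<psi> u \<le> a u y - a u u"
  by (simp add: fh_density[symmetric] Q.minus_mem Q.a_minus uV y \<psi>)
 then have "L f \<psi> - a u \<psi> \<le> L f u - a u u"
  using s[of \<psi> y] s[of u y] s[of \<psi> u] y(2)[OF \<psi>] y(2)[OF uV] by linarith
 with 1 have "a u (u \<ominus> \<psi>) = L f (u \<ominus> \<psi>)" by (simp add: L_minus[OF f_adm] Q.a_minus uV \<psi>)
 then show ?thesis using KO u by (simp add: sol_c_def)
qed

text \<open>The Lewy--Stampacchia inequality: the largest possible load \<open>max f fh\<close> under the upper constraint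
 \<open>v \<le> u\<close> produces a solution \<open>w\<close> which lies above the obstacle, and hence coincides with \<open>u\<close>.\<close>

lemma b_imp_KB:
 assumes b: "sol_b u"
 shows "u \<in> KB"
proof -
 have u: "u \<in> KO" and vi: "\<And>v. v \<in> KO ==> L f (v \<ominus> u) \<le> a u (v \<ominus> u)" using b by (auto simp: sol_b_def)
 have uV: "u \<in> V" and u\<psi>: "AE x in Leb. \<psi> x \<le> u x" using u by (auto simp: mem_K0)
 define K where "K = {v \<in> V. AE x in Leb. v x \<in> {..u x}}"
 have "Q.convex_in K"
  unfolding Q.convex_in_def
 proof (intro conjI subsetI ballI)
  fix v w t assume v: "v \<in> K" and w: "w \<in> K" and t: "t \<in> {0..1::real}"
  have "AE x in Leb. v x \<le> u x" "AE x in Leb. w x \<le> u x" using v w by (auto simp: K_def)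
  then have "AE x in Leb. (1 - t) * v x + t * w x \<le> u x"
  proof eventually_elim
   case (elim x)
   then have "(1 - t) * v x + t * w x \<le> (1 - t) * u x + t * u x" using t by (intro add_mono mult_left_mono) auto
   then show ?case by (simp only: convex_combination_le)
  qed
  then show "(\<lambda>x. (1 - t) * v x + t * w x) \<in> K" using v w V_lincomb by (auto simp: K_def)
 qed (auto simp: K_def)
 moreover have "u \<in> K" using uV by (simp add: K_def)
 then have "K \<noteq> {}" by auto
 moreover have "v \<in> K" if w: "\<And>k. w k \<in> K" and v: "v \<in> V" and lim: "(\<lambda>k. hsq (w k \<ominus> v)) \<leadsto> 0" for w v
  using AE_closed[OF _ _ v lim, of "\<lambda>x. {..u x}"] w v by (simp add: K_def)
 ultimately have "\<exists>w\<in>K. \<forall>v\<in>K. L M (v \<ominus> w) \<le> a w (v \<ominus> w)" by (rule VI_exists[OF M_adm])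
 then obtain w where w: "w \<in> K" and wvi: "\<And>v. v \<in> K ==> L M (v \<ominus> w) \<le> a w (v \<ominus> w)" by auto
 have wV: "w \<in> V" and wu: "AE x in Leb. w x \<le> u x" using w by (auto simp: K_def)
 \<comment> \<open>w + q is the maximum of w and \<psi>, which is still at most u. As the load M is
   at least fh, testing with it gives a (\<psi> - w) q \<le> 0, and so q = 0.\<close>
 define q where "q = (\<lambda>x. max 0 (\<psi> x - w x))"
 have qV: "q \<in> V" unfolding q_def using V_pos_part(1)[OF Q.minus_mem[OF \<psi> wV]] .
 have "AE x in Leb. w x + q x \<le> u x" using wu u\<psi> by eventually_elim (simp add: q_def)
 then have "(\<lambda>x. w x + q x) \<in> K" using Q.plus_mem[OF wV qV] by (simp add: K_def)
 from wvi[OF this] have "L M q \<le> a w q" by simp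
 moreover have "L fh q \<le> L M q"
  by (rule functional_mono[OF fh_adm M_adm V_H1[OF qV] _ M_ge(2)]) (simp add: q_def)
 ultimately have "a (\<psi> \<ominus> w) q \<le> 0" using fh_density[OF qV] by (simp add: Q.a_minus' \<psi> wV qV)
 then have "a q q \<le> 0" using bilin_a_pos_part[OF Q.minus_mem[OF \<psi> wV], of \<sigma>] by (simp add: q_def)
 then have "AE x in Leb. q x = 0" by (rule null(1)[OF qV])
 then have "AE x in Leb. \<psi> x \<le> w x" by eventually_elim (simp add: q_def max_def split: if_splits)
 then have "w \<in> KO" using wV by (simp add: mem_K0)
 \<comment> \<open>Now u and w are admissible in each other's problem. Adding the two inequalities
   and f \<le> M leaves a (u - w) (u - w) \<le> 0.\<close>
 from vi[OF this] have 1: "L f w - L f u \<le> a u w - a u u" by (simp add: L_minus[OF f_adm] Q.a_minus uV wV)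
 have 2: "L M (u \<ominus> w) \<le> a w u - a w w" using wvi[OF \<open>u \<in> K\<close>] by (simp add: Q.a_minus uV wV)
 have "AE x in Leb. 0 \<le> u x - w x" using wu by eventually_elim simp
 then have "L f (u \<ominus> w) \<le> L M (u \<ominus> w)"
  by (rule functional_mono[OF f_adm M_adm V_H1[OF Q.minus_mem[OF uV wV]] _ M_ge(1)])
 then have 3: "L f u - L f w \<le> L M (u \<ominus> w)" by (simp add: L_minus[OF f_adm] uV wV)
 have "a (u \<ominus> w) (u \<ominus> w) \<le> 0"
  using 1 2 3 bilin_a_sym[of \<sigma> u w] by (simp add: Q.a_diff_self uV wV)
 note eq = null(2)[OF Q.minus_mem[OF uV wV] this]
 show ?thesis
  unfolding mem_K2
 proof (intro conjI ballI impI)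
  show "u \<in> KA" using b unfolding b_iff_c by (simp add: sol_c_def)
  fix \<phi> assume \<phi>: "\<phi> \<in> V" "AE x in Leb. 0 \<le> \<phi> x"
  \<comment> \<open>Lowering w never violates the upper constraint, so w satisfies A w \<le> M, and
    the bound passes to u.\<close>
  have "AE x in Leb. w x - \<phi> x \<le> u x" using wu \<phi>(2) by eventually_elim simp
  then have K: "w \<ominus> \<phi> \<in> K" using Q.minus_mem[OF wV \<phi>(1)] by (simp add: K_def)
  note m = Q.minus_mem[OF wV \<phi>(1)]
  have "L M \<phi> \<ge> a w \<phi>"
   using wvi[OF K] unfolding L_minus[OF M_adm m wV] L_minus[OF M_adm wV \<phi>(1)] Q.a_minus[OF m wV wV] Q.a_minus[OF wV \<phi>(1) wV] by simp
  moreover have "a u \<phi> = a w \<phi>" using eq[OF \<phi>(1)] by (simp add: Q.a_minus' uV wV \<phi>)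
  ultimately show "a u \<phi> \<le> L M \<phi>" by simp
 qed
qed

lemma c_imp_g:
 assumes c: "sol_c u"
 shows "sol_g u"
 using c_imp_d[OF c] b_imp_KB c by (auto simp: sol_g_def sol_d_def mem_K2 b_iff_c)

lemma b_exists: "\<exists>u. sol_b u"
proof -
 have "\<psi> \<in> KO" using \<psi> by (simp add: mem_K0)
 then have "KO \<noteq> {}" by auto
 moreover have "v \<in> KO" if w: "\<And>k. w k \<in> KO" and v: "v \<in> V" and lim: "(\<lambda>k. hsq (w k \<ominus> v)) \<leadsto> 0" for w v
  using AE_closed[OF _ _ v lim, of "\<lambda>x. {\<psi> x..}"] w v by (simp add: mem_K0)
 ultimately have "\<exists>u\<in>KO. \<forall>v\<in>KO. L f (v \<ominus> u) \<le> a u (v \<ominus> u)" by (rule VI_exists[OF f_adm convex_KO])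
 then show ?thesis by (auto simp: sol_b_def)
qed

text \<open>Since \<open>KB\<close> is smaller than \<open>KA\<close>, the inequality for u says
  nothing about general competitors in \<open>KA\<close>. But the solution s of the obstacle problem
  exists and lies in \<open>KB\<close>, so u and s can be inserted into each other's inequality and
  differ by a null function only.\<close>

lemma g_imp_c:
 assumes g: "sol_g u"
 shows "sol_c u"
proof -
 have u: "u \<in> KB" and vi: "\<And>v. v \<in> KB ==> L fh (v \<ominus> u) \<le> a u (v \<ominus> u)" using g by (auto simp: sol_g_def)
 obtain s where "sol_b s" using b_exists by auto
 then have sc: "sol_c s" and sB: "s \<in> KB" using b_imp_KB by (auto simp: b_iff_c)
 have sd: "\<And>v. v \<in> KA ==> L fh (v \<ominus> s) \<le> a s (v \<ominus> s)" using c_imp_d[OF sc] by (simp add: sol_d_def)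
 have uA: "u \<in> KA" and uV: "u \<in> V" and sV: "s \<in> V" using u sB by (auto simp: mem_K1 mem_K2)
 have "a \<psi> s - a \<psi> u \<le> a u s - a u u"
  using vi[OF sB] by (simp add: fh_density[symmetric] Q.minus_mem Q.a_minus uV sV \<psi>)
 moreover have "a \<psi> u - a \<psi> s \<le> a s u - a s s"
  using sd[OF uA] by (simp add: fh_density[symmetric] Q.minus_mem Q.a_minus uV sV \<psi>)
 ultimately have "a (u \<ominus> s) (u \<ominus> s) \<le> 0" using bilin_a_sym[of \<sigma> u s] by (simp add: Q.a_diff_self uV sV)
 note null = null[OF Q.minus_mem[OF uV sV] this]
 have "AE x in Leb. \<psi> x \<le> s x" using sc by (simp add: sol_c_def mem_K0)
 with null(1) have "AE x in Leb. \<psi> x \<le> u x" by eventually_elim simp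
 then have "u \<in> KO" using uV by (simp add: mem_K0)
 moreover have "a u \<psi> = a s \<psi>" "a u u = a s u" "a u s = a s s"
  using null(2)[OF \<psi>] null(2)[OF uV] null(2)[OF sV] by (simp_all add: Q.a_minus' uV sV \<psi>)
 moreover have "L f u = L f s" using null(3)[of f] by (simp add: L_minus[OF f_adm] uV sV)
 moreover have "a s s - a s \<psi> = L f s - L f \<psi>"
  using sc by (simp add: sol_c_def L_minus[OF f_adm] Q.a_minus sV \<psi>)
 ultimately show ?thesis
  using uA bilin_a_sym[of \<sigma> u s] by (simp add: sol_c_def L_minus[OF f_adm] Q.a_minus uV \<psi>)
qed

lemma h_imp_c:
 assumes "sol_h u"
 shows "sol_c u"
proof -
 obtain g where u: "u \<in> KO" "u \<in> KA" and g: "g \<in> Lp p Leb" "\<And>v. v \<in> V ==> a u v = L g v"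
  and z: "AE x in Leb. (g x - f x) * (u x - \<psi> x) = 0"
  using assms by (auto simp: sol_h_def mem_K2)
 have d: "u \<ominus> \<psi> \<in> V" using u \<psi> by (auto simp: mem_K0 intro: Q.minus_mem)
 have "L g (u \<ominus> \<psi>) = L f (u \<ominus> \<psi>)"
  unfolding Lp_functional_def
 proof (rule integral_cong_AE)
  show "AE x in Leb. g x * (u x - \<psi> x) = f x * (u x - \<psi> x)"
   using z by eventually_elim (auto simp: algebra_simps)
 qed (use admissible_integrable[OF Lp_admissible[OF p g(1)] V_H1[OF d]] admissible_integrable[OF f_adm V_H1[OF d]] in auto)
 then show ?thesis using u g(2)[OF d] by (simp add: sol_c_def)
qed

end

context obstacle_problem
begin

interpretation Q: quadratic_form V a "\<lambda>_. 0" 0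
 by (rule zero_form)

text \<open>The functional \<open>Au - f\<close> lies between \<open>0\<close> and \<open>h = max f fh - f\<close>, so it is bounded in \<open>L\<^sup>2(h dx)\<close> and
 its Riesz representative there is a density with values in \<open>[0, h]\<close>.\<close>

lemma c_imp_h:
 assumes c: "sol_c u"
 shows "sol_h u"
proof -
 have u: "u \<in> KO" "u \<in> KA" and eq: "a u (u \<ominus> \<psi>) = L f (u \<ominus> \<psi>)" using c by (auto simp: sol_c_def)
 have uB: "u \<in> KB" using c b_imp_KB by (simp add: b_iff_c)
 have uV: "u \<in> V" using u by (simp add: mem_K0)
 define h where "h = (M \<ominus> f)"
 have h0: "0 \<le> h x" for x using M_ge(1)[of x] by (simp add: h_def)
 have hm: "h \<in> borel_measurable Leb" unfolding h_def using M_Lp f by (auto simp: Lp_def)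
 have hp: "h \<in> Lp p Leb" by (rule Lp_abs_le[OF M_Lp f p(1) hm]) (simp add: h_def)
 have ha: "admissible h" by (rule Lp_admissible[OF p hp])
 have hi: "integrable Leb h" using admissible_integrable[OF ha H1_const(1)[of 1]] by simp
 \<comment> \<open>Multiplication by sq realises the space L2(h dx) inside the unweighted
   L2.\<close>
 define sq where "sq = (\<lambda>x. sqrt (h x))"
 have sq2: "sq x * sq x = h x" for x using h0 by (simp add: sq_def)
 have sq0: "\<bar>sq x\<bar> = sq x" for x using h0 by (simp add: sq_def)
 have sqm: "sq \<in> borel_measurable Leb" unfolding sq_def using hm by measurable
 have sqL: "sq \<in> Lp 2 Leb" using hi sqm by (simp add: Lp2_iff power2_eq_square sq2)
 define ell where "ell = (\<lambda>\<phi>. a u \<phi> - L f \<phi>)"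
 have ell_pos: "0 \<le> ell \<phi>" "ell \<phi> \<le> L h \<phi>" if \<phi>: "\<phi> \<in> V" "AE x in Leb. 0 \<le> \<phi> x" for \<phi>
 proof -
  show "0 \<le> ell \<phi>" using u(2) \<phi> by (simp add: ell_def mem_K1)
  have "L h \<phi> = L M \<phi> - L f \<phi>"
   using admissible_integrable[OF M_adm V_H1[OF \<phi>(1)]] admissible_integrable[OF f_adm V_H1[OF \<phi>(1)]]
   by (simp add: Lp_functional_def h_def left_diff_distrib)
  then show "ell \<phi> \<le> L h \<phi>" using uB \<phi> by (simp add: ell_def mem_K2)
 qed
 have ell_lin: "ell (\<lambda>x. s * v x + t * w x) = s * ell v + t * ell w" if "v \<in> V" "w \<in> V" for v w s t
 proof -
  obtain C where "quadratic_form V a (L f) C" using V_form[OF f_adm] ..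
  from quadratic_form.l_lin[OF this that] Q.a_lin2[OF that uV] show ?thesis by (simp add: ell_def algebra_simps)
 qed
 \<comment> \<open>The two-sided bound is known for nonnegative functions only, so positive and
   negative part are treated separately.\<close>
 have ell_abs: "\<bar>ell \<phi>\<bar> \<le> (LINT x|Leb. h x * \<bar>\<phi> x\<bar>)" if \<phi>: "\<phi> \<in> V" for \<phi>
 proof -
  define P where "P = (\<lambda>x. max 0 (\<phi> x))"
  define N where "N = (\<lambda>x. max 0 (- \<phi> x))"
  have P: "P \<in> V" unfolding P_def by (rule V_pos_part(1)[OF \<phi>])
  have "(\<lambda>x. - \<phi> x) \<in> V" using V_lincomb[OF \<phi> \<phi>, of "-1" 0] by simp
  then have N: "N \<in> V" unfolding N_def by (rule V_pos_part(1))
  have "(\<lambda>x. 1 * P x + -1 * N x) = \<phi>" by (auto simp: P_def N_def fun_eq_iff)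
  then have "ell \<phi> = ell P - ell N" using ell_lin[OF P N, of 1 "-1"] by simp
  moreover have "AE x in Leb. 0 \<le> P x" "AE x in Leb. 0 \<le> N x" by (auto simp: P_def N_def)
  note ell_pos[OF P this(1)] ell_pos[OF N this(2)]
  moreover have "L h P + L h N = (LINT x|Leb. h x * \<bar>\<phi> x\<bar>)"
  proof -
   have "(\<lambda>x. h x * P x + h x * N x) = (\<lambda>x. h x * \<bar>\<phi> x\<bar>)" by (auto simp: P_def N_def fun_eq_iff max_def)
   then show ?thesis
    using Bochner_Integration.integral_add[OF admissible_integrable[OF ha V_H1[OF P]] admissible_integrable[OF ha V_H1[OF N]]]
    by (simp add: Lp_functional_def)
  qed
  ultimately show ?thesis by linarith
 qed
 \<comment> \<open>h \<phi>^2 need not be integrable for every \<phi> in V. Bounded members of V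
   belong to W because h is integrable.\<close>
 define W where "W = {\<phi> \<in> V. (\<lambda>x. sq x * \<phi> x) \<in> Lp 2 Leb}"
 define b where "b = (\<lambda>\<phi> \<theta>. LINT x|Leb. (sq x * \<phi> x) * (sq x * \<theta> x))"
 define I where "I = (LINT x|Leb. h x)"
 have W: "\<phi> \<in> V" "(\<lambda>x. sq x * \<phi> x) \<in> Lp 2 Leb" if "\<phi> \<in> W" for \<phi> using that by (auto simp: W_def)
 have form: "quadratic_form W b ell I"
 proof
  fix v w y :: "'a => real" and s t :: real
  assume v: "v \<in> W" and w: "w \<in> W"
  show "(\<lambda>x. s * v x + t * w x) \<in> W"
   using V_lincomb[OF W(1)[OF v] W(1)[OF w]] L2_lincomb[OF W(2)[OF v] W(2)[OF w], of s t]
   by (simp add: W_def distrib_left mult.left_commute)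
  show "ell (\<lambda>x. s * v x + t * w x) = s * ell v + t * ell w" by (rule ell_lin[OF W(1)[OF v] W(1)[OF w]])
  show "b (\<lambda>x. s * v x + t * w x) y = s * b v y + t * b w y" if y: "y \<in> W"
  proof -
   have "(\<lambda>x. (sq x * (s * v x + t * w x)) * (sq x * y x)) =
     (\<lambda>x. s * ((sq x * v x) * (sq x * y x)) + t * ((sq x * w x) * (sq x * y x)))"
    by (simp add: fun_eq_iff algebra_simps)
   then show ?thesis
    using L2_integrable_mult[OF W(2)[OF v] W(2)[OF y]] L2_integrable_mult[OF W(2)[OF w] W(2)[OF y]] by (simp add: b_def)
  qed
 next
  show "b v w = b w v" for v w by (simp add: b_def mult.commute)
  show "0 \<le> I" unfolding I_def by (rule Bochner_Integration.integral_nonneg[OF h0])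
 next
  fix v assume v: "v \<in> W"
  show "0 \<le> b v v" unfolding b_def by (rule Bochner_Integration.integral_nonneg) simp
  have av: "(\<lambda>x. \<bar>sq x * v x\<bar>) \<in> Lp 2 Leb" using W(2)[OF v] by (auto simp: Lp2_iff)
  have "(LINT x|Leb. h x * \<bar>v x\<bar>) = (LINT x|Leb. sq x * \<bar>sq x * v x\<bar>)"
   by (rule Bochner_Integration.integral_cong[OF refl]) (simp add: abs_mult sq0 sq2 mult.assoc[symmetric])
  then have "(LINT x|Leb. h x * \<bar>v x\<bar>)^2 \<le> (LINT x|Leb. (sq x)^2) * (LINT x|Leb. (\<bar>sq x * v x\<bar>)^2)"
   using L2_Cauchy_Schwarz[OF sqL av L2_integrable_mult[OF sqL av]] by simp
  also have "\<dots> = I * b v v" by (simp add: I_def b_def power2_eq_square sq2)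
  finally have "(LINT x|Leb. h x * \<bar>v x\<bar>)^2 \<le> I * b v v" .
  moreover have "(ell v)^2 \<le> (LINT x|Leb. h x * \<bar>v x\<bar>)^2"
   using power_mono[OF ell_abs[OF W(1)[OF v]] abs_ge_zero, of 2] by simp
  ultimately show "(ell v)^2 \<le> I * b v v" by linarith
 qed
 interpret B: quadratic_form W b ell I by (rule form)
 have Wbd: "\<phi> \<in> W" if \<phi>: "\<phi> \<in> V" "\<And>x. \<bar>\<phi> x\<bar> \<le> R" for \<phi> R
 proof -
  have "(\<lambda>x. \<phi> x *\<^sub>R sq x) \<in> Lp 2 Leb"
   by (rule L2_bounded_mult[OF sqL]) (use \<phi>(2) H1D(1)[OF V_H1[OF \<phi>(1)]] in \<open>auto simp: Lp2_iff\<close>)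
  then show ?thesis using \<phi>(1) by (simp add: W_def mult.commute)
 qed
 have "(\<lambda>x. sq x * (0::real)) \<in> Lp 2 Leb" using L2_lincomb[OF sqL sqL, of 0 0] by simp
 then have "(\<lambda>x. 0) \<in> W" using V_lincomb[OF \<psi> \<psi>, of 0 0] by (simp add: W_def)
 then have W_ne: "W \<noteq> {}" by auto
 have convex: "B.convex_in W" by (auto simp: B.convex_in_def intro: B.lin)
 \<comment> \<open>The minimising sequence is only seen to converge after multiplication by sq. The
   limit \<Theta> in L2 represents \<open>ell\<close> in the weighted sense, and \<Theta> sq is its
   density.\<close>
 obtain w where w: "B.minimizing W w" using B.minimizing_exists[OF order_refl W_ne] ..
 have wW: "w k \<in> W" for k using w by (simp add: B.minimizing_def)
 have "(LINT x|Leb. (norm (sq x * w m x - sq x * w n x))^2) \<le> b (w m \<ominus> w n) (w m \<ominus> w n)" for m n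
  by (simp add: b_def power2_eq_square right_diff_distrib)
 from L2_complete[OF finite_measure_dom W(2)[OF wW] this B.minimizing_Cauchy[OF w convex]]
 obtain \<Theta> where \<Theta>: "\<Theta> \<in> Lp 2 Leb" and lim: "L2_lim Leb (\<lambda>k x. sq x * w k x) \<Theta>" by auto
 define g0 where "g0 = (\<lambda>x. \<Theta> x * sq x)"
 have g0i: "integrable Leb g0" unfolding g0_def by (rule L2_integrable_mult[OF \<Theta> sqL])
 have rep: "ell \<phi> = L g0 \<phi>" if \<phi>: "\<phi> \<in> W" for \<phi>
 proof -
  have "(\<lambda>k. LINT x|Leb. (sq x * w k x) \<bullet> (sq x * \<phi> x)) \<leadsto> (LINT x|Leb. \<Theta> x \<bullet> (sq x * \<phi> x))"
   by (rule L2_tendsto_integral[OF W(2)[OF wW] \<Theta> W(2)[OF \<phi>] lim])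
  then have "(\<lambda>k. b (w k) \<phi>) \<leadsto> L g0 \<phi>" by (simp add: b_def Lp_functional_def g0_def mult.assoc)
  with B.minimizing_weak_limit[OF w \<phi>] show ?thesis by (rule LIMSEQ_unique)
 qed
 have test: "\<phi> \<in> W" if t: "\<phi> \<in> test_functions \<Omega>" for \<phi>
 proof -
  obtain R where "\<And>x. \<bar>\<phi> x\<bar> \<le> R" using test_function_bounded[OF t] by auto
  from Wbd[OF V_test_function[OF t] this] show ?thesis .
 qed
 have g0_pos: "AE x in Leb. 0 \<le> g0 x"
 proof (rule nonneg_from_test_functions[OF integrable_locally_integrable[OF g0i]])
  fix \<phi> assume t: "\<phi> \<in> test_functions \<Omega>" "\<And>x. 0 \<le> \<phi> x"
  show "0 \<le> (LINT x|Leb. g0 x * \<phi> x)"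
   using rep[OF test[OF t(1)]] ell_pos(1)[OF V_test_function[OF t(1)]] t(2) by (simp add: Lp_functional_def)
 qed
 have "AE x in Leb. 0 \<le> h x - g0 x"
 proof (rule nonneg_from_test_functions[OF integrable_locally_integrable[OF Bochner_Integration.integrable_diff[OF hi g0i]]])
  fix \<phi> assume t: "\<phi> \<in> test_functions \<Omega>" "\<And>x. 0 \<le> \<phi> x"
  have "(LINT x|Leb. (h x - g0 x) * \<phi> x) = L h \<phi> - L g0 \<phi>"
   using admissible_integrable[OF ha V_H1[OF V_test_function[OF t(1)]]]
    integrable_loc_times_test[OF integrable_locally_integrable[OF g0i] t(1)]
   by (simp add: Lp_functional_def left_diff_distrib)
  then show "0 \<le> (LINT x|Leb. (h x - g0 x) * \<phi> x)"
   using rep[OF test[OF t(1)]] ell_pos(2)[OF V_test_function[OF t(1)]] t(2) by simp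
 qed
 \<comment> \<open>In fact 0 \<le> g0 \<le> h; the bound is doubled to match the form of
   \<open>Lp_abs_le\<close>.\<close>
 with g0_pos have g0_le: "AE x in Leb. \<bar>g0 x\<bar> \<le> \<bar>h x\<bar> + \<bar>h x\<bar>" by eventually_elim simp
 have g0p: "g0 \<in> Lp p Leb" by (rule Lp_abs_le[OF hp hp p(1) _ g0_le]) (use g0i in auto)
 define g where "g = (\<lambda>x. f x + g0 x)"
 have gp: "g \<in> Lp p Leb"
  by (rule Lp_abs_le[OF f g0p p(1)]) (use g0p f in \<open>auto simp: g_def Lp_def\<close>)
 have ga: "admissible g" by (rule Lp_admissible[OF p gp])
 have g0a: "admissible g0" by (rule Lp_admissible[OF p g0p])
 have g_eq: "L g v = L f v + L g0 v" if v: "v \<in> V" for v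
  using admissible_integrable[OF f_adm V_H1[OF v]] admissible_integrable[OF g0a V_H1[OF v]]
  by (simp add: Lp_functional_def g_def distrib_right)
 have density: "a u v = L g v" if v: "v \<in> V" for v
 proof -
  \<comment> \<open>So far the representation holds on W. The truncations of v are bounded, hence in
    W, and they converge to v in H1, where both functionals are continuous.\<close>
  define d where "d = (\<lambda>k x. truncate k (v x) - v x)"
  have tV: "(\<lambda>x. truncate k (v x)) \<in> V" for k by (rule V_truncate(1)[OF v])
  have dV: "d k \<in> V" for k unfolding d_def by (rule Q.minus_mem[OF tV v])
  have dl: "(\<lambda>k. hsq (d k)) \<leadsto> 0" unfolding d_def by (rule V_truncate(2)[OF v])
  obtain C where C: "\<And>v. v \<in> H1 \<Omega> ==> (L g v)^2 \<le> C * hsq v" using admissible_bound[OF ga] by auto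
  have 1: "(\<lambda>k. L g (d k)) \<leadsto> 0" by (rule square_bounded_tendsto_0[OF C[OF V_H1[OF dV]] dl])
  have "(a u (d k))^2 \<le> (a u u * (1 + \<sigma>)) * hsq (d k)" for k
   using order_trans[OF Q.a_Cauchy_Schwarz[OF uV dV] mult_left_mono[OF a_le_hsq[OF dV] Q.a_nonneg[OF uV]], of k]
   by (simp add: mult.assoc)
  from square_bounded_tendsto_0[OF this dl] have 2: "(\<lambda>k. a u (d k)) \<leadsto> 0" .
  have "a u v - L g v = L g (d k) - a u (d k)" for k
  proof -
   have "ell (\<lambda>x. truncate k (v x)) = L g0 (\<lambda>x. truncate k (v x))"
    by (rule rep[OF Wbd[OF tV truncate_limit(5)]])
   then have "a u (\<lambda>x. truncate k (v x)) = L g (\<lambda>x. truncate k (v x))" by (simp add: ell_def g_eq[OF tV])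
   then show ?thesis unfolding d_def L_minus[OF ga tV v] Q.a_minus[OF tV v uV] by simp
  qed
  then have "(\<lambda>k. a u v - L g v) \<leadsto> 0" using tendsto_diff[OF 1 2] by simp
  then show ?thesis by (simp add: LIMSEQ_const_iff)
 qed
 have dV: "u \<ominus> \<psi> \<in> V" by (rule Q.minus_mem[OF uV \<psi>])
 have "L g0 (u \<ominus> \<psi>) = 0" using eq density[OF dV] g_eq[OF dV] by simp
 moreover have "AE x in Leb. \<psi> x \<le> u x" using u by (simp add: mem_K0)
 with g0_pos have "AE x in Leb. 0 \<le> g0 x * (u x - \<psi> x)" by eventually_elim simp
 ultimately have "AE x in Leb. g0 x * (u x - \<psi> x) = 0"
  unfolding Lp_functional_def by (subst (asm) integral_nonneg_eq_0_iff_AE[OF admissible_integrable[OF g0a V_H1[OF dV]]]) auto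
 then have "AE x in Leb. (g x - f x) * (u x - \<psi> x) = 0" by (simp add: g_def)
 then show ?thesis using u(1) uB gp density by (auto simp: sol_h_def)
qed

lemma minimizer_iff_b: "u \<in> KO \<and> (\<forall>v\<in>KO. J \<Omega> \<sigma> f u \<le> J \<Omega> \<sigma> f v) \<longleftrightarrow> sol_b u"
 using J_minimizer_iff[OF f_adm convex_KO] by (auto simp: sol_b_def)

lemma minimizer_iff_d: "u \<in> KA \<and> (\<forall>v\<in>KA. J \<Omega> \<sigma> fh u \<le> J \<Omega> \<sigma> fh v) \<longleftrightarrow> sol_d u"
 using J_minimizer_iff[OF fh_adm convex_KA] by (auto simp: sol_d_def)

lemma minimizer_iff_g: "u \<in> KB \<and> (\<forall>v\<in>KB. J \<Omega> \<sigma> fh u \<le> J \<Omega> \<sigma> fh v) \<longleftrightarrow> sol_g u"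
 using J_minimizer_iff[OF fh_adm convex_KB] by (auto simp: sol_g_def)

lemma c_iff: "sol_c u \<longleftrightarrow> sol_d u" "sol_c u \<longleftrightarrow> sol_g u" "sol_c u \<longleftrightarrow> sol_h u"
 using c_imp_d d_imp_c c_imp_g g_imp_c c_imp_h h_imp_c by blast+

end

theorem theorem3p2:
  fixes \<Omega> \<Gamma>\<^sub>D \<Gamma>\<^sub>N :: "'a::euclidean_space set"
    and \<sigma> p :: real
    and f \<psi> fhat u :: "'a \<Rightarrow> real"
  assumes "bounded_lipschitz_domain \<Omega>"
    and "\<Gamma>\<^sub>D \<union> \<Gamma>\<^sub>N = frontier \<Omega>" and "\<Gamma>\<^sub>D \<inter> \<Gamma>\<^sub>N = {}"
    and "openin (top_of_set (frontier \<Omega>)) \<Gamma>\<^sub>D"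
    and "\<sigma> \<ge> 0"
    and "emeasure surface_measure \<Gamma>\<^sub>D = 0 \<longrightarrow> \<sigma> > 0"
    and "1 < p" and "p \<ge> 2 * real DIM('a) / (real DIM('a) + 2)"
    and "f \<in> Lp p (lebesgue_on \<Omega>)"
    and "\<psi> \<in> V_space \<Omega> \<Gamma>\<^sub>D"
    and "is_Lp_density \<Omega> \<Gamma>\<^sub>D p (A_op \<Omega> \<sigma> \<psi>) fhat"
    and "u \<in> V_space \<Omega> \<Gamma>\<^sub>D"
  shows
    "let K\<^sub>0 = K0 \<Omega> \<Gamma>\<^sub>D \<psi>; K\<^sub>1 = K1 \<Omega> \<Gamma>\<^sub>D \<sigma> f; K\<^sub>2 = K2 \<Omega> \<Gamma>\<^sub>D \<sigma> f fhat;
         A = A_op \<Omega> \<sigma>; a = bilin_a \<Omega> \<sigma>; F = Lp_functional \<Omega> f; Fhat = Lp_functional \<Omega> fhat;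
         Jf = J \<Omega> \<sigma> f; Jhat = J \<Omega> \<sigma> fhat;
         cond_a = (u \<in> K\<^sub>0 \<and> (\<forall>v\<in>K\<^sub>0. Jf u \<le> Jf v));
         cond_b = (u \<in> K\<^sub>0 \<and> (\<forall>v\<in>K\<^sub>0. a u (\<lambda>x. v x - u x) \<ge> F (\<lambda>x. v x - u x)));
         cond_c = (u \<in> K\<^sub>0 \<inter> K\<^sub>1 \<and> A u (\<lambda>x. u x - \<psi> x) - F (\<lambda>x. u x - \<psi> x) = 0);
         cond_d = (u \<in> K\<^sub>1 \<and> (\<forall>v\<in>K\<^sub>1. a u (\<lambda>x. v x - u x) \<ge> Fhat (\<lambda>x. v x - u x)));
         cond_e = (u \<in> K\<^sub>1 \<and> (\<forall>v\<in>K\<^sub>1. Jhat u \<le> Jhat v));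
         cond_f = (u \<in> K\<^sub>2 \<and> (\<forall>v\<in>K\<^sub>2. Jhat u \<le> Jhat v));
         cond_g = (u \<in> K\<^sub>2 \<and> (\<forall>v\<in>K\<^sub>2. a u (\<lambda>x. v x - u x) \<ge> Fhat (\<lambda>x. v x - u x)));
         cond_h = (u \<in> K\<^sub>0 \<inter> K\<^sub>2 \<and>
                   (\<exists>g. is_Lp_density \<Omega> \<Gamma>\<^sub>D p (A u) g \<and>
                        (AE x in lebesgue_on \<Omega>. (g x - f x) * (u x - \<psi> x) = 0)))
     in (cond_a \<longleftrightarrow> cond_b) \<and> (cond_b \<longleftrightarrow> cond_c) \<and> (cond_c \<longleftrightarrow> cond_d) \<and> (cond_d \<longleftrightarrow> cond_e) \<and>
        (cond_e \<longleftrightarrow> cond_f) \<and> (cond_f \<longleftrightarrow> cond_g) \<and> (cond_g \<longleftrightarrow> cond_h)"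
proof -
 have sub: "\<Gamma>\<^sub>D \<subseteq> frontier \<Omega>" using assms(2) by auto
 obtain T where "open T" "\<Gamma>\<^sub>D = frontier \<Omega> \<inter> T" using assms(4) by (auto simp: openin_open)
 then have borel: "\<Gamma>\<^sub>D \<in> sets borel" by auto
 have d: "fhat \<in> Lp p (lebesgue_on \<Omega>)"
  "\<And>v. v \<in> V_space \<Omega> \<Gamma>\<^sub>D ==> bilin_a \<Omega> \<sigma> \<psi> v = Lp_functional \<Omega> fhat v"
  using assms(11) by (auto simp: is_Lp_density_def A_op_def)
 interpret obstacle_problem \<Omega> \<Gamma>\<^sub>D \<sigma> p f \<psi> fhat
  by unfold_locales (use assms sub borel d in auto)
 have h: "u \<in> KO \<inter> KB \<and> (\<exists>g. is_Lp_density \<Omega> \<Gamma>\<^sub>D p (A_op \<Omega> \<sigma> u) g \<and>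
   (AE x in lebesgue_on \<Omega>. (g x - f x) * (u x - \<psi> x) = 0)) \<longleftrightarrow> sol_h u"
  by (auto simp: sol_h_def is_Lp_density_def A_op_def)
 have c: "u \<in> KO \<inter> KA \<and> A_op \<Omega> \<sigma> u (\<lambda>x. u x - \<psi> x) - Lp_functional \<Omega> f (\<lambda>x. u x - \<psi> x) = 0 \<longleftrightarrow> sol_c u"
  by (auto simp: sol_c_def A_op_def)
 \<comment> \<open>Minimality identifies (a) with (b), (e) with (d) and (f) with (g); the rest is
   compared through (c).\<close>
 show ?thesis
  unfolding Let_def h c minimizer_iff_b minimizer_iff_d minimizer_iff_g
   sol_b_def[symmetric] sol_d_def[symmetric] sol_g_def[symmetric]
  using b_iff_c[of u] c_iff[of u] by blast
qed

end
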